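(* Fix natural numbers $g$, $i$, and $n$. The $\mathcal{G}_g^{\mathrm{op}}$-module over $\mathbb{Z}$ given by $$G\mapsto H_i\big(\mathrm{UConf}_n(G);\mathbb{Z}\big)$$ is $(g+i+n)$-small. In particular, it is finitely generated.
   Context: Graphs. A graph is a finite CW complex of dimension at most 1; 0-cells are vertices, 1-cells are edges (loops and multiple edges are allowed). The genus of a non-empty connected graph is the rank of its first homology; a "graph of genus $g$" is always non-empty and connected. A map of CW complexes between graphs is very cellular if it takes every vertex to a vertex and every edge to either a vertex or an edge (in the former case the edge is called contracted). A graph morphism is an equivalence class of very cellular maps under homotopy through very cellular maps. A contraction is a surjective graph morphism with contractible fibers (so it amounts to collapsing a set of edges forming a forest, followed by a graph isomorphism). $\mathcal{G}_g$ is the category of graphs of genus $g$ with contractions as morphisms. Modules. For a commutative ring $k$, a $\mathcal{G}_g^{\mathrm{op}}$-module over $k$ is a functor $M$ from $\mathcal{G}_g^{\mathrm{op}}$ to $k$-modules. It is finitely generated if there are finitely many graphs $G_1,\dots,G_r$ of genus $g$ and elements $v_i\in M(G_i)$ such that for every $G$, $M(G)$ is spanned by the images of the $v_i$ under the maps $\varphi^*:M(G_i)\to M(G)$ induced by all contractions $\varphi:G\to G_i$; it is finitely generated in degrees $\le d$ if the $G_i$ can be chosen with at most $d$ edges. $M$ is $d$-small if it is a subquotient of a module that is finitely generated in degrees $\le d$. Configuration spaces. $\mathrm{UConf}_n(G)=\{(x_1,\dots,x_n)\in G^n\mid x_i\ne x_j \text{ for } i\neq j\}/S_n$. Module structure.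 Each edge has two half-edges, one at each of its ends; a half-edge $h$ has an edge $e(h)$ and a vertex $v(h)$. Let $A_G$ be the integral polynomial ring on the edges of $G$. For a vertex $v$ let $S(v)$ be the free $A_G$-module on the symbol $\emptyset$ and the half-edges $h$ with $v(h)=v$, bigraded so that edges have degree $(0,1)$, $\emptyset$ degree $(0,0)$, half-edges degree $(1,1)$. Let $\widetilde S(v)\subset S(v)$ be the submodule generated by $\emptyset$ and all differences $h-h'$, with $A_G$-linear differential $\partial(h-h')=(e(h)-e(h'))\emptyset$, $\partial\emptyset=0$. The reduced Świątkowski complex is $\widetilde S(G)=\bigotimes_{v}\widetilde S(v)$ (tensor product of complexes over $A_G$). For $G$ not a single point there is an isomorphism (An, Drummond-Cole, Knudsen) between $H_i(\mathrm{UConf}_n(G);\mathbb{Z})$ and the bidegree $(i,n)$ part of $H_\bullet(\widetilde S(G))$. A contraction $\varphi:G\to G'$ induces $\widetilde\varphi^*:\widetilde S(G')\to\widetilde S(G)$ as follows. If $\varphi$ is an isomorphism it is the evident relabeling. If $\varphi$ contracts exactly one edge, identify that edge with $[0,1]$, let $h_0,h_1$ be its half-edges at its end vertices $0$ and $1$, and let $w'$ be its image. Each edge and half-edge of $G'$ has a unique preimage edge or half-edge in $G$, giving a ring map $A_{G'}\to A_G$ and maps on the factors $\widetilde S(v')$, $v'\neq w'$; on $\widetilde S(w')\to\widetilde S(0)\otimes\widetilde S(1)$ it is (the restriction of) $\emptyset\mapsto\emptyset\otimes\emptyset$, and, for a half-edge $h'$ at $w'$ with preimage $h$, $h'\mapsto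 (h-h_0)\otimes\emptyset$ if $v(h)=0$, and $h'\mapsto\emptyset\otimes(h-h_1)$ if $v(h)=1$. General contractions are compositions of these, and the result does not depend on the factorization. These chain maps induce on homology the maps $\varphi^*:H_i(\mathrm{UConf}_n(G');\mathbb{Z})\to H_i(\mathrm{UConf}_n(G);\mathbb{Z})$ defining the module. In the exceptional case that $G'$ is a single point and $(i,n)=(0,1)$, where $H_0(\mathrm{UConf}_1(G'))=\mathbb{Z}$ is not seen by the complex, the map $\mathbb{Z}=H_0(G')\to H_0(G)=\mathbb{Z}$ is the canonical identification. *)

theory Defs
  imports "HOL-Homology.Homology" "HOL-Combinatorics.Permutations"
begin

section \<open>Graphs\<close>

text \<open>
  A finite CW complex of dimension at most 1: the edge \<open>e\<close> is a copy of \<open>[0,1]\<close> whose ends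
  \<open>0\<close> and \<open>1\<close> are attached to \<open>endpt G e False\<close> and \<open>endpt G e True\<close>. Loops and multiple edges
  are allowed. Cells are labelled by natural numbers; every finite graph is isomorphic to one
  of this form, so the graphs below form a category equivalent to that of all finite graphs.
  Values of \<open>endpt\<close> outside \<open>edges G\<close> are irrelevant.
\<close>

record graph =
  verts :: "nat set"
  edges :: "nat set"
  endpt :: "nat \<Rightarrow> bool \<Rightarrow> nat"

definition wf_graph :: "graph \<Rightarrow> bool" where
  "wf_graph G \<longleftrightarrow> finite (verts G) \<and> finite (edges G) \<and> (\<forall>e\<in>edges G. \<forall>b. endpt G e b \<in> verts G)"

text \<open>A half-edge \<open>h\<close> is an edge \<open>e(h) = fst h\<close> together with one of its two ends.\<close>

type_synonym half = "nat \<times> bool"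

definition halves :: "graph \<Rightarrow> half set" where
  "halves G = edges G \<times> UNIV"

definition hvert :: "graph \<Rightarrow> half \<Rightarrow> nat" where
  "hvert G h = endpt G (fst h) (snd h)"

definition halves_at :: "graph \<Rightarrow> nat \<Rightarrow> half set" where
  "halves_at G v = {h \<in> halves G. hvert G h = v}"

definition connected_graph :: "graph \<Rightarrow> bool" where
  "connected_graph G \<longleftrightarrow>
     (\<forall>u\<in>verts G. \<forall>v\<in>verts G. (u, v) \<in> {(endpt G e b, endpt G e (\<not> b)) | e b. e \<in> edges G}\<^sup>*)"

text \<open>
  First homology of the CW complex: there are no 2-cells, so it is the group of cellular
  1-cycles. It is free, and its rank is the largest size of a linearly independent subset.
\<close>

definition cell_boundary :: "graph \<Rightarrow> (nat \<Rightarrow>\<^sub>0 int) \<Rightarrow> (nat \<Rightarrow>\<^sub>0 int)" where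
  "cell_boundary G = frag_extend (\<lambda>e. frag_of (endpt G e True) - frag_of (endpt G e False))"

definition cell_H1 :: "graph \<Rightarrow> (nat \<Rightarrow>\<^sub>0 int) set" where
  "cell_H1 G = {z. Poly_Mapping.keys z \<subseteq> edges G \<and> cell_boundary G z = 0}"

definition lin_indep :: "(nat \<Rightarrow>\<^sub>0 int) set \<Rightarrow> bool" where
  "lin_indep B \<longleftrightarrow> (\<forall>a. (\<Sum>z\<in>B. frag_cmul (a z) z) = 0 \<longrightarrow> (\<forall>z\<in>B. a z = 0))"

definition genus :: "graph \<Rightarrow> nat" where
  "genus G = Max {card B | B. finite B \<and> B \<subseteq> cell_H1 G \<and> lin_indep B}"

definition graph_of_genus :: "nat \<Rightarrow> graph \<Rightarrow> bool" where
  "graph_of_genus g G \<longleftrightarrow> wf_graph G \<and> verts G \<noteq> {} \<and> connected_graph G \<and> genus G = g"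

definition single_point :: "graph \<Rightarrow> bool" where
  "single_point G \<longleftrightarrow> card (verts G) = 1 \<and> edges G = {}"


section \<open>Contractions\<close>

text \<open>
  A homotopy class of very cellular maps that are homeomorphisms on the open edges they do not
  contract is determined by its effect on vertices and half-edges, where \<open>hmap \<phi> h = None\<close> says
  that the edge of \<open>h\<close> is contracted. (Edgewise homeomorphisms suffice for contractions, whose
  fibres are contractible. Flipping a loop is not homotopic to the identity through very cellular
  maps, which is why half-edges rather than edges are recorded.) The maps are undefined outside
  the domain, so that equality of morphisms is equality in HOL.
\<close>

record cmap =
  vmap :: "nat \<Rightarrow> nat"
  hmap :: "half \<Rightarrow> half option"

definition edgewise_morphism :: "graph \<Rightarrow> graph \<Rightarrow> cmap \<Rightarrow> bool" where
  "edgewise_morphism G G' \<phi> \<longleftrightarrow>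
     wf_graph G \<and> wf_graph G' \<and>
     vmap \<phi> \<in> verts G \<rightarrow>\<^sub>E verts G' \<and>
     dom (hmap \<phi>) \<subseteq> halves G \<and> ran (hmap \<phi>) \<subseteq> halves G' \<and>
     (\<forall>e b e' b'. hmap \<phi> (e, b) = Some (e', b') \<longrightarrow>
        hmap \<phi> (e, \<not> b) = Some (e', \<not> b') \<and> vmap \<phi> (endpt G e b) = endpt G' e' b') \<and>
     (\<forall>e\<in>edges G. hmap \<phi> (e, True) = None \<longrightarrow>
        vmap \<phi> (endpt G e False) = vmap \<phi> (endpt G e True))"

definition contracted_edges :: "graph \<Rightarrow> cmap \<Rightarrow> nat set" where
  "contracted_edges G \<phi> = {e \<in> edges G. hmap \<phi> (e, True) = None}"

definition fibre :: "graph \<Rightarrow> cmap \<Rightarrow> nat \<Rightarrow> graph" where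
  "fibre G \<phi> w =
     \<lparr>verts = {v \<in> verts G. vmap \<phi> v = w},
      edges = {e \<in> contracted_edges G \<phi>. vmap \<phi> (endpt G e True) = w},
      endpt = endpt G\<rparr>"

text \<open>
  The fibre over a vertex is a subgraph, and a graph is contractible iff it is a tree, i.e. a graph
  of genus 0; the fibre over an interior point of an edge has one point for each edge above it,
  so it is contractible iff there is exactly one.
\<close>

definition contraction :: "graph \<Rightarrow> graph \<Rightarrow> cmap \<Rightarrow> bool" where
  "contraction G G' \<phi> \<longleftrightarrow>
     edgewise_morphism G G' \<phi> \<and>
     vmap \<phi> ` verts G = verts G' \<and> ran (hmap \<phi>) = halves G' \<and>
     inj_on (hmap \<phi>) (dom (hmap \<phi>)) \<and>
     (\<forall>w\<in>verts G'. graph_of_genus 0 (fibre G \<phi> w))"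

definition cmap_id :: "graph \<Rightarrow> cmap" where
  "cmap_id G = \<lparr>vmap = restrict id (verts G), hmap = (\<lambda>h. if h \<in> halves G then Some h else None)\<rparr>"

text \<open>\<open>cmap_comp G \<psi> \<phi>\<close> is \<open>\<phi>\<close>, with source \<open>G\<close>, followed by \<open>\<psi>\<close>.\<close>

definition cmap_comp :: "graph \<Rightarrow> cmap \<Rightarrow> cmap \<Rightarrow> cmap" where
  "cmap_comp G \<psi> \<phi> = \<lparr>vmap = compose (verts G) (vmap \<psi>) (vmap \<phi>), hmap = hmap \<psi> \<circ>\<^sub>m hmap \<phi>\<rparr>"


section \<open>Modules over the opposite contraction category\<close>

text \<open>
  Integral modules are abelian groups (in the multiplicative notation of HOL-Algebra);
  \<open>mor M G G' \<phi>\<close> is the map \<open>M(G') \<rightarrow> M(G)\<close> induced by a contraction \<open>\<phi> : G \<rightarrow> G'\<close>.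
\<close>

record 'a gop_module =
  obj :: "graph \<Rightarrow> 'a monoid"
  mor :: "graph \<Rightarrow> graph \<Rightarrow> cmap \<Rightarrow> 'a \<Rightarrow> 'a"

definition Gop_module :: "nat \<Rightarrow> 'a gop_module \<Rightarrow> bool" where
  "Gop_module g M \<longleftrightarrow>
     (\<forall>G. graph_of_genus g G \<longrightarrow> comm_group (obj M G)) \<and>
     (\<forall>G G' \<phi>. graph_of_genus g G \<and> graph_of_genus g G' \<and> contraction G G' \<phi> \<longrightarrow>
        mor M G G' \<phi> \<in> hom (obj M G') (obj M G)) \<and>
     (\<forall>G. graph_of_genus g G \<longrightarrow> (\<forall>x\<in>carrier (obj M G). mor M G G (cmap_id G) x = x)) \<and>
     (\<forall>G G' G'' \<phi> \<psi>. graph_of_genus g G \<and> graph_of_genus g G' \<and> graph_of_genus g G'' \<and>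
        contraction G G' \<phi> \<and> contraction G' G'' \<psi> \<longrightarrow>
        (\<forall>x\<in>carrier (obj M G''). mor M G G'' (cmap_comp G \<psi> \<phi>) x = mor M G G' \<phi> (mor M G' G'' \<psi> x)))"

definition generated_by :: "nat \<Rightarrow> 'a gop_module \<Rightarrow> (graph \<times> 'a) set \<Rightarrow> bool" where
  "generated_by g M X \<longleftrightarrow>
     (\<forall>(G', v)\<in>X. graph_of_genus g G' \<and> v \<in> carrier (obj M G')) \<and>
     (\<forall>G. graph_of_genus g G \<longrightarrow>
        generate (obj M G) {mor M G G' \<phi> v | G' \<phi> v. (G', v) \<in> X \<and> contraction G G' \<phi>}
          = carrier (obj M G))"

definition finitely_generated :: "nat \<Rightarrow> 'a gop_module \<Rightarrow> bool" where
  "finitely_generated g M \<longleftrightarrow> (\<exists>X. finite X \<and> generated_by g M X)"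

definition finitely_generated_in_degrees_le :: "nat \<Rightarrow> nat \<Rightarrow> 'a gop_module \<Rightarrow> bool" where
  "finitely_generated_in_degrees_le g d M \<longleftrightarrow>
     (\<exists>X. finite X \<and> generated_by g M X \<and> (\<forall>(G', v)\<in>X. card (edges G') \<le> d))"

definition Gop_submodule :: "nat \<Rightarrow> (graph \<Rightarrow> 'a set) \<Rightarrow> 'a gop_module \<Rightarrow> bool" where
  "Gop_submodule g P N \<longleftrightarrow>
     (\<forall>G. graph_of_genus g G \<longrightarrow> subgroup (P G) (obj N G)) \<and>
     (\<forall>G G' \<phi>. graph_of_genus g G \<and> graph_of_genus g G' \<and> contraction G G' \<phi> \<longrightarrow>
        mor N G G' \<phi> ` P G' \<subseteq> P G)"

text \<open>
  \<open>M\<close> is a quotient (via \<open>\<pi>\<close>) of a submodule \<open>P\<close> of \<open>N\<close>.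
\<close>

definition subquotient :: "nat \<Rightarrow> 'a gop_module \<Rightarrow> 'b gop_module \<Rightarrow> bool" where
  "subquotient g M N \<longleftrightarrow>
     (\<exists>P \<pi>. Gop_submodule g P N \<and>
        (\<forall>G. graph_of_genus g G \<longrightarrow>
           \<pi> G \<in> epi ((obj N G)\<lparr>carrier := P G\<rparr>) (obj M G)) \<and>
        (\<forall>G G' \<phi>. graph_of_genus g G \<and> graph_of_genus g G' \<and> contraction G G' \<phi> \<longrightarrow>
           (\<forall>x\<in>P G'. \<pi> G (mor N G G' \<phi> x) = mor M G G' \<phi> (\<pi> G' x))))"

text \<open>
  The type \<open>nat\<close> for the elements of \<open>N\<close> is no restriction: there are finitely many contractions
  between two graphs, so each value of a finitely generated module is a finitely generated, hence
  countable, abelian group.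
\<close>

definition small :: "nat \<Rightarrow> nat \<Rightarrow> 'a gop_module \<Rightarrow> bool" where
  "small g d M \<longleftrightarrow>
     (\<exists>N :: nat gop_module. Gop_module g N \<and> finitely_generated_in_degrees_le g d N \<and> subquotient g M N)"


section \<open>Configuration spaces\<close>

definition quotient_topology :: "'a topology \<Rightarrow> ('a \<Rightarrow> 'b) \<Rightarrow> 'b topology" where
  "quotient_topology X q =
     topology (\<lambda>U. U \<subseteq> q ` topspace X \<and> openin X {x \<in> topspace X. q x \<in> U})"

lemma openin_quotient_topology:
  "openin (quotient_topology X q) U \<longleftrightarrow> U \<subseteq> q ` topspace X \<and> openin X {x \<in> topspace X. q x \<in> U}"
proof -
  have "istopology (\<lambda>U. U \<subseteq> q ` topspace X \<and> openin X {x \<in> topspace X. q x \<in> U})"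
    unfolding istopology_def
  proof (intro conjI allI impI)
    fix S T assume "S \<subseteq> q ` topspace X \<and> openin X {x \<in> topspace X. q x \<in> S}"
      "T \<subseteq> q ` topspace X \<and> openin X {x \<in> topspace X. q x \<in> T}"
    moreover have "{x \<in> topspace X. q x \<in> S \<inter> T} = {x \<in> topspace X. q x \<in> S} \<inter> {x \<in> topspace X. q x \<in> T}"
      by auto
    ultimately show "S \<inter> T \<subseteq> q ` topspace X" "openin X {x \<in> topspace X. q x \<in> S \<inter> T}"
      by auto
  next
    fix K assume K: "\<forall>S\<in>K. S \<subseteq> q ` topspace X \<and> openin X {x \<in> topspace X. q x \<in> S}"
    have "{x \<in> topspace X. q x \<in> \<Union>K} = (\<Union>S\<in>K. {x \<in> topspace X. q x \<in> S})"
      by auto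
    with K show "\<Union>K \<subseteq> q ` topspace X" "openin X {x \<in> topspace X. q x \<in> \<Union>K}"
      by auto
  qed
  then show ?thesis
    by (simp add: quotient_topology_def topology_inverse')
qed

lemma quotient_map_quotient_topology: "quotient_map X (quotient_topology X q) q"
proof -
  have "openin (quotient_topology X q) (q ` topspace X)"
    by (auto simp: openin_quotient_topology cong: conj_cong)
  then have "topspace (quotient_topology X q) = q ` topspace X"
    by (metis openin_quotient_topology openin_subset openin_topspace subset_antisym)
  then show ?thesis
    by (auto simp: quotient_map_def openin_quotient_topology)
qed

text \<open>The geometric realization is a quotient of \<open>verts G \<squnion> edges G \<times> [0,1]\<close>.\<close>

datatype gpoint = Vertex nat | Interior nat real

fun attach :: "graph \<Rightarrow> nat + nat \<times> real \<Rightarrow> gpoint" where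
  "attach G (Inl v) = Vertex v"
| "attach G (Inr (e, t)) =
     (if t = 0 then Vertex (endpt G e False)
      else if t = 1 then Vertex (endpt G e True)
      else Interior e t)"

text \<open>
  The disjoint union is formed inside \<open>nat + nat \<times> real\<close>: a set is open iff its intersection
  with each edge is open in \<open>[0,1]\<close> (vertices are isolated).
\<close>

definition cells :: "graph \<Rightarrow> (nat + nat \<times> real) topology" where
  "cells G = topology (\<lambda>U. U \<subseteq> Inl ` verts G \<union> Inr ` (edges G \<times> {0..1}) \<and>
     (\<forall>e\<in>edges G. openin (top_of_set {0..1}) {t. Inr (e, t) \<in> U}))"

lemma openin_cells:
  "openin (cells G) U \<longleftrightarrow> U \<subseteq> Inl ` verts G \<union> Inr ` (edges G \<times> {0..1}) \<and>
     (\<forall>e\<in>edges G. openin (top_of_set {0..1}) {t. Inr (e, t) \<in> U})"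
proof -
  have "istopology (\<lambda>U. U \<subseteq> Inl ` verts G \<union> Inr ` (edges G \<times> {0..1::real}) \<and>
     (\<forall>e\<in>edges G. openin (top_of_set {0..1}) {t. Inr (e, t) \<in> U}))" (is "istopology ?L")
    unfolding istopology_def
  proof (intro conjI allI impI)
    fix S T assume "?L S" "?L T"
    moreover have "{t. Inr (e, t) \<in> S \<inter> T} = {t. Inr (e, t) \<in> S} \<inter> {t. Inr (e, t) \<in> T}" for e
      by auto
    ultimately show "S \<inter> T \<subseteq> Inl ` verts G \<union> Inr ` (edges G \<times> {0..1})"
      "\<forall>e\<in>edges G. openin (top_of_set {0..1}) {t. Inr (e, t) \<in> S \<inter> T}"
      by auto
  next
    fix K assume K: "\<forall>S\<in>K. ?L S"
    have "{t. Inr (e, t) \<in> \<Union>K} = (\<Union>S\<in>K. {t. Inr (e, t) \<in> S})" for e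
      by auto
    then show "\<forall>e\<in>edges G. openin (top_of_set {0..1}) {t. Inr (e, t) \<in> \<Union>K}"
      using K by auto
    show "\<Union>K \<subseteq> Inl ` verts G \<union> Inr ` (edges G \<times> {0..1})"
      using K by blast
  qed
  then show ?thesis
    by (simp add: cells_def topology_inverse')
qed

definition realization :: "graph \<Rightarrow> gpoint topology" where
  "realization G = quotient_topology (cells G) (attach G)"

definition Conf :: "nat \<Rightarrow> 'a topology \<Rightarrow> (nat \<Rightarrow> 'a) topology" where
  "Conf n X = subtopology (product_topology (\<lambda>_. X) {..<n}) {x. inj_on x {..<n}}"

definition orbit :: "nat \<Rightarrow> (nat \<Rightarrow> 'a) \<Rightarrow> (nat \<Rightarrow> 'a) set" where
  "orbit n x = {x \<circ> \<sigma> | \<sigma>. \<sigma> permutes {..<n}}"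

definition UConf :: "nat \<Rightarrow> graph \<Rightarrow> (nat \<Rightarrow> gpoint) set topology" where
  "UConf n G = quotient_topology (Conf n (realization G)) (orbit n)"


section \<open>The reduced Swiatkowski complex\<close>

text \<open>
  Polynomials in the edges; a monomial is a finitely supported exponent function.
\<close>

type_synonym epoly = "(nat \<Rightarrow>\<^sub>0 nat) \<Rightarrow>\<^sub>0 int"

definition edge_var :: "nat \<Rightarrow> epoly" where
  "edge_var e = Poly_Mapping.single (Poly_Mapping.single e 1) 1"

definition A_ring :: "graph \<Rightarrow> epoly set" where
  "A_ring G = {p. \<forall>m\<in>Poly_Mapping.keys p. Poly_Mapping.keys m \<subseteq> edges G}"

definition mono_degree :: "(nat \<Rightarrow>\<^sub>0 nat) \<Rightarrow> nat" where
  "mono_degree m = (\<Sum>e\<in>Poly_Mapping.keys m. Poly_Mapping.lookup m e)"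

text \<open>Elements of a free module on a set of symbols of type \<open>'x\<close> have type \<open>'x \<Rightarrow>\<^sub>0 epoly\<close>.\<close>

definition smul :: "epoly \<Rightarrow> ('x \<Rightarrow>\<^sub>0 epoly) \<Rightarrow> ('x \<Rightarrow>\<^sub>0 epoly)" where
  "smul p = Poly_Mapping.map ((*) p)"

inductive_set A_span :: "graph \<Rightarrow> ('x \<Rightarrow>\<^sub>0 epoly) set \<Rightarrow> ('x \<Rightarrow>\<^sub>0 epoly) set"
  for G :: graph and B :: "('x \<Rightarrow>\<^sub>0 epoly) set" where
  zero: "0 \<in> A_span G B"
| add: "x \<in> A_span G B \<Longrightarrow> b \<in> B \<Longrightarrow> p \<in> A_ring G \<Longrightarrow> x + smul p b \<in> A_span G B"

text \<open>
  The basis of \<open>S(v)\<close> consists of \<open>None\<close>, standing for the symbol \<open>\<emptyset>\<close>, and \<open>Some h\<close> for the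
  half-edges \<open>h\<close> at \<open>v\<close>.
\<close>

definition basis_elt :: "half option \<Rightarrow> (half option \<Rightarrow>\<^sub>0 epoly)" where
  "basis_elt b = Poly_Mapping.single b 1"

definition reduced_S :: "graph \<Rightarrow> nat \<Rightarrow> (half option \<Rightarrow>\<^sub>0 epoly) set" where
  "reduced_S G v =
     A_span G (insert (basis_elt None)
       {basis_elt (Some h) - basis_elt (Some h') | h h'. h \<in> halves_at G v \<and> h' \<in> halves_at G v})"

text \<open>
  The tensor product over \<open>A_G\<close> of the free modules \<open>S(v)\<close> is free on the states, i.e. the
  choices of one basis element of each \<open>S(v)\<close>. Each reduced module is a direct summand of \<open>S(v)\<close>,
  so the tensor product of the reduced modules is the submodule of it spanned by the pure tensors
  of reduced elements.
\<close>

type_synonym state = "nat \<Rightarrow> half option"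
type_synonym sw_chain = "state \<Rightarrow>\<^sub>0 epoly"

definition states :: "graph \<Rightarrow> state set" where
  "states G = {s. \<forall>v h. s v = Some h \<longrightarrow> v \<in> verts G \<and> h \<in> halves_at G v}"

definition occupied :: "state \<Rightarrow> nat set" where
  "occupied s = {v. s v \<noteq> None}"

definition pure_tensor :: "graph \<Rightarrow> (nat \<Rightarrow> (half option \<Rightarrow>\<^sub>0 epoly)) \<Rightarrow> sw_chain" where
  "pure_tensor G x =
     (\<Sum>s\<in>states G. Poly_Mapping.single s (\<Prod>v\<in>verts G. Poly_Mapping.lookup (x v) (s v)))"

definition sw_complex :: "graph \<Rightarrow> sw_chain set" where
  "sw_complex G = A_span G {pure_tensor G x | x. \<forall>v\<in>verts G. x v \<in> reduced_S G v}"

text \<open>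
  The differential of a tensor product of complexes, with the tensor factors in increasing order
  of the vertices and the Koszul sign \<open>(-1)^k\<close> for passing \<open>k\<close> factors of homological degree 1.
  On a factor it is \<open>h \<mapsto> e(h)\<emptyset>\<close>, which restricts to \<open>h - h' \<mapsto> (e(h) - e(h'))\<emptyset>\<close>.
\<close>

definition sw_diff :: "sw_chain \<Rightarrow> sw_chain" where
  "sw_diff c =
     (\<Sum>s\<in>Poly_Mapping.keys c. \<Sum>v\<in>occupied s.
        Poly_Mapping.single (s(v := None))
          ((-1) ^ card {w \<in> occupied s. w < v} * edge_var (fst (the (s v))) * Poly_Mapping.lookup c s))"

text \<open>Edges have bidegree \<open>(0,1)\<close>, \<open>\<emptyset>\<close> has \<open>(0,0)\<close>, half-edges have \<open>(1,1)\<close>.\<close>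

definition sw_part :: "graph \<Rightarrow> nat \<Rightarrow> nat \<Rightarrow> sw_chain set" where
  "sw_part G i n =
     {c \<in> sw_complex G. \<forall>s\<in>Poly_Mapping.keys c. card (occupied s) = i \<and>
        (\<forall>m\<in>Poly_Mapping.keys (Poly_Mapping.lookup c s). mono_degree m + card (occupied s) = n)}"

definition sw_cycle_group :: "graph \<Rightarrow> nat \<Rightarrow> nat \<Rightarrow> sw_chain monoid" where
  "sw_cycle_group G i n = \<lparr>carrier = {c \<in> sw_part G i n. sw_diff c = 0}, monoid.mult = (+), one = 0\<rparr>"

definition sw_boundaries :: "graph \<Rightarrow> nat \<Rightarrow> nat \<Rightarrow> sw_chain set" where
  "sw_boundaries G i n = sw_diff ` sw_part G (i + 1) n"

definition sw_homology :: "graph \<Rightarrow> nat \<Rightarrow> nat \<Rightarrow> sw_chain set monoid" where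
  "sw_homology G i n = sw_cycle_group G i n Mod sw_boundaries G i n"


section \<open>Maps induced by contractions\<close>

definition pre_half :: "cmap \<Rightarrow> half \<Rightarrow> half" where
  "pre_half \<phi> h' = (THE h. hmap \<phi> h = Some h')"

definition pre_edge :: "cmap \<Rightarrow> nat \<Rightarrow> nat" where
  "pre_edge \<phi> e' = fst (pre_half \<phi> (e', True))"

text \<open>The ring homomorphism sending each variable \<open>e'\<close> to the variable \<open>f e'\<close>.\<close>

definition rename_vars :: "(nat \<Rightarrow> nat) \<Rightarrow> epoly \<Rightarrow> epoly" where
  "rename_vars f p =
     (\<Sum>m\<in>Poly_Mapping.keys p. Poly_Mapping.single 0 (Poly_Mapping.lookup p m) *
        (\<Prod>e\<in>Poly_Mapping.keys m. edge_var (f e) ^ Poly_Mapping.lookup m e))"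

text \<open>
  Let \<open>\<phi> : G \<rightarrow> G'\<close> be an isomorphism or contract exactly one edge, let \<open>s\<close> be a state of \<open>G'\<close>
  and \<open>v\<close> a vertex of \<open>G\<close>. The image of the basis tensor \<open>s\<close> is, up to the Koszul sign, the pure
  tensor with factor \<open>induced_factor G \<phi> s v\<close> at \<open>v\<close>. A half-edge \<open>h'\<close> of \<open>s\<close> with preimage \<open>h\<close>
  contributes to the factor at \<open>v(h)\<close> only: it gives \<open>h\<close> if \<open>v(h)\<close> is not an end of a contracted
  edge, and \<open>h - k\<close> if \<open>v(h)\<close> is an end of the contracted edge and \<open>k\<close> is the half-edge of that
  edge there. The remaining factors are \<open>\<emptyset>\<close>.
\<close>

definition lands_at :: "graph \<Rightarrow> cmap \<Rightarrow> state \<Rightarrow> nat \<Rightarrow> bool" where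
  "lands_at G \<phi> s v \<longleftrightarrow> (\<exists>h'. s (vmap \<phi> v) = Some h' \<and> hvert G (pre_half \<phi> h') = v)"

definition induced_factor :: "graph \<Rightarrow> cmap \<Rightarrow> state \<Rightarrow> nat \<Rightarrow> (half option \<Rightarrow>\<^sub>0 epoly)" where
  "induced_factor G \<phi> s v =
     (if lands_at G \<phi> s v
      then basis_elt (Some (pre_half \<phi> (the (s (vmap \<phi> v)))))
           - (\<Sum>k\<in>{k \<in> halves_at G v. fst k \<in> contracted_edges G \<phi>}. basis_elt (Some k))
      else basis_elt None)"

text \<open>
  The factors of degree 1 arise in the order of the vertices of \<open>G'\<close> and have to be reordered
  according to the vertices of \<open>G\<close>.
\<close>

definition koszul_inversions :: "graph \<Rightarrow> cmap \<Rightarrow> state \<Rightarrow> nat" where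
  "koszul_inversions G \<phi> s =
     card {(u, v). u \<in> verts G \<and> v \<in> verts G \<and> lands_at G \<phi> s u \<and> lands_at G \<phi> s v \<and>
                   u < v \<and> vmap \<phi> v < vmap \<phi> u}"

definition elementary_pullback :: "graph \<Rightarrow> cmap \<Rightarrow> sw_chain \<Rightarrow> sw_chain" where
  "elementary_pullback G \<phi> c =
     (\<Sum>s\<in>Poly_Mapping.keys c.
        smul ((-1) ^ koszul_inversions G \<phi> s * rename_vars (pre_edge \<phi>) (Poly_Mapping.lookup c s))
             (pure_tensor G (induced_factor G \<phi> s)))"

text \<open>\<open>is_pullback G G' \<phi> f\<close>: \<open>f\<close> arises from a factorization of \<open>\<phi>\<close> into elementary contractions.\<close>

inductive is_pullback :: "graph \<Rightarrow> graph \<Rightarrow> cmap \<Rightarrow> (sw_chain \<Rightarrow> sw_chain) \<Rightarrow> bool" where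
  elementary: "contraction G G' \<phi> \<Longrightarrow> card (contracted_edges G \<phi>) \<le> 1 \<Longrightarrow>
     is_pullback G G' \<phi> (elementary_pullback G \<phi>)"
| composite: "is_pullback G G' \<phi> f \<Longrightarrow> is_pullback G' G'' \<psi> f' \<Longrightarrow>
     is_pullback G G'' (cmap_comp G \<psi> \<phi>) (f \<circ> f')"

text \<open>On the reduced complex of \<open>G'\<close> the result does not depend on the factorization chosen.\<close>

definition sw_pullback :: "graph \<Rightarrow> graph \<Rightarrow> cmap \<Rightarrow> sw_chain \<Rightarrow> sw_chain" where
  "sw_pullback G G' \<phi> = (SOME f. is_pullback G G' \<phi> f)"

text \<open>The homology class of \<open>z\<close> goes to that of \<open>sw_pullback G G' \<phi> z\<close>.\<close>

definition sw_homology_map ::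
    "graph \<Rightarrow> graph \<Rightarrow> cmap \<Rightarrow> nat \<Rightarrow> nat \<Rightarrow> sw_chain set \<Rightarrow> sw_chain set" where
  "sw_homology_map G G' \<phi> i n Z =
     sw_boundaries G i n <#>\<^bsub>sw_cycle_group G i n\<^esub> (sw_pullback G G' \<phi> ` Z)"


section \<open>The module structure on the homology of configuration spaces\<close>

type_synonym uconf_class = "(nat \<Rightarrow> gpoint) set chain set"

definition exceptional :: "nat \<Rightarrow> nat \<Rightarrow> graph \<Rightarrow> bool" where
  "exceptional i n G \<longleftrightarrow> i = 0 \<and> n = 1 \<and> single_point G"

definition point_class :: "'a topology \<Rightarrow> 'a \<Rightarrow> 'a chain set" where
  "point_class X x = homologous_rel_set 0 X {} (frag_of (restrict (\<lambda>_. x) (standard_simplex 0)))"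

text \<open>
  A family of isomorphisms between the singular homology of the configuration spaces and the
  homology of the reduced complexes, as provided by the theorem of An, Drummond-Cole and Knudsen.
  In bidegree \<open>(0,1)\<close>, where both sides are infinite cyclic, it is normalized as theirs is: the class
  of a particle corresponds to the class of \<open>e\<emptyset>\<close>, for any edge \<open>e\<close>. This fixes the sign, so that
  it is compatible with the canonical identification used when the target is a point.
\<close>

definition ADK_isomorphisms ::
    "nat \<Rightarrow> nat \<Rightarrow> nat \<Rightarrow> (graph \<Rightarrow> uconf_class \<Rightarrow> sw_chain set) \<Rightarrow> bool" where
  "ADK_isomorphisms g i n \<theta> \<longleftrightarrow>
     (\<forall>G. graph_of_genus g G \<and> \<not> exceptional i n G \<longrightarrow>
        \<theta> G \<in> iso (homology_group (int i) (UConf n G)) (sw_homology G i n)) \<and>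
     (i = 0 \<and> n = 1 \<longrightarrow>
        (\<forall>G x e. graph_of_genus g G \<and> x \<in> topspace (UConf 1 G) \<and> e \<in> edges G \<longrightarrow>
           \<theta> G (point_class (UConf 1 G) x) =
             sw_boundaries G 0 1 #>\<^bsub>sw_cycle_group G 0 1\<^esub> Poly_Mapping.single (\<lambda>_. None) (edge_var e)))"

text \<open>
  In the exceptional case the canonical identification \<open>H_0(UConf_1(G')) \<rightarrow> H_0(UConf_1(G))\<close>
  is the inverse of the isomorphism induced by the map to the one-point space \<open>UConf_1(G')\<close>.
\<close>

definition canonical_H0 :: "graph \<Rightarrow> graph \<Rightarrow> uconf_class \<Rightarrow> uconf_class" where
  "canonical_H0 G G' =
     inv_into (carrier (homology_group 0 (UConf 1 G)))
       (hom_induced 0 (UConf 1 G) {} (UConf 1 G') {} (\<lambda>_. the_elem (topspace (UConf 1 G'))))"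

definition conf_module ::
    "nat \<Rightarrow> nat \<Rightarrow> (graph \<Rightarrow> uconf_class \<Rightarrow> sw_chain set) \<Rightarrow> uconf_class gop_module" where
  "conf_module i n \<theta> =
     \<lparr>obj = (\<lambda>G. homology_group (int i) (UConf n G)),
      mor = (\<lambda>G G' \<phi>.
        if exceptional i n G' then canonical_H0 G G'
        else inv_into (carrier (homology_group (int i) (UConf n G))) (\<theta> G)
               \<circ> sw_homology_map G G' \<phi> i n \<circ> \<theta> G')\<rparr>"

end

theory Submission
  imports Defs "HOL-Library.Tree" "HOL-Library.Ramsey" "HOL-Library.List_Lexorder"
begin

text \<open>
  A chain of the reduced complex amounts to an alternating function on lists of half-edges whose sums
  over the half-edges at each vertex vanish, and in these terms the pullback along a contraction is
  described without Koszul signs and without a factorization: outside the contracted forest it is a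
  relabelling, and on the forest it is antisymmetric, hence determined by flow conservation. This gives
  functoriality and compatibility with the differential.

  Noetherianity of the module of chains of fixed bidegree is a Groebner basis argument. After the choice
  of a spanning tree a chain of bidegree \<open>(i, n)\<close> is determined by its coefficients at words of \<open>n\<close>
  half-edges none of which points to the root, and so has a leading word for the preorder of the tree. Graphs decorated with a word are labelled binary trees; a tree embedding extends to a
  contraction along which leading words and leading coefficients are preserved. By Kruskal's theorem,
  and since ideals of \<open>\<int>\<close> are principal, finitely many chains carry all leading terms of a submodule, in
  particular of the cycles. The chains themselves are generated in degree \<open>g + i + n\<close>, because in a
  larger graph some tree edge is not involved in a given basis chain and can be contracted. Homology is a
  quotient of the submodule of cycles. Over a single point the complex misses the class of one particle;
  this only happens for \<open>(g, i, n) = (0, 0, 1)\<close>, where the module is constant.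
\<close>

section \<open>Well-quasi-orders and binary trees\<close>

text \<open>Finite generation and the degree bound are separate matters. The noetherian argument
  yields finitely many generators of any submodule, with no control of their degree; the bound is
  proved for the module of all chains only, and homology inherits it as smallness. The number
  \<open>g + i + n\<close> is a count: a spanning tree has \<open>g\<close> edges fewer than the
  graph, a basis chain occupies \<open>i\<close> vertices and, apart from parent edges of these,
  involves at most \<open>n\<close> edges; beyond the bound some free vertex has a free parent edge.
  Leading words survive a pullback for this reason: the coefficient at a word with a contracted
  half-edge pointing away from the root is, by antisymmetry and the vertex sum at the far end, the
  sum of the coefficients with that letter replaced by a half-edge continuing beyond it. Such
  letters come later in the preorder, so eliminating contracted letters only moves words upward,
  onto images under the embedding. Chords must never be contracted; there are always
  \<open>g\<close> of them, so a finite alphabet can number them, and a word is recorded by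
  labelling each node with its positions in it.\<close>

definition almost_full_on :: "('a \<Rightarrow> 'a \<Rightarrow> bool) \<Rightarrow> 'a set \<Rightarrow> bool" where
  "almost_full_on R A \<longleftrightarrow> (\<forall>f :: nat \<Rightarrow> 'a. range f \<subseteq> A \<longrightarrow> (\<exists>i j. i < j \<and> R (f i) (f j)))"

text \<open>Ramsey's theorem for pairs: on an infinite set of indices where all pairs have one
  colour, the colour "unrelated" is excluded, since some pair of that subsequence is related. The
  colour of an unordered pair is read off its minimum and maximum.\<close>

lemma almost_full_on_subsequence:
  assumes "almost_full_on R A" "range f \<subseteq> A"
  shows "\<exists>h :: nat \<Rightarrow> nat. strict_mono h \<and> (\<forall>i j. i < j \<longrightarrow> R (f (h i)) (f (h j)))"
proof -
  define c where "c = (\<lambda>X :: nat set. if R (f (Min X)) (f (Max X)) then 0 else 1 :: nat)"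
  have "\<exists>Y t. Y \<subseteq> UNIV \<and> infinite Y \<and> t < 2 \<and> (\<forall>x\<in>Y. \<forall>y\<in>Y. x \<noteq> y \<longrightarrow> c {x, y} = t)"
    by (rule Ramsey2) (auto simp: c_def)
  then obtain Y t where Y: "infinite Y" "\<And>x y. x \<in> Y \<Longrightarrow> y \<in> Y \<Longrightarrow> x \<noteq> y \<Longrightarrow> c {x, y} = t"
    by metis
  define h where "h = enumerate Y"
  have h: "strict_mono h" "\<And>i. h i \<in> Y"
    using Y(1) by (auto simp: h_def strict_mono_enumerate enumerate_in_set)
  have "range (f \<circ> h) \<subseteq> A"
    using assms(2) by auto
  then obtain i j where ij: "i < j" "R (f (h i)) (f (h j))"
    using assms(1) unfolding almost_full_on_def by (metis comp_apply)
  have cc: "c {h i, h j} = (if R (f (h i)) (f (h j)) then 0 else 1)" if "i < j" for i j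
  proof -
    have "h i < h j"
      using that h(1) by (simp add: strict_mono_def)
    then show ?thesis
      by (simp add: c_def)
  qed
  have "t = 0"
    using cc[OF ij(1)] ij Y(2)[of "h i" "h j"] h by (auto simp: strict_mono_eq)
  have "R (f (h i)) (f (h j))" if "i < j" for i j
    using cc[OF that] Y(2)[of "h i" "h j"] h that \<open>t = 0\<close>
    by (auto simp: strict_mono_eq split: if_splits)
  then show ?thesis
    using h(1) by auto
qed

text \<open>If every finite subset missed something, picking again and again an element above none
  of the earlier picks would give a sequence without a related pair.\<close>

lemma almost_full_on_finite_basis:
  assumes "almost_full_on R A"
  shows "\<exists>S. finite S \<and> S \<subseteq> A \<and> (\<forall>a\<in>A. a \<in> S \<or> (\<exists>s\<in>S. R s a))"
proof (rule ccontr)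
  assume "\<not> ?thesis"
  then have *: "\<exists>a\<in>A. a \<notin> S \<and> (\<forall>s\<in>S. \<not> R s a)" if "finite S" "S \<subseteq> A" for S
    using that by metis
  define pick where "pick S = (SOME a. a \<in> A \<and> (\<forall>s\<in>S. \<not> R s a))" for S
  have pick: "pick S \<in> A" "\<And>s. s \<in> S \<Longrightarrow> \<not> R s (pick S)" if "finite S" "S \<subseteq> A" for S
    using someI_ex[of "\<lambda>a. a \<in> A \<and> (\<forall>s\<in>S. \<not> R s a)"] *[OF that] unfolding pick_def by (auto 4 3)
  define T where "T = rec_nat {} (\<lambda>_ S. insert (pick S) S)"
  have T: "T 0 = {}" "T (Suc n) = insert (pick (T n)) (T n)" for n
    by (auto simp: T_def)
  have fin: "finite (T n) \<and> T n \<subseteq> A" for n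
    by (induction n) (auto simp: T pick)
  have mono: "i \<le> j \<Longrightarrow> T i \<subseteq> T j" for i j
    by (rule lift_Suc_mono_le[of T]) (auto simp: T)
  have "\<not> R (pick (T i)) (pick (T j))" if "i < j" for i j
    using mono[of "Suc i" j] that fin[of j] pick(2)[of "T j" "pick (T i)"] by (auto simp: T)
  moreover have "range (\<lambda>i. pick (T i)) \<subseteq> A"
    using fin pick(1) by auto
  ultimately show False
    using assms unfolding almost_full_on_def by (metis (lifting))
qed

section \<open>Kruskal's theorem for binary trees with finitely many labels\<close>

text \<open>\<open>left\<close> and \<open>right\<close> discard the root of the target together
  with one of its subtrees; \<open>node\<close> sends left to left and right to right. Read on
  forests, this keeps descendants below and later siblings beside a matched node, so that ancestry
  is neither lost nor created.\<close>

inductive tree_emb :: "('a \<Rightarrow> 'b \<Rightarrow> bool) \<Rightarrow> 'a tree \<Rightarrow> 'b tree \<Rightarrow> bool" for P where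
  Leaf: "tree_emb P Leaf t"
| left: "tree_emb P t l \<Longrightarrow> tree_emb P t (Node l a r)"
| right: "tree_emb P t r \<Longrightarrow> tree_emb P t (Node l a r)"
| node: "P a b \<Longrightarrow> tree_emb P l l' \<Longrightarrow> tree_emb P r r' \<Longrightarrow> tree_emb P (Node l a r) (Node l' b r')"

text \<open>Kruskal's theorem speaks of trees with labels from a finite set, whereas the node map
  extracted from an embedding has to act on half-edges; this passes from the label trees back to the
  trees that were labelled.\<close>

lemma tree_emb_map:
  "tree_emb (=) s t \<Longrightarrow> s = map_tree f u \<Longrightarrow> t = map_tree g v \<Longrightarrow> tree_emb (\<lambda>x y. f x = g y) u v"
proof (induction s t arbitrary: u v rule: tree_emb.induct)
  case (Leaf t)
  then show ?case by (cases u) (auto intro: tree_emb.intros)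
next
  case (left t l a r)
  then show ?case by (cases v) (auto intro: tree_emb.intros)
next
  case (right t r l a)
  then show ?case by (cases v) (auto intro: tree_emb.intros)
next
  case (node a b l l' r r')
  then show ?case by (cases u; cases v) (auto intro: tree_emb.intros)
qed

text \<open>Kruskal's theorem by Nash-Williams' minimal bad sequence argument.\<close>

lemma almost_full_on_tree_emb:
  assumes "finite L"
  shows "almost_full_on (tree_emb (=)) {t. set_tree t \<subseteq> L}"
proof (rule ccontr)
  let ?R = "tree_emb (=) :: 'a tree \<Rightarrow> 'a tree \<Rightarrow> bool" and ?A = "{t. set_tree t \<subseteq> L}"
  define bad where "bad f \<longleftrightarrow> range f \<subseteq> ?A \<and> (\<forall>i j. i < j \<longrightarrow> \<not> ?R (f i) (f j))" for f :: "nat \<Rightarrow> 'a tree"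
  assume "\<not> almost_full_on ?R ?A"
  then obtain f0 where f0: "bad f0"
    unfolding almost_full_on_def bad_def by blast
  \<comment> \<open>Minimality in the sense of Nash-Williams: the entry at \<open>n\<close> is as
    small as in any bad sequence with the same entries before \<open>n\<close>.\<close>
  define P where "P n x \<longleftrightarrow> bad x \<and> (\<forall>g. bad g \<and> (\<forall>i<n. g i = x i) \<longrightarrow> size (x n) \<le> size (g n))" for n x
  have ex: "\<exists>y. P n y \<and> (\<forall>i<n. y i = x i)" if "bad x" for n x
  proof -
    define y where "y = arg_min (\<lambda>g. size (g n)) (\<lambda>g. bad g \<and> (\<forall>i<n. g i = x i))"
    have y: "bad y \<and> (\<forall>i<n. y i = x i)"
      unfolding y_def by (rule arg_min_natI[where k=x]) (use that in auto)
    have "size (y n) \<le> size (g n)" if "bad g \<and> (\<forall>i<n. g i = x i)" for g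
      unfolding y_def using arg_min_nat_le[of "\<lambda>g. bad g \<and> (\<forall>i<n. g i = x i)" g "\<lambda>g. size (g n)"] that
      by auto
    with y show ?thesis
      unfolding P_def by auto
  qed
  have "\<exists>F. \<forall>n. P n (F n) \<and> (\<forall>i\<le>n. F (Suc n) i = F n i)"
  proof (rule dependent_nat_choice)
    show "\<exists>x. P 0 x"
      using ex[OF f0, of 0] by blast
  next
    fix x n assume "P n x"
    then have "bad x"
      by (simp add: P_def)
    from ex[OF this, of "Suc n"] show "\<exists>y. P (Suc n) y \<and> (\<forall>i\<le>n. y i = x i)"
      by (auto simp: less_Suc_eq_le)
  qed
  then obtain F where F: "\<And>n. P n (F n)" "\<And>n i. i \<le> n \<Longrightarrow> F (Suc n) i = F n i"
    by metis
  \<comment> \<open>From stage \<open>n\<close> on the entry at \<open>n\<close> no longer changes,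
    so the diagonal is the minimal bad sequence.\<close>
  define m where "m n = F n n" for n
  have Fm: "F k i = m i" if "i \<le> k" for i k
    using that by (induction k rule: dec_induct) (auto simp: m_def F(2))
  have bad_m: "bad m"
    unfolding bad_def
  proof (intro conjI allI impI)
    show "range m \<subseteq> ?A"
      using F(1) unfolding P_def bad_def m_def by blast
    fix i j :: nat assume "i < j"
    then show "\<not> ?R (m i) (m j)"
      using F(1)[of j] Fm[of i j] Fm[of j j] unfolding P_def bad_def by (metis less_imp_le order_refl)
  qed
  have min_m: "size (m n) \<le> size (g n)" if "bad g" "\<And>i. i < n \<Longrightarrow> g i = m i" for g n
    using F(1)[of n] that Fm[of _ n] unfolding P_def by (metis less_imp_le order_refl)
  have "m n \<noteq> Leaf" for n
    using bad_m unfolding bad_def by (metis lessI tree_emb.Leaf)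
  then have "\<forall>n. \<exists>l a r. m n = Node l a r"
    by (metis tree.exhaust)
  then obtain l a r where m: "\<And>n. m n = Node (l n) (a n) (r n)"
    by metis
  define S where "S = range l \<union> range r"
  have S: "almost_full_on ?R S"
    unfolding almost_full_on_def
  proof (intro allI impI, rule ccontr)
    fix g :: "nat \<Rightarrow> 'a tree" assume "range g \<subseteq> S" and bad_g: "\<nexists>i j. i < j \<and> ?R (g i) (g j)"
    then have "\<forall>k. \<exists>p. g k = l p \<or> g k = r p"
      unfolding S_def by blast
    then obtain p where p: "\<And>k. g k = l (p k) \<or> g k = r (p k)"
      by metis
    define k0 where "k0 = arg_min p (\<lambda>_. True)"
    have k0: "p k0 \<le> p k" for k
      unfolding k0_def by (rule arg_min_nat_le) simp
    \<comment> \<open>The splice: \<open>m\<close> up to the smallest index from which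
      \<open>g\<close> draws a subtree, then \<open>g\<close> from that place on. It is bad again,
      because a tree embedding into a subtree embeds into the whole tree, and its entry at
      \<open>p k0\<close> is a proper subtree of the one of \<open>m\<close>.\<close>
    define h where "h i = (if i < p k0 then m i else g (k0 + i - p k0))" for i
    have sub: "set_tree (l n) \<subseteq> L" "set_tree (r n) \<subseteq> L" for n
      using bad_m m[of n] unfolding bad_def by (auto simp: image_subset_iff dest!: spec[of _ n])
    have "bad h"
      unfolding bad_def
    proof (intro conjI allI impI)
      show "range h \<subseteq> ?A"
        using bad_m sub p unfolding bad_def h_def by (auto simp: image_subset_iff) (metis in_mono)+
      fix i j :: nat assume ij: "i < j"
      show "\<not> ?R (h i) (h j)"
      proof (cases "i < p k0")
        case True
        show ?thesis
        proof (cases "j < p k0")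
          case True
          then show ?thesis
            using ij bad_m unfolding bad_def h_def by auto
        next
          case False
          let ?k = "k0 + j - p k0"
          have "\<not> ?R (m i) (m (p ?k))"
            using True k0[of ?k] bad_m unfolding bad_def by auto
          then have "\<not> ?R (m i) (g ?k)"
            using p[of ?k] m[of "p ?k"] tree_emb.left tree_emb.right by metis
          then show ?thesis
            using True False by (simp add: h_def)
        qed
      next
        case False
        then have "k0 + i - p k0 < k0 + j - p k0"
          using ij by auto
        then show ?thesis
          using False ij bad_g by (auto simp: h_def)
      qed
    qed
    moreover have "h i = m i" if "i < p k0" for i
      using that by (simp add: h_def)
    ultimately have "size (m (p k0)) \<le> size (h (p k0))"
      by (rule min_m)
    then show False
      using p[of k0] m[of "p k0"] by (auto simp: h_def)
  qed
  have "\<exists>u :: nat \<Rightarrow> nat. strict_mono u \<and> (\<forall>i j. i < j \<longrightarrow> ?R (l (u i)) (l (u j)))"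
    by (rule almost_full_on_subsequence[OF S]) (auto simp: S_def)
  then obtain u :: "nat \<Rightarrow> nat" where u: "strict_mono u" "\<forall>i j. i < j \<longrightarrow> ?R (l (u i)) (l (u j))"
    by metis
  have "\<exists>v :: nat \<Rightarrow> nat. strict_mono v \<and> (\<forall>i j. i < j \<longrightarrow> ?R ((r \<circ> u) (v i)) ((r \<circ> u) (v j)))"
    by (rule almost_full_on_subsequence[OF S]) (auto simp: S_def)
  then obtain v :: "nat \<Rightarrow> nat" where v: "strict_mono v" "\<forall>i j. i < j \<longrightarrow> ?R ((r \<circ> u) (v i)) ((r \<circ> u) (v j))"
    by metis
  have "a n \<in> L" for n
    using bad_m m[of n] unfolding bad_def by (auto simp: image_subset_iff dest!: spec[of _ n])
  then have "range (a \<circ> u \<circ> v) \<subseteq> L"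
    by auto
  then have "finite (range (a \<circ> u \<circ> v))"
    using assms finite_subset by blast
  \<comment> \<open>Root labels take finitely many values, so two of them agree along the common
    subsequence; there the left and the right subtrees embed as well.\<close>
  then have "\<not> inj (a \<circ> u \<circ> v)"
    using finite_imageD infinite_UNIV_nat by blast
  then obtain i j where "i \<noteq> j" "a (u (v i)) = a (u (v j))"
    unfolding inj_def by auto
  then obtain i j where ij: "i < j" "a (u (v i)) = a (u (v j))"
    by (metis nat_neq_iff)
  then have "v i < v j"
    using v(1) by (simp add: strict_mono_def)
  then have "?R (m (u (v i))) (m (u (v j)))" "u (v i) < u (v j)"
    unfolding m using ij u v(2) by (auto intro!: tree_emb.node simp: strict_mono_def)
  then show False
    using bad_m unfolding bad_def by blast
qed

text \<open>A binary tree is read as an ordered forest: the left subtree of a node is the forest of its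
  children, the right subtree consists of its later siblings.\<close>

primrec tree_distinct :: "'a tree \<Rightarrow> bool" where
  "tree_distinct Leaf = True"
| "tree_distinct (Node l a r) \<longleftrightarrow> a \<notin> set_tree l \<and> a \<notin> set_tree r \<and> set_tree l \<inter> set_tree r = {} \<and>
     tree_distinct l \<and> tree_distinct r"

primrec tree_anc :: "'a tree \<Rightarrow> ('a \<times> 'a) set" where
  "tree_anc Leaf = {}"
| "tree_anc (Node l a r) = {a} \<times> set_tree l \<union> tree_anc l \<union> tree_anc r"

primrec preorder_index :: "'a tree \<Rightarrow> 'a \<Rightarrow> nat" where
  "preorder_index Leaf x = 0"
| "preorder_index (Node l a r) x =
     (if x = a then 0 else if x \<in> set_tree l then Suc (preorder_index l x)
      else Suc (size l + preorder_index r x))"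

lemma preorder_index_less_size: "x \<in> set_tree t \<Longrightarrow> preorder_index t x < size t"
  by (induction t) auto

text \<open>The index is the position of the first occurrence in preorder, so it is injective even
  on a tree with repetitions.\<close>

lemma inj_on_preorder_index: "inj_on (preorder_index t) (set_tree t)"
proof (induction t)
  case (Node l a r)
  have "preorder_index l x \<noteq> size l + k" if "x \<in> set_tree l" for x k
    using preorder_index_less_size[OF that] by auto
  then show ?case
    using Node unfolding inj_on_def by auto (metis add.commute)+
qed auto

lemma tree_anc_subset: "tree_anc t \<subseteq> set_tree t \<times> set_tree t"
  by (induction t) auto

lemma tree_ancD: "(x, y) \<in> tree_anc t \<Longrightarrow> x \<in> set_tree t \<and> y \<in> set_tree t"
  using tree_anc_subset by blast

lemma tree_anc_preorder_index:
  "tree_distinct t \<Longrightarrow> (x, y) \<in> tree_anc t \<Longrightarrow> preorder_index t x < preorder_index t y"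
proof (induction t)
  case (Node l a r)
  then show ?case
    using tree_anc_subset[of l] tree_anc_subset[of r] by auto
qed auto

text \<open>Induction on the embedding; in the \<open>node\<close> case the root and the maps of the
  two subtrees are glued. Distinctness keeps the images of the three pieces apart, so the only
  ancestry between them is that of the root over its left subtree. Ancestry will produce the
  contraction, and the preorder will compare words.\<close>

lemma tree_emb_map_nodes:
  assumes "tree_emb P s t" "tree_distinct s" "tree_distinct t"
  shows "\<exists>\<iota>. (\<forall>x\<in>set_tree s. \<iota> x \<in> set_tree t \<and> P x (\<iota> x)) \<and>
    (\<forall>x\<in>set_tree s. \<forall>y\<in>set_tree s. preorder_index s x < preorder_index s y \<longrightarrow>
       preorder_index t (\<iota> x) < preorder_index t (\<iota> y)) \<and>
    (\<forall>x\<in>set_tree s. \<forall>y\<in>set_tree s. (\<iota> x, \<iota> y) \<in> tree_anc t \<longleftrightarrow> (x, y) \<in> tree_anc s)"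
proof -
  let ?G = "\<lambda>s t \<iota>. (\<forall>x\<in>set_tree s. \<iota> x \<in> set_tree t \<and> P x (\<iota> x)) \<and>
    (\<forall>x\<in>set_tree s. \<forall>y\<in>set_tree s. preorder_index s x < preorder_index s y \<longrightarrow>
       preorder_index t (\<iota> x) < preorder_index t (\<iota> y)) \<and>
    (\<forall>x\<in>set_tree s. \<forall>y\<in>set_tree s. (\<iota> x, \<iota> y) \<in> tree_anc t \<longleftrightarrow> (x, y) \<in> tree_anc s)"
  show "\<exists>\<iota>. ?G s t \<iota>"
    using assms
  proof (induction rule: tree_emb.induct)
    case (left t l a r)
    then obtain \<iota> where i: "?G t l \<iota>" by auto
    have "?G t (Node l a r) \<iota>"
      using i left.prems tree_anc_subset[of r] by auto
    then show ?case by blast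
  next
    case (right t r l a)
    then obtain \<iota> where i: "?G t r \<iota>" by auto
    have "?G t (Node l a r) \<iota>"
      using i right.prems tree_anc_subset[of l] by auto
    then show ?case by blast
  next
    case (node a b l l' r r')
    then obtain \<iota>1 \<iota>2 where i1: "?G l l' \<iota>1" and i2: "?G r r' \<iota>2" by auto
    define \<iota> where "\<iota> x = (if x = a then b else if x \<in> set_tree l then \<iota>1 x else \<iota>2 x)" for x
    have \<iota>: "\<iota> a = b" "\<And>x. x \<in> set_tree l \<Longrightarrow> \<iota> x = \<iota>1 x" "\<And>x. x \<in> set_tree r \<Longrightarrow> \<iota> x = \<iota>2 x"
      using node.prems by (auto simp: \<iota>_def)
    have *: "\<iota>1 x \<in> set_tree l'" "\<iota>1 x \<noteq> b" "\<iota>1 x \<notin> set_tree r'" if "x \<in> set_tree l" for x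
      using i1 that node.prems by auto
    have **: "\<iota>2 x \<in> set_tree r'" "\<iota>2 x \<noteq> b" "\<iota>2 x \<notin> set_tree l'" if "x \<in> set_tree r" for x
      using i2 that node.prems by auto
    have nin: "x \<notin> set_tree r \<and> x \<noteq> a" if "x \<in> set_tree l" for x
      using that node.prems by auto
    have nin2: "x \<notin> set_tree l \<and> x \<noteq> a" if "x \<in> set_tree r" for x
      using that node.prems by auto
    have a: "a \<notin> set_tree l" "a \<notin> set_tree r" "b \<notin> set_tree l'" "b \<notin> set_tree r'"
      using node.prems by auto
    have lt: "preorder_index l' (\<iota>1 x) < size l'" if "x \<in> set_tree l" for x
      using *[OF that] by (simp add: preorder_index_less_size)
    have lt2: "preorder_index l x < size l" if "x \<in> set_tree l" for x
      using that by (simp add: preorder_index_less_size)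
    have "?G (Node l a r) (Node l' b r') \<iota>"
    proof (intro conjI ballI)
      fix x assume "x \<in> set_tree (Node l a r)"
      then show "\<iota> x \<in> set_tree (Node l' b r')" "P x (\<iota> x)"
        using i1 i2 node.hyps \<iota> by auto
    next
      fix x y assume x: "x \<in> set_tree (Node l a r)" and y: "y \<in> set_tree (Node l a r)"
      consider "x = a" | "x \<in> set_tree l" | "x \<in> set_tree r"
        using x by auto
      note cx = this
      consider "y = a" | "y \<in> set_tree l" | "y \<in> set_tree r"
        using y by auto
      note cy = this
      show "preorder_index (Node l a r) x < preorder_index (Node l a r) y \<longrightarrow>
            preorder_index (Node l' b r') (\<iota> x) < preorder_index (Node l' b r') (\<iota> y)"
      proof (cases rule: cx; cases rule: cy)
        assume "x \<in> set_tree l" "y \<in> set_tree l"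
        then show ?thesis using i1 nin * by (auto simp: \<iota>)
      next
        assume "x \<in> set_tree r" "y \<in> set_tree r"
        then show ?thesis using i2 nin2 ** by (auto simp: \<iota>)
      next
        assume "x \<in> set_tree l" "y \<in> set_tree r"
        then show ?thesis using nin nin2 * ** lt[of x] by (auto simp: \<iota>)
      next
        assume "x \<in> set_tree r" "y \<in> set_tree l"
        then show ?thesis using nin nin2 * ** lt2[of y] by (auto simp: \<iota>)
      qed (use nin nin2 * ** in \<open>auto simp: \<iota>\<close>)
      show "(\<iota> x, \<iota> y) \<in> tree_anc (Node l' b r') \<longleftrightarrow> (x, y) \<in> tree_anc (Node l a r)"
      proof (cases rule: cx; cases rule: cy)
        assume "x \<in> set_tree l" "y \<in> set_tree l"
        then show ?thesis using i1 nin * by (auto simp: \<iota> dest: tree_ancD)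
      next
        assume "x \<in> set_tree r" "y \<in> set_tree r"
        then show ?thesis using i2 nin2 ** by (auto simp: \<iota> dest: tree_ancD)
      qed (use a nin nin2 * ** in \<open>auto simp: \<iota> dest: tree_ancD\<close>)
    qed
    then show ?case by blast
  next
    case (Leaf t)
    show ?case by simp
  qed
qed

section \<open>Spanning trees and the genus\<close>

definition opp :: "half \<Rightarrow> half" where
  "opp h = (fst h, \<not> snd h)"

lemma opp_simps [simp]: "opp (e, b) = (e, \<not> b)" "fst (opp h) = fst h" "snd (opp h) = (\<not> snd h)"
    "opp (opp h) = h" "opp h \<noteq> h" "h \<noteq> opp h"
  by (auto simp: opp_def prod_eq_iff)

lemma fst_eq_cases: "fst (h :: half) = fst k \<longleftrightarrow> h = k \<or> h = opp k"
  by (auto simp: opp_def prod_eq_iff)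

lemma mem_halves [simp]: "h \<in> halves G \<longleftrightarrow> fst h \<in> edges G"
  by (cases h) (auto simp: halves_def)

lemma mem_halves_at [simp]: "h \<in> halves_at G v \<longleftrightarrow> fst h \<in> edges G \<and> hvert G h = v"
  by (auto simp: halves_at_def)

lemma hvert_simp [simp]: "hvert G (e, b) = endpt G e b"
  by (simp add: hvert_def)

lemma wf_graph_hvert: "wf_graph G \<Longrightarrow> fst h \<in> edges G \<Longrightarrow> hvert G h \<in> verts G"
  by (cases h) (auto simp: wf_graph_def)

lemma finite_halves: "wf_graph G \<Longrightarrow> finite (halves G)"
  by (simp add: wf_graph_def halves_def)

lemma finite_halves_at: "wf_graph G \<Longrightarrow> finite (halves_at G v)"
  unfolding halves_at_def by (rule finite_subset[OF _ finite_halves]) auto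

definition adj :: "graph \<Rightarrow> (nat \<times> nat) set" where
  "adj G = {(endpt G e b, endpt G e (\<not> b)) | e b. e \<in> edges G}"

lemma connected_graph_adj:
  "connected_graph G \<longleftrightarrow> (\<forall>u\<in>verts G. \<forall>v\<in>verts G. (u, v) \<in> (adj G)\<^sup>*)"
  by (simp add: connected_graph_def adj_def)

lemma adjI: "fst h \<in> edges G \<Longrightarrow> (hvert G h, hvert G (opp h)) \<in> adj G"
  by (cases h) (auto simp: adj_def)

lemma adjE:
  assumes "(u, v) \<in> adj G"
  obtains h where "fst h \<in> edges G" "hvert G h = u" "hvert G (opp h) = v"
  using assms by (force simp: adj_def hvert_def opp_def)

lemma sum_halves_at:
  assumes "wf_graph G"
  shows "(\<Sum>h\<in>halves_at G v. f h) = (\<Sum>e\<in>edges G. \<Sum>b\<in>UNIV. if endpt G e b = v then f (e, b) else (0 :: 'a :: comm_monoid_add))"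
proof -
  have "(\<Sum>h\<in>halves_at G v. f h) = (\<Sum>h\<in>halves G. if hvert G h = v then f h else 0)"
    unfolding halves_at_def by (rule sum.inter_filter[OF finite_halves[OF assms]])
  also have "\<dots> = (\<Sum>e\<in>edges G. \<Sum>b\<in>UNIV. if endpt G e b = v then f (e, b) else 0)"
    unfolding halves_def by (subst sum.cartesian_product) (auto intro!: sum.cong simp: hvert_def)
  finally show ?thesis .
qed

text \<open>Signed by the direction of the half-edge, a 1-chain is an antisymmetric function of
  half-edges whose boundary is the sum at each vertex. Cycles are thus flows in the sense of
  \<open>flow_zero\<close>.\<close>

lemma lookup_cell_boundary:
  assumes "wf_graph G" "Poly_Mapping.keys z \<subseteq> edges G"
  shows "Poly_Mapping.lookup (cell_boundary G z) v =
    (\<Sum>h\<in>halves_at G v. (if snd h then 1 else -1) * Poly_Mapping.lookup z (fst h))"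
proof -
  have fin: "finite (edges G)"
    using assms by (simp add: wf_graph_def)
  have "Poly_Mapping.lookup (cell_boundary G z) v =
    (\<Sum>e\<in>Poly_Mapping.keys z. Poly_Mapping.lookup z e *
       ((if endpt G e True = v then 1 else 0) - (if endpt G e False = v then 1 else 0)))"
    by (auto simp: cell_boundary_def frag_extend_def lookup_sum lookup_minus lookup_single when_def
        intro!: sum.cong)
  also have "\<dots> = (\<Sum>e\<in>edges G. Poly_Mapping.lookup z e *
       ((if endpt G e True = v then 1 else 0) - (if endpt G e False = v then 1 else 0)))"
    using assms fin by (intro sum.mono_neutral_left) (auto simp: in_keys_iff)
  finally show ?thesis
    using assms(1) by (simp add: sum_halves_at UNIV_bool) (auto intro!: sum.cong)
qed

section \<open>Rooted spanning trees and flows\<close>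

text \<open>The spanning tree is encoded by \<open>par v\<close>, the half-edge at \<open>v\<close>
  leading towards the root. A rank that drops along it excludes cycles and provides the inductions,
  away from the root or towards it.\<close>

locale rooted_graph =
  fixes G :: graph and r :: nat and par :: "nat \<Rightarrow> half" and rk :: "nat \<Rightarrow> nat"
  assumes wf: "wf_graph G" and root: "r \<in> verts G"
    and par_at: "v \<in> verts G \<Longrightarrow> v \<noteq> r \<Longrightarrow> par v \<in> halves_at G v"
    and par_rk: "v \<in> verts G \<Longrightarrow> v \<noteq> r \<Longrightarrow> rk (hvert G (opp (par v))) < rk v"
begin

definition tree_edges :: "nat set" where
  "tree_edges = (\<lambda>v. fst (par v)) ` (verts G - {r})"

definition chords :: "nat set" where
  "chords = edges G - tree_edges"

lemma finite_graph [simp]: "finite (verts G)" "finite (edges G)"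
  using wf by (auto simp: wf_graph_def)

lemma par_simps: "v \<in> verts G \<Longrightarrow> v \<noteq> r \<Longrightarrow> fst (par v) \<in> edges G \<and> hvert G (par v) = v"
  using par_at by simp

text \<open>Two vertices sharing a parent edge would each be the parent of the other, against the
  descent of the rank.\<close>

lemma par_edge_inj:
  assumes "v \<in> verts G" "v \<noteq> r" "w \<in> verts G" "w \<noteq> r" "fst (par v) = fst (par w)"
  shows "v = w"
proof (rule ccontr)
  assume "v \<noteq> w"
  then have "par v = opp (par w)"
    using assms par_simps unfolding fst_eq_cases by metis
  then show False
    using par_rk[of v] par_rk[of w] par_simps[of v] par_simps[of w] assms by simp
qed

lemma tree_edges_subset: "tree_edges \<subseteq> edges G"
  using par_simps by (auto simp: tree_edges_def)

lemma card_chords: "card chords + card (verts G) = card (edges G) + 1"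
proof -
  have "card tree_edges = card (verts G - {r})"
    unfolding tree_edges_def by (rule card_image) (auto intro!: inj_onI par_edge_inj)
  moreover have "card (verts G - {r}) + 1 = card (verts G)"
    using root by (metis Suc_eq_plus1 card_Suc_Diff1 finite_graph(1))
  moreover have "card chords = card (edges G) - card tree_edges" "card tree_edges \<le> card (edges G)"
    unfolding chords_def using tree_edges_subset
    by (auto intro!: card_Diff_subset card_mono intro: finite_subset)
  ultimately show ?thesis
    by linarith
qed

text \<open>From the leaves towards the root: the half-edges at \<open>v\<close> other than
  \<open>par v\<close> lie on chords or are opposite to the parent half-edge of a child, and
  \<open>q\<close> is already known to vanish there, so the sum at \<open>v\<close> leaves
  \<open>q (par v) = 0\<close>.\<close>

lemma flow_zero:
  fixes q :: "half \<Rightarrow> 'a :: ab_group_add"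
  assumes anti: "\<And>h. fst h \<in> edges G \<Longrightarrow> q h + q (opp h) = 0"
    and sum: "\<And>v. v \<in> verts G \<Longrightarrow> (\<Sum>h\<in>halves_at G v. q h) = 0"
    and chord: "\<And>h. fst h \<in> chords \<Longrightarrow> q h = 0"
    and h: "fst h \<in> edges G"
  shows "q h = 0"
proof -
  have tree: "q (par v) = 0" if "v \<in> verts G" "v \<noteq> r" for v
    using that
  proof (induction "Max (rk ` verts G) - rk v" arbitrary: v rule: less_induct)
    case less
    have "q h = 0" if h: "h \<in> halves_at G v - {par v}" for h
    proof (cases "fst h \<in> chords")
      case False
      with h obtain w where w: "w \<in> verts G" "w \<noteq> r" "fst h = fst (par w)"
        by (auto simp: chords_def tree_edges_def)
      then have "h = opp (par w)"
        using h par_simps[OF w(1,2)] by (auto simp: fst_eq_cases)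
      then have "rk v < rk w"
        using h par_rk[OF w(1,2)] by auto
      moreover have "rk w \<le> Max (rk ` verts G)"
        using w by simp
      ultimately have "q (par w) = 0"
        using less.hyps[OF _ w(1,2)] by (metis diff_less_mono2 order_less_le_trans)
      moreover have "fst (opp (par w)) \<in> edges G"
        using par_simps[OF w(1,2)] by simp
      ultimately show ?thesis
        using anti[of "opp (par w)"] \<open>h = opp (par w)\<close> by simp
    qed (rule chord)
    then have "(\<Sum>h\<in>halves_at G v - {par v}. q h) = 0"
      by (rule sum.neutral[rule_format])
    then show ?case
      using sum[OF less.prems(1)] par_at[OF less.prems] finite_halves_at[OF wf, of v]
      by (simp add: sum.remove)
  qed
  show ?thesis
  proof (cases "fst h \<in> chords")
    case False
    with h obtain w where w: "w \<in> verts G" "w \<noteq> r" "fst h = fst (par w)"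
      by (auto simp: chords_def tree_edges_def)
    then show ?thesis
      using tree[OF w(1,2)] anti[of h] h unfolding fst_eq_cases by auto
  qed (rule chord)
qed

lemma cell_H1_zero:
  assumes "z \<in> cell_H1 G" "\<And>e. e \<in> chords \<Longrightarrow> Poly_Mapping.lookup z e = 0"
  shows "z = 0"
proof -
  have z: "Poly_Mapping.keys z \<subseteq> edges G" "cell_boundary G z = 0"
    using assms(1) by (auto simp: cell_H1_def)
  have "(if snd h then 1 else -1) * Poly_Mapping.lookup z (fst h) = 0" if "fst h \<in> edges G" for h
    using that
    by (rule flow_zero[rotated 3]) (use assms(2) lookup_cell_boundary[OF wf z(1)] z(2) in auto)
  then have "Poly_Mapping.lookup z e = 0" if "e \<in> edges G" for e
    using that by (metis fst_conv mult_cancel_right1 mult_minus1 neg_equal_0_iff_equal)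
  then show ?thesis
    using z(1) by (metis in_keys_iff lookup_zero poly_mapping_eqI subsetD)
qed

lemma tree_path:
  assumes "v \<in> verts G"
  shows "\<exists>p. Poly_Mapping.keys p \<subseteq> tree_edges \<and> cell_boundary G p = frag_of v - frag_of r"
  using assms
proof (induction "rk v" arbitrary: v rule: less_induct)
  case less
  show ?case
  proof (cases "v = r")
    case True
    then show ?thesis by (intro exI[of _ 0]) (simp add: cell_boundary_def)
  next
    case False
    let ?u = "hvert G (opp (par v))"
    note pv = par_simps[OF less.prems False]
    have "?u \<in> verts G"
      using wf_graph_hvert[OF wf] pv by simp
    then obtain p where p: "Poly_Mapping.keys p \<subseteq> tree_edges" "cell_boundary G p = frag_of ?u - frag_of r"
      using less.hyps par_rk[OF less.prems False] by blast
    let ?e = "fst (par v)" and ?s = "if snd (par v) then 1 else -1"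
    let ?q = "p + frag_cmul ?s (frag_of ?e)"
    have "?e \<in> tree_edges"
      using less.prems False by (auto simp: tree_edges_def)
    then have "Poly_Mapping.keys ?q \<subseteq> tree_edges"
      using p(1) keys_add[of p "frag_cmul ?s (frag_of ?e)"] by (auto split: if_splits)
    moreover have "cell_boundary G ?q = frag_of v - frag_of r"
      using pv p(2) by (cases "par v") (auto simp: cell_boundary_def frag_extend_add frag_extend_minus)
    ultimately show ?thesis by blast
  qed
qed

end

text \<open>A breadth-first tree: the rank is the distance from \<open>r\<close>, and the parent
  half-edge is the last step of a shortest path, reversed.\<close>

lemma rooted_graph_exists:
  assumes "wf_graph G" "connected_graph G" "r \<in> verts G"
  shows "\<exists>par rk. rooted_graph G r par rk"
proof -
  define rk where "rk v = (LEAST n. (r, v) \<in> adj G ^^ n)" for v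
  have "\<exists>h. h \<in> halves_at G v \<and> rk (hvert G (opp h)) < rk v" if v: "v \<in> verts G" "v \<noteq> r" for v
  proof -
    have "(r, v) \<in> (adj G)\<^sup>*"
      using assms v by (auto simp: connected_graph_adj)
    then have "\<exists>n. (r, v) \<in> adj G ^^ n"
      by (simp add: rtrancl_power)
    then have rk: "(r, v) \<in> adj G ^^ rk v"
      unfolding rk_def by (rule LeastI_ex)
    moreover have "rk v \<noteq> 0"
      using rk v(2) by (intro notI) simp
    ultimately obtain m where m: "rk v = Suc m" "(r, v) \<in> adj G ^^ Suc m"
      by (metis not0_implies_Suc)
    then obtain u where u: "(r, u) \<in> adj G ^^ m" "(u, v) \<in> adj G"
      by auto
    have "rk u \<le> m"
      unfolding rk_def using u(1) by (rule Least_le)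
    moreover obtain h where "fst h \<in> edges G" "hvert G h = u" "hvert G (opp h) = v"
      using u(2) by (rule adjE)
    ultimately show ?thesis
      using m by (intro exI[of _ "opp h"]) auto
  qed
  then have "\<forall>v\<in>verts G - {r}. \<exists>h. h \<in> halves_at G v \<and> rk (hvert G (opp h)) < rk v"
    by auto
  then obtain par where "\<forall>v\<in>verts G - {r}. par v \<in> halves_at G v \<and> rk (hvert G (opp (par v))) < rk v"
    unfolding bchoice_iff by blast
  then show ?thesis
    using assms by (intro exI[of _ par] exI[of _ rk]) (auto simp: rooted_graph_def)
qed

section \<open>The genus as the number of chords\<close>

text \<open>Gaussian elimination without division, one equation at a time: an unknown with nonzero
  pivot is removed, and the other rows are multiplied by the pivot so as to stay integral.\<close>

lemma int_matrix_kernel: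
  fixes M :: "'b \<Rightarrow> 'c \<Rightarrow> int"
  assumes "finite C" "finite B" "card C < card B"
  shows "\<exists>a. (\<exists>b\<in>B. a b \<noteq> 0) \<and> (\<forall>c\<in>C. (\<Sum>b\<in>B. a b * M b c) = 0)"
  using assms
proof (induction C arbitrary: B M rule: finite_induct)
  case empty
  then have "B \<noteq> {}" by auto
  then show ?case by (intro exI[of _ "\<lambda>_. 1"]) auto
next
  case (insert e C)
  show ?case
  proof (cases "\<forall>b\<in>B. M b e = 0")
    case True
    have "card C < card B"
      using insert.prems insert.hyps by simp
    from insert.IH[OF insert.prems(1) this, of M]
    obtain a where "\<exists>b\<in>B. a b \<noteq> 0" "\<forall>c\<in>C. (\<Sum>b\<in>B. a b * M b c) = 0"
      by (elim exE conjE)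
    with True show ?thesis
      by (intro exI[of _ a]) simp
  next
    case False
    then obtain b0 where b0: "b0 \<in> B" "M b0 e \<noteq> 0" by blast
    define B' where "B' = B - {b0}"
    have B: "B = insert b0 B'" "b0 \<notin> B'" "finite B'"
      using b0 insert.prems by (auto simp: B'_def)
    have "card C < card B'"
      using insert.prems insert.hyps B by simp
    from insert.IH[OF B(3) this, of "\<lambda>b c. M b0 e * M b c - M b e * M b0 c"]
    obtain a where a: "\<exists>b\<in>B'. a b \<noteq> 0"
        "\<forall>c\<in>C. (\<Sum>b\<in>B'. a b * (M b0 e * M b c - M b e * M b0 c)) = 0"
      by (elim exE conjE)
    \<comment> \<open>The removed unknown gets the value that makes equation \<open>e\<close> hold;
      scaling the others by the pivot avoids the division.\<close>
    define a' where "a' b = (if b = b0 then - (\<Sum>b\<in>B'. a b * M b e) else M b0 e * a b)" for b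
    have sum: "(\<Sum>b\<in>B. a' b * M b c) = (\<Sum>b\<in>B'. a b * (M b0 e * M b c - M b e * M b0 c))" for c
    proof -
      have "(\<Sum>b\<in>B'. a' b * M b c) = (\<Sum>b\<in>B'. M b0 e * a b * M b c)"
        using B(2) by (intro sum.cong) (auto simp: a'_def)
      moreover have "a' b0 * M b0 c = - (\<Sum>b\<in>B'. a b * M b e * M b0 c)"
        by (simp add: a'_def sum_distrib_right)
      ultimately show ?thesis
        using B by (simp add: algebra_simps sum_subtractf sum.distrib)
    qed
    have "\<exists>b\<in>B. a' b \<noteq> 0"
      using a(1) b0(2) B by (auto simp: a'_def)
    moreover have "(\<Sum>b\<in>B. a' b * M b e) = 0"
      unfolding sum by (simp add: mult.commute)
    moreover have "(\<Sum>b\<in>B. a' b * M b c) = 0" if "c \<in> C" for c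
      unfolding sum using a(2) that by simp
    ultimately show ?thesis
      by (intro exI[of _ a']) auto
  qed
qed

lemma lookup_frag_sum:
  "Poly_Mapping.lookup (\<Sum>z\<in>B. frag_cmul (a z) z) e = (\<Sum>z\<in>B. a z * Poly_Mapping.lookup z e)"
  by (simp add: lookup_sum)

lemma cell_H1_sum:
  assumes "B \<subseteq> cell_H1 G"
  shows "(\<Sum>z\<in>B. frag_cmul (a z) z) \<in> cell_H1 G"
  using assms
proof (induction B rule: infinite_finite_induct)
  case (insert x F)
  then show ?case
    using keys_add[of "frag_cmul (a x) x" "\<Sum>z\<in>F. frag_cmul (a z) z"]
    by (auto simp: cell_H1_def cell_boundary_def frag_extend_add frag_extend_cmul)
qed (auto simp: cell_H1_def cell_boundary_def)

text \<open>A cycle is determined by its values on the chords, so more cycles than chords are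
  dependent; the fundamental cycles of the chords reach the bound.\<close>

lemma (in rooted_graph) genus_eq_card_chords: "genus G = card chords"
  unfolding genus_def
proof (rule Max_eqI)
  have fin: "finite chords"
    by (simp add: chords_def)
  have le: "card B \<le> card chords" if B: "finite B" "B \<subseteq> cell_H1 G" "lin_indep B" for B
  proof (rule ccontr)
    assume "\<not> card B \<le> card chords"
    then obtain a where a: "\<exists>b\<in>B. a b \<noteq> 0"
        "\<forall>c\<in>chords. (\<Sum>b\<in>B. a b * Poly_Mapping.lookup b c) = 0"
      using int_matrix_kernel[OF fin B(1), of Poly_Mapping.lookup] by auto
    have "(\<Sum>z\<in>B. frag_cmul (a z) z) = 0"
      using a(2) cell_H1_sum[OF B(2)] by (intro cell_H1_zero) (auto simp: lookup_frag_sum)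
    then show False
      using a(1) B(3) unfolding lin_indep_def by blast
  qed
  have "{card B |B. finite B \<and> B \<subseteq> cell_H1 G \<and> lin_indep B} \<subseteq> {..card chords}"
  proof
    fix y assume "y \<in> {card B |B. finite B \<and> B \<subseteq> cell_H1 G \<and> lin_indep B}"
    then obtain B where "y = card B" "finite B" "B \<subseteq> cell_H1 G" "lin_indep B"
      by (elim CollectE exE conjE)
    then show "y \<in> {..card chords}"
      using le[of B] by simp
  qed
  note sub = this
  show "finite {card B |B. finite B \<and> B \<subseteq> cell_H1 G \<and> lin_indep B}"
    by (rule finite_subset[OF sub]) simp
  show "y \<le> card chords" if "y \<in> {card B |B. finite B \<and> B \<subseteq> cell_H1 G \<and> lin_indep B}" for y
    using subsetD[OF sub that] by simp
  from tree_path have "\<forall>v\<in>verts G. \<exists>p. Poly_Mapping.keys p \<subseteq> tree_edges \<and> cell_boundary G p = frag_of v - frag_of r"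
    by simp
  then obtain P where "\<forall>v\<in>verts G. Poly_Mapping.keys (P v) \<subseteq> tree_edges \<and> cell_boundary G (P v) = frag_of v - frag_of r"
    unfolding bchoice_iff by (rule exE)
  then have P: "\<And>v. v \<in> verts G \<Longrightarrow> Poly_Mapping.keys (P v) \<subseteq> tree_edges"
      "\<And>v. v \<in> verts G \<Longrightarrow> cell_boundary G (P v) = frag_of v - frag_of r"
    by auto
  \<comment> \<open>The fundamental cycle of \<open>e\<close>: the edge, then the tree path from its
    end to the root and from the root to its start.\<close>
  define cyc where "cyc e = frag_of e - P (endpt G e True) + P (endpt G e False)" for e
  have vs: "endpt G e b \<in> verts G" if "e \<in> chords" for e b
    using that wf by (auto simp: chords_def wf_graph_def)
  have tree0: "Poly_Mapping.lookup (P v) c = 0" if "v \<in> verts G" "c \<in> chords" for v c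
    using that P(1)[OF that(1)] by (metis DiffD2 chords_def in_keys_iff subsetD)
  have lk: "Poly_Mapping.lookup (cyc e) c = (if c = e then 1 else 0)" if "e \<in> chords" "c \<in> chords" for e c
    using that vs tree0 by (simp add: cyc_def lookup_add lookup_minus lookup_single when_def)
  have H1: "cyc e \<in> cell_H1 G" if "e \<in> chords" for e
  proof -
    have "Poly_Mapping.keys (cyc e) \<subseteq> {e} \<union> tree_edges"
      unfolding cyc_def using keys_add[of "frag_of e - P (endpt G e True)" "P (endpt G e False)"]
        keys_diff[of "frag_of e" "P (endpt G e True)"] P(1)[OF vs[OF that]] by auto
    then have "Poly_Mapping.keys (cyc e) \<subseteq> edges G"
      using that tree_edges_subset by (auto simp: chords_def)
    moreover have "cell_boundary G (cyc e) = 0"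
      using P(2)[OF vs[OF that]] by (simp add: cyc_def cell_boundary_def frag_extend_add frag_extend_diff)
    ultimately show ?thesis
      by (simp add: cell_H1_def)
  qed
  have inj: "inj_on cyc chords"
    by (rule inj_onI) (metis lk zero_neq_one)
  have "lin_indep (cyc ` chords)"
    unfolding lin_indep_def
  proof (intro allI impI ballI)
    fix a z assume 0: "(\<Sum>z\<in>cyc ` chords. frag_cmul (a z) z) = 0" and "z \<in> cyc ` chords"
    then obtain c where c: "c \<in> chords" "z = cyc c" by blast
    have "(\<Sum>e\<in>chords. a (cyc e) * Poly_Mapping.lookup (cyc e) c) =
        Poly_Mapping.lookup (\<Sum>z\<in>cyc ` chords. frag_cmul (a z) z) c"
      by (simp add: sum.reindex[OF inj] lookup_sum)
    then have "0 = (\<Sum>e\<in>chords. a (cyc e) * Poly_Mapping.lookup (cyc e) c)"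
      unfolding 0 by simp
    also have "\<dots> = (\<Sum>e\<in>chords. if e = c then a (cyc e) else 0)"
      using c(1) lk by (intro sum.cong) auto
    finally show "a z = 0"
      using c fin by simp
  qed
  then show "card chords \<in> {card B |B. finite B \<and> B \<subseteq> cell_H1 G \<and> lin_indep B}"
    using H1 fin by (intro CollectI exI[of _ "cyc ` chords"]) (auto simp: card_image[OF inj])
qed

lemma genus_formula:
  assumes "wf_graph G" "connected_graph G" "verts G \<noteq> {}"
  shows "genus G + card (verts G) = card (edges G) + 1"
proof -
  obtain r where "r \<in> verts G"
    using assms by blast
  then obtain par rk where "rooted_graph G r par rk"
    using rooted_graph_exists assms by blast
  then interpret rooted_graph G r par rk .
  show ?thesis
    using card_chords genus_eq_card_chords by simp
qed

lemma graph_of_genus_formula: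
  "graph_of_genus g G \<Longrightarrow> g + card (verts G) = card (edges G) + 1"
  using genus_formula[of G] by (auto simp: graph_of_genus_def)

text \<open>With the Euler characteristic in place of a maximum over independent sets of cycles, the
  genus can be checked by counting cells.\<close>

lemma graph_of_genus_iff:
  "graph_of_genus g G \<longleftrightarrow> wf_graph G \<and> verts G \<noteq> {} \<and> connected_graph G \<and>
     g + card (verts G) = card (edges G) + 1"
  using genus_formula[of G] by (cases "verts G = {}") (auto simp: graph_of_genus_def)

lemma (in rooted_graph) tree_edge_not_loop:
  assumes "e \<in> tree_edges"
  shows "endpt G e False \<noteq> endpt G e True"
proof -
  obtain v where v: "v \<in> verts G" "v \<noteq> r" "e = fst (par v)"
    using assms by (auto simp: tree_edges_def)
  show ?thesis
    using v par_rk[of v] par_simps[of v] by (cases "par v"; cases "snd (par v)") auto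
qed

section \<open>Connectedness along maps of graphs\<close>

lemma connected_image:
  assumes "connected_graph H" "f ` verts H = verts K" "wf_graph H"
    and "\<And>h. fst h \<in> edges H \<Longrightarrow> (f (hvert H h), f (hvert H (opp h))) \<in> (adj K)\<^sup>*"
  shows "connected_graph K"
  unfolding connected_graph_adj
proof (intro ballI)
  fix a b assume "a \<in> verts K" "b \<in> verts K"
  then obtain u v where uv: "u \<in> verts H" "v \<in> verts H" "a = f u" "b = f v"
    using assms(2) by (metis imageE)
  have "(u, v) \<in> (adj H)\<^sup>*"
    using assms(1) uv by (simp add: connected_graph_adj)
  then have "(f u, f v) \<in> (adj K)\<^sup>*"
  proof (induction rule: rtrancl_induct)
    case (step y z)
    from step.hyps(2) obtain h where "fst h \<in> edges H" "hvert H h = y" "hvert H (opp h) = z"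
      by (rule adjE)
    then show ?case
      using assms(4)[of h] step.IH by auto
  qed simp
  then show "(a, b) \<in> (adj K)\<^sup>*"
    using uv by simp
qed

text \<open>Along a path in \<open>K\<close>, all vertices of \<open>H\<close> above the current
  vertex are reachable: each edge of \<open>K\<close> lifts somewhere, and the vertices above one
  vertex are joined to each other.\<close>

lemma connected_lift:
  assumes "connected_graph K" "f \<in> verts H \<rightarrow> verts K"
    and "\<And>u v. u \<in> verts H \<Longrightarrow> v \<in> verts H \<Longrightarrow> f u = f v \<Longrightarrow> (u, v) \<in> (adj H)\<^sup>*"
    and "\<And>h. fst h \<in> edges K \<Longrightarrow> \<exists>k. fst k \<in> edges H \<and> hvert H k \<in> verts H \<and> hvert H (opp k) \<in> verts H \<and>
           f (hvert H k) = hvert K h \<and> f (hvert H (opp k)) = hvert K (opp h)"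
  shows "connected_graph H"
  unfolding connected_graph_adj
proof (intro ballI)
  fix u v assume uv: "u \<in> verts H" "v \<in> verts H"
  have "(f u, f v) \<in> (adj K)\<^sup>*"
    using assms(1,2) uv by (auto simp: connected_graph_adj)
  then have "\<forall>v\<in>verts H. f v = w \<longrightarrow> (u, v) \<in> (adj H)\<^sup>*" if "w = f v" for w
    unfolding that[symmetric]
  proof (induction rule: rtrancl_induct)
    case base
    then show ?case using assms(3) uv by metis
  next
    case (step y z)
    from step.hyps(2) obtain h where h: "fst h \<in> edges K" "hvert K h = y" "hvert K (opp h) = z"
      by (rule adjE)
    obtain k where k: "fst k \<in> edges H" "hvert H k \<in> verts H" "hvert H (opp k) \<in> verts H"
           "f (hvert H k) = y" "f (hvert H (opp k)) = z"
      using assms(4)[OF h(1)] h by auto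
    have "(u, hvert H k) \<in> (adj H)\<^sup>*"
      using step.IH k by blast
    then have *: "(u, hvert H (opp k)) \<in> (adj H)\<^sup>*"
      using adjI[OF k(1)] by (rule rtrancl_into_rtrancl)
    show ?case
    proof (intro ballI impI)
      fix v assume "v \<in> verts H" "f v = z"
      then have "(hvert H (opp k), v) \<in> (adj H)\<^sup>*"
        using assms(3)[of "hvert H (opp k)" v] k by simp
      with * show "(u, v) \<in> (adj H)\<^sup>*"
        by (rule rtrancl_trans)
    qed
  qed
  then show "(u, v) \<in> (adj H)\<^sup>*"
    using uv by simp
qed

lemma fibre_simps [simp]:
  "verts (fibre G \<phi> w) = {v \<in> verts G. vmap \<phi> v = w}"
  "edges (fibre G \<phi> w) = {e \<in> contracted_edges G \<phi>. vmap \<phi> (endpt G e True) = w}"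
  "endpt (fibre G \<phi> w) = endpt G" "hvert (fibre G \<phi> w) = hvert G"
  by (auto simp: fibre_def hvert_def)

section \<open>Contractions, their fibres and Euler characteristics\<close>

locale edgewise =
  fixes G G' :: graph and \<phi> :: cmap
  assumes edgewise: "edgewise_morphism G G' \<phi>"
begin

abbreviation "C \<equiv> contracted_edges G \<phi>"

definition hm :: "half \<Rightarrow> half" where "hm h = the (hmap \<phi> h)"

lemma wf: "wf_graph G" and wf': "wf_graph G'"
  and vmap_ext: "vmap \<phi> \<in> verts G \<rightarrow>\<^sub>E verts G'"
  using edgewise by (auto simp: edgewise_morphism_def)

lemma vmap_verts [simp]: "v \<in> verts G \<Longrightarrow> vmap \<phi> v \<in> verts G'"
  using vmap_ext by (auto simp: PiE_def)

lemma finite_graphs [simp]: "finite (verts G)" "finite (edges G)" "finite (verts G')" "finite (edges G')"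
  using wf wf' by (auto simp: wf_graph_def)

lemma C_subset: "C \<subseteq> edges G"
  by (auto simp: contracted_edges_def)

lemma finite_C [simp]: "finite C"
  by (rule finite_subset[OF C_subset]) simp

lemma hmap_opp:
  assumes "hmap \<phi> h = Some h'"
  shows "hmap \<phi> (opp h) = Some (opp h')" "vmap \<phi> (hvert G h) = hvert G' h'"
    "fst h \<in> edges G" "fst h' \<in> edges G'"
proof -
  obtain e b e' b' where h: "h = (e, b)" "h' = (e', b')"
    by fastforce
  show "hmap \<phi> (opp h) = Some (opp h')" "vmap \<phi> (hvert G h) = hvert G' h'"
    using assms edgewise unfolding edgewise_morphism_def h by auto
  have "h \<in> halves G" "h' \<in> halves G'"
    using assms edgewise unfolding edgewise_morphism_def by (blast intro: ranI)+
  then show "fst h \<in> edges G" "fst h' \<in> edges G'"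
    by auto
qed

text \<open>\<open>contracted_edges\<close> tests the end \<open>True\<close> only, but the two
  halves of an edge are contracted together, so the edge decides for both.\<close>

lemma hmap_None_iff: "hmap \<phi> h = None \<longleftrightarrow> fst h \<in> edges G \<longrightarrow> fst h \<in> C"
proof (cases "fst h \<in> edges G")
  case True
  have "hmap \<phi> h = None \<longleftrightarrow> hmap \<phi> (opp h) = None"
    by (metis hmap_opp(1) not_None_eq opp_simps(4))
  then have "hmap \<phi> h = None \<longleftrightarrow> hmap \<phi> (fst h, True) = None"
    by (cases h; cases "snd h") (auto simp: opp_def)
  then show ?thesis
    using True by (auto simp: contracted_edges_def)
next
  case False
  then show ?thesis
    by (metis hmap_opp(3) not_None_eq)
qed

lemma hmap_hm: "fst h \<in> edges G \<Longrightarrow> fst h \<notin> C \<Longrightarrow> hmap \<phi> h = Some (hm h)"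
  unfolding hm_def using hmap_None_iff[of h] by auto

lemma hm_simps:
  assumes "fst h \<in> edges G" "fst h \<notin> C"
  shows "hm (opp h) = opp (hm h)" "vmap \<phi> (hvert G h) = hvert G' (hm h)" "fst (hm h) \<in> edges G'"
  using hmap_opp[OF hmap_hm[OF assms]] by (auto simp: hm_def)

lemma C_vmap: "fst h \<in> C \<Longrightarrow> vmap \<phi> (hvert G (opp h)) = vmap \<phi> (hvert G h)"
  using edgewise unfolding edgewise_morphism_def contracted_edges_def
  by (cases h; cases "snd h") auto

lemma C_vmap_True: "fst h \<in> C \<Longrightarrow> vmap \<phi> (endpt G (fst h) True) = vmap \<phi> (hvert G h)"
  using C_vmap[of h] by (cases h; cases "snd h") auto

lemma wf_fibre: "wf_graph (fibre G \<phi> w)"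
  unfolding wf_graph_def
proof (intro conjI ballI allI)
  fix e b assume e: "e \<in> edges (fibre G \<phi> w)"
  then have "e \<in> edges G"
    using C_subset by auto
  then have "endpt G e b \<in> verts G"
    using wf by (auto simp: wf_graph_def)
  then show "endpt (fibre G \<phi> w) e b \<in> verts (fibre G \<phi> w)"
    using e C_vmap_True[of "(e, b)"] by auto
qed auto

lemma sum_card_fibres:
  assumes "vmap \<phi> ` verts G \<subseteq> W" "finite W"
  shows "(\<Sum>w\<in>W. card (verts (fibre G \<phi> w))) = card (verts G)"
    and "(\<Sum>w\<in>W. card (edges (fibre G \<phi> w))) = card C"
proof -
  show "(\<Sum>w\<in>W. card (verts (fibre G \<phi> w))) = card (verts G)"
    using sum.group[of "verts G" W "vmap \<phi>" "\<lambda>_. 1 :: nat"] assms by simp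
  have "(\<lambda>e. vmap \<phi> (endpt G e True)) ` C \<subseteq> W"
    using assms(1) wf C_subset by (auto simp: wf_graph_def)
  then show "(\<Sum>w\<in>W. card (edges (fibre G \<phi> w))) = card C"
    using sum.group[of C W "\<lambda>e. vmap \<phi> (endpt G e True)" "\<lambda>_. 1 :: nat"] assms by simp
qed

lemma card_edges:
  assumes "ran (hmap \<phi>) = halves G'" "inj_on (hmap \<phi>) (dom (hmap \<phi>))"
  shows "card (edges G) = card C + card (edges G')"
proof -
  have dom: "dom (hmap \<phi>) = (edges G - C) \<times> UNIV"
    using hmap_None_iff by (auto simp: dom_def)
  have "hmap \<phi> ` dom (hmap \<phi>) = Some ` ran (hmap \<phi>)"
    by (force simp: dom_def ran_def)
  then have "card (dom (hmap \<phi>)) = card (halves G')"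
    using assms card_image[OF assms(2)] by (simp add: card_image)
  then have "card (edges G - C) = card (edges G')"
    unfolding dom halves_def by (simp add: card_cartesian_product UNIV_bool)
  moreover have "card (edges G) = card C + card (edges G - C)"
    using C_subset by (metis card_Diff_subset card_mono finite_C finite_graphs(2) le_add_diff_inverse)
  ultimately show ?thesis
    by simp
qed

end

text \<open>Connected fibres suffice: counting cells, the genera of the fibres add up to the genus
  of \<open>G\<close> minus that of \<open>G'\<close>, which is zero here, so each fibre is a
  tree.\<close>

lemma contractionI:
  assumes "edgewise_morphism G G' \<phi>" "graph_of_genus g G" "graph_of_genus g G'"
    and surj: "vmap \<phi> ` verts G = verts G'" "ran (hmap \<phi>) = halves G'" "inj_on (hmap \<phi>) (dom (hmap \<phi>))"
    and conn: "\<And>w. w \<in> verts G' \<Longrightarrow> connected_graph (fibre G \<phi> w)"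
  shows "contraction G G' \<phi>"
proof -
  interpret edgewise G G' \<phi>
    by unfold_locales (rule assms(1))
  have formula: "genus (fibre G \<phi> w) + card (verts (fibre G \<phi> w)) = card (edges (fibre G \<phi> w)) + 1"
      and ne: "verts (fibre G \<phi> w) \<noteq> {}" if "w \<in> verts G'" for w
  proof -
    have "w \<in> vmap \<phi> ` verts G"
      using surj(1) that by simp
    then show "verts (fibre G \<phi> w) \<noteq> {}"
      by auto
    then show "genus (fibre G \<phi> w) + card (verts (fibre G \<phi> w)) = card (edges (fibre G \<phi> w)) + 1"
      by (intro genus_formula wf_fibre conn that)
  qed
  have "(\<Sum>w\<in>verts G'. genus (fibre G \<phi> w) + card (verts (fibre G \<phi> w))) =
      (\<Sum>w\<in>verts G'. card (edges (fibre G \<phi> w)) + 1)"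
    by (intro sum.cong refl formula)
  then have "(\<Sum>w\<in>verts G'. genus (fibre G \<phi> w)) + card (verts G) = card C + card (verts G')"
    unfolding sum.distrib using sum_card_fibres[of "verts G'"] surj(1) by simp
  moreover note card_edges[OF surj(2,3)] graph_of_genus_formula[OF assms(2)] graph_of_genus_formula[OF assms(3)]
  ultimately have "(\<Sum>w\<in>verts G'. genus (fibre G \<phi> w)) = 0"
    by linarith
  then have "genus (fibre G \<phi> w) = 0" if "w \<in> verts G'" for w
    using that by simp
  then show ?thesis
    unfolding contraction_def graph_of_genus_def
    using assms conn ne wf_fibre by blast
qed

locale contracting = edgewise +
  assumes contraction: "contraction G G' \<phi>"
begin

lemma surj: "vmap \<phi> ` verts G = verts G'" "ran (hmap \<phi>) = halves G'" "inj_on (hmap \<phi>) (dom (hmap \<phi>))"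
  and fibre_tree: "w \<in> verts G' \<Longrightarrow> graph_of_genus 0 (fibre G \<phi> w)"
  using contraction by (auto simp: contraction_def)

lemma hm_inj: "fst h \<in> edges G - C \<Longrightarrow> fst k \<in> edges G - C \<Longrightarrow> hm h = hm k \<Longrightarrow> h = k"
  using inj_onD[OF surj(3), of h k] hmap_hm[of h] hmap_hm[of k] by (auto simp: dom_def)

lemma pre_half:
  assumes "fst h' \<in> edges G'"
  shows "hmap \<phi> (pre_half \<phi> h') = Some h'" "fst (pre_half \<phi> h') \<in> edges G"
    "fst (pre_half \<phi> h') \<notin> C" "hm (pre_half \<phi> h') = h'"
    "vmap \<phi> (hvert G (pre_half \<phi> h')) = hvert G' h'"
proof -
  have "h' \<in> ran (hmap \<phi>)"
    using assms surj by simp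
  then obtain h where h: "hmap \<phi> h = Some h'"
    by (auto simp: ran_def)
  show 1: "hmap \<phi> (pre_half \<phi> h') = Some h'"
    unfolding pre_half_def
  proof (rule theI)
    fix k assume "hmap \<phi> k = Some h'"
    then show "k = h"
      using h surj(3) unfolding inj_on_def by (metis domI)
  qed (rule h)
  show "fst (pre_half \<phi> h') \<in> edges G" "vmap \<phi> (hvert G (pre_half \<phi> h')) = hvert G' h'"
    using hmap_opp[OF 1] by auto
  show "fst (pre_half \<phi> h') \<notin> C" "hm (pre_half \<phi> h') = h'"
    using 1 hmap_None_iff[of "pre_half \<phi> h'"] by (auto simp: hm_def)
qed

lemma pre_half_hm:
  assumes "fst h \<in> edges G" "fst h \<notin> C"
  shows "pre_half \<phi> (hm h) = h"
  using assms hm_inj[of "pre_half \<phi> (hm h)" h] pre_half[OF hm_simps(3)[OF assms]] by auto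

lemma pre_half_opp:
  assumes "fst h' \<in> edges G'"
  shows "pre_half \<phi> (opp h') = opp (pre_half \<phi> h')"
  using pre_half[OF assms] pre_half_hm[of "opp (pre_half \<phi> h')"] hm_simps(1)[of "pre_half \<phi> h'"] by simp

lemma pre_edge_fst:
  assumes "fst h' \<in> edges G'"
  shows "pre_edge \<phi> (fst h') = fst (pre_half \<phi> h')"
  using pre_half_opp[OF assms] by (cases h'; cases "snd h'") (auto simp: pre_edge_def)

lemma pre_edge_hm: "fst h \<in> edges G \<Longrightarrow> fst h \<notin> C \<Longrightarrow> pre_edge \<phi> (fst (hm h)) = fst h"
  using pre_edge_fst[of "hm h"] pre_half_hm[of h] hm_simps(3)[of h] by simp

lemma pre_edge_mem: "e \<in> edges G' \<Longrightarrow> pre_edge \<phi> e \<in> edges G - C"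
  using pre_edge_fst[of "(e, True)"] pre_half[of "(e, True)"] by simp

lemma inj_pre_edge: "inj_on (pre_edge \<phi>) (edges G')"
proof (rule inj_onI)
  fix e e' assume e: "e \<in> edges G'" "e' \<in> edges G'" "pre_edge \<phi> e = pre_edge \<phi> e'"
  then have "fst (pre_half \<phi> (e, True)) = fst (pre_half \<phi> (e', True))"
    using pre_edge_fst[of "(e, True)"] pre_edge_fst[of "(e', True)"] by simp
  then have "pre_half \<phi> (e, True) = pre_half \<phi> (e', True) \<or> pre_half \<phi> (e, True) = pre_half \<phi> (opp (e', True))"
    using pre_half_opp[of "(e', True)"] e by (simp add: fst_eq_cases)
  then have "hm (pre_half \<phi> (e, True)) = hm (pre_half \<phi> (e', True)) \<or>
      hm (pre_half \<phi> (e, True)) = hm (pre_half \<phi> (opp (e', True)))"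
    by (rule disj_forward) (rule arg_cong, assumption)+
  then have "(e, True) = (e', True) \<or> (e, True) = opp (e', True)"
    using e by (simp add: pre_half(4))
  then show "e = e'"
    by auto
qed

lemma fibre_rooted:
  assumes "w \<in> verts G'"
  obtains r par rk where "rooted_graph (fibre G \<phi> w) r par rk" "rooted_graph.chords (fibre G \<phi> w) r par = {}"
proof -
  note t = fibre_tree[OF assms]
  then obtain r where "r \<in> verts (fibre G \<phi> w)"
    by (auto simp: graph_of_genus_def)
  then obtain par rk where R: "rooted_graph (fibre G \<phi> w) r par rk"
    using rooted_graph_exists t unfolding graph_of_genus_def by blast
  then interpret R: rooted_graph "fibre G \<phi> w" r par rk .
  have "card R.chords = 0"
    using R.genus_eq_card_chords t by (simp add: graph_of_genus_def)
  then have "R.chords = {}"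
    unfolding R.chords_def using R.finite_graph(2) by simp
  with R show thesis
    by (rule that)
qed

lemma contracted_not_loop:
  assumes "e \<in> C"
  shows "endpt G e False \<noteq> endpt G e True"
proof -
  let ?w = "vmap \<phi> (endpt G e True)"
  have "?w \<in> verts G'"
    using assms C_subset wf by (auto simp: wf_graph_def)
  then obtain r par rk where R: "rooted_graph (fibre G \<phi> ?w) r par rk"
      and c: "rooted_graph.chords (fibre G \<phi> ?w) r par = {}"
    by (rule fibre_rooted)
  interpret R: rooted_graph "fibre G \<phi> ?w" r par rk
    by (rule R)
  have "e \<in> R.tree_edges"
    using c assms unfolding R.chords_def by auto
  then show ?thesis
    using R.tree_edge_not_loop by simp
qed

text \<open>The fibre through \<open>h\<close> is a tree without chords, and half-edges leaving it
  carry nothing, so the vertex sums in \<open>G\<close> are vertex sums in the fibre and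
  \<open>flow_zero\<close> applies. This rigidity determines a pullback on contracted
  half-edges.\<close>

lemma contracted_flow_zero:
  fixes q :: "half \<Rightarrow> 'a :: ab_group_add"
  assumes anti: "\<And>h. fst h \<in> C \<Longrightarrow> q h + q (opp h) = 0"
    and out: "\<And>h. fst h \<in> edges G \<Longrightarrow> fst h \<notin> C \<Longrightarrow> q h = 0"
    and sum: "\<And>v. v \<in> verts G \<Longrightarrow> (\<Sum>h\<in>halves_at G v. q h) = 0"
    and h: "fst h \<in> C"
  shows "q h = 0"
proof -
  let ?w = "vmap \<phi> (hvert G h)"
  have w: "?w \<in> verts G'"
    using h C_subset wf_graph_hvert[OF wf, of h] by auto
  obtain r par rk where R: "rooted_graph (fibre G \<phi> ?w) r par rk"
      and c: "rooted_graph.chords (fibre G \<phi> ?w) r par = {}"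
    using w by (rule fibre_rooted)
  interpret R: rooted_graph "fibre G \<phi> ?w" r par rk
    by (rule R)
  show ?thesis
  proof (rule R.flow_zero[of q])
    show "fst h \<in> edges (fibre G \<phi> ?w)"
      using h C_vmap_True[of h] by simp
    show "q k + q (opp k) = 0" if "fst k \<in> edges (fibre G \<phi> ?w)" for k
      using that anti by simp
    show "q k = 0" if "fst k \<in> R.chords" for k
      using that c by simp
    fix v assume v: "v \<in> verts (fibre G \<phi> ?w)"
    have "(\<Sum>h\<in>halves_at (fibre G \<phi> ?w) v. q h) = (\<Sum>h\<in>halves_at G v. q h)"
    proof (rule sum.mono_neutral_left[OF finite_halves_at[OF wf]])
      show "halves_at (fibre G \<phi> ?w) v \<subseteq> halves_at G v"
        using C_subset by auto
      show "\<forall>k\<in>halves_at G v - halves_at (fibre G \<phi> ?w) v. q k = 0"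
      proof
        fix k assume k: "k \<in> halves_at G v - halves_at (fibre G \<phi> ?w) v"
        then have "fst k \<notin> C"
          using v C_vmap_True[of k] by auto
        then show "q k = 0"
          using out k by simp
      qed
    qed
    then show "(\<Sum>h\<in>halves_at (fibre G \<phi> ?w) v. q h) = 0"
      using sum v by simp
  qed
qed

lemma card_graphs: "card (edges G) = card C + card (edges G')" "card (verts G) = card C + card (verts G')"
proof -
  show "card (edges G) = card C + card (edges G')"
    using surj by (intro card_edges)
  have "(\<Sum>w\<in>verts G'. card (verts (fibre G \<phi> w))) = (\<Sum>w\<in>verts G'. card (edges (fibre G \<phi> w)) + 1)"
    using graph_of_genus_formula[OF fibre_tree] by (intro sum.cong) auto
  then show "card (verts G) = card C + card (verts G')"
    unfolding sum.distrib using sum_card_fibres[of "verts G'"] surj(1) by simp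
qed

text \<open>A contraction removes as many vertices as edges, and connectedness passes to the
  image.\<close>

lemma graph_of_genus_target:
  assumes "graph_of_genus g G"
  shows "graph_of_genus g G'"
proof -
  have "connected_graph G'"
  proof (rule connected_image[of G "vmap \<phi>"])
    show "(vmap \<phi> (hvert G h), vmap \<phi> (hvert G (opp h))) \<in> (adj G')\<^sup>*" if "fst h \<in> edges G" for h
    proof (cases "fst h \<in> C")
      case True
      then show ?thesis using C_vmap by simp
    next
      case False
      then show ?thesis
        using that hm_simps[of h] hm_simps[of "opp h"] adjI[of "hm h" G'] by auto
    qed
  qed (use assms surj wf in \<open>auto simp: graph_of_genus_def\<close>)
  then show ?thesis
    using assms wf' surj(1) card_graphs unfolding graph_of_genus_iff by auto
qed

end

lemma contracting_iff: "contracting G G' \<phi> \<longleftrightarrow> contraction G G' \<phi>"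
  by (auto simp: contracting_def contracting_axioms_def edgewise_def contraction_def)

section \<open>Collapsing one edge\<close>

text \<open>The end \<open>True\<close> of \<open>e\<close> is merged into the end
  \<open>False\<close>, whose label survives. All other cells keep their names, so the collapsing
  map is a partial identity on half-edges.\<close>

definition contr :: "graph \<Rightarrow> nat \<Rightarrow> graph" where
  "contr G e = \<lparr>verts = verts G - {endpt G e True}, edges = edges G - {e},
     endpt = (\<lambda>x b. if endpt G x b = endpt G e True then endpt G e False else endpt G x b)\<rparr>"

definition contr_map :: "graph \<Rightarrow> nat \<Rightarrow> cmap" where
  "contr_map G e = \<lparr>vmap = restrict (\<lambda>v. if v = endpt G e True then endpt G e False else v) (verts G),
     hmap = (\<lambda>h. if fst h \<in> edges G \<and> fst h \<noteq> e then Some h else None)\<rparr>"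

lemma contr_simps [simp]:
  "verts (contr G e) = verts G - {endpt G e True}" "edges (contr G e) = edges G - {e}"
  "endpt (contr G e) x b = (if endpt G x b = endpt G e True then endpt G e False else endpt G x b)"
  "hvert (contr G e) h = (if hvert G h = endpt G e True then endpt G e False else hvert G h)"
  by (auto simp: contr_def hvert_def)

lemma contr_map_simps [simp]:
  "vmap (contr_map G e) = restrict (\<lambda>v. if v = endpt G e True then endpt G e False else v) (verts G)"
  "hmap (contr_map G e) h = (if fst h \<in> edges G \<and> fst h \<noteq> e then Some h else None)"
  by (auto simp: contr_map_def)

lemma contracted_contr_map: "e \<in> edges G \<Longrightarrow> contracted_edges G (contr_map G e) = {e}"
  by (auto simp: contracted_edges_def)

lemma contraction_contr:
  assumes wf: "wf_graph G" and e: "e \<in> edges G" "endpt G e False \<noteq> endpt G e True"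
  shows "contraction G (contr G e) (contr_map G e)"
proof -
  let ?p = "endpt G e False" and ?c = "endpt G e True" and ?\<phi> = "contr_map G e"
  have V: "endpt G x b \<in> verts G" if "x \<in> edges G" for x b
    using wf that by (auto simp: wf_graph_def)
  have wf': "wf_graph (contr G e)"
    using wf e V by (auto simp: wf_graph_def)
  have ew: "edgewise_morphism G (contr G e) ?\<phi>"
    unfolding edgewise_morphism_def
    using wf wf' e V by (auto simp: dom_def ran_def split: if_splits)
  interpret edgewise G "contr G e" ?\<phi>
    by unfold_locales (rule ew)
  have "graph_of_genus 0 (fibre G ?\<phi> w)" if w: "w \<in> verts (contr G e)" for w
  proof (cases "w = ?p")
    case True
    have v: "verts (fibre G ?\<phi> w) = {?p, ?c}"
      using True e V w by auto
    have ed: "edges (fibre G ?\<phi> w) = {e}"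
      using True e V w by (auto simp: contracted_contr_map)
    have "(?p, ?c) \<in> adj (fibre G ?\<phi> w)" "(?c, ?p) \<in> adj (fibre G ?\<phi> w)"
      using adjI[of "(e, False)" "fibre G ?\<phi> w"] adjI[of "(e, True)" "fibre G ?\<phi> w"] unfolding ed by auto
    then have "connected_graph (fibre G ?\<phi> w)"
      unfolding connected_graph_adj v by auto
    then show ?thesis
      unfolding graph_of_genus_iff v ed using wf_fibre e(2) by simp
  next
    case False
    have v: "verts (fibre G ?\<phi> w) = {w}"
      using False w by auto
    have ed: "edges (fibre G ?\<phi> w) = {}"
      using False e V by (auto simp: contracted_contr_map)
    show ?thesis
      unfolding graph_of_genus_iff connected_graph_adj v ed using wf_fibre by simp
  qed
  moreover have "vmap ?\<phi> ` verts G = verts (contr G e)"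
    using e V by (auto simp: image_iff)
  moreover have "ran (hmap ?\<phi>) = halves (contr G e)"
    by (auto simp: ran_def)
  moreover have "inj_on (hmap ?\<phi>) (dom (hmap ?\<phi>))"
    by (auto simp: inj_on_def dom_def split: if_splits)
  ultimately show ?thesis
    using ew by (simp add: contraction_def)
qed

lemma vmap_cmap_comp [simp]:
  "vmap (cmap_comp G \<psi> \<phi>) = compose (verts G) (vmap \<psi>) (vmap \<phi>)"
  by (simp add: cmap_comp_def)

lemma hmap_cmap_comp:
  "hmap (cmap_comp G \<psi> \<phi>) = hmap \<psi> \<circ>\<^sub>m hmap \<phi>"
  by (simp add: cmap_comp_def)

section \<open>Composition of contractions\<close>

locale composed = A: contracting G G' \<phi> + B: contracting G' G'' \<psi> for G G' G'' \<phi> \<psi>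
begin

abbreviation "\<kappa> \<equiv> cmap_comp G \<psi> \<phi>"

lemma hmap_comp: "hmap \<kappa> h = (if fst h \<in> edges G \<and> fst h \<notin> A.C then hmap \<psi> (A.hm h) else None)"
  using A.hmap_None_iff[of h] A.hmap_hm[of h] by (auto simp: hmap_cmap_comp map_comp_def)

lemma contracted_comp_iff:
  assumes "fst h \<in> edges G"
  shows "fst h \<in> contracted_edges G \<kappa> \<longleftrightarrow> fst h \<in> A.C \<or> fst (A.hm h) \<in> B.C"
proof (cases "fst h \<in> A.C")
  case True
  then show ?thesis
    using assms hmap_comp[of "(fst h, True)"] by (auto simp: contracted_edges_def)
next
  case False
  have *: "hmap \<psi> (A.hm k) = None \<longleftrightarrow> fst (A.hm k) \<in> B.C" if "fst k = fst h" for k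
    using B.hmap_None_iff[of "A.hm k"] A.hm_simps(3)[of k] assms False that by auto
  have "fst (A.hm (fst h, True)) = fst (A.hm h)"
    using A.hm_simps(1)[OF assms False] by (cases h; cases "snd h") auto
  then show ?thesis
    using assms False *[of "(fst h, True)"] hmap_comp[of "(fst h, True)"] by (auto simp: contracted_edges_def)
qed

lemma C_comp: "contracted_edges G \<kappa> = A.C \<union> pre_edge \<phi> ` B.C"
proof (intro equalityI subsetI)
  fix e assume e: "e \<in> contracted_edges G \<kappa>"
  then have "e \<in> edges G"
    by (simp add: contracted_edges_def)
  then show "e \<in> A.C \<union> pre_edge \<phi> ` B.C"
    using e contracted_comp_iff[of "(e, True)"] A.pre_edge_hm[of "(e, True)"] by force
next
  fix e assume "e \<in> A.C \<union> pre_edge \<phi> ` B.C"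
  then show "e \<in> contracted_edges G \<kappa>"
  proof
    assume "e \<in> A.C"
    then show ?thesis
      using contracted_comp_iff[of "(e, True)"] A.C_subset by auto
  next
    assume "e \<in> pre_edge \<phi> ` B.C"
    then obtain f where f: "f \<in> B.C" "e = pre_edge \<phi> f" by blast
    then have "f \<in> edges G'"
      using B.C_subset by auto
    then show ?thesis
      using f A.pre_half[of "(f, True)"] A.pre_edge_fst[of "(f, True)"]
        contracted_comp_iff[of "pre_half \<phi> (f, True)"] by auto
  qed
qed

lemma edgewise_comp: "edgewise_morphism G G'' \<kappa>"
  unfolding edgewise_morphism_def
proof (intro conjI allI impI ballI)
  show "vmap \<kappa> \<in> verts G \<rightarrow>\<^sub>E verts G''"
    by (auto simp: compose_def)
  show "dom (hmap \<kappa>) \<subseteq> halves G"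
    by (auto simp: hmap_comp dom_def split: if_splits)
  show "ran (hmap \<kappa>) \<subseteq> halves G''"
  proof
    fix h assume "h \<in> ran (hmap \<kappa>)"
    then obtain k where "hmap \<kappa> k = Some h"
      by (auto simp: ran_def)
    then have "hmap \<psi> (A.hm k) = Some h"
      by (simp add: hmap_comp split: if_splits)
    then show "h \<in> halves G''"
      using B.hmap_opp(4) by simp
  qed
  fix e b e' b' assume *: "hmap \<kappa> (e, b) = Some (e', b')"
  then have e: "e \<in> edges G" "e \<notin> A.C" "hmap \<psi> (A.hm (e, b)) = Some (e', b')"
    by (auto simp: hmap_comp split: if_splits)
  then have "endpt G e b \<in> verts G"
    using A.wf by (auto simp: wf_graph_def)
  then show "hmap \<kappa> (e, \<not> b) = Some (e', \<not> b')" "vmap \<kappa> (endpt G e b) = endpt G'' e' b'"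
    using e A.hm_simps[of "(e, b)"] B.hmap_opp[OF e(3)] by (auto simp: hmap_comp compose_def)
next
  fix e assume e: "e \<in> edges G" "hmap \<kappa> (e, True) = None"
  then have V: "endpt G e True \<in> verts G" "endpt G e False \<in> verts G"
    using A.wf by (auto simp: wf_graph_def)
  have "e \<in> contracted_edges G \<kappa>"
    using e by (simp add: contracted_edges_def)
  then have "vmap \<psi> (vmap \<phi> (endpt G e False)) = vmap \<psi> (vmap \<phi> (endpt G e True))"
  proof (cases "e \<in> A.C")
    case True
    then show ?thesis
      using A.C_vmap[of "(e, True)"] by simp
  next
    case False
    then have "fst (A.hm (e, True)) \<in> B.C"
      using contracted_comp_iff[of "(e, True)"] e \<open>e \<in> contracted_edges G \<kappa>\<close> by simp
    then show ?thesis
      using B.C_vmap[of "A.hm (e, True)"] A.hm_simps[of "(e, True)"] A.hm_simps[of "(e, False)"] False e by auto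
  qed
  then show "vmap \<kappa> (endpt G e False) = vmap \<kappa> (endpt G e True)"
    using V by (simp add: compose_def)
qed (use A.wf B.wf' in auto)

sublocale comp: edgewise G G'' \<kappa>
  by unfold_locales (rule edgewise_comp)

text \<open>This fibre lies over a fibre of \<open>\<psi>\<close>, which is a tree, with fibres of
  \<open>\<phi>\<close> above its vertices, which are trees too. Counting vertices and edges over
  this base gives Euler characteristic 1, and connectedness lifts by
  \<open>connected_lift\<close>.\<close>

lemma fibre_comp:
  assumes w: "w \<in> verts G''"
  shows "graph_of_genus 0 (fibre G \<kappa> w)"
proof -
  let ?U = "verts (fibre G' \<psi> w)" and ?H = "fibre G \<kappa> w"
  have V: "endpt G e b \<in> verts G" if "e \<in> edges G" for e b
    using A.wf that by (auto simp: wf_graph_def)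
  have verts: "verts ?H = {v \<in> verts G. vmap \<phi> v \<in> ?U}"
    by (auto simp: compose_def)
  have sub1: "vmap \<phi> ` verts ?H \<subseteq> ?U"
    unfolding verts by blast
  have fin1: "finite (verts ?H)" "finite ?U"
    by auto
  have "card (verts ?H) = (\<Sum>u\<in>?U. card {v \<in> verts ?H. vmap \<phi> v = u})"
    using sum.group[OF _ _ sub1, of "\<lambda>_. 1 :: nat"] fin1 by (simp del: fibre_simps)
  also have "\<dots> = (\<Sum>u\<in>?U. card (verts (fibre G \<phi> u)))"
    unfolding verts by (intro sum.cong arg_cong[of _ _ card]) auto
  also have "\<dots> = (\<Sum>u\<in>?U. card (edges (fibre G \<phi> u)) + 1)"
    using graph_of_genus_formula[OF A.fibre_tree] by (intro sum.cong) auto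
  also have "\<dots> = (\<Sum>u\<in>?U. card (edges (fibre G \<phi> u))) + card ?U"
    unfolding sum.distrib by simp
  also have "card ?U = card (edges (fibre G' \<psi> w)) + 1"
    using graph_of_genus_formula[OF B.fibre_tree[OF w]] by simp
  finally have cv: "card (verts ?H) = (\<Sum>u\<in>?U. card (edges (fibre G \<phi> u))) + card (edges (fibre G' \<psi> w)) + 1"
    by simp
  \<comment> \<open>The edges of the composite fibre are of two kinds: these, already contracted by
    \<open>\<phi>\<close>, and the preimages of edges contracted by \<open>\<psi>\<close>.\<close>
  define E1 where "E1 = {e \<in> A.C. vmap \<phi> (endpt G e True) \<in> ?U}"
  have sub2: "(\<lambda>e. vmap \<phi> (endpt G e True)) ` E1 \<subseteq> ?U"
    unfolding E1_def by blast
  have E2: "vmap \<kappa> (endpt G (pre_edge \<phi> f) True) = w \<longleftrightarrow> vmap \<psi> (endpt G' f True) = w" if "f \<in> B.C" for f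
  proof -
    have f: "f \<in> edges G'"
      using that B.C_subset by auto
    let ?h = "pre_half \<phi> (f, True)"
    note h = A.pre_half[of "(f, True)"] A.pre_edge_fst[of "(f, True)"]
    have "vmap \<kappa> (hvert G ?h) = vmap \<psi> (endpt G' f True)"
      using h f wf_graph_hvert[OF A.wf, of ?h] by (auto simp: compose_def)
    moreover have "pre_edge \<phi> f \<in> contracted_edges G \<kappa>"
      using C_comp that by auto
    ultimately show ?thesis
      using comp.C_vmap_True[of ?h] h f by auto
  qed
  have ed: "edges ?H = E1 \<union> pre_edge \<phi> ` edges (fibre G' \<psi> w)"
  proof (intro equalityI subsetI)
    fix e assume "e \<in> edges ?H"
    then have e: "e \<in> contracted_edges G \<kappa>" "vmap \<kappa> (endpt G e True) = w"
      by auto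
    show "e \<in> E1 \<union> pre_edge \<phi> ` edges (fibre G' \<psi> w)"
    proof (cases "e \<in> A.C")
      case True
      then have "endpt G e True \<in> verts G"
        using V A.C_subset by auto
      then show ?thesis
        using True e by (auto simp: E1_def compose_def)
    next
      case False
      then obtain f where "f \<in> B.C" "e = pre_edge \<phi> f"
        using e C_comp by auto
      then show ?thesis
        using e E2[of f] by auto
    qed
  next
    fix e assume "e \<in> E1 \<union> pre_edge \<phi> ` edges (fibre G' \<psi> w)"
    then show "e \<in> edges ?H"
    proof
      assume e: "e \<in> E1"
      then have "endpt G e True \<in> verts G"
        using V A.C_subset by (auto simp: E1_def)
      then show ?thesis
        using e C_comp by (auto simp: E1_def compose_def)
    next
      assume "e \<in> pre_edge \<phi> ` edges (fibre G' \<psi> w)"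
      then show ?thesis
        using E2 C_comp by auto
    qed
  qed
  have sub: "edges (fibre G' \<psi> w) \<subseteq> edges G'"
    using B.C_subset by auto
  have "finite E1" "finite (edges (fibre G' \<psi> w))"
    by (auto simp: E1_def)
  moreover have "E1 \<inter> pre_edge \<phi> ` edges (fibre G' \<psi> w) = {}"
    using A.pre_edge_mem sub by (fastforce simp: E1_def)
  ultimately have "card (edges ?H) = card E1 + card (pre_edge \<phi> ` edges (fibre G' \<psi> w))"
    unfolding ed by (intro card_Un_disjoint) auto
  also have "card (pre_edge \<phi> ` edges (fibre G' \<psi> w)) = card (edges (fibre G' \<psi> w))"
    using inj_on_subset[OF A.inj_pre_edge sub] by (rule card_image)
  also have "card E1 = (\<Sum>u\<in>?U. card {e \<in> E1. vmap \<phi> (endpt G e True) = u})"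
    using sum.group[OF \<open>finite E1\<close> fin1(2) sub2, of "\<lambda>_. 1 :: nat"] by (simp del: fibre_simps)
  also have "\<dots> = (\<Sum>u\<in>?U. card (edges (fibre G \<phi> u)))"
    by (intro sum.cong arg_cong[of _ _ card]) (auto simp: E1_def)
  finally have ce: "card (verts ?H) = card (edges ?H) + 1"
    using cv by simp
  then have ne: "verts ?H \<noteq> {}"
    by (metis add_is_0 card.empty one_neq_zero)
  have "connected_graph ?H"
  proof (rule connected_lift[of "fibre G' \<psi> w" "vmap \<phi>"])
    show "connected_graph (fibre G' \<psi> w)"
      using B.fibre_tree[OF w] by (simp add: graph_of_genus_def)
    show "vmap \<phi> \<in> verts ?H \<rightarrow> ?U"
      unfolding verts by auto
  next
    fix u v assume u: "u \<in> verts ?H" "v \<in> verts ?H" "vmap \<phi> u = vmap \<phi> v"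
    let ?F = "fibre G \<phi> (vmap \<phi> u)"
    have "vmap \<phi> u \<in> verts G'"
      using u by auto
    then have "(u, v) \<in> (adj ?F)\<^sup>*"
      using A.fibre_tree[of "vmap \<phi> u"] u unfolding graph_of_genus_def connected_graph_adj by auto
    moreover have "vmap \<phi> u \<in> ?U"
      using u(1) unfolding verts by simp
    then have "edges ?F \<subseteq> edges ?H"
      unfolding ed by (auto simp: E1_def)
    then have "adj ?F \<subseteq> adj ?H"
      by (auto simp: adj_def)
    ultimately show "(u, v) \<in> (adj ?H)\<^sup>*"
      using rtrancl_mono by blast
  next
    fix h :: half assume h: "fst h \<in> edges (fibre G' \<psi> w)"
    then have hG: "fst h \<in> edges G'"
      using sub by auto
    have "fst h \<in> B.C" "vmap \<psi> (hvert G' h) = w" "vmap \<psi> (hvert G' (opp h)) = w"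
      using h B.C_vmap_True[of h] B.C_vmap_True[of "opp h"] by auto
    moreover have "hvert G' h \<in> verts G'" "hvert G' (opp h) \<in> verts G'"
      using wf_graph_hvert[OF B.wf] hG by auto
    ultimately have U: "hvert G' h \<in> ?U" "hvert G' (opp h) \<in> ?U"
      by auto
    let ?k = "pre_half \<phi> h"
    have "fst ?k \<in> edges ?H"
      unfolding ed using h A.pre_edge_fst[OF hG] by (metis UnCI image_eqI)
    moreover have "vmap \<phi> (hvert G ?k) = hvert G' h" "vmap \<phi> (hvert G (opp ?k)) = hvert G' (opp h)"
      using A.pre_half[OF hG] A.pre_half[of "opp h"] A.pre_half_opp[OF hG] hG by auto
    moreover have "hvert G ?k \<in> verts G" "hvert G (opp ?k) \<in> verts G"
      using wf_graph_hvert[OF A.wf] A.pre_half[OF hG] by auto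
    ultimately show "\<exists>k. fst k \<in> edges ?H \<and> hvert ?H k \<in> verts ?H \<and> hvert ?H (opp k) \<in> verts ?H \<and>
           vmap \<phi> (hvert ?H k) = hvert (fibre G' \<psi> w) h \<and> vmap \<phi> (hvert ?H (opp k)) = hvert (fibre G' \<psi> w) (opp h)"
      using U unfolding verts by (intro exI[of _ ?k]) (simp only: mem_Collect_eq fibre_simps simp_thms)
  qed
  then show ?thesis
    using ce ne comp.wf_fibre unfolding graph_of_genus_iff by simp
qed

lemma contraction_comp: "contraction G G'' \<kappa>"
proof -
  have "vmap \<kappa> ` verts G = vmap \<psi> ` vmap \<phi> ` verts G"
    by (auto simp: compose_def image_image)
  then have "vmap \<kappa> ` verts G = verts G''"
    using A.surj(1) B.surj(1) by simp
  moreover have "ran (hmap \<kappa>) = halves G''"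
  proof (intro equalityI subsetI)
    fix h assume "h \<in> ran (hmap \<kappa>)"
    then show "h \<in> halves G''"
      using edgewise_comp unfolding edgewise_morphism_def by blast
  next
    fix h assume "h \<in> halves G''"
    then have h: "fst h \<in> edges G''"
      by simp
    let ?k = "pre_half \<psi> h"
    have "hmap \<kappa> (pre_half \<phi> ?k) = Some h"
      using A.pre_half[of ?k] B.pre_half[OF h] by (simp add: hmap_cmap_comp map_comp_def)
    then show "h \<in> ran (hmap \<kappa>)"
      by (rule ranI)
  qed
  moreover have "inj_on (hmap \<kappa>) (dom (hmap \<kappa>))"
  proof (rule inj_onI)
    fix h k assume a: "h \<in> dom (hmap \<kappa>)" "k \<in> dom (hmap \<kappa>)" "hmap \<kappa> h = hmap \<kappa> k"
    then have b: "fst h \<in> edges G - A.C" "fst k \<in> edges G - A.C"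
        "A.hm h \<in> dom (hmap \<psi>)" "A.hm k \<in> dom (hmap \<psi>)" "hmap \<psi> (A.hm h) = hmap \<psi> (A.hm k)"
      by (auto simp: hmap_comp dom_def split: if_splits)
    then have "A.hm h = A.hm k"
      using B.surj(3) by (metis inj_onD)
    then show "h = k"
      using A.hm_inj b by blast
  qed
  ultimately show ?thesis
    unfolding contraction_def using edgewise_comp fibre_comp by simp
qed

end

lemma contraction_cmap_comp:
  "contraction G G' \<phi> \<Longrightarrow> contraction G' G'' \<psi> \<Longrightarrow> contraction G G'' (cmap_comp G \<psi> \<phi>)"
  using composed.contraction_comp[of G G' G'' \<phi> \<psi>] by (simp add: composed_def contracting_iff)

lemma is_pullback_contraction: "is_pullback G G' \<phi> f \<Longrightarrow> contraction G G' \<phi>"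
  by (induction rule: is_pullback.induct) (auto intro: contraction_cmap_comp)

section \<open>Factorization into contractions of single edges\<close>

text \<open>After the collapse of \<open>e\<close> the rest of \<open>\<phi>\<close> is given by the
  same data, because both ends of \<open>e\<close> have the same image. Its fibres are images of the
  fibres of \<open>\<phi>\<close>, hence connected, and \<open>contractionI\<close> does the
  rest.\<close>

lemma contraction_factor:
  assumes c: "contraction G G' \<phi>" and g: "graph_of_genus g G" and e: "e \<in> contracted_edges G \<phi>"
  defines "\<psi> \<equiv> \<lparr>vmap = restrict (vmap \<phi>) (verts (contr G e)), hmap = hmap \<phi>\<rparr>"
  shows "contraction (contr G e) G' \<psi>" "cmap_comp G \<psi> (contr_map G e) = \<phi>"
    "contracted_edges (contr G e) \<psi> = contracted_edges G \<phi> - {e}"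
proof -
  interpret contracting G G' \<phi>
    using c by (simp add: contracting_iff)
  let ?p = "endpt G e False" and ?c = "endpt G e True" and ?G1 = "contr G e"
  have eG: "e \<in> edges G"
    using e C_subset by auto
  have V: "endpt G x b \<in> verts G" if "x \<in> edges G" for x b
    using wf that by (auto simp: wf_graph_def)
  have nl: "?p \<noteq> ?c"
    using e by (rule contracted_not_loop)
  have c1: "contraction G ?G1 (contr_map G e)"
    using wf eG nl by (rule contraction_contr)
  then have g1: "graph_of_genus g ?G1"
    using g contracting.graph_of_genus_target contracting_iff by blast
  have pc: "vmap \<phi> ?c = vmap \<phi> ?p"
    using C_vmap[of "(e, False)"] e by simp
  have he: "hmap \<phi> (e, b) = None" for b
    using hmap_None_iff[of "(e, b)"] e by simp
  have vG1: "vmap \<psi> (hvert ?G1 h) = vmap \<phi> (hvert G h)" if "fst h \<in> edges G" for h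
    using V eG nl that pc wf_graph_hvert[OF wf that] by (auto simp: \<psi>_def)
  have ew: "edgewise_morphism ?G1 G' \<psi>"
    unfolding edgewise_morphism_def
  proof (intro conjI allI impI ballI)
    show "wf_graph ?G1" "wf_graph G'"
      using g1 wf' by (auto simp: graph_of_genus_def)
    show "vmap \<psi> \<in> verts ?G1 \<rightarrow>\<^sub>E verts G'"
      by (auto simp: \<psi>_def)
    have "hmap \<phi> h = Some k \<Longrightarrow> fst h \<in> edges G - {e}" for h k
      using hmap_opp(3) he by (metis DiffI option.distinct(1) prod.collapse singletonD)
    then show "dom (hmap \<psi>) \<subseteq> halves ?G1"
      by (auto simp: \<psi>_def dom_def)
    show "ran (hmap \<psi>) \<subseteq> halves G'"
      using surj(2) by (simp add: \<psi>_def)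
    fix x b x' b' assume h: "hmap \<psi> (x, b) = Some (x', b')"
    then have "hmap \<phi> (x, b) = Some (x', b')"
      by (simp add: \<psi>_def)
    note o = hmap_opp[OF this]
    show "hmap \<psi> (x, \<not> b) = Some (x', \<not> b')"
      using o by (simp add: \<psi>_def)
    show "vmap \<psi> (endpt ?G1 x b) = endpt G' x' b'"
      using vG1[of "(x, b)"] o by simp
  next
    fix x assume x: "x \<in> edges ?G1" "hmap \<psi> (x, True) = None"
    then have "x \<in> C"
      by (auto simp: \<psi>_def contracted_edges_def)
    then show "vmap \<psi> (endpt ?G1 x False) = vmap \<psi> (endpt ?G1 x True)"
      using vG1[of "(x, False)"] vG1[of "(x, True)"] C_vmap[of "(x, True)"] x by simp
  qed
  show C1: "contracted_edges ?G1 \<psi> = C - {e}"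
    by (auto simp: contracted_edges_def \<psi>_def)
  show "contraction ?G1 G' \<psi>"
  proof (rule contractionI[OF ew g1])
    show "graph_of_genus g G'"
      using g by (rule graph_of_genus_target)
    have "vmap \<psi> ` verts ?G1 = vmap \<phi> ` (verts G - {?c})"
      by (auto simp: \<psi>_def)
    also have "\<dots> = vmap \<phi> ` verts G"
      using pc V[OF eG] nl by (auto simp: image_iff)
    finally show "vmap \<psi> ` verts ?G1 = verts G'"
      using surj by simp
    show "ran (hmap \<psi>) = halves G'" "inj_on (hmap \<psi>) (dom (hmap \<psi>))"
      using surj by (auto simp: \<psi>_def)
    fix w assume w: "w \<in> verts G'"
    show "connected_graph (fibre ?G1 \<psi> w)"
    proof (rule connected_image[of "fibre G \<phi> w" "\<lambda>v. if v = ?c then ?p else v"])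
      show "connected_graph (fibre G \<phi> w)"
        using fibre_tree[OF w] by (simp add: graph_of_genus_def)
      show "wf_graph (fibre G \<phi> w)"
        by (rule wf_fibre)
      show "(\<lambda>v. if v = ?c then ?p else v) ` verts (fibre G \<phi> w) = verts (fibre ?G1 \<psi> w)"
        using pc V[OF eG] nl by (auto simp: \<psi>_def image_iff)
      fix h :: half assume h: "fst h \<in> edges (fibre G \<phi> w)"
      then have hG: "fst h \<in> edges G"
        using C_subset by auto
      show "(if hvert (fibre G \<phi> w) h = ?c then ?p else hvert (fibre G \<phi> w) h,
          if hvert (fibre G \<phi> w) (opp h) = ?c then ?p else hvert (fibre G \<phi> w) (opp h)) \<in> (adj (fibre ?G1 \<psi> w))\<^sup>*"
      proof (cases "fst h = e")
        case True
        then show ?thesis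
          by (cases h; cases "snd h") auto
      next
        case False
        then have "fst h \<in> edges (fibre ?G1 \<psi> w)"
          using h C1 vG1[of "(fst h, True)"] hG by (simp add: C1)
        then show ?thesis
          using adjI[of h "fibre ?G1 \<psi> w"] by auto
      qed
    qed
  qed
  have "vmap (cmap_comp G \<psi> (contr_map G e)) = vmap \<phi>"
  proof
    fix v show "vmap (cmap_comp G \<psi> (contr_map G e)) v = vmap \<phi> v"
      using vmap_ext pc V[OF eG] nl by (cases "v \<in> verts G") (auto simp: compose_def \<psi>_def PiE_def extensional_def)
  qed
  moreover have "hmap (cmap_comp G \<psi> (contr_map G e)) = hmap \<phi>"
  proof
    fix h show "hmap (cmap_comp G \<psi> (contr_map G e)) h = hmap \<phi> h"
      using hmap_None_iff[of h] e by (auto simp: hmap_cmap_comp map_comp_def \<psi>_def)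
  qed
  ultimately show "cmap_comp G \<psi> (contr_map G e) = \<phi>"
    by (intro cmap.equality) auto
qed

lemma is_pullback_exists:
  assumes "contraction G G' \<phi>" "graph_of_genus g G"
  shows "\<exists>f. is_pullback G G' \<phi> f"
  using assms
proof (induction "card (contracted_edges G \<phi>)" arbitrary: G \<phi> rule: less_induct)
  case less
  interpret contracting G G' \<phi>
    using less.prems by (simp add: contracting_iff)
  show ?case
  proof (cases "card C \<le> 1")
    case True
    then show ?thesis
      using less.prems is_pullback.elementary by blast
  next
    case False
    then obtain e where e: "e \<in> C"
      by (metis card.empty equals0I zero_le_one)
    let ?\<psi> = "\<lparr>vmap = restrict (vmap \<phi>) (verts (contr G e)), hmap = hmap \<phi>\<rparr>"
    note f = contraction_factor[OF less.prems e]
    have eG: "e \<in> edges G"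
      using e C_subset by auto
    have c1: "contraction G (contr G e) (contr_map G e)"
      using wf eG contracted_not_loop[OF e] by (rule contraction_contr)
    have g1: "graph_of_genus g (contr G e)"
      using c1 less.prems(2) contracting.graph_of_genus_target contracting_iff by blast
    have "card (contracted_edges (contr G e) ?\<psi>) < card C"
        unfolding f(3) using e by (intro card_Diff1_less) auto
    then obtain f' where "is_pullback (contr G e) G' ?\<psi> f'"
      using less.hyps f(1) g1 by blast
    moreover have "is_pullback G (contr G e) (contr_map G e) (elementary_pullback G (contr_map G e))"
      using c1 by (rule is_pullback.elementary) (simp add: contracted_contr_map[OF eG])
    ultimately have "is_pullback G G' (cmap_comp G ?\<psi> (contr_map G e)) (elementary_pullback G (contr_map G e) \<circ> f')"
      by (intro is_pullback.composite)
    then show ?thesis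
      unfolding f(2) by blast
  qed
qed

lemma contraction_cmap_id:
  assumes "wf_graph G"
  shows "contraction G G (cmap_id G)" "contracted_edges G (cmap_id G) = {}"
proof -
  show C: "contracted_edges G (cmap_id G) = {}"
    by (auto simp: contracted_edges_def cmap_id_def)
  have ew: "edgewise_morphism G G (cmap_id G)"
    using assms unfolding edgewise_morphism_def cmap_id_def wf_graph_def
    by (auto simp: dom_def ran_def split: if_splits)
  have "graph_of_genus 0 (fibre G (cmap_id G) w)" if "w \<in> verts G" for w
  proof -
    have "verts (fibre G (cmap_id G) w) = {w}"
      using that by (auto simp: cmap_id_def)
    moreover have "edges (fibre G (cmap_id G) w) = {}"
      by (simp add: C)
    moreover have "wf_graph (fibre G (cmap_id G) w)"
      by (rule edgewise.wf_fibre) (unfold_locales, rule ew)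
    ultimately show ?thesis
      unfolding graph_of_genus_iff connected_graph_adj by (simp del: fibre_simps)
  qed
  then show "contraction G G (cmap_id G)"
    unfolding contraction_def using ew
    by (auto simp: cmap_id_def ran_def inj_on_def dom_def split: if_splits)
qed

text \<open>From here on half-edges are handled as atoms, so quantifiers over them are not to be
  split into edge and end.\<close>

declare split_paired_All [simp del] split_paired_Ex [simp del]

section \<open>Polynomials in the edges\<close>

definition rename_mono :: "(nat \<Rightarrow> nat) \<Rightarrow> (nat \<Rightarrow>\<^sub>0 nat) \<Rightarrow> (nat \<Rightarrow>\<^sub>0 nat)" where
  "rename_mono f m = (\<Sum>e\<in>Poly_Mapping.keys m. Poly_Mapping.single (f e) (Poly_Mapping.lookup m e))"

lemma edge_var_power: "edge_var e ^ k = Poly_Mapping.single (Poly_Mapping.single e k) 1"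
  by (induction k) (simp_all add: edge_var_def mult_single single_add[symmetric])

lemma prod_single_1:
  "(\<Prod>e\<in>S. Poly_Mapping.single (g e) (1 :: int)) = Poly_Mapping.single (\<Sum>e\<in>S. g e :: nat \<Rightarrow>\<^sub>0 nat) 1"
  by (induction S rule: infinite_finite_induct) (simp_all add: mult_single)

text \<open>A polynomial is an element of the free abelian group on the monomials, and renaming is
  the linear extension of a map of monomials; additivity then comes from
  \<open>frag_extend\<close>.\<close>

lemma rename_vars_frag_extend:
  "rename_vars f = frag_extend (\<lambda>m. frag_of (rename_mono f m))"
proof
  fix p
  have "frag_cmul c (frag_of m) = Poly_Mapping.single m c" for c and m :: "nat \<Rightarrow>\<^sub>0 nat"
    by (rule poly_mapping_eqI) (simp add: lookup_single when_def)
  then show "rename_vars f p = frag_extend (\<lambda>m. frag_of (rename_mono f m)) p"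
    by (simp add: rename_vars_def frag_extend_def edge_var_power prod_single_1 rename_mono_def mult_single)
qed

lemma rename_vars_0 [simp]: "rename_vars f 0 = 0"
  by (simp add: rename_vars_frag_extend)

lemma rename_vars_add: "rename_vars f (p + q) = rename_vars f p + rename_vars f q"
  by (simp add: rename_vars_frag_extend frag_extend_add)

lemma rename_vars_minus: "rename_vars f (- p) = - rename_vars f p"
  by (simp add: rename_vars_frag_extend frag_extend_minus)

lemma rename_vars_sum: "rename_vars f (\<Sum>x\<in>S. p x) = (\<Sum>x\<in>S. rename_vars f (p x))"
  by (induction S rule: infinite_finite_induct) (simp_all add: rename_vars_add)

lemma rename_vars_sign: "rename_vars f ((-1) ^ k * p) = (-1) ^ k * rename_vars f p"
  by (cases "even k") (simp_all add: rename_vars_minus)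

lemma rename_mono_add: "rename_mono f (m + m') = rename_mono f m + rename_mono f m'"
  unfolding rename_mono_def by (subst setsum_keys_plus_distrib) (simp_all add: single_add)

lemma rename_mono_single [simp]: "rename_mono f (Poly_Mapping.single e k) = Poly_Mapping.single (f e) k"
  by (cases "k = 0") (simp_all add: rename_mono_def)

lemma rename_vars_edge_var_mult:
  "rename_vars f (edge_var e * p) = edge_var (f e) * rename_vars f p"
proof -
  have "p \<in> UNIV \<Longrightarrow> rename_vars f (edge_var e * p) = edge_var (f e) * rename_vars f p"
  proof (rule frag_induction[of p UNIV])
    show "rename_vars f (edge_var e * frag_of m) = edge_var (f e) * rename_vars f (frag_of m)" for m
      by (simp add: edge_var_def mult_single rename_vars_frag_extend rename_mono_add)
    show "rename_vars f (edge_var e * (p - q)) = edge_var (f e) * rename_vars f (p - q)"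
      if "rename_vars f (edge_var e * p) = edge_var (f e) * rename_vars f p"
        "rename_vars f (edge_var e * q) = edge_var (f e) * rename_vars f q" for p q
      using that by (simp add: right_diff_distrib rename_vars_frag_extend frag_extend_diff)
  qed auto
  then show ?thesis by simp
qed

lemma keys_rename_vars: "Poly_Mapping.keys (rename_vars f p) \<subseteq> rename_mono f ` Poly_Mapping.keys p"
  unfolding rename_vars_frag_extend using keys_frag_extend[of "\<lambda>m. frag_of (rename_mono f m)" p] by auto

lemma keys_rename_mono: "Poly_Mapping.keys (rename_mono f m) \<subseteq> f ` Poly_Mapping.keys m"
  unfolding rename_mono_def
  by (rule order_trans[OF keys_sum]) (auto split: if_splits)

lemma lookup_rename_mono:
  assumes "inj_on f E" "Poly_Mapping.keys m \<subseteq> E" "e \<in> E"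
  shows "Poly_Mapping.lookup (rename_mono f m) (f e) = Poly_Mapping.lookup m e"
proof -
  have "Poly_Mapping.lookup (rename_mono f m) (f e) =
      (\<Sum>x\<in>Poly_Mapping.keys m. if x = e then Poly_Mapping.lookup m x else 0)"
    unfolding rename_mono_def lookup_sum lookup_single when_def
    using assms by (intro sum.cong) (auto simp: inj_on_eq_iff)
  then show ?thesis
    by (simp add: in_keys_iff)
qed

lemma rename_mono_inj:
  assumes "inj_on f E" "Poly_Mapping.keys m \<subseteq> E" "Poly_Mapping.keys m' \<subseteq> E" "rename_mono f m = rename_mono f m'"
  shows "m = m'"
proof (rule poly_mapping_eqI)
  fix e show "Poly_Mapping.lookup m e = Poly_Mapping.lookup m' e"
  proof (cases "e \<in> E")
    case True
    then show ?thesis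
      using lookup_rename_mono[OF assms(1,2), of e] lookup_rename_mono[OF assms(1,3), of e] assms(4) by simp
  next
    case False
    then show ?thesis
      using assms(2,3) by (metis in_keys_iff subsetD)
  qed
qed

text \<open>Injectivity on the variables that occur keeps distinct monomials distinct, so no
  coefficients are added up.\<close>

lemma lookup_rename_vars:
  assumes "inj_on f E" "\<forall>m\<in>Poly_Mapping.keys p. Poly_Mapping.keys m \<subseteq> E" "Poly_Mapping.keys m \<subseteq> E"
  shows "Poly_Mapping.lookup (rename_vars f p) (rename_mono f m) = Poly_Mapping.lookup p m"
proof -
  have "Poly_Mapping.lookup (rename_vars f p) (rename_mono f m) =
      (\<Sum>x\<in>Poly_Mapping.keys p. if x = m then Poly_Mapping.lookup p x else 0)"
    unfolding rename_vars_frag_extend frag_extend_def lookup_sum lookup_frag_cmul lookup_single when_def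
    using assms by (intro sum.cong) (auto dest: rename_mono_inj)
  then show ?thesis
    by (simp add: in_keys_iff)
qed

lemma mono_degree_add: "mono_degree (m + m') = mono_degree m + mono_degree m'"
  unfolding mono_degree_def by (subst setsum_keys_plus_distrib) simp_all

lemma mono_degree_0 [simp]: "mono_degree 0 = 0"
  by (simp add: mono_degree_def)

lemma mono_degree_single [simp]: "mono_degree (Poly_Mapping.single e k) = k"
  by (cases "k = 0") (simp_all add: mono_degree_def)

lemma mono_degree_sum: "mono_degree (\<Sum>x\<in>S. m x) = (\<Sum>x\<in>S. mono_degree (m x))"
  by (induction S rule: infinite_finite_induct) (simp_all add: mono_degree_add)

lemma mono_degree_rename [simp]: "mono_degree (rename_mono f m) = mono_degree m"
  by (simp add: rename_mono_def mono_degree_sum) (simp add: mono_degree_def)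

lemma mono_degree_eq_0_iff: "mono_degree m = 0 \<longleftrightarrow> m = 0"
  unfolding mono_degree_def by (auto simp: in_keys_iff intro!: poly_mapping_eqI)

section \<open>The polynomial ring of a graph\<close>

lemma A_ring_0 [simp]: "0 \<in> A_ring G"
  and A_ring_1 [simp]: "1 \<in> A_ring G"
  by (simp_all add: A_ring_def)

lemma A_ring_add: "p \<in> A_ring G \<Longrightarrow> q \<in> A_ring G \<Longrightarrow> p + q \<in> A_ring G"
  using keys_add[of p q] by (auto simp: A_ring_def)

lemma A_ring_minus: "p \<in> A_ring G \<Longrightarrow> - p \<in> A_ring G"
  by (simp add: A_ring_def)

lemma A_ring_diff: "p \<in> A_ring G \<Longrightarrow> q \<in> A_ring G \<Longrightarrow> p - q \<in> A_ring G"
  using keys_diff[of p q] by (auto simp: A_ring_def)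

lemma A_ring_mult:
  assumes "p \<in> A_ring G" "q \<in> A_ring G"
  shows "p * q \<in> A_ring G"
  unfolding A_ring_def
proof (intro CollectI ballI)
  fix m assume "m \<in> Poly_Mapping.keys (p * q)"
  then obtain a b where "m = a + b" "a \<in> Poly_Mapping.keys p" "b \<in> Poly_Mapping.keys q"
    using keys_mult[of p q] by blast
  moreover from this have "Poly_Mapping.keys a \<subseteq> edges G" "Poly_Mapping.keys b \<subseteq> edges G"
    using assms by (auto simp: A_ring_def)
  ultimately show "Poly_Mapping.keys m \<subseteq> edges G"
    using keys_add[of a b] by blast
qed

lemma A_ring_sum: "(\<And>x. x \<in> S \<Longrightarrow> p x \<in> A_ring G) \<Longrightarrow> (\<Sum>x\<in>S. p x) \<in> A_ring G"
  by (induction S rule: infinite_finite_induct) (auto intro: A_ring_add)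

lemma A_ring_prod: "(\<And>x. x \<in> S \<Longrightarrow> p x \<in> A_ring G) \<Longrightarrow> (\<Prod>x\<in>S. p x) \<in> A_ring G"
  by (induction S rule: infinite_finite_induct) (auto intro: A_ring_mult)

lemma A_ring_sign: "p \<in> A_ring G \<Longrightarrow> (-1) ^ k * p \<in> A_ring G"
  by (cases "even k") (auto intro: A_ring_minus)

lemma A_ring_edge_var: "e \<in> edges G \<Longrightarrow> edge_var e \<in> A_ring G"
  by (simp add: A_ring_def edge_var_def)

section \<open>States and the reduced complex\<close>

lemma finite_states: "wf_graph G \<Longrightarrow> finite (states G)"
proof -
  assume wf: "wf_graph G"
  have "states G \<subseteq> {s. \<forall>v. (v \<in> verts G \<longrightarrow> s v \<in> insert None (Some ` halves G)) \<and> (v \<notin> verts G \<longrightarrow> s v = None)}"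
  proof
    fix s assume s: "s \<in> states G"
    have "s v \<in> insert None (Some ` halves G)" for v
      using s by (cases "s v") (auto simp: states_def)
    moreover have "s v = None" if "v \<notin> verts G" for v
      using s that by (cases "s v") (auto simp: states_def)
    ultimately show "s \<in> {s. \<forall>v. (v \<in> verts G \<longrightarrow> s v \<in> insert None (Some ` halves G)) \<and> (v \<notin> verts G \<longrightarrow> s v = None)}"
      by blast
  qed
  moreover have "finite \<dots>"
    using wf finite_halves[OF wf] by (intro finite_set_of_finite_funs) (auto simp: wf_graph_def)
  ultimately show ?thesis
    by (rule finite_subset)
qed

lemma states_None: "s \<in> states G \<Longrightarrow> v \<notin> verts G \<Longrightarrow> s v = None"
  by (cases "s v") (auto simp: states_def)

lemma states_SomeD: "s \<in> states G \<Longrightarrow> s v = Some h \<Longrightarrow> fst h \<in> edges G \<and> hvert G h = v \<and> v \<in> verts G"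
  unfolding states_def using mem_halves_at by blast

lemma states_upd_None: "s \<in> states G \<Longrightarrow> s(v := None) \<in> states G"
  by (auto simp: states_def)

lemma states_upd_Some:
  "wf_graph G \<Longrightarrow> s \<in> states G \<Longrightarrow> fst h \<in> edges G \<Longrightarrow> s(hvert G h \<mapsto> h) \<in> states G"
  using wf_graph_hvert[of G h] by (auto simp: states_def)

lemma occupied_subset: "s \<in> states G \<Longrightarrow> occupied s \<subseteq> verts G"
  using states_None[of s G] by (fastforce simp: occupied_def)

lemma lookup_smul [simp]: "Poly_Mapping.lookup (smul p x) k = p * Poly_Mapping.lookup x k"
  by (simp add: smul_def Poly_Mapping.map.rep_eq when_def)

lemma lookup_pure_tensor:
  assumes "wf_graph G"
  shows "Poly_Mapping.lookup (pure_tensor G x) s =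
    (if s \<in> states G then \<Prod>v\<in>verts G. Poly_Mapping.lookup (x v) (s v) else 0)"
  using finite_states[OF assms] by (simp add: pure_tensor_def lookup_sum lookup_single when_def)

lemma lookup_basis_elt: "Poly_Mapping.lookup (basis_elt b) b' = (if b = b' then 1 else 0)"
  by (simp add: basis_elt_def lookup_single when_def)

lemma A_span_add:
  assumes "x \<in> A_span G B" "y \<in> A_span G B"
  shows "x + y \<in> A_span G B"
  using assms(2)
proof (induction y rule: A_span.induct)
  case (add y b p)
  then show ?case
    using A_span.add[of "x + y" G B b p] by (simp add: add.assoc)
qed (use assms(1) in simp)

lemma A_span_sum: "(\<And>i. i \<in> S \<Longrightarrow> x i \<in> A_span G B) \<Longrightarrow> (\<Sum>i\<in>S. x i) \<in> A_span G B"
  by (induction S rule: infinite_finite_induct) (auto intro: A_span.zero A_span_add)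

lemma A_span_smul_gen: "b \<in> B \<Longrightarrow> p \<in> A_ring G \<Longrightarrow> smul p b \<in> A_span G B"
  using A_span.add[OF A_span.zero] by (metis add_0)

lemma reduced_S_D:
  assumes wf: "wf_graph G" and "y \<in> reduced_S G v"
  shows "Poly_Mapping.lookup y b \<in> A_ring G" "(\<Sum>h\<in>halves_at G v. Poly_Mapping.lookup y (Some h)) = 0"
proof -
  have "(\<forall>b. Poly_Mapping.lookup y b \<in> A_ring G) \<and> (\<Sum>h\<in>halves_at G v. Poly_Mapping.lookup y (Some h)) = 0"
    using assms(2) unfolding reduced_S_def
  proof (induction y rule: A_span.induct)
    case (add x b p)
    have b: "\<forall>k. Poly_Mapping.lookup b k \<in> A_ring G"
        "(\<Sum>h\<in>halves_at G v. Poly_Mapping.lookup b (Some h)) = 0"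
      using add.hyps(2) finite_halves_at[OF wf, of v]
      by (auto simp: lookup_basis_elt lookup_minus sum_subtractf A_ring_minus)
    show ?case
      using add b by (auto simp: lookup_add sum.distrib sum_distrib_left[symmetric] intro!: A_ring_add A_ring_mult)
  qed auto
  then show "Poly_Mapping.lookup y b \<in> A_ring G" "(\<Sum>h\<in>halves_at G v. Poly_Mapping.lookup y (Some h)) = 0"
    by auto
qed

text \<open>The coefficients of a reduced chain are determined by those at the states that avoid a
  reference half-edge at each vertex.\<close>

definition vertex_sums_zero :: "graph \<Rightarrow> sw_chain \<Rightarrow> bool" where
  "vertex_sums_zero G c \<longleftrightarrow> (\<forall>v\<in>verts G. \<forall>s\<in>states G. s v = None \<longrightarrow>
     (\<Sum>h\<in>halves_at G v. Poly_Mapping.lookup c (s(v \<mapsto> h))) = 0)"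

lemma vertex_sums_zeroD:
  "vertex_sums_zero G c \<Longrightarrow> v \<in> verts G \<Longrightarrow> s \<in> states G \<Longrightarrow> s v = None \<Longrightarrow>
     (\<Sum>h\<in>halves_at G v. Poly_Mapping.lookup c (s(v \<mapsto> h))) = 0"
  by (simp add: vertex_sums_zero_def)

text \<open>If a state has the reference half-edge at \<open>v\<close>, the vertex sum at
  \<open>v\<close> expresses its coefficient through states with another half-edge there; induction
  on the number of vertices that carry their reference.\<close>

lemma reference_determines:
  assumes wf: "wf_graph G" and red: "vertex_sums_zero G c" and keys: "Poly_Mapping.keys c \<subseteq> states G"
    and zero: "\<And>s. s \<in> states G \<Longrightarrow> (\<And>v. s v = None \<or> s v \<noteq> ref v) \<Longrightarrow> Poly_Mapping.lookup c s = 0"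
  shows "c = 0"
proof -
  have "Poly_Mapping.lookup c s = 0" if "s \<in> states G" for s
    using that
  proof (induction "card {v \<in> verts G. s v \<noteq> None \<and> s v = ref v}" arbitrary: s rule: less_induct)
    case less
    have fin: "finite (verts G)"
      using wf by (simp add: wf_graph_def)
    show ?case
    proof (cases "\<exists>v h. s v = Some h \<and> ref v = Some h")
      case False
      then show ?thesis
        using zero[OF less.prems] by (metis not_None_eq)
    next
      case True
      then obtain v h where v: "s v = Some h" "ref v = Some h" by blast
      then have vh: "v \<in> verts G" "h \<in> halves_at G v"
        using states_SomeD[OF less.prems] by auto
      define s0 where "s0 = s(v := None)"
      have s0: "s0 \<in> states G" "s0 v = None"
        using less.prems by (auto simp: s0_def states_upd_None)
      have "Poly_Mapping.lookup c (s0(v \<mapsto> k)) = 0" if "k \<in> halves_at G v - {h}" for k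
      proof (rule less.hyps)
        show "s0(v \<mapsto> k) \<in> states G"
          using states_upd_Some[OF wf s0(1), of k] that by auto
        have "{u \<in> verts G. (s0(v \<mapsto> k)) u \<noteq> None \<and> (s0(v \<mapsto> k)) u = ref u} =
            {u \<in> verts G. s u \<noteq> None \<and> s u = ref u} - {v}"
          using that v by (auto simp: s0_def)
        then show "card {u \<in> verts G. (s0(v \<mapsto> k)) u \<noteq> None \<and> (s0(v \<mapsto> k)) u = ref u} <
            card {u \<in> verts G. s u \<noteq> None \<and> s u = ref u}"
          using vh v fin by (simp only:, intro card_Diff1_less) auto
      qed
      then have "(\<Sum>k\<in>halves_at G v. Poly_Mapping.lookup c (s0(v \<mapsto> k))) = Poly_Mapping.lookup c (s0(v \<mapsto> h))"
        using vh finite_halves_at[OF wf, of v] by (simp add: sum.remove)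
      moreover have "s0(v \<mapsto> h) = s"
        using v by (auto simp: s0_def)
      ultimately show ?thesis
        using vertex_sums_zeroD[OF red vh(1) s0] by simp
    qed
  qed
  then show ?thesis
    using keys by (metis in_keys_iff lookup_zero poly_mapping_eqI subsetD)
qed

lemma vertex_sums_zero_add: "vertex_sums_zero G c \<Longrightarrow> vertex_sums_zero G d \<Longrightarrow> vertex_sums_zero G (c + d)"
  by (simp add: vertex_sums_zero_def lookup_add sum.distrib)

lemma vertex_sums_zero_minus: "vertex_sums_zero G c \<Longrightarrow> vertex_sums_zero G (- c)"
  by (simp add: vertex_sums_zero_def sum_negf)

lemma vertex_sums_zero_smul: "vertex_sums_zero G c \<Longrightarrow> vertex_sums_zero G (smul p c)"
  by (simp add: vertex_sums_zero_def sum_distrib_left[symmetric])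

lemma vertex_sums_zero_0: "vertex_sums_zero G 0"
  by (simp add: vertex_sums_zero_def)

lemma vertex_sums_zero_sum: "(\<And>i. i \<in> S \<Longrightarrow> vertex_sums_zero G (c i)) \<Longrightarrow> vertex_sums_zero G (\<Sum>i\<in>S. c i)"
  by (induction S rule: infinite_finite_induct) (auto intro: vertex_sums_zero_add vertex_sums_zero_0)

lemma keys_smul: "Poly_Mapping.keys (smul p c) \<subseteq> Poly_Mapping.keys c"
  by (auto simp: in_keys_iff)

lemma keys_pure_tensor: "wf_graph G \<Longrightarrow> Poly_Mapping.keys (pure_tensor G x) \<subseteq> states G"
  by (auto simp: in_keys_iff lookup_pure_tensor split: if_splits)

lemma pure_tensor_vertex_sum:
  assumes wf: "wf_graph G" and v: "v \<in> verts G" and s: "s \<in> states G" "s v = None"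
    and x: "(\<Sum>h\<in>halves_at G v. Poly_Mapping.lookup (x v) (Some h)) = 0"
  shows "(\<Sum>h\<in>halves_at G v. Poly_Mapping.lookup (pure_tensor G x) (s(v \<mapsto> h))) = 0"
proof -
  have fin: "finite (verts G)"
    using wf by (simp add: wf_graph_def)
  have "Poly_Mapping.lookup (pure_tensor G x) (s(v \<mapsto> h)) =
      Poly_Mapping.lookup (x v) (Some h) * (\<Prod>u\<in>verts G - {v}. Poly_Mapping.lookup (x u) (s u))"
    if "h \<in> halves_at G v" for h
    using states_upd_Some[OF wf s(1), of h] that v fin
    by (simp add: lookup_pure_tensor[OF wf] prod.remove)
  then have "(\<Sum>h\<in>halves_at G v. Poly_Mapping.lookup (pure_tensor G x) (s(v \<mapsto> h))) =
      (\<Sum>h\<in>halves_at G v. Poly_Mapping.lookup (x v) (Some h)) *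
      (\<Prod>u\<in>verts G - {v}. Poly_Mapping.lookup (x u) (s u))"
    unfolding sum_distrib_right by (rule sum.cong[OF refl])
  then show ?thesis
    using x by simp
qed

lemma pure_tensor_reduced:
  assumes "wf_graph G"
    and "\<And>v. v \<in> verts G \<Longrightarrow> (\<Sum>h\<in>halves_at G v. Poly_Mapping.lookup (x v) (Some h)) = 0"
  shows "vertex_sums_zero G (pure_tensor G x)"
  unfolding vertex_sums_zero_def using pure_tensor_vertex_sum[OF assms(1)] assms(2) by blast

section \<open>The basis attached to reference half-edges\<close>

text \<open>Once a reference half-edge is fixed, \<open>\<emptyset>\<close> and the differences of
  the other half-edges with it form a basis of the reduced module at a vertex; this selects the
  basis element belonging to the entry of \<open>s\<close>.\<close>

definition reference_factor :: "state \<Rightarrow> state \<Rightarrow> nat \<Rightarrow> (half option \<Rightarrow>\<^sub>0 epoly)" where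
  "reference_factor ref s v =
     (case s v of None \<Rightarrow> basis_elt None | Some h \<Rightarrow> basis_elt (Some h) - basis_elt (ref v))"

lemma reference_factor_reduced_S:
  assumes "s \<in> states G" "s v \<noteq> None \<Longrightarrow> ref v \<in> Some ` halves_at G v"
  shows "reference_factor ref s v \<in> reduced_S G v"
proof -
  have "smul 1 (reference_factor ref s v) \<in> reduced_S G v"
    unfolding reduced_S_def
  proof (rule A_span_smul_gen)
    show "reference_factor ref s v \<in> insert (basis_elt None)
       {basis_elt (Some h) - basis_elt (Some h') | h h'. h \<in> halves_at G v \<and> h' \<in> halves_at G v}"
    proof (cases "s v")
      case None
      then show ?thesis by (simp add: reference_factor_def)
    next
      case (Some h)
      then obtain h' where "ref v = Some h'" "h' \<in> halves_at G v"
        using assms(2) by auto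
      moreover have "h \<in> halves_at G v"
        using states_SomeD[OF assms(1) Some] by simp
      moreover have "reference_factor ref s v = basis_elt (Some h) - basis_elt (ref v)"
        using Some by (simp add: reference_factor_def)
      ultimately show ?thesis
        by (metis (mono_tags, lifting) insertI2 mem_Collect_eq)
    qed
  qed simp
  moreover have "smul 1 (reference_factor ref s v) = reference_factor ref s v"
    by (rule poly_mapping_eqI) simp
  ultimately show ?thesis by simp
qed

lemma lookup_reference_factor:
  assumes "s' v = None \<or> s' v \<noteq> ref v" "s v \<noteq> None \<Longrightarrow> ref v \<noteq> None"
  shows "Poly_Mapping.lookup (reference_factor ref s v) (s' v) = (if s v = s' v then 1 else 0)"
  using assms by (cases "s v") (auto simp: reference_factor_def lookup_basis_elt lookup_minus)

text \<open>Both sides have vanishing vertex sums, and at states avoiding the references the tensors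
  on the right are Kronecker deltas, so the difference falls under
  \<open>reference_determines\<close>. References are asked for at occupied vertices alone, which
  later lets a root go without one.\<close>

lemma reference_expansion:
  assumes wf: "wf_graph G" and red: "vertex_sums_zero G c" and keys: "Poly_Mapping.keys c \<subseteq> states G"
    and ref: "\<And>s v. s \<in> Poly_Mapping.keys c \<Longrightarrow> s v \<noteq> None \<Longrightarrow> ref v \<in> Some ` halves_at G v"
  shows "c = (\<Sum>s\<in>{s \<in> Poly_Mapping.keys c. \<forall>v. s v = None \<or> s v \<noteq> ref v}.
    smul (Poly_Mapping.lookup c s) (pure_tensor G (reference_factor ref s)))" (is "c = ?d")
proof -
  let ?N = "{s \<in> Poly_Mapping.keys c. \<forall>v. s v = None \<or> s v \<noteq> ref v}"
  have fin: "finite ?N" "finite (verts G)"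
    using wf by (auto simp: wf_graph_def)
  have "c - ?d = 0"
  proof (rule reference_determines[OF wf, where ref=ref])
    have "vertex_sums_zero G ?d"
    proof (intro vertex_sums_zero_sum vertex_sums_zero_smul pure_tensor_reduced[OF wf])
      fix s v assume "s \<in> ?N"
      then show "(\<Sum>h\<in>halves_at G v. Poly_Mapping.lookup (reference_factor ref s v) (Some h)) = 0"
        using keys ref[of s v] by (intro reduced_S_D(2)[OF wf] reference_factor_reduced_S) auto
    qed
    then show "vertex_sums_zero G (c - ?d)"
      using vertex_sums_zero_add[OF red vertex_sums_zero_minus] by simp
    have "Poly_Mapping.keys ?d \<subseteq> states G"
      by (intro order_trans[OF keys_sum] UN_least order_trans[OF keys_smul] keys_pure_tensor[OF wf])
    then show "Poly_Mapping.keys (c - ?d) \<subseteq> states G"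
      using keys keys_diff[of c ?d] by blast
    fix s' assume s': "s' \<in> states G" "\<And>v. s' v = None \<or> s' v \<noteq> ref v"
    have "Poly_Mapping.lookup (pure_tensor G (reference_factor ref s)) s' = (if s = s' then 1 else 0)" if "s \<in> ?N" for s
    proof -
      have ss: "s \<in> states G"
        using that keys by blast
      have "Poly_Mapping.lookup (reference_factor ref s v) (s' v) = (if s v = s' v then 1 else 0)" for v
        using s'(2)[of v] by (rule lookup_reference_factor) (use ref[of s v] that in auto)
      then have "Poly_Mapping.lookup (pure_tensor G (reference_factor ref s)) s' =
          (\<Prod>v\<in>verts G. if s v = s' v then 1 else 0)"
        using s'(1) by (simp add: lookup_pure_tensor[OF wf])
      also have "\<dots> = (if \<forall>v\<in>verts G. s v = s' v then 1 else 0)"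
        using fin by (auto intro: prod.neutral prod_zero)
      also have "(\<forall>v\<in>verts G. s v = s' v) \<longleftrightarrow> s = s'"
        using states_None[OF ss] states_None[OF s'(1)] by (metis ext)
      finally show ?thesis .
    qed
    then have "Poly_Mapping.lookup ?d s' = (\<Sum>s\<in>?N. if s = s' then Poly_Mapping.lookup c s else 0)"
      unfolding lookup_sum lookup_smul by (intro sum.cong) auto
    also have "\<dots> = Poly_Mapping.lookup c s'"
      using fin s'(2) by (auto simp: in_keys_iff)
    finally show "Poly_Mapping.lookup (c - ?d) s' = 0"
      by (simp add: lookup_minus)
  qed
  then show ?thesis by simp
qed

text \<open>Trades spans of pure tensors for conditions on coefficients. The generators satisfy them
  factor by factor; conversely the reference expansion exhibits such a chain as a combination of
  reduced pure tensors.\<close>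

lemma sw_complex_iff:
  assumes wf: "wf_graph G"
  shows "c \<in> sw_complex G \<longleftrightarrow>
    Poly_Mapping.keys c \<subseteq> states G \<and> (\<forall>s. Poly_Mapping.lookup c s \<in> A_ring G) \<and> vertex_sums_zero G c"
proof (intro iffI conjI allI)
  assume "c \<in> sw_complex G"
  then have "Poly_Mapping.keys c \<subseteq> states G \<and> (\<forall>s. Poly_Mapping.lookup c s \<in> A_ring G) \<and> vertex_sums_zero G c"
    unfolding sw_complex_def
  proof (induction c rule: A_span.induct)
    case zero
    then show ?case by (simp add: vertex_sums_zero_0)
  next
    case (add c b p)
    then obtain x where x: "b = pure_tensor G x" "\<forall>v\<in>verts G. x v \<in> reduced_S G v"
      by blast
    have "vertex_sums_zero G b"
      unfolding x(1) using x(2) reduced_S_D(2)[OF wf] by (intro pure_tensor_reduced[OF wf]) blast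
    moreover have "Poly_Mapping.lookup b s \<in> A_ring G" for s
      unfolding x(1) lookup_pure_tensor[OF wf] using x(2) reduced_S_D(1)[OF wf] by (auto intro!: A_ring_prod)
    moreover have "Poly_Mapping.keys b \<subseteq> states G"
      unfolding x(1) by (rule keys_pure_tensor[OF wf])
    moreover have "Poly_Mapping.keys (c + smul p b) \<subseteq> Poly_Mapping.keys c \<union> Poly_Mapping.keys b"
      using keys_add[of c "smul p b"] keys_smul[of p b] by blast
    ultimately show ?case
      using add.IH add.hyps(3)
      by (simp add: lookup_add A_ring_add A_ring_mult vertex_sums_zero_add vertex_sums_zero_smul) blast
  qed
  then show "Poly_Mapping.keys c \<subseteq> states G" "\<And>s. Poly_Mapping.lookup c s \<in> A_ring G" "vertex_sums_zero G c"
    by auto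
next
  assume c: "Poly_Mapping.keys c \<subseteq> states G \<and> (\<forall>s. Poly_Mapping.lookup c s \<in> A_ring G) \<and> vertex_sums_zero G c"
  \<comment> \<open>The default \<open>None\<close> is for vertices without half-edges, which no
    state can occupy.\<close>
  define ref where "ref v = (if halves_at G v = {} then None else Some (SOME h. h \<in> halves_at G v))" for v
  have ref: "ref v \<in> Some ` halves_at G v" if s: "s \<in> Poly_Mapping.keys c" "s v \<noteq> None" for s v
  proof -
    obtain h where "s v = Some h"
      using s(2) by blast
    then have "h \<in> halves_at G v"
      using states_SomeD[of s G v h] s(1) c by auto
    then have "halves_at G v \<noteq> {}"
      by blast
    then show ?thesis
      unfolding ref_def using some_in_eq[of "halves_at G v"] by (simp del: mem_halves_at)
  qed
  have "c = (\<Sum>s\<in>{s \<in> Poly_Mapping.keys c. \<forall>v. s v = None \<or> s v \<noteq> ref v}.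
      smul (Poly_Mapping.lookup c s) (pure_tensor G (reference_factor ref s)))"
    using c ref by (intro reference_expansion[OF wf]) auto
  also have "\<dots> \<in> sw_complex G"
    unfolding sw_complex_def
  proof (intro A_span_sum A_span_smul_gen)
    fix s assume "s \<in> {s \<in> Poly_Mapping.keys c. \<forall>v. s v = None \<or> s v \<noteq> ref v}"
    then show "pure_tensor G (reference_factor ref s) \<in> {pure_tensor G x |x. \<forall>v\<in>verts G. x v \<in> reduced_S G v}"
      using c ref by (auto intro!: exI[of _ "reference_factor ref s"] reference_factor_reduced_S)
  qed (use c in auto)
  finally show "c \<in> sw_complex G" .
qed

section \<open>Chains as alternating functions\<close>

primrec inv_count :: "nat list \<Rightarrow> nat" where
  "inv_count [] = 0"
| "inv_count (v # vs) = length (filter (\<lambda>w. w < v) vs) + inv_count vs"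

text \<open>Carrying \<open>v\<close> past one different entry changes the number of inversions by
  exactly one.\<close>

lemma even_inv_count_move:
  "distinct (xs @ v # ys) \<Longrightarrow> even (inv_count (xs @ v # ys)) = even (length xs + inv_count (v # xs @ ys))"
proof (induction xs)
  case (Cons x xs)
  then have "x \<noteq> v" "distinct (xs @ v # ys)"
    by auto
  with Cons.IH show ?case
    by (cases "x < v") auto
qed simp

definition vsign :: "nat list \<Rightarrow> epoly" where
  "vsign vs = (-1) ^ inv_count vs"

lemma vsign_sq [simp]: "vsign vs * vsign vs = 1" "vsign vs * (vsign vs * p) = p"
  by (simp_all add: vsign_def mult.assoc[symmetric] power_mult_distrib[symmetric])

lemma vsign_move:
  assumes "distinct (xs @ v # ys)"
  shows "vsign (xs @ v # ys) = (-1) ^ length xs * vsign (v # xs @ ys)"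
proof -
  have "(-1 :: epoly) ^ a = (-1) ^ b" if "even a = even b" for a b
    using that by (cases "even a") auto
  then show ?thesis
    unfolding vsign_def power_add[symmetric] using even_inv_count_move[OF assms] by metis
qed

lemma vsign_nonzero [simp]: "vsign vs \<noteq> 0"
  by (simp add: vsign_def)

lemma vsign_mult_eq_0_iff [simp]: "vsign vs * p = 0 \<longleftrightarrow> p = 0"
  by (metis mult_zero_right vsign_sq(2))

text \<open>The coefficient of a chain at a state, with the half-edges of the state listed in an arbitrary
  order; reordering costs the sign of the permutation, so that no Koszul signs are left.\<close>

definition state_of :: "graph \<Rightarrow> half list \<Rightarrow> state" where
  "state_of G ks = map_of (map (\<lambda>k. (hvert G k, k)) ks)"

definition hat :: "graph \<Rightarrow> sw_chain \<Rightarrow> half list \<Rightarrow> epoly" where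
  "hat G c ks =
     (if distinct (map (hvert G) ks) \<and> fst ` set ks \<subseteq> edges G
      then vsign (map (hvert G) ks) * Poly_Mapping.lookup c (state_of G ks) else 0)"

lemma state_of_simps [simp]:
  "state_of G [] = (\<lambda>_. None)" "state_of G (k # ks) = (state_of G ks)(hvert G k \<mapsto> k)"
  by (simp_all add: state_of_def)

lemma state_of_None_iff: "state_of G ks v = None \<longleftrightarrow> v \<notin> hvert G ` set ks"
  by (induction ks) auto

lemma state_of_Some:
  "distinct (map (hvert G) ks) \<Longrightarrow> state_of G ks v = Some k \<longleftrightarrow> k \<in> set ks \<and> hvert G k = v"
  by (induction ks) (auto simp: rev_image_eqI)

lemma occupied_state_of: "occupied (state_of G ks) = hvert G ` set ks"
  using state_of_None_iff by (auto simp: occupied_def)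

lemma state_of_states: "wf_graph G \<Longrightarrow> fst ` set ks \<subseteq> edges G \<Longrightarrow> state_of G ks \<in> states G"
proof (induction ks)
  case Nil
  then show ?case by (simp add: states_def)
next
  case (Cons k ks)
  then show ?case
    unfolding state_of_simps by (intro states_upd_Some) auto
qed

lemma state_of_move:
  assumes "distinct (map (hvert G) (xs @ k # ys))"
  shows "state_of G (xs @ k # ys) = state_of G (k # xs @ ys)"
  using assms by (induction xs) (auto simp: fun_upd_twist)

text \<open>The form in which antisymmetry is used throughout: any entry may be brought to the front
  at the cost of a sign, which reduces statements about an arbitrary place to the first one.\<close>

lemma hat_move: "hat G c (xs @ k # ys) = (-1) ^ length xs * hat G c (k # xs @ ys)"
proof (cases "distinct (map (hvert G) (xs @ k # ys))")
  case True
  then have "vsign (map (hvert G) (xs @ k # ys)) = (-1) ^ length xs * vsign (map (hvert G) (k # xs @ ys))"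
    using vsign_move[of "map (hvert G) xs" "hvert G k" "map (hvert G) ys"] by simp
  moreover have "distinct (map (hvert G) (k # xs @ ys))"
    using True by auto
  ultimately show ?thesis
    unfolding hat_def state_of_move[OF True] using True by (simp del: state_of_simps add: mult.assoc insert_commute)
next
  case False
  then have "\<not> distinct (map (hvert G) (k # xs @ ys))"
    by auto
  with False show ?thesis
    unfolding hat_def by (simp only: if_False simp_thms mult_zero_right)
qed

lemma states_state_of:
  assumes wf: "wf_graph G" and s: "s \<in> states G"
  obtains ks where "distinct (map (hvert G) ks)" "fst ` set ks \<subseteq> edges G" "state_of G ks = s"
    "length ks = card (occupied s)"
proof -
  define ks where "ks = map (\<lambda>v. the (s v)) (sorted_list_of_set (occupied s))"
  have fin: "finite (occupied s)"
    using wf occupied_subset[OF s] by (auto simp: wf_graph_def intro: finite_subset)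
  have the: "s v = Some (the (s v))" if "v \<in> occupied s" for v
    using that by (auto simp: occupied_def)
  have "map (hvert G) ks = map (\<lambda>v. v) (sorted_list_of_set (occupied s))"
    unfolding ks_def map_map o_def
    using states_SomeD[OF s the] fin by (intro map_cong) auto
  then have m: "map (hvert G) ks = sorted_list_of_set (occupied s)"
    by simp
  have set: "set ks = (\<lambda>v. the (s v)) ` occupied s"
    using fin by (simp add: ks_def)
  have d: "distinct (map (hvert G) ks)"
    unfolding m by simp
  have "state_of G ks v = s v" for v
  proof (cases "v \<in> occupied s")
    case True
    then show ?thesis
      using state_of_Some[OF d, of v "the (s v)"] states_SomeD[OF s the[OF True]] the[OF True] set by auto
  next
    case False
    then have "v \<notin> set (map (hvert G) ks)"
      unfolding m using fin by simp
    then show ?thesis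
      using False state_of_None_iff[of G ks v] by (simp add: occupied_def)
  qed
  moreover have "fst ` set ks \<subseteq> edges G"
    using set states_SomeD[OF s the] by auto
  moreover have "length ks = card (occupied s)"
    by (simp add: ks_def)
  ultimately show thesis
    using that d by (metis ext)
qed

lemma hat_eqD:
  assumes wf: "wf_graph G" and keys: "Poly_Mapping.keys c \<subseteq> states G" "Poly_Mapping.keys d \<subseteq> states G"
    and eq: "\<And>ks. hat G c ks = hat G d ks"
  shows "c = d"
proof (rule poly_mapping_eqI)
  fix s show "Poly_Mapping.lookup c s = Poly_Mapping.lookup d s"
  proof (cases "s \<in> states G")
    case True
    then obtain ks where ks: "distinct (map (hvert G) ks)" "fst ` set ks \<subseteq> edges G" "state_of G ks = s"
      using states_state_of[OF wf] by metis
    have "vsign (map (hvert G) ks) * hat G c ks = vsign (map (hvert G) ks) * hat G d ks"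
      using eq by simp
    then show ?thesis
      using ks by (simp add: hat_def)
  next
    case False
    then show ?thesis
      using keys by (metis in_keys_iff subsetD)
  qed
qed

lemma hat_add: "hat G (c + d) ks = hat G c ks + hat G d ks"
  by (simp add: hat_def lookup_add distrib_left)

lemma hat_diff: "hat G (c - d) ks = hat G c ks - hat G d ks"
  by (simp add: hat_def lookup_minus right_diff_distrib)

lemma hat_0 [simp]: "hat G 0 ks = 0"
  by (simp add: hat_def)

lemma hat_nonzeroD:
  "hat G c ks \<noteq> 0 \<Longrightarrow> distinct (map (hvert G) ks) \<and> fst ` set ks \<subseteq> edges G"
  by (simp add: hat_def split: if_splits)

lemma hat_sum_at:
  assumes "wf_graph G" "v \<in> verts G"
  shows "(\<Sum>h\<in>halves_at G v. hat G c (h # ks)) =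
    (if distinct (map (hvert G) ks) \<and> fst ` set ks \<subseteq> edges G \<and> v \<notin> hvert G ` set ks
     then vsign (v # map (hvert G) ks) * (\<Sum>h\<in>halves_at G v. Poly_Mapping.lookup c ((state_of G ks)(v \<mapsto> h)))
     else 0)"
proof (cases "distinct (map (hvert G) ks) \<and> fst ` set ks \<subseteq> edges G \<and> v \<notin> hvert G ` set ks")
  case True
  then have "hat G c (h # ks) = vsign (v # map (hvert G) ks) * Poly_Mapping.lookup c ((state_of G ks)(v \<mapsto> h))"
    if "h \<in> halves_at G v" for h
    using that by (auto simp: hat_def)
  with True show ?thesis
    by (simp add: sum_distrib_left)
next
  case False
  then have "hat G c (h # ks) = 0" if "h \<in> halves_at G v" for h
    using that by (auto simp: hat_def)
  then have "(\<Sum>h\<in>halves_at G v. hat G c (h # ks)) = 0"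
    by (intro sum.neutral) blast
  with False show ?thesis
    by (simp only: if_False)
qed

text \<open>The sorting sign depends on the vertices only, so it is common to all half-edges added
  at \<open>v\<close> and factors out of the sum; inadmissible lists contribute zero.\<close>

lemma vertex_sums_zero_hat:
  assumes wf: "wf_graph G"
  shows "vertex_sums_zero G c \<longleftrightarrow> (\<forall>v\<in>verts G. \<forall>ks. (\<Sum>h\<in>halves_at G v. hat G c (h # ks)) = 0)"
proof
  assume "vertex_sums_zero G c"
  then show "\<forall>v\<in>verts G. \<forall>ks. (\<Sum>h\<in>halves_at G v. hat G c (h # ks)) = 0"
    using state_of_states[OF wf]
    by (auto simp: hat_sum_at[OF wf] state_of_None_iff simp del: mem_halves_at intro!: vertex_sums_zeroD)
next
  assume *: "\<forall>v\<in>verts G. \<forall>ks. (\<Sum>h\<in>halves_at G v. hat G c (h # ks)) = 0"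
  show "vertex_sums_zero G c"
    unfolding vertex_sums_zero_def
  proof (intro ballI impI)
    fix v s assume v: "v \<in> verts G" "s \<in> states G" "s v = None"
    then obtain ks where ks: "distinct (map (hvert G) ks)" "fst ` set ks \<subseteq> edges G" "state_of G ks = s"
      using states_state_of[OF wf] by metis
    then have "v \<notin> hvert G ` set ks"
      using v(3) state_of_None_iff by metis
    then show "(\<Sum>h\<in>halves_at G v. Poly_Mapping.lookup c (s(v \<mapsto> h))) = 0"
      using *[rule_format, OF v(1), of ks] ks by (simp add: hat_sum_at[OF wf v(1)])
  qed
qed

lemma hat_sum_zero:
  assumes wf: "wf_graph G" and c: "vertex_sums_zero G c" and v: "v \<in> verts G"
  shows "(\<Sum>h\<in>halves_at G v. hat G c (xs @ h # ys)) = 0"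
proof -
  have "(\<Sum>h\<in>halves_at G v. hat G c (xs @ h # ys)) =
      (-1) ^ length xs * (\<Sum>h\<in>halves_at G v. hat G c (h # xs @ ys))"
    unfolding hat_move[of G c xs] sum_distrib_left ..
  then show ?thesis
    using c v unfolding vertex_sums_zero_hat[OF wf] by simp
qed

lemma hat_A_ring: "(\<And>s. Poly_Mapping.lookup c s \<in> A_ring G) \<Longrightarrow> hat G c ks \<in> A_ring G"
  by (simp add: hat_def vsign_def A_ring_sign)

lemma A_ring_hat:
  assumes "wf_graph G" "Poly_Mapping.keys c \<subseteq> states G" "\<And>ks. hat G c ks \<in> A_ring G"
  shows "Poly_Mapping.lookup c s \<in> A_ring G"
proof (cases "s \<in> states G")
  case True
  then obtain ks where ks: "distinct (map (hvert G) ks)" "fst ` set ks \<subseteq> edges G" "state_of G ks = s"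
    using states_state_of[OF assms(1)] by metis
  have "vsign (map (hvert G) ks) * hat G c ks \<in> A_ring G"
    using assms(3) unfolding vsign_def by (intro A_ring_sign)
  then show ?thesis
    using ks by (simp add: hat_def)
next
  case False
  then have "Poly_Mapping.lookup c s = 0"
    using assms(2) by (metis in_keys_iff subsetD)
  then show ?thesis by simp
qed

definition homogeneous :: "nat \<Rightarrow> epoly \<Rightarrow> bool" where
  "homogeneous d p \<longleftrightarrow> (\<forall>m\<in>Poly_Mapping.keys p. mono_degree m = d)"

lemma homogeneous_vsign: "homogeneous d (vsign vs * p) \<longleftrightarrow> homogeneous d p"
  by (cases "even (inv_count vs)") (simp_all add: homogeneous_def vsign_def)

lemma homogeneous_0 [simp]: "homogeneous d 0"
  by (simp add: homogeneous_def)

lemma homogeneous_sum: "(\<And>x. x \<in> S \<Longrightarrow> homogeneous d (p x)) \<Longrightarrow> homogeneous d (\<Sum>x\<in>S. p x)"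
  using keys_sum[of p S] unfolding homogeneous_def by blast

lemma homogeneous_edge_var_mult:
  assumes "homogeneous d p"
  shows "homogeneous (Suc d) (edge_var e * p)"
  unfolding homogeneous_def
proof
  fix m assume "m \<in> Poly_Mapping.keys (edge_var e * p)"
  then obtain a b where "m = a + b" "a \<in> Poly_Mapping.keys (edge_var e)" "b \<in> Poly_Mapping.keys p"
    using keys_mult by blast
  then show "mono_degree m = Suc d"
    using assms by (auto simp: homogeneous_def edge_var_def mono_degree_add)
qed

lemma homogeneous_rename_vars: "homogeneous d p \<Longrightarrow> homogeneous d (rename_vars f p)"
  using keys_rename_vars[of f p] by (auto simp: homogeneous_def)

text \<open>The homological degree is the length of the list. The clause \<open>i \<le> n\<close>
  belongs to it because the polynomial degree is written as a truncated difference
  \<open>n - i\<close>.\<close>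

lemma sw_part_iff:
  assumes wf: "wf_graph G"
  shows "c \<in> sw_part G i n \<longleftrightarrow> c \<in> sw_complex G \<and>
    (\<forall>ks. hat G c ks \<noteq> 0 \<longrightarrow> length ks = i \<and> i \<le> n \<and> homogeneous (n - i) (hat G c ks))"
proof
  assume c: "c \<in> sw_part G i n"
  show "c \<in> sw_complex G \<and> (\<forall>ks. hat G c ks \<noteq> 0 \<longrightarrow> length ks = i \<and> i \<le> n \<and> homogeneous (n - i) (hat G c ks))"
  proof (intro conjI allI impI)
    show "c \<in> sw_complex G"
      using c by (simp add: sw_part_def)
    fix ks assume nz: "hat G c ks \<noteq> 0"
    then have ks: "distinct (map (hvert G) ks)" "state_of G ks \<in> Poly_Mapping.keys c"
      by (auto simp: hat_def in_keys_iff split: if_splits)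
    have "card (occupied (state_of G ks)) = length ks"
      unfolding occupied_state_of using ks(1) by (metis distinct_card length_map set_map)
    then have i: "length ks = i"
      using c ks by (simp add: sw_part_def)
    have "mono_degree m + i = n" if "m \<in> Poly_Mapping.keys (Poly_Mapping.lookup c (state_of G ks))" for m
      using that c ks(2) by (auto simp: sw_part_def)
    then have "homogeneous (n - i) (Poly_Mapping.lookup c (state_of G ks))" "i \<le> n"
      using ks(2) unfolding homogeneous_def by (force, metis all_not_in_conv in_keys_iff keys_eq_empty le_add2)
    then show "length ks = i" "i \<le> n" "homogeneous (n - i) (hat G c ks)"
      using i nz by (auto simp: hat_def homogeneous_vsign split: if_splits)
  qed
next
  assume c: "c \<in> sw_complex G \<and> (\<forall>ks. hat G c ks \<noteq> 0 \<longrightarrow> length ks = i \<and> i \<le> n \<and> homogeneous (n - i) (hat G c ks))"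
  then have "Poly_Mapping.keys c \<subseteq> states G"
    by (simp add: sw_complex_iff[OF wf])
  have "card (occupied s) = i \<and> (\<forall>m\<in>Poly_Mapping.keys (Poly_Mapping.lookup c s). mono_degree m + card (occupied s) = n)"
    if s: "s \<in> Poly_Mapping.keys c" for s
  proof -
    have "s \<in> states G"
      using s \<open>Poly_Mapping.keys c \<subseteq> states G\<close> by blast
    then obtain ks where ks: "distinct (map (hvert G) ks)" "fst ` set ks \<subseteq> edges G" "state_of G ks = s"
        "length ks = card (occupied s)"
      using states_state_of[OF wf] by metis
    then have h: "hat G c ks = vsign (map (hvert G) ks) * Poly_Mapping.lookup c s"
      by (simp add: hat_def)
    then have "hat G c ks \<noteq> 0"
      using s by (simp add: in_keys_iff)
    then have "length ks = i \<and> i \<le> n \<and> homogeneous (n - i) (hat G c ks)"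
      using c by blast
    then have "length ks = i" "i \<le> n" "homogeneous (n - i) (Poly_Mapping.lookup c s)"
      unfolding h by (auto simp: homogeneous_vsign)
    then show ?thesis
      using ks(4) by (auto simp: homogeneous_def)
  qed
  then show "c \<in> sw_part G i n"
    using c unfolding sw_part_def by blast
qed

section \<open>The differential on alternating functions\<close>

text \<open>The Koszul sign at a vertex is the parity of the number of smaller occupied vertices,
  and this is also the sign of putting the half-edge there in front of the list. The two cancel, so
  the differential sums over all half-edges without signs.\<close>

lemma hat_sw_diff:
  assumes wf: "wf_graph G" and keys: "Poly_Mapping.keys c \<subseteq> states G"
  shows "hat G (sw_diff c) ks = (\<Sum>k\<in>halves G. edge_var (fst k) * hat G c (k # ks))"
proof (cases "distinct (map (hvert G) ks) \<and> fst ` set ks \<subseteq> edges G")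
  case True
  define s where "s = state_of G ks"
  have s: "s \<in> states G"
    unfolding s_def using True by (intro state_of_states[OF wf]) simp
  define F where "F s' v = (-1) ^ card {w \<in> occupied s'. w < v} * edge_var (fst (the (s' v))) * Poly_Mapping.lookup c s'" for s' v
  have fins: "finite (states G)" "finite (occupied s')" if "s' \<in> states G" for s'
    using finite_states[OF wf] occupied_subset[OF that] wf by (auto simp: wf_graph_def intro: finite_subset)
  have "Poly_Mapping.lookup (sw_diff c) s =
      (\<Sum>s'\<in>Poly_Mapping.keys c. \<Sum>v\<in>occupied s'. if s'(v := None) = s then F s' v else 0)"
    by (simp add: sw_diff_def lookup_sum lookup_single when_def F_def cong: if_cong)
  also have "\<dots> = (\<Sum>s'\<in>states G. \<Sum>v\<in>occupied s'. if s'(v := None) = s then F s' v else 0)"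
    using keys finite_states[OF wf] by (intro sum.mono_neutral_left) (auto simp: F_def in_keys_iff intro!: sum.neutral)
  also have "\<dots> = (\<Sum>(s', v)\<in>Sigma (states G) occupied. if s'(v := None) = s then F s' v else 0)"
    using fins finite_states[OF wf] by (subst sum.Sigma) auto
  also have "\<dots> = (\<Sum>(s', v)\<in>{(s', v) \<in> Sigma (states G) occupied. s'(v := None) = s}. F s' v)"
  proof (rule sum.mono_neutral_cong_right)
    show "finite (Sigma (states G) occupied)"
      using fins finite_states[OF wf] by (intro finite_SigmaI)
  qed (auto split: if_splits)
  \<comment> \<open>A state and a vertex whose emptying leaves \<open>s\<close> amount to the
    half-edge that sat there, at a vertex free in \<open>s\<close>.\<close>
  also have "\<dots> = (\<Sum>k\<in>{k \<in> halves G. s (hvert G k) = None}. F (s(hvert G k \<mapsto> k)) (hvert G k))"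
  proof (rule sum.reindex_bij_witness[where j = "\<lambda>(s', v). the (s' v)" and i = "\<lambda>k. (s(hvert G k \<mapsto> k), hvert G k)"])
    fix a assume "a \<in> {(s', v) \<in> Sigma (states G) occupied. s'(v := None) = s}"
    then obtain s' v k where a: "a = (s', v)" "s' \<in> states G" "s' v = Some k" "s'(v := None) = s"
      by (auto simp: occupied_def)
    then have k: "hvert G k = v" "fst k \<in> edges G"
      using states_SomeD by blast+
    have e: "s(v \<mapsto> k) = s'"
      unfolding a(4)[symmetric] using a(3) by (simp add: fun_eq_iff)
    show "(s(hvert G (case a of (s', v) \<Rightarrow> the (s' v)) \<mapsto> case a of (s', v) \<Rightarrow> the (s' v)),
        hvert G (case a of (s', v) \<Rightarrow> the (s' v))) = a"
      using a(1,3) k e by simp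
    show "(case a of (s', v) \<Rightarrow> the (s' v)) \<in> {k \<in> halves G. s (hvert G k) = None}"
      using a k by auto
    show "F (s(hvert G (case a of (s', v) \<Rightarrow> the (s' v)) \<mapsto> case a of (s', v) \<Rightarrow> the (s' v)))
         (hvert G (case a of (s', v) \<Rightarrow> the (s' v))) = (case a of (s', v) \<Rightarrow> F s' v)"
      using a(1,3) k e by simp
  next
    fix k assume k: "k \<in> {k \<in> halves G. s (hvert G k) = None}"
    then show "(s(hvert G k \<mapsto> k), hvert G k) \<in> {(s', v) \<in> Sigma (states G) occupied. s'(v := None) = s}"
      using states_upd_Some[OF wf s, of k] by (auto simp: occupied_def)
  qed auto
  finally have lk: "Poly_Mapping.lookup (sw_diff c) s =
      (\<Sum>k\<in>{k \<in> halves G. s (hvert G k) = None}. F (s(hvert G k \<mapsto> k)) (hvert G k))" .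
  have F: "vsign (map (hvert G) ks) * F (s(hvert G k \<mapsto> k)) (hvert G k) = edge_var (fst k) * hat G c (k # ks)"
    if "fst k \<in> edges G" "s (hvert G k) = None" for k
  proof -
    have kn: "hvert G k \<notin> hvert G ` set ks"
      using that(2) unfolding s_def state_of_None_iff .
    have "{w \<in> occupied (s(hvert G k \<mapsto> k)). w < hvert G k} = set (filter (\<lambda>w. w < hvert G k) (map (hvert G) ks))"
      using occupied_state_of[of G ks] by (auto simp: s_def[symmetric] occupied_def)
    then have "card {w \<in> occupied (s(hvert G k \<mapsto> k)). w < hvert G k} =
        length (filter (\<lambda>w. w < hvert G k) (map (hvert G) ks))"
      using True distinct_card[of "filter (\<lambda>w. w < hvert G k) (map (hvert G) ks)"] by simp
    then have "vsign (hvert G k # map (hvert G) ks) =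
        (-1) ^ card {w \<in> occupied (s(hvert G k \<mapsto> k)). w < hvert G k} * vsign (map (hvert G) ks)"
      by (simp add: vsign_def power_add)
    then show ?thesis
      using True that kn by (simp add: hat_def F_def s_def algebra_simps)
  qed
  have "hat G (sw_diff c) ks = vsign (map (hvert G) ks) * Poly_Mapping.lookup (sw_diff c) s"
    using True by (simp add: hat_def s_def)
  also have "\<dots> = (\<Sum>k\<in>{k \<in> halves G. s (hvert G k) = None}. edge_var (fst k) * hat G c (k # ks))"
    unfolding lk sum_distrib_left by (intro sum.cong) (auto simp: F)
  also have "\<dots> = (\<Sum>k\<in>halves G. edge_var (fst k) * hat G c (k # ks))"
    using finite_halves[OF wf] by (intro sum.mono_neutral_left) (auto simp: hat_def s_def state_of_None_iff)
  finally show ?thesis .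
next
  case False
  then have "hat G c (k # ks) = 0" for k
    by (auto simp: hat_def)
  moreover have "hat G (sw_diff c) ks = 0"
    unfolding hat_def using False by (simp only: if_False)
  ultimately show ?thesis
    by simp
qed

lemma keys_sw_diff:
  assumes "Poly_Mapping.keys c \<subseteq> states G"
  shows "Poly_Mapping.keys (sw_diff c) \<subseteq> states G"
  unfolding sw_diff_def
proof (intro order_trans[OF keys_sum] UN_least)
  fix s v assume "s \<in> Poly_Mapping.keys c"
  then have "s(v := None) \<in> states G"
    using assms states_upd_None by blast
  then show "Poly_Mapping.keys (Poly_Mapping.single (s(v := None))
     ((-1) ^ card {w \<in> occupied s. w < v} * edge_var (fst (the (s v))) * Poly_Mapping.lookup c s)) \<subseteq> states G"
    by simp
qed

lemma sw_diff_complex: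
  assumes wf: "wf_graph G" and c: "c \<in> sw_complex G"
  shows "sw_diff c \<in> sw_complex G"
proof -
  note c' = c[unfolded sw_complex_iff[OF wf]]
  then have keys: "Poly_Mapping.keys c \<subseteq> states G" and red: "vertex_sums_zero G c"
    by auto
  note hd = hat_sw_diff[OF wf keys]
  have "vertex_sums_zero G (sw_diff c)"
    unfolding vertex_sums_zero_hat[OF wf]
  proof (intro ballI allI)
    fix v ks assume v: "v \<in> verts G"
    have "(\<Sum>h\<in>halves_at G v. hat G (sw_diff c) (h # ks)) =
        (\<Sum>k\<in>halves G. edge_var (fst k) * (\<Sum>h\<in>halves_at G v. hat G c ([k] @ h # ks)))"
      unfolding hd sum_distrib_left by (subst sum.swap) simp
    then show "(\<Sum>h\<in>halves_at G v. hat G (sw_diff c) (h # ks)) = 0"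
      unfolding hat_sum_zero[OF wf red v] by simp
  qed
  moreover have "Poly_Mapping.lookup (sw_diff c) s \<in> A_ring G" for s
  proof (rule A_ring_hat[OF wf keys_sw_diff[OF keys]])
    fix ks show "hat G (sw_diff c) ks \<in> A_ring G"
      unfolding hd using c' by (intro A_ring_sum A_ring_mult A_ring_edge_var hat_A_ring) auto
  qed
  ultimately show ?thesis
    using keys_sw_diff[OF keys] by (simp add: sw_complex_iff[OF wf])
qed

lemma sw_diff_part:
  assumes wf: "wf_graph G" and c: "c \<in> sw_part G (i + 1) n"
  shows "sw_diff c \<in> sw_part G i n"
  unfolding sw_part_iff[OF wf]
proof (intro conjI allI impI)
  note c' = c[unfolded sw_part_iff[OF wf]]
  then show "sw_diff c \<in> sw_complex G"
    using sw_diff_complex[OF wf] by blast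
  have keys: "Poly_Mapping.keys c \<subseteq> states G"
    using c' sw_complex_iff[OF wf] by blast
  fix ks assume "hat G (sw_diff c) ks \<noteq> 0"
  then obtain k where "hat G c (k # ks) \<noteq> 0"
    unfolding hat_sw_diff[OF wf keys] by (metis (no_types, lifting) mult_zero_right sum.neutral)
  then have i: "length ks = i" "i + 1 \<le> n"
    using c' by fastforce+
  then show "length ks = i" "i \<le> n"
    by auto
  have "homogeneous (n - (i + 1)) (hat G c (k # ks))" for k
    using c' by (cases "hat G c (k # ks) = 0") auto
  then have "homogeneous (Suc (n - (i + 1))) (edge_var (fst k) * hat G c (k # ks))" for k
    by (rule homogeneous_edge_var_mult)
  then show "homogeneous (n - i) (hat G (sw_diff c) ks)"
    unfolding hat_sw_diff[OF wf keys] using i by (intro homogeneous_sum) (metis Suc_diff_Suc Suc_eq_plus1 Suc_le_lessD)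
qed

text \<open>Exchanging the two new half-edges changes the sign of the double sum, which is therefore
  its own negative; integer coefficients have no 2-torsion.\<close>

lemma sw_diff_sw_diff:
  assumes wf: "wf_graph G" and c: "c \<in> sw_complex G"
  shows "sw_diff (sw_diff c) = 0"
proof -
  have keys: "Poly_Mapping.keys c \<subseteq> states G"
    using c sw_complex_iff[OF wf] by blast
  note keys' = keys_sw_diff[OF keys]
  show ?thesis
  proof (rule hat_eqD[OF wf keys_sw_diff[OF keys']])
    fix ks
    let ?f = "\<lambda>k l. edge_var (fst k) * (edge_var (fst l) * hat G c (l # k # ks))"
    define A where "A = (\<Sum>k\<in>halves G. \<Sum>l\<in>halves G. ?f k l)"
    have f: "?f k l = - ?f l k" for k l
      using hat_move[of G c "[l]" k ks] by simp
    have "A = (\<Sum>k\<in>halves G. \<Sum>l\<in>halves G. - ?f l k)"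
      unfolding A_def by (intro sum.cong refl f)
    also have "\<dots> = - (\<Sum>k\<in>halves G. \<Sum>l\<in>halves G. ?f l k)"
      unfolding sum_negf ..
    also have "\<dots> = - A"
      unfolding A_def by (subst sum.swap) (rule refl)
    finally have "A = - A" .
    have "A = 0"
    proof (rule poly_mapping_eqI)
      fix m
      have "Poly_Mapping.lookup A m = - Poly_Mapping.lookup A m"
        using arg_cong[OF \<open>A = - A\<close>, of "\<lambda>p. Poly_Mapping.lookup p m"] unfolding lookup_uminus .
      then show "Poly_Mapping.lookup A m = Poly_Mapping.lookup 0 m"
        by simp
    qed
    moreover have "hat G (sw_diff (sw_diff c)) ks = A"
      unfolding hat_sw_diff[OF wf keys'] hat_sw_diff[OF wf keys] sum_distrib_left A_def ..
    ultimately have "hat G (sw_diff (sw_diff c)) ks = 0"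
      by simp
    then show "hat G (sw_diff (sw_diff c)) ks = hat G 0 ks"
      by simp
  qed simp
qed

lemma sw_diff_add:
  assumes "wf_graph G" "Poly_Mapping.keys c \<subseteq> states G" "Poly_Mapping.keys d \<subseteq> states G"
  shows "sw_diff (c + d) = sw_diff c + sw_diff d"
proof -
  have k: "Poly_Mapping.keys (c + d) \<subseteq> states G" "Poly_Mapping.keys (sw_diff c + sw_diff d) \<subseteq> states G"
    using assms keys_add[of c d] keys_add[of "sw_diff c" "sw_diff d"] keys_sw_diff[of c G] keys_sw_diff[of d G] by blast+
  show ?thesis
    using assms k
    by (intro hat_eqD[of G]) (auto simp: hat_sw_diff hat_add distrib_left sum.distrib dest: subsetD[OF keys_sw_diff[OF k(1)]])
qed

section \<open>Pullbacks\<close>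

lemma rename_mono_sum: "rename_mono f (\<Sum>x\<in>S. m x) = (\<Sum>x\<in>S. rename_mono f (m x))"
  by (induction S rule: infinite_finite_induct) (simp_all add: rename_mono_add, simp_all add: rename_mono_def)

lemma rename_mono_comp: "rename_mono f (rename_mono g m) = rename_mono (f \<circ> g) m"
  by (simp add: rename_mono_def[of g] rename_mono_sum) (simp add: rename_mono_def[of "f \<circ> g"])

lemma rename_vars_comp: "rename_vars f (rename_vars g p) = rename_vars (f \<circ> g) p"
proof -
  have "p \<in> UNIV \<Longrightarrow> rename_vars f (rename_vars g p) = rename_vars (f \<circ> g) p"
    by (rule frag_induction[of p UNIV])
      (simp_all add: rename_vars_frag_extend rename_mono_comp frag_extend_diff o_def)
  then show ?thesis by simp
qed

lemma rename_vars_cong: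
  assumes "p \<in> A_ring G" "\<And>e. e \<in> edges G \<Longrightarrow> f e = g e"
  shows "rename_vars f p = rename_vars g p"
  unfolding rename_vars_frag_extend
proof (rule frag_extend_eq)
  fix m assume "m \<in> Poly_Mapping.keys p"
  then have "Poly_Mapping.keys m \<subseteq> edges G"
    using assms(1) by (auto simp: A_ring_def)
  then show "frag_of (rename_mono f m) = frag_of (rename_mono g m)"
    unfolding rename_mono_def using assms(2) by (auto intro!: arg_cong[of _ _ frag_of] sum.cong)
qed

lemma A_ring_rename:
  assumes "p \<in> A_ring G'" "\<And>e. e \<in> edges G' \<Longrightarrow> f e \<in> edges G"
  shows "rename_vars f p \<in> A_ring G"
  unfolding A_ring_def
proof (intro CollectI ballI)
  fix m assume "m \<in> Poly_Mapping.keys (rename_vars f p)"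
  then obtain m' where "m' \<in> Poly_Mapping.keys p" "m = rename_mono f m'"
    using keys_rename_vars by blast
  moreover from this have "Poly_Mapping.keys m' \<subseteq> edges G'"
    using assms(1) by (auto simp: A_ring_def)
  ultimately show "Poly_Mapping.keys m \<subseteq> edges G"
    using assms(2) keys_rename_mono[of f m'] by blast
qed

text \<open>On half-edges that are not contracted the chain \<open>y\<close> is the relabelled chain \<open>c\<close>; on the
  contracted forests it is antisymmetric, hence a flow, and a flow on a forest is determined by its
  boundary values.\<close>

definition pulls_back :: "graph \<Rightarrow> graph \<Rightarrow> cmap \<Rightarrow> sw_chain \<Rightarrow> sw_chain \<Rightarrow> bool" where
  "pulls_back G G' \<phi> c y \<longleftrightarrow> y \<in> sw_complex G \<and>
     (\<forall>ks. fst ` set ks \<subseteq> edges G - contracted_edges G \<phi> \<longrightarrow>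
        hat G y ks = rename_vars (pre_edge \<phi>) (hat G' c (map (\<lambda>h. the (hmap \<phi> h)) ks))) \<and>
     (\<forall>h ks. fst h \<in> contracted_edges G \<phi> \<longrightarrow> hat G y (h # ks) + hat G y (opp h # ks) = 0)"

section \<open>Rigidity of pullbacks along one contraction\<close>

context contracting
begin

text \<open>Induction on the number of contracted entries. With the other places fixed,
  \<open>H\<close> as a function of the half-edge in a contracted place is a flow; off the forest it
  vanishes by induction, hence on the forest too. Uniqueness of pullbacks, control of their
  monomials and antisymmetry for composites all come from here.\<close>

lemma flow_vanish:
  fixes H :: "half list \<Rightarrow> epoly"
  assumes red: "\<And>xs ys v. v \<in> verts G \<Longrightarrow> (\<Sum>h\<in>halves_at G v. H (xs @ h # ys)) = 0"
    and anti: "\<And>h xs ys. fst h \<in> C \<Longrightarrow> H (xs @ h # ys) + H (xs @ opp h # ys) = 0"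
    and supp: "\<And>ks. \<not> fst ` set ks \<subseteq> edges G \<Longrightarrow> H ks = 0"
    and zero: "\<And>ks. fst ` set ks \<subseteq> edges G - C \<Longrightarrow> H ks = 0"
  shows "H ks = 0"
proof (induction "length (filter (\<lambda>k. fst k \<in> C) ks)" arbitrary: ks rule: less_induct)
  case less
  show ?case
  proof (cases "fst ` set ks \<subseteq> edges G - C \<or> \<not> fst ` set ks \<subseteq> edges G")
    case True
    then show ?thesis using supp zero by blast
  next
    case False
    then obtain k where "k \<in> set ks" "fst k \<in> C"
      by blast
    then obtain xs ys where ks: "ks = xs @ k # ys"
      by (meson split_list)
    have "H (xs @ h # ys) = 0" if "fst h \<notin> C" for h
      using that \<open>fst k \<in> C\<close> by (intro less) (simp add: ks)
    then show ?thesis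
      unfolding ks using contracted_flow_zero[of "\<lambda>h. H (xs @ h # ys)" k] anti red \<open>fst k \<in> C\<close> by simp
  qed
qed

lemma pulls_back_iff:
  "pulls_back G G' \<phi> c y \<longleftrightarrow> y \<in> sw_complex G \<and>
     (\<forall>ks. fst ` set ks \<subseteq> edges G - C \<longrightarrow> hat G y ks = rename_vars (pre_edge \<phi>) (hat G' c (map hm ks))) \<and>
     (\<forall>h ks. fst h \<in> C \<longrightarrow> hat G y (h # ks) + hat G y (opp h # ks) = 0)"
  unfolding pulls_back_def hm_def ..

lemma pulls_backD:
  assumes "pulls_back G G' \<phi> c y"
  shows "y \<in> sw_complex G"
    "fst ` set ks \<subseteq> edges G - C \<Longrightarrow> hat G y ks = rename_vars (pre_edge \<phi>) (hat G' c (map hm ks))"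
    "fst h \<in> C \<Longrightarrow> hat G y (xs @ h # ys) + hat G y (xs @ opp h # ys) = 0"
    "v \<in> verts G \<Longrightarrow> (\<Sum>h\<in>halves_at G v. hat G y (xs @ h # ys)) = 0"
    "Poly_Mapping.keys y \<subseteq> states G"
proof -
  show y: "y \<in> sw_complex G"
    and "fst ` set ks \<subseteq> edges G - C \<Longrightarrow> hat G y ks = rename_vars (pre_edge \<phi>) (hat G' c (map hm ks))"
    using assms unfolding pulls_back_iff by blast+
  show "v \<in> verts G \<Longrightarrow> (\<Sum>h\<in>halves_at G v. hat G y (xs @ h # ys)) = 0"
      "Poly_Mapping.keys y \<subseteq> states G"
    using y hat_sum_zero[OF wf] unfolding sw_complex_iff[OF wf] by blast+
  show "hat G y (xs @ h # ys) + hat G y (xs @ opp h # ys) = 0" if "fst h \<in> C"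
  proof -
    have "hat G y (h # xs @ ys) + hat G y (opp h # xs @ ys) = 0"
      using assms that unfolding pulls_back_iff by blast
    then show ?thesis
      unfolding hat_move[of G y xs] distrib_left[symmetric] by simp
  qed
qed

text \<open>The difference of two candidates meets the hypotheses of \<open>flow_vanish\<close>.
  Consequently all factorizations of a contraction give the same map on the reduced complex,
  whichever one \<open>sw_pullback\<close> picks.\<close>

lemma pulls_back_unique:
  assumes "pulls_back G G' \<phi> c y" "pulls_back G G' \<phi> c y'"
  shows "y = y'"
proof (rule hat_eqD[OF wf pulls_backD(5)[OF assms(1)] pulls_backD(5)[OF assms(2)]])
  fix ks
  have "hat G y ks - hat G y' ks = 0"
  proof (rule flow_vanish[of "\<lambda>ks. hat G y ks - hat G y' ks"])
    show "(\<Sum>h\<in>halves_at G v. hat G y (xs @ h # ys) - hat G y' (xs @ h # ys)) = 0" if "v \<in> verts G" for xs ys v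
      unfolding sum_subtractf using pulls_backD(4)[OF assms(1) that] pulls_backD(4)[OF assms(2) that] by simp
    show "hat G y (xs @ h # ys) - hat G y' (xs @ h # ys) + (hat G y (xs @ opp h # ys) - hat G y' (xs @ opp h # ys)) = 0"
      if "fst h \<in> C" for h xs ys
      unfolding add_diff_add[symmetric]
      using pulls_backD(3)[OF assms(1) that, of xs ys] pulls_backD(3)[OF assms(2) that, of xs ys] by simp
    show "hat G y ks - hat G y' ks = 0" if "\<not> fst ` set ks \<subseteq> edges G" for ks
      using that by (simp add: hat_def)
    show "hat G y ks - hat G y' ks = 0" if "fst ` set ks \<subseteq> edges G - C" for ks
      using pulls_backD(2)[OF assms(1) that] pulls_backD(2)[OF assms(2) that] by simp
  qed
  then show "hat G y ks = hat G y' ks"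
    by simp
qed

lemma pulls_back_add:
  assumes "pulls_back G G' \<phi> c y" "pulls_back G G' \<phi> c' y'"
  shows "pulls_back G G' \<phi> (c + c') (y + y')"
  unfolding pulls_back_iff
proof (intro conjI allI impI)
  show "y + y' \<in> sw_complex G"
    using pulls_backD(1)[OF assms(1)] pulls_backD(1)[OF assms(2)] unfolding sw_complex_def by (rule A_span_add)
  show "hat G (y + y') ks = rename_vars (pre_edge \<phi>) (hat G' (c + c') (map hm ks))"
    if "fst ` set ks \<subseteq> edges G - C" for ks
    unfolding hat_add rename_vars_add using pulls_backD(2)[OF assms(1) that] pulls_backD(2)[OF assms(2) that] by simp
  show "hat G (y + y') (h # ks) + hat G (y + y') (opp h # ks) = 0" if "fst h \<in> C" for h ks
    using pulls_backD(3)[OF assms(1) that, of "[]" ks] pulls_backD(3)[OF assms(2) that, of "[]" ks]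
    unfolding hat_add by (simp add: algebra_simps)
qed

lemma sum_hm:
  "(\<Sum>k\<in>{k \<in> halves G. fst k \<notin> C \<and> P (hm k)}. F (hm k)) = (\<Sum>h\<in>{h \<in> halves G'. P h}. F h)"
  by (rule sum.reindex_bij_witness[where i = "pre_half \<phi>" and j = hm])
    (auto simp: pre_half pre_half_hm hm_simps)

lemma sum_C:
  assumes "\<And>h. fst h \<in> C \<Longrightarrow> q h + q (opp h) = (0 :: 'a :: comm_monoid_add)"
  shows "(\<Sum>k\<in>{k \<in> halves G. fst k \<in> C}. q k) = 0"
proof -
  have "{k \<in> halves G. fst k \<in> C} = C \<times> UNIV"
    using C_subset by auto
  then have "(\<Sum>k\<in>{k \<in> halves G. fst k \<in> C}. q k) = (\<Sum>e\<in>C. \<Sum>b\<in>UNIV. q (e, b))"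
    by (simp add: sum.cartesian_product)
  also have "\<dots> = 0"
    using assms[of "(_, True)"] by (intro sum.neutral) (simp add: UNIV_bool add.commute)
  finally show ?thesis .
qed

text \<open>In the differential of \<open>y\<close> the two halves of a contracted edge carry the
  same variable and opposite coefficients, so they cancel; the remaining half-edges are those of
  \<open>G'\<close> relabelled.\<close>

lemma pulls_back_sw_diff:
  assumes c: "c \<in> sw_complex G'" and "pulls_back G G' \<phi> c y"
  shows "pulls_back G G' \<phi> (sw_diff c) (sw_diff y)"
  unfolding pulls_back_iff
proof (intro conjI allI impI)
  note D = pulls_backD[OF assms(2)]
  have keys: "Poly_Mapping.keys c \<subseteq> states G'"
    using c sw_complex_iff[OF wf'] by blast
  show "sw_diff y \<in> sw_complex G"
    by (rule sw_diff_complex[OF wf D(1)])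
  show "hat G (sw_diff y) ks = rename_vars (pre_edge \<phi>) (hat G' (sw_diff c) (map hm ks))"
    if ks: "fst ` set ks \<subseteq> edges G - C" for ks
  proof -
    let ?q = "\<lambda>k. edge_var (fst k) * hat G y (k # ks)"
    let ?H = "{k \<in> halves G. fst k \<notin> C}"
    have "hat G (sw_diff y) ks = sum ?q ({k \<in> halves G. fst k \<in> C} \<union> ?H)"
      unfolding hat_sw_diff[OF wf D(5)] by (rule sum.cong) auto
    also have "\<dots> = sum ?q {k \<in> halves G. fst k \<in> C} + sum ?q ?H"
      by (intro sum.union_disjoint finite_subset[OF _ finite_halves[OF wf]]) auto
    also have "sum ?q {k \<in> halves G. fst k \<in> C} = 0"
      using D(3)[of _ "[]" ks] by (intro sum_C) (simp add: distrib_left[symmetric])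
    also have "sum ?q ?H =
        (\<Sum>k\<in>?H. rename_vars (pre_edge \<phi>) (edge_var (fst (hm k)) * hat G' c (hm k # map hm ks)))"
    proof (rule sum.cong)
      fix k assume k: "k \<in> ?H"
      then have "fst ` set (k # ks) \<subseteq> edges G - C"
        using ks by simp
      from D(2)[OF this] show "?q k = rename_vars (pre_edge \<phi>) (edge_var (fst (hm k)) * hat G' c (hm k # map hm ks))"
        using k by (simp add: rename_vars_edge_var_mult pre_edge_hm)
    qed simp
    also have "\<dots> = (\<Sum>h\<in>halves G'. rename_vars (pre_edge \<phi>) (edge_var (fst h) * hat G' c (h # map hm ks)))"
      using sum_hm[where P = "\<lambda>_. True" and F = "\<lambda>h. rename_vars (pre_edge \<phi>) (edge_var (fst h) * hat G' c (h # map hm ks))"]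
      by (simp del: mem_halves)
    finally show ?thesis
      unfolding hat_sw_diff[OF wf' keys] rename_vars_sum by simp
  qed
  show "hat G (sw_diff y) (h # ks) + hat G (sw_diff y) (opp h # ks) = 0" if h: "fst h \<in> C" for h ks
  proof -
    have "hat G y (k # h # ks) + hat G y (k # opp h # ks) = 0" for k
      using D(3)[OF h, of "[k]" ks] by simp
    then show ?thesis
      unfolding hat_sw_diff[OF wf D(5)] sum.distrib[symmetric] distrib_left[symmetric] by simp
  qed
qed

text \<open>The projection \<open>L\<close> to the monomials violating \<open>Q\<close> is additive,
  so it respects vertex sums and antisymmetry; it kills the values at lists without contracted
  half-edges by hypothesis, and then all values by \<open>flow_vanish\<close>. It serves with
  \<open>Q\<close> the bidegree and with \<open>Q\<close> the absence of contracted edges.\<close>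

lemma pulls_back_monomials:
  assumes "pulls_back G G' \<phi> c y"
    and Q: "\<And>ks m. fst ` set ks \<subseteq> edges G - C \<Longrightarrow>
      m \<in> Poly_Mapping.keys (rename_vars (pre_edge \<phi>) (hat G' c (map hm ks))) \<Longrightarrow> Q (length ks) m"
    and m: "m \<in> Poly_Mapping.keys (hat G y ks)"
  shows "Q (length ks) m"
proof (rule ccontr)
  note D = pulls_backD[OF assms(1)]
  define L where "L l = frag_extend (\<lambda>m. if Q l m then 0 else frag_of m)" for l
  have L_add: "L l (p + q) = L l p + L l q" and L_0 [simp]: "L l 0 = 0" for l p q
    by (simp_all add: L_def frag_extend_add)
  have L_sum: "L l (\<Sum>x\<in>S. p x) = (\<Sum>x\<in>S. L l (p x))" for l S and p :: "half \<Rightarrow> epoly"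
    by (induction S rule: infinite_finite_induct) (simp_all add: L_add)
  have "L (length ks) (hat G y ks) = 0"
  proof (rule flow_vanish[of "\<lambda>ks. L (length ks) (hat G y ks)"])
    show "(\<Sum>h\<in>halves_at G v. L (length (xs @ h # ys)) (hat G y (xs @ h # ys))) = 0" if "v \<in> verts G" for xs ys v
      using D(4)[OF that, of xs ys] L_sum[of "length xs + Suc (length ys)" "\<lambda>h. hat G y (xs @ h # ys)" "halves_at G v"]
      by simp
    show "L (length (xs @ h # ys)) (hat G y (xs @ h # ys)) + L (length (xs @ opp h # ys)) (hat G y (xs @ opp h # ys)) = 0"
      if "fst h \<in> C" for h xs ys
      using D(3)[OF that, of xs ys] by (simp add: L_add[symmetric])
    show "L (length ks) (hat G y ks) = 0" if "\<not> fst ` set ks \<subseteq> edges G" for ks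
    proof -
      have "hat G y ks = 0"
        using that hat_nonzeroD by blast
      then show ?thesis by simp
    qed
    show "L (length ks) (hat G y ks) = 0" if "fst ` set ks \<subseteq> edges G - C" for ks
      unfolding L_def by (rule frag_extend_eq_0) (use D(2)[OF that] Q[OF that] in simp)
  qed
  moreover assume "\<not> Q (length ks) m"
  then have "Poly_Mapping.lookup (L (length ks) (hat G y ks)) m =
      (\<Sum>x\<in>Poly_Mapping.keys (hat G y ks). if x = m then Poly_Mapping.lookup (hat G y ks) x else 0)"
    unfolding L_def frag_extend_def lookup_sum by (intro sum.cong) (auto simp: lookup_single)
  ultimately show False
    using m by (simp add: in_keys_iff)
qed

lemma pulls_back_part:
  assumes c: "c \<in> sw_part G' i n" and y: "pulls_back G G' \<phi> c y"
  shows "y \<in> sw_part G i n"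
proof -
  have "length ks = i \<and> i \<le> n \<and> mono_degree m = n - i" if "m \<in> Poly_Mapping.keys (hat G y ks)" for ks m
    using y _ that
  proof (rule pulls_back_monomials[where Q = "\<lambda>l m. l = i \<and> i \<le> n \<and> mono_degree m = n - i"])
    fix ks m assume m: "m \<in> Poly_Mapping.keys (rename_vars (pre_edge \<phi>) (hat G' c (map hm ks)))"
    then have "hat G' c (map hm ks) \<noteq> 0"
      by auto
    then have "length (map hm ks) = i \<and> i \<le> n \<and> homogeneous (n - i) (hat G' c (map hm ks))"
      using c[unfolded sw_part_iff[OF wf']] by blast
    moreover from this have "homogeneous (n - i) (rename_vars (pre_edge \<phi>) (hat G' c (map hm ks)))"
      using homogeneous_rename_vars by blast
    ultimately show "length ks = i \<and> i \<le> n \<and> mono_degree m = n - i"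
      using m unfolding homogeneous_def by simp
  qed
  then have "length ks = i \<and> i \<le> n \<and> homogeneous (n - i) (hat G y ks)" if "hat G y ks \<noteq> 0" for ks
    using that unfolding homogeneous_def by (metis all_not_in_conv keys_eq_empty)
  then show ?thesis
    unfolding sw_part_iff[OF wf] using pulls_backD(1)[OF y] by blast
qed

end

section \<open>Pullbacks along composites\<close>

context composed
begin

sublocale comp: contracting G G'' \<kappa>
  by (simp add: contracting_iff contraction_comp)

lemma hm_comp: "fst h \<in> edges G \<Longrightarrow> fst h \<notin> A.C \<Longrightarrow> comp.hm h = B.hm (A.hm h)"
  by (simp add: comp.hm_def B.hm_def hmap_comp)

lemma pre_half_comp:
  assumes "fst h \<in> edges G''"
  shows "pre_half \<kappa> h = pre_half \<phi> (pre_half \<psi> h)"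
proof -
  let ?k = "pre_half \<phi> (pre_half \<psi> h)"
  note k = B.pre_half[OF assms] A.pre_half[of "pre_half \<psi> h"]
  then have "comp.hm ?k = h" "fst ?k \<in> edges G" "fst ?k \<notin> comp.C"
    using hm_comp[of ?k] contracted_comp_iff[of ?k] by auto
  then show ?thesis
    using comp.pre_half_hm by metis
qed

text \<open>The point is antisymmetry across an edge contracted by \<open>\<psi>\<close> but not by
  \<open>\<phi>\<close>: the sum over its two halves in the first place, as a function of the
  remaining list, satisfies the hypotheses of \<open>flow_vanish\<close> for \<open>\<phi>\<close>,
  and at lists without contracted half-edges it is the relation for \<open>x\<close>,
  relabelled.\<close>

lemma pulls_back_comp:
  assumes c: "c \<in> sw_complex G''" and x: "pulls_back G' G'' \<psi> c x" and y: "pulls_back G G' \<phi> x y"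
  shows "pulls_back G G'' \<kappa> c y"
  unfolding comp.pulls_back_iff
proof (intro conjI allI impI)
  note X = B.pulls_backD[OF x] and Y = A.pulls_backD[OF y]
  show "y \<in> sw_complex G"
    by (rule Y(1))
  have out: "fst h \<notin> A.C" "fst (A.hm h) \<in> edges G' - B.C" if "fst h \<in> edges G - comp.C" for h
    using that contracted_comp_iff[of h] A.hm_simps[of h] by auto
  show "hat G y ks = rename_vars (pre_edge \<kappa>) (hat G'' c (map comp.hm ks))"
    if ks: "fst ` set ks \<subseteq> edges G - comp.C" for ks
  proof -
    have "fst ` set ks \<subseteq> edges G - A.C" "fst ` set (map A.hm ks) \<subseteq> edges G' - B.C"
      using ks out by auto
    then have "hat G y ks = rename_vars (pre_edge \<phi>) (rename_vars (pre_edge \<psi>) (hat G'' c (map B.hm (map A.hm ks))))"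
      using X(2) Y(2) by simp
    also have "map B.hm (map A.hm ks) = map comp.hm ks"
      using ks out hm_comp by (auto simp: image_subset_iff)
    also have "rename_vars (pre_edge \<phi>) (rename_vars (pre_edge \<psi>) (hat G'' c (map comp.hm ks))) =
        rename_vars (pre_edge \<kappa>) (hat G'' c (map comp.hm ks))"
      unfolding rename_vars_comp
    proof (rule rename_vars_cong)
      show "hat G'' c (map comp.hm ks) \<in> A_ring G''"
        using c sw_complex_iff[OF B.wf'] by (intro hat_A_ring) blast
      show "(pre_edge \<phi> \<circ> pre_edge \<psi>) e = pre_edge \<kappa> e" if "e \<in> edges G''" for e
        using that pre_half_comp[of "(e, True)"] A.pre_edge_fst[of "pre_half \<psi> (e, True)"]
          B.pre_half[of "(e, True)"] B.pre_edge_fst[of "(e, True)"] comp.pre_edge_fst[of "(e, True)"] by simp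
    qed
    finally show ?thesis .
  qed
  show "hat G y (h # ks) + hat G y (opp h # ks) = 0" if h: "fst h \<in> comp.C" for h ks
  proof (cases "fst h \<in> A.C")
    case True
    then show ?thesis
      using Y(3)[of h "[]" ks] by simp
  next
    case False
    then have h': "fst h \<in> edges G" "fst (A.hm h) \<in> B.C" "A.hm (opp h) = opp (A.hm h)"
      using h comp.C_subset contracted_comp_iff[of h] A.hm_simps(1)[of h] by auto
    show ?thesis
    proof (rule A.flow_vanish[of "\<lambda>ks. hat G y (h # ks) + hat G y (opp h # ks)"])
      fix v and xs ys :: "half list" assume v: "v \<in> verts G"
      show "(\<Sum>k\<in>halves_at G v. hat G y (h # xs @ k # ys) + hat G y (opp h # xs @ k # ys)) = 0"
        using Y(4)[OF v, of "h # xs" ys] Y(4)[OF v, of "opp h # xs" ys] by (simp add: sum.distrib)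
    next
      fix k :: half and xs ys assume k: "fst k \<in> A.C"
      have "hat G y (h # xs @ k # ys) + hat G y (h # xs @ opp k # ys) = 0"
          "hat G y (opp h # xs @ k # ys) + hat G y (opp h # xs @ opp k # ys) = 0"
        using Y(3)[OF k, of "h # xs" ys] Y(3)[OF k, of "opp h # xs" ys] by simp_all
      then show "hat G y (h # xs @ k # ys) + hat G y (opp h # xs @ k # ys) +
         (hat G y (h # xs @ opp k # ys) + hat G y (opp h # xs @ opp k # ys)) = 0"
        by (simp add: add.assoc add.left_commute) (metis add.left_commute add_0_right)
    next
      fix ks :: "half list" assume ks: "\<not> fst ` set ks \<subseteq> edges G"
      have "hat G y (k # ks) = 0" for k
        using ks hat_nonzeroD[of G y "k # ks"] by auto
      then show "hat G y (h # ks) + hat G y (opp h # ks) = 0"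
        by simp
    next
      fix ks :: "half list" assume ks: "fst ` set ks \<subseteq> edges G - A.C"
      then have "fst ` set (h # ks) \<subseteq> edges G - A.C" "fst ` set (opp h # ks) \<subseteq> edges G - A.C"
        using False h' by auto
      then have "hat G y (h # ks) + hat G y (opp h # ks) = rename_vars (pre_edge \<phi>)
          (hat G' x (A.hm h # map A.hm ks) + hat G' x (opp (A.hm h) # map A.hm ks))"
        using Y(2) h' by (simp add: rename_vars_add)
      then show "hat G y (h # ks) + hat G y (opp h # ks) = 0"
        using X(3)[OF h'(2), of "[]" "map A.hm ks"] by simp
    qed
  qed
qed

end

section \<open>The explicit formula for contracting at most one edge\<close>

text \<open>A pair of entries is an inversion of one list but not of the other exactly when
  \<open>f\<close> reverses its order; modulo 2 the pairs inverted in both lists drop out.\<close>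

lemma even_crossings:
  assumes "distinct vs" "inj_on f (set vs)"
  shows "even (card {(u, v). u \<in> set vs \<and> v \<in> set vs \<and> u < v \<and> (f v :: nat) < f u}) =
    even (inv_count vs + inv_count (map f vs))"
  using assms
proof (induction vs)
  case (Cons x vs)
  let ?S = "\<lambda>vs. {(u, v). u \<in> set vs \<and> v \<in> set vs \<and> u < v \<and> f v < f u}"
  let ?A = "{w \<in> set vs. w < x}" and ?B = "{w \<in> set vs. f w < f x}"
  let ?P = "{w \<in> set vs. w < x \<and> f x < f w}" and ?Q = "{w \<in> set vs. x < w \<and> f w < f x}"
  have x: "x \<notin> set vs" "distinct vs" "inj_on f (set vs)" "\<And>w. w \<in> set vs \<Longrightarrow> f w \<noteq> f x"
    using Cons.prems by (auto simp: image_iff)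
  have S: "?S (x # vs) = ?S vs \<union> ((\<lambda>w. (w, x)) ` ?P \<union> (\<lambda>w. (x, w)) ` ?Q)"
    by auto
  have fin: "finite (?S vs)"
    by (rule finite_subset[of _ "set vs \<times> set vs"]) auto
  have "card (?S (x # vs)) = card (?S vs) + card ((\<lambda>w. (w, x)) ` ?P \<union> (\<lambda>w. (x, w)) ` ?Q)"
    unfolding S using x(1) fin by (intro card_Un_disjoint) auto
  also have "card ((\<lambda>w. (w, x)) ` ?P \<union> (\<lambda>w. (x, w)) ` ?Q) = card ?P + card ?Q"
    by (subst card_Un_disjoint) (auto simp: card_image inj_on_def)
  finally have 1: "card (?S (x # vs)) = card (?S vs) + (card ?P + card ?Q)" .
  have "?A = ?P \<union> (?A \<inter> ?B)" "?B = ?Q \<union> (?A \<inter> ?B)"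
    using x by (auto simp: not_less_iff_gr_or_eq)
  moreover have "card (?P \<union> (?A \<inter> ?B)) = card ?P + card (?A \<inter> ?B)"
      "card (?Q \<union> (?A \<inter> ?B)) = card ?Q + card (?A \<inter> ?B)"
    by (intro card_Un_disjoint; auto)+
  ultimately have "card ?A = card ?P + card (?A \<inter> ?B)" "card ?B = card ?Q + card (?A \<inter> ?B)"
    by argo+
  then have "card ?A + card ?B = card ?P + card ?Q + 2 * card (?A \<inter> ?B)"
    by linarith
  then have 2: "even (card ?P + card ?Q) = even (card ?A + card ?B)"
    by (simp only: even_add even_mult_iff even_numeral simp_thms)
  have "length (filter (\<lambda>w. w < x) vs) = card ?A"
    using distinct_card[of "filter (\<lambda>w. w < x) vs"] x(2) by simp
  moreover have "length (filter (\<lambda>w. w < f x) (map f vs)) = card ?B"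
    using distinct_card[of "filter (\<lambda>w. f w < f x) vs"] x(2) by (simp add: filter_map o_def)
  ultimately show ?case
    using 1 2 Cons.IH[OF x(2,3)] by simp argo
qed simp

context contracting
begin

lemma one_edge_fibre:
  assumes "card C \<le> 1" "u \<in> verts G" "v \<in> verts G" "u \<noteq> v" "vmap \<phi> u = vmap \<phi> v"
  shows "\<exists>h. fst h \<in> C \<and> hvert G h = u \<and> hvert G (opp h) = v"
proof -
  let ?F = "fibre G \<phi> (vmap \<phi> u)"
  have "(u, v) \<in> (adj ?F)\<^sup>*"
    using fibre_tree[of "vmap \<phi> u"] assms unfolding graph_of_genus_def connected_graph_adj by auto
  then obtain w where w: "(u, w) \<in> adj ?F"
    using assms(4) by (metis converse_rtranclE)
  obtain w' where w': "(w', v) \<in> adj ?F"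
    using \<open>(u, v) \<in> (adj ?F)\<^sup>*\<close> assms(4) by (metis rtranclE)
  from w obtain h where h: "fst h \<in> edges ?F" "hvert ?F h = u"
    by (rule adjE)
  from w' obtain k where k: "fst k \<in> edges ?F" "hvert ?F (opp k) = v"
    by (rule adjE)
  have "fst h \<in> C" "fst k \<in> C"
    using h k by auto
  then have "fst h = fst k"
    using assms(1) card_le_Suc0_iff_eq[OF finite_C] by simp
  then have "opp k = h \<or> opp k = opp h"
    using fst_eq_cases[of "opp k" h] by simp
  then show ?thesis
    using h k assms(4) \<open>fst h \<in> C\<close> by (intro exI[of _ h]) auto
qed

context
  assumes C1: "card C \<le> 1"
begin

lemma C_unique: "e \<in> C \<Longrightarrow> f \<in> C \<Longrightarrow> e = f"
  using C1 card_le_Suc0_iff_eq[OF finite_C] by simp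

lemma contracted_halves_at:
  assumes "fst h \<in> C"
  shows "{k \<in> halves_at G (hvert G h). fst k \<in> C} = {h}"
proof -
  have "k = h" if "hvert G k = hvert G h" "fst k \<in> C" for k
  proof -
    have "fst k = fst h"
      using C_unique assms that by blast
    then consider "k = h" | "k = opp h"
      using fst_eq_cases by blast
    then show ?thesis
      using that contracted_not_loop[OF assms] by cases (auto simp: hvert_def, metis (full_types))
  qed
  then show ?thesis
    using assms C_subset by auto
qed

text \<open>The state of \<open>G\<close> on the preimages of the half-edges of \<open>s'\<close>.
  It is the only term of the induced tensor that avoids the contracted edge.\<close>

definition lift_state :: "state \<Rightarrow> state" where
  "lift_state s' v = (if lands_at G \<phi> s' v then Some (pre_half \<phi> (the (s' (vmap \<phi> v)))) else None)"

lemma lands_atD: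
  assumes "s' \<in> states G'" "lands_at G \<phi> s' v"
  obtains h' where "s' (vmap \<phi> v) = Some h'" "hvert G (pre_half \<phi> h') = v" "fst h' \<in> edges G'"
    "lift_state s' v = Some (pre_half \<phi> h')"
  using assms states_SomeD unfolding lands_at_def lift_state_def by fastforce

lemma lands_atI:
  assumes "s' \<in> states G'" "s' w = Some h'"
  shows "lands_at G \<phi> s' (hvert G (pre_half \<phi> h'))" "lift_state s' (hvert G (pre_half \<phi> h')) = Some (pre_half \<phi> h')"
    "vmap \<phi> (hvert G (pre_half \<phi> h')) = w"
proof -
  show w: "vmap \<phi> (hvert G (pre_half \<phi> h')) = w"
    using pre_half(5)[of h'] states_SomeD[OF assms] by simp
  then show "lands_at G \<phi> s' (hvert G (pre_half \<phi> h'))"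
    using assms(2) by (auto simp: lands_at_def)
  then show "lift_state s' (hvert G (pre_half \<phi> h')) = Some (pre_half \<phi> h')"
    using assms(2) w by (simp add: lift_state_def)
qed

text \<open>The correction by the half-edge \<open>k\<close> of the contracted edge is invisible at
  other half-edges, so there the factor is a delta function.\<close>

lemma lookup_induced_factor:
  assumes "b = None \<or> b \<in> Some ` {k. fst k \<notin> C}" "s' \<in> states G'"
  shows "Poly_Mapping.lookup (induced_factor G \<phi> s' v) b = (if b = lift_state s' v then 1 else 0)"
proof -
  have "Poly_Mapping.lookup (\<Sum>k\<in>{k \<in> halves_at G v. fst k \<in> C}. basis_elt (Some k)) b = 0"
    unfolding lookup_sum using assms(1) by (intro sum.neutral) (auto simp: lookup_basis_elt)
  then show ?thesis
    by (auto simp: induced_factor_def lift_state_def lookup_minus lookup_basis_elt simp del: mem_halves_at)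
qed

lemma lookup_induced_factor_not_lands:
  "\<not> lands_at G \<phi> s' v \<Longrightarrow> Poly_Mapping.lookup (induced_factor G \<phi> s' v) (Some k) = 0"
  by (simp add: induced_factor_def lookup_basis_elt)

lemma induced_factor_A_ring: "Poly_Mapping.lookup (induced_factor G \<phi> s' v) b \<in> A_ring G"
  by (auto simp: induced_factor_def lookup_minus lookup_sum lookup_basis_elt intro!: A_ring_sum A_ring_minus A_ring_diff)

text \<open>At an end of the contracted edge the factor is a difference \<open>h - k\<close> or
  \<open>\<emptyset>\<close>, so the sum vanishes for each state separately. At other vertices a
  factor can be a single half-edge, and the vertex sum vanishes only after summing over states, in
  \<open>elementary_sum\<close>.\<close>

lemma induced_factor_sum:
  assumes "fst h \<in> C" "s' \<in> states G'"
  shows "(\<Sum>k\<in>halves_at G (hvert G h). Poly_Mapping.lookup (induced_factor G \<phi> s' (hvert G h)) (Some k)) = 0"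
proof (cases "lands_at G \<phi> s' (hvert G h)")
  case True
  then obtain h' where h': "s' (vmap \<phi> (hvert G h)) = Some h'" "hvert G (pre_half \<phi> h') = hvert G h" "fst h' \<in> edges G'"
    by (rule lands_atD[OF assms(2)]) (rule that; assumption)
  have "Poly_Mapping.lookup (induced_factor G \<phi> s' (hvert G h)) (Some k) =
      (if pre_half \<phi> h' = k then 1 else 0) - (if h = k then 1 else 0)" for k
    unfolding induced_factor_def contracted_halves_at[OF assms(1)]
    using True h' by (simp add: lookup_minus lookup_basis_elt)
  then show ?thesis
    using h' pre_half[of h'] assms C_subset finite_halves_at[OF wf, of "hvert G h"]
    by (simp add: sum_subtractf) auto
qed (simp add: lookup_induced_factor_not_lands)

context
  fixes c y
  assumes c: "c \<in> sw_complex G'"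
  defines "y \<equiv> elementary_pullback G \<phi> c"
begin

lemma keys_c: "Poly_Mapping.keys c \<subseteq> states G'" and red_c: "vertex_sums_zero G' c"
  and A_c: "Poly_Mapping.lookup c s \<in> A_ring G'"
  using c by (auto simp: sw_complex_iff[OF wf'])

lemma lookup_elementary:
  "Poly_Mapping.lookup y s =
    (if s \<in> states G then \<Sum>s'\<in>Poly_Mapping.keys c. (-1) ^ koszul_inversions G \<phi> s' *
      rename_vars (pre_edge \<phi>) (Poly_Mapping.lookup c s') *
      (\<Prod>v\<in>verts G. Poly_Mapping.lookup (induced_factor G \<phi> s' v) (s v)) else 0)"
  by (simp add: y_def elementary_pullback_def lookup_sum lookup_pure_tensor[OF wf])

lemma keys_elementary: "Poly_Mapping.keys y \<subseteq> states G"
  by (auto simp: in_keys_iff lookup_elementary split: if_splits)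

lemma elementary_A_ring: "Poly_Mapping.lookup y s \<in> A_ring G"
  unfolding lookup_elementary using A_c pre_edge_mem
  by (auto intro!: A_ring_sum A_ring_mult[OF A_ring_sign] A_ring_rename A_ring_prod induced_factor_A_ring)

lemma elementary_end_sum:
  assumes h: "fst h \<in> C"
  shows "(\<Sum>k\<in>halves_at G (hvert G h). hat G y (k # ks)) = 0"
proof -
  let ?v = "hvert G h"
  have v: "?v \<in> verts G"
    using h C_subset wf_graph_hvert[OF wf] by blast
  have "(\<Sum>k\<in>halves_at G ?v. Poly_Mapping.lookup y (s(?v \<mapsto> k))) = 0" if s: "s \<in> states G" "s ?v = None" for s
  proof -
    have "s(?v \<mapsto> k) \<in> states G" if "k \<in> halves_at G ?v" for k
      using states_upd_Some[OF wf s(1), of k] that by simp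
    then have "(\<Sum>k\<in>halves_at G ?v. Poly_Mapping.lookup y (s(?v \<mapsto> k))) =
        (\<Sum>k\<in>halves_at G ?v. \<Sum>s'\<in>Poly_Mapping.keys c. (-1) ^ koszul_inversions G \<phi> s' *
          rename_vars (pre_edge \<phi>) (Poly_Mapping.lookup c s') *
          Poly_Mapping.lookup (pure_tensor G (induced_factor G \<phi> s')) (s(?v \<mapsto> k)))"
      by (intro sum.cong refl) (simp add: lookup_elementary lookup_pure_tensor[OF wf])
    also have "\<dots> = (\<Sum>s'\<in>Poly_Mapping.keys c. (-1) ^ koszul_inversions G \<phi> s' *
          rename_vars (pre_edge \<phi>) (Poly_Mapping.lookup c s') *
          (\<Sum>k\<in>halves_at G ?v. Poly_Mapping.lookup (pure_tensor G (induced_factor G \<phi> s')) (s(?v \<mapsto> k))))"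
      unfolding sum_distrib_left by (rule sum.swap)
    also have "\<dots> = 0"
    proof (intro sum.neutral ballI)
      fix s' assume "s' \<in> Poly_Mapping.keys c"
      then have "(\<Sum>k\<in>halves_at G ?v. Poly_Mapping.lookup (pure_tensor G (induced_factor G \<phi> s')) (s(?v \<mapsto> k))) = 0"
        using keys_c induced_factor_sum[OF h, of s'] by (intro pure_tensor_vertex_sum[OF wf v] s) auto
      then show "(-1) ^ koszul_inversions G \<phi> s' * rename_vars (pre_edge \<phi>) (Poly_Mapping.lookup c s') *
          (\<Sum>k\<in>halves_at G ?v. Poly_Mapping.lookup (pure_tensor G (induced_factor G \<phi> s')) (s(?v \<mapsto> k))) = 0"
        by simp
    qed
    finally show ?thesis .
  qed
  then show ?thesis
    using state_of_states[OF wf] by (simp add: hat_sum_at[OF wf v] state_of_None_iff)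
qed

text \<open>Occupying both ends would take two half-edges at the image vertex, where a state has at
  most one.\<close>

lemma elementary_both_ends:
  assumes h: "fst h \<in> C" "h \<in> set ks" "opp h \<in> set ks"
  shows "hat G y ks = 0"
proof (cases "distinct (map (hvert G) ks) \<and> fst ` set ks \<subseteq> edges G")
  case True
  let ?s = "state_of G ks"
  have V: "hvert G h \<in> verts G" "hvert G (opp h) \<in> verts G"
    using h C_subset wf_graph_hvert[OF wf, of h] wf_graph_hvert[OF wf, of "opp h"] by auto
  have s: "?s (hvert G h) = Some h" "?s (hvert G (opp h)) = Some (opp h)"
    using True h by (simp_all add: state_of_Some)
  have "(\<Prod>v\<in>verts G. Poly_Mapping.lookup (induced_factor G \<phi> s' v) (?s v)) = 0" if "s' \<in> Poly_Mapping.keys c" for s'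
  proof -
    have "\<not> (lands_at G \<phi> s' (hvert G h) \<and> lands_at G \<phi> s' (hvert G (opp h)))"
      using C_vmap[OF h(1)] contracted_not_loop[OF h(1)]
      by (cases h; cases "snd h") (auto simp: lands_at_def)
    then show ?thesis
      using V s lookup_induced_factor_not_lands by (metis (no_types, lifting) finite_graphs(1) prod_zero)
  qed
  then have "Poly_Mapping.lookup y ?s = 0"
    by (simp add: lookup_elementary del: prod_zero_iff)
  then show ?thesis
    by (simp add: hat_def)
next
  case False
  then show ?thesis
    unfolding hat_def by (simp only: if_False)
qed

text \<open>The Koszul exponent counts the pairs of occupied vertices whose order
  \<open>\<phi>\<close> reverses; by \<open>even_crossings\<close> its parity is the difference of
  the two sorting signs.\<close>

lemma koszul_sign:
  assumes ks: "distinct (map (hvert G) ks)" "distinct (map (hvert G') (map hm ks))"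
    "fst ` set ks \<subseteq> edges G - C"
  shows "(-1) ^ koszul_inversions G \<phi> (state_of G' (map hm ks)) * vsign (map (hvert G) ks) =
    vsign (map (hvert G') (map hm ks))"
proof -
  let ?s = "state_of G' (map hm ks)"
  have vm: "map (hvert G') (map hm ks) = map (vmap \<phi>) (map (hvert G) ks)"
    using ks(3) hm_simps(2) by (auto simp: image_subset_iff)
  have lands: "lands_at G \<phi> ?s v \<longleftrightarrow> v \<in> hvert G ` set ks" for v
  proof
    assume "lands_at G \<phi> ?s v"
    then obtain k where k: "k \<in> set ks" "?s (vmap \<phi> v) = Some (hm k)" "hvert G (pre_half \<phi> (hm k)) = v"
      using state_of_Some[OF ks(2)] by (auto simp: lands_at_def)
    then show "v \<in> hvert G ` set ks"
      using pre_half_hm[of k] ks(3) by auto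
  next
    assume "v \<in> hvert G ` set ks"
    then obtain k where k: "k \<in> set ks" "v = hvert G k" by blast
    then have "fst k \<in> edges G" "fst k \<notin> C"
      using ks(3) by auto
    then have "?s (vmap \<phi> v) = Some (hm k)" "pre_half \<phi> (hm k) = k"
      using k hm_simps(2)[of k] pre_half_hm by (auto simp: state_of_Some[OF ks(2)])
    then show "lands_at G \<phi> ?s v"
      using k by (auto simp: lands_at_def)
  qed
  have "hvert G ` set ks \<subseteq> verts G"
    using ks(3) wf_graph_hvert[OF wf] by auto
  then have "koszul_inversions G \<phi> ?s =
      card {(u, v). u \<in> set (map (hvert G) ks) \<and> v \<in> set (map (hvert G) ks) \<and> u < v \<and> vmap \<phi> v < vmap \<phi> u}"
    unfolding koszul_inversions_def lands by (intro arg_cong[of _ _ card]) auto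
  moreover have "inj_on (vmap \<phi>) (set (map (hvert G) ks))"
    using ks(2) unfolding vm distinct_map by blast
  ultimately have "even (koszul_inversions G \<phi> ?s + inv_count (map (hvert G) ks)) =
      even (inv_count (map (hvert G') (map hm ks)))"
    using even_crossings[OF ks(1)] unfolding vm by simp argo
  moreover have "(-1 :: epoly) ^ a = (-1) ^ b" if "even a = even b" for a b
    using that by (cases "even a") auto
  ultimately show ?thesis
    unfolding vsign_def power_add[symmetric] by blast
qed

text \<open>At such a list each induced tensor is a delta function, so only states lifting to the
  given state contribute. If the image vertices are distinct there is exactly one, that of the
  relabelled list, and \<open>koszul_sign\<close> compares the signs.\<close>

lemma elementary_uncontracted:
  assumes ks: "fst ` set ks \<subseteq> edges G - C"
  shows "hat G y ks = rename_vars (pre_edge \<phi>) (hat G' c (map hm ks))"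
proof (cases "distinct (map (hvert G) ks)")
  case True
  let ?s = "state_of G ks" and ?t = "state_of G' (map hm ks)"
  have s: "?s \<in> states G"
    using ks by (intro state_of_states[OF wf]) auto
  have hmk: "fst (hm k) \<in> edges G'" "pre_half \<phi> (hm k) = k" "vmap \<phi> (hvert G k) = hvert G' (hm k)" if "k \<in> set ks" for k
    using that ks hm_simps[of k] pre_half_hm[of k] by auto
  have "(\<Prod>v\<in>verts G. Poly_Mapping.lookup (induced_factor G \<phi> s' v) (?s v)) = (if ?s = lift_state s' then 1 else 0)"
    if s': "s' \<in> states G'" for s'
  proof -
    have "?s v = None \<or> ?s v \<in> Some ` {k. fst k \<notin> C}" for v
    proof (cases "?s v")
      case (Some k)
      then have "fst k \<notin> C"
        using state_of_Some[OF True, of v k] ks by blast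
      then show ?thesis
        using Some by blast
    qed simp
    then have "(\<Prod>v\<in>verts G. Poly_Mapping.lookup (induced_factor G \<phi> s' v) (?s v)) =
        (\<Prod>v\<in>verts G. if ?s v = lift_state s' v then 1 else 0)"
      using s' by (intro prod.cong refl lookup_induced_factor) auto
    also have "\<dots> = (if \<forall>v\<in>verts G. ?s v = lift_state s' v then 1 else 0)"
      by (auto intro: prod.neutral prod_zero)
    also have "(\<forall>v\<in>verts G. ?s v = lift_state s' v) \<longleftrightarrow> ?s = lift_state s'"
    proof
      assume *: "\<forall>v\<in>verts G. ?s v = lift_state s' v"
      have "lift_state s' v = None" if "v \<notin> verts G" for v
      proof (rule ccontr)
        assume "lift_state s' v \<noteq> None"
        then have "lands_at G \<phi> s' v"
          by (auto simp: lift_state_def split: if_splits)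
        then obtain h' where "hvert G (pre_half \<phi> h') = v" "fst h' \<in> edges G'"
          by (rule lands_atD[OF s']) (rule that; assumption)
        then show False
          using that pre_half(2) wf_graph_hvert[OF wf] by metis
      qed
      then show "?s = lift_state s'"
        using * states_None[OF s] by (intro ext) metis
    qed simp
    finally show ?thesis .
  qed
  then have "Poly_Mapping.lookup y ?s = (\<Sum>s'\<in>Poly_Mapping.keys c. (-1) ^ koszul_inversions G \<phi> s' *
      rename_vars (pre_edge \<phi>) (Poly_Mapping.lookup c s') * (if ?s = lift_state s' then 1 else 0))"
    unfolding lookup_elementary using s keys_c by (auto intro!: sum.cong)
  also have "\<dots> = (\<Sum>s'\<in>states G'. (-1) ^ koszul_inversions G \<phi> s' *
      rename_vars (pre_edge \<phi>) (Poly_Mapping.lookup c s') * (if ?s = lift_state s' then 1 else 0))"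
    using keys_c finite_states[OF wf'] by (intro sum.mono_neutral_left) (auto simp: in_keys_iff)
  finally have lk: "Poly_Mapping.lookup y ?s = (\<Sum>s'\<in>states G'. (-1) ^ koszul_inversions G \<phi> s' *
      rename_vars (pre_edge \<phi>) (Poly_Mapping.lookup c s') * (if ?s = lift_state s' then 1 else 0))" .
  have lift: "s' (hvert G' (hm k)) = Some (hm k)" if l: "s' \<in> states G'" "?s = lift_state s'" "k \<in> set ks" for s' k
  proof -
    have "lift_state s' (hvert G k) = Some k"
      using l state_of_Some[OF True, of "hvert G k" k] by simp
    moreover from this have "lands_at G \<phi> s' (hvert G k)"
      by (auto simp: lift_state_def split: if_splits)
    then obtain h' where "s' (vmap \<phi> (hvert G k)) = Some h'" "fst h' \<in> edges G'"
        "lift_state s' (hvert G k) = Some (pre_half \<phi> h')"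
      by (rule lands_atD[OF l(1)]) (rule that; assumption)
    ultimately show ?thesis
      using hmk(3)[OF l(3)] pre_half(4)[of h'] by simp
  qed
  show ?thesis
  proof (cases "distinct (map (hvert G') (map hm ks))")
    case d': True
    have "?s = lift_state s' \<longleftrightarrow> s' = ?t" if s': "s' \<in> states G'" for s'
    proof
      assume *: "?s = lift_state s'"
      show "s' = ?t"
      proof
        fix w
        show "s' w = ?t w"
        proof (cases "s' w")
          case None
          have "?t w = None"
          proof (rule ccontr)
            assume "?t w \<noteq> None"
            then obtain k where "k \<in> set ks" "hvert G' (hm k) = w"
              using state_of_None_iff[of G' "map hm ks" w] by auto
            then show False
              using lift[OF s' *] None by fastforce
          qed
          with None show ?thesis by simp
        next
          case (Some h')
          then have "?s (hvert G (pre_half \<phi> h')) = Some (pre_half \<phi> h')"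
            using lands_atI[OF s'] * by simp
          then have "pre_half \<phi> h' \<in> set ks"
            by (simp add: state_of_Some[OF True])
          moreover have "hm (pre_half \<phi> h') = h'" "hvert G' h' = w"
            using states_SomeD[OF s' Some] pre_half(4) by auto
          ultimately have "h' \<in> set (map hm ks) \<and> hvert G' h' = w"
            by (metis image_eqI set_map)
          then show ?thesis
            using Some state_of_Some[OF d', of w h'] by (simp del: set_map)
        qed
      qed
    next
      assume s0: "s' = ?t"
      show "?s = lift_state s'"
      proof
        fix v
        show "?s v = lift_state s' v"
        proof (cases "?s v")
          case None
          have "\<not> lands_at G \<phi> s' v"
          proof
            assume "lands_at G \<phi> s' v"
            then obtain h' where "s' (vmap \<phi> v) = Some h'" "hvert G (pre_half \<phi> h') = v"
              by (rule lands_atD[OF s']) (rule that; assumption)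
            then obtain k where "k \<in> set ks" "hvert G k = v"
              unfolding s0 state_of_Some[OF d'] using hmk by auto
            then show False
              using None by (auto simp: state_of_None_iff)
          qed
          then show ?thesis
            using None by (simp add: lift_state_def)
        next
          case (Some k)
          then have k: "k \<in> set ks" "hvert G k = v"
            by (auto simp: state_of_Some[OF True])
          then have "s' (vmap \<phi> v) = Some (hm k)"
            unfolding s0 state_of_Some[OF d'] using hmk(3)[OF k(1)] by auto
          then show ?thesis
            using lands_atI[OF s', of "vmap \<phi> v" "hm k"] hmk(2)[OF k(1)] k Some by simp
        qed
      qed
    qed
    moreover have "?t \<in> states G'"
      using hmk by (intro state_of_states[OF wf']) auto
    ultimately have "Poly_Mapping.lookup y ?s = (-1) ^ koszul_inversions G \<phi> ?t *
        rename_vars (pre_edge \<phi>) (Poly_Mapping.lookup c ?t)"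
      unfolding lk using finite_states[OF wf'] by (simp add: if_distrib[of "\<lambda>x. _ * x"] cong: if_cong)
    moreover have "fst ` set (map hm ks) \<subseteq> edges G'" "fst ` set ks \<subseteq> edges G"
      using hmk ks by auto
    ultimately have "hat G y ks = vsign (map (hvert G) ks) * ((-1) ^ koszul_inversions G \<phi> ?t *
        rename_vars (pre_edge \<phi>) (Poly_Mapping.lookup c ?t))"
      and hat': "hat G' c (map hm ks) = vsign (map (hvert G') (map hm ks)) * Poly_Mapping.lookup c ?t"
      using True d' by (simp_all add: hat_def del: map_map)
    then have "hat G y ks = ((-1) ^ koszul_inversions G \<phi> ?t * vsign (map (hvert G) ks)) *
        rename_vars (pre_edge \<phi>) (Poly_Mapping.lookup c ?t)"
      by (simp only: ac_simps)
    then show ?thesis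
      unfolding hat' koszul_sign[OF True d' ks] unfolding vsign_def rename_vars_sign .
  next
    \<comment> \<open>Two listed vertices become one in \<open>G'\<close>, where no state holds two
      half-edges; so nothing lifts to \<open>?s\<close>, and both sides are zero.\<close>
    case False
    then obtain k l where kl: "k \<in> set ks" "l \<in> set ks" "k \<noteq> l" "hvert G' (hm k) = hvert G' (hm l)"
      using True by (auto simp: distinct_map inj_on_def)
    have "?s \<noteq> lift_state s'" if "s' \<in> states G'" for s'
      using lift[OF that _ kl(1)] lift[OF that _ kl(2)] kl hmk(2) by (metis option.inject)
    then have "Poly_Mapping.lookup y ?s = 0"
      unfolding lk by simp
    then show ?thesis
      using False by (simp add: hat_def del: map_map)
  qed
next
  case False
  have "map (hvert G') (map hm ks) = map (vmap \<phi>) (map (hvert G) ks)"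
    using ks hm_simps(2) by (auto simp: image_subset_iff)
  then have "\<not> distinct (map (hvert G') (map hm ks))"
    using False by (metis distinct_map)
  then show ?thesis
    using False by (simp add: hat_def del: map_map)
qed

text \<open>The sums at the two ends express both terms through half-edges off the contracted edge.
  Together these are all half-edges at the image vertex, over which \<open>c\<close> sums to zero.
  If the rest of the list meets the edge again, both terms vanish.\<close>

lemma elementary_antisymmetric:
  assumes h: "fst h \<in> C"
  shows "hat G y (h # ks) + hat G y (opp h # ks) = 0"
proof (cases "fst ` set ks \<subseteq> edges G - C")
  case ks: True
  have end_sum: "hat G y (k # ks) = - (\<Sum>l\<in>{l \<in> halves_at G (hvert G k). fst l \<notin> C}. hat G y (l # ks))"
    if "fst k \<in> C" for k
  proof -
    have "halves_at G (hvert G k) = insert k {l \<in> halves_at G (hvert G k). fst l \<notin> C}"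
      using contracted_halves_at[OF that] that C_subset by blast
    then have "0 = hat G y (k # ks) + (\<Sum>l\<in>{l \<in> halves_at G (hvert G k). fst l \<notin> C}. hat G y (l # ks))"
      using elementary_end_sum[OF that, of ks] that finite_halves_at[OF wf, of "hvert G k"]
      by (metis (no_types, lifting) finite_insert mem_Collect_eq sum.insert)
    then show ?thesis
      unfolding eq_neg_iff_add_eq_0 by (rule sym)
  qed
  let ?w = "vmap \<phi> (hvert G h)"
  let ?A = "\<lambda>v. {l \<in> halves_at G v. fst l \<notin> C}"
  have V: "hvert G h \<in> verts G" "hvert G (opp h) \<in> verts G"
    using h C_subset wf_graph_hvert[OF wf, of h] wf_graph_hvert[OF wf, of "opp h"] by auto
  have ne: "hvert G h \<noteq> hvert G (opp h)"
    using contracted_not_loop[OF h] by (cases h; cases "snd h") auto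
  have "?A (hvert G h) \<union> ?A (hvert G (opp h)) = {l \<in> halves G. fst l \<notin> C \<and> hvert G' (hm l) = ?w}"
  proof (intro equalityI subsetI)
    fix l assume l: "l \<in> ?A (hvert G h) \<union> ?A (hvert G (opp h))"
    then show "l \<in> {l \<in> halves G. fst l \<notin> C \<and> hvert G' (hm l) = ?w}"
      using hm_simps(2)[of l] C_vmap[OF h] by auto
  next
    fix l assume l: "l \<in> {l \<in> halves G. fst l \<notin> C \<and> hvert G' (hm l) = ?w}"
    then have "vmap \<phi> (hvert G l) = ?w" "hvert G l \<in> verts G"
      using hm_simps(2)[of l] wf_graph_hvert[OF wf, of l] by auto
    then have "hvert G l = hvert G h \<or> (\<exists>k. fst k \<in> C \<and> hvert G k = hvert G l \<and> hvert G (opp k) = hvert G h)"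
      using one_edge_fibre[OF C1, of "hvert G l" "hvert G h"] V by blast
    then show "l \<in> ?A (hvert G h) \<union> ?A (hvert G (opp h))"
    proof
      assume "\<exists>k. fst k \<in> C \<and> hvert G k = hvert G l \<and> hvert G (opp k) = hvert G h"
      then obtain k where k: "fst k \<in> C" "hvert G k = hvert G l" "hvert G (opp k) = hvert G h"
        by blast
      then have "k = h \<or> k = opp h"
        using C_unique[OF h k(1)] fst_eq_cases by metis
      then show ?thesis
        using k l by auto
    qed (use l in auto)
  qed
  moreover have "hat G y (h # ks) + hat G y (opp h # ks) =
      - (\<Sum>l\<in>?A (hvert G h) \<union> ?A (hvert G (opp h)). hat G y (l # ks))"
  proof -
    have "finite (?A v)" for v
      by (rule finite_subset[OF _ finite_halves_at[OF wf, of v]]) blast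
    moreover have "?A (hvert G h) \<inter> ?A (hvert G (opp h)) = {}"
      using ne by auto
    ultimately have "(\<Sum>l\<in>?A (hvert G h) \<union> ?A (hvert G (opp h)). hat G y (l # ks)) =
        (\<Sum>l\<in>?A (hvert G h). hat G y (l # ks)) + (\<Sum>l\<in>?A (hvert G (opp h)). hat G y (l # ks))"
      by (intro sum.union_disjoint)
    moreover have "fst (opp h) \<in> C"
      using h by simp
    ultimately show ?thesis
      using end_sum[OF h] end_sum[of "opp h"] by (simp only: minus_add_distrib)
  qed
  ultimately have "hat G y (h # ks) + hat G y (opp h # ks) =
      - (\<Sum>l\<in>{l \<in> halves G. fst l \<notin> C \<and> hvert G' (hm l) = ?w}. hat G y (l # ks))"
    by simp
  also have "(\<Sum>l\<in>{l \<in> halves G. fst l \<notin> C \<and> hvert G' (hm l) = ?w}. hat G y (l # ks)) =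
      (\<Sum>l\<in>{l \<in> halves G. fst l \<notin> C \<and> hvert G' (hm l) = ?w}.
        rename_vars (pre_edge \<phi>) (hat G' c (hm l # map hm ks)))"
    using ks by (intro sum.cong refl) (subst elementary_uncontracted, auto)
  also have "\<dots> = rename_vars (pre_edge \<phi>) (\<Sum>l\<in>{l \<in> halves G'. hvert G' l = ?w}. hat G' c (l # map hm ks))"
    unfolding rename_vars_sum
    by (rule sum_hm[where F = "\<lambda>l. rename_vars (pre_edge \<phi>) (hat G' c (l # map hm ks))" and P = "\<lambda>l. hvert G' l = ?w"])
  also have "{l \<in> halves G'. hvert G' l = ?w} = halves_at G' ?w"
    by auto
  also have "(\<Sum>l\<in>halves_at G' ?w. hat G' c (l # map hm ks)) = 0"
    using hat_sum_zero[OF wf' red_c, of ?w "[]"] V by simp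
  finally show ?thesis
    by simp
next
  case False
  show ?thesis
  proof (cases "fst ` set ks \<subseteq> edges G")
    case True
    with False obtain k where k: "k \<in> set ks" "fst k \<in> C"
      by blast
    then have "k = h \<or> k = opp h"
      using C_unique[OF h k(2)] fst_eq_cases by metis
    then have "hat G y (h # ks) = 0 \<and> hat G y (opp h # ks) = 0"
      using elementary_both_ends[OF h, of "h # ks"] elementary_both_ends[OF h, of "opp h # ks"] k(1)
      by (auto simp: hat_def)
    then show ?thesis by simp
  next
    case False
    then have "hat G y (k # ks) = 0" for k
      using hat_nonzeroD[of G y "k # ks"] by auto
    then show ?thesis by simp
  qed
qed

text \<open>An end of the edge is settled by \<open>elementary_end_sum\<close>. Any other vertex is
  alone in its fibre, so its sum is a relabelled vertex sum of \<open>c\<close>, provided the rest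
  of the list is uncontracted; contracted entries are removed beforehand by trading them, through an
  end sum, for the other half-edges at that end.\<close>

lemma elementary_sum:
  assumes v: "v \<in> verts G"
  shows "(\<Sum>h\<in>halves_at G v. hat G y (h # ks)) = 0"
proof (induction "length (filter (\<lambda>k. fst k \<in> C) ks)" arbitrary: ks rule: less_induct)
  case less
  show ?case
  proof (cases "\<exists>h. fst h \<in> C \<and> hvert G h = v")
    case True
    then show ?thesis
      using elementary_end_sum by blast
  next
    case no_end: False
    show ?thesis
    proof (cases "fst ` set ks \<subseteq> edges G - C")
      case ks: True
      have eq: "halves_at G v = {l \<in> halves G. fst l \<notin> C \<and> hvert G' (hm l) = vmap \<phi> v}"
      proof (intro equalityI subsetI)
        fix l assume "l \<in> halves_at G v"
        then show "l \<in> {l \<in> halves G. fst l \<notin> C \<and> hvert G' (hm l) = vmap \<phi> v}"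
          using no_end hm_simps(2)[of l] by (cases "fst l \<in> C") auto
      next
        fix l assume l: "l \<in> {l \<in> halves G. fst l \<notin> C \<and> hvert G' (hm l) = vmap \<phi> v}"
        then have "vmap \<phi> v = vmap \<phi> (hvert G l)" "hvert G l \<in> verts G"
          using hm_simps(2)[of l] wf_graph_hvert[OF wf, of l] by auto
        then have "hvert G l = v"
          using one_edge_fibre[OF C1 v, of "hvert G l"] no_end by blast
        then show "l \<in> halves_at G v"
          using l by simp
      qed
      have "(\<Sum>h\<in>halves_at G v. hat G y (h # ks)) = (\<Sum>l\<in>{l \<in> halves G. fst l \<notin> C \<and> hvert G' (hm l) = vmap \<phi> v}.
          rename_vars (pre_edge \<phi>) (hat G' c (hm l # map hm ks)))"
        unfolding eq using ks by (intro sum.cong refl) (subst elementary_uncontracted, auto)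
      also have "\<dots> = rename_vars (pre_edge \<phi>) (\<Sum>l\<in>{l \<in> halves G'. hvert G' l = vmap \<phi> v}. hat G' c (l # map hm ks))"
        unfolding rename_vars_sum
        by (rule sum_hm[where F = "\<lambda>l. rename_vars (pre_edge \<phi>) (hat G' c (l # map hm ks))" and P = "\<lambda>l. hvert G' l = vmap \<phi> v"])
      also have "{l \<in> halves G'. hvert G' l = vmap \<phi> v} = halves_at G' (vmap \<phi> v)"
        by auto
      also have "(\<Sum>l\<in>halves_at G' (vmap \<phi> v). hat G' c (l # map hm ks)) = 0"
        using hat_sum_zero[OF wf' red_c, of "vmap \<phi> v" "[]"] v by simp
      finally show ?thesis by simp
    next
      case not_ks: False
      show ?thesis
      proof (cases "fst ` set ks \<subseteq> edges G")
        case True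
        with not_ks obtain k0 where k0: "k0 \<in> set ks" "fst k0 \<in> C"
          by blast
        then obtain xs ys where ks: "ks = xs @ k0 # ys"
          by (meson split_list)
        let ?A = "halves_at G (hvert G k0) - {k0}"
        have A: "hat G y (k0 # zs) = - (\<Sum>k\<in>?A. hat G y (k # zs))" for zs
        proof -
          have "k0 \<in> halves_at G (hvert G k0)"
            using k0 C_subset by auto
          then have "0 = hat G y (k0 # zs) + (\<Sum>k\<in>?A. hat G y (k # zs))"
            using elementary_end_sum[OF k0(2), of zs] finite_halves_at[OF wf, of "hvert G k0"]
            by (metis sum.remove)
          then show ?thesis
            unfolding eq_neg_iff_add_eq_0 by (rule sym)
        qed
        have hat: "hat G y (h # ks) = (-1) ^ (length xs + 1) * (\<Sum>k\<in>?A. hat G y (h # k # xs @ ys))" for h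
        proof -
          have "hat G y (h # ks) = (-1) ^ (length xs + 1) * hat G y (k0 # h # xs @ ys)"
            using hat_move[of G y "h # xs" k0 ys] unfolding ks by simp
          also have "hat G y (k0 # h # xs @ ys) = (\<Sum>k\<in>?A. hat G y (h # k # xs @ ys))"
            unfolding A sum_negf[symmetric] using hat_move[of G y "[h]" _ "xs @ ys"] by (intro sum.cong) auto
          finally show ?thesis .
        qed
        have "(\<Sum>h\<in>halves_at G v. hat G y (h # ks)) =
            (-1) ^ (length xs + 1) * (\<Sum>k\<in>?A. \<Sum>h\<in>halves_at G v. hat G y (h # k # xs @ ys))"
          unfolding hat sum_distrib_left[symmetric] by (subst sum.swap) (rule refl)
        also have "(\<Sum>k\<in>?A. \<Sum>h\<in>halves_at G v. hat G y (h # k # xs @ ys)) = 0"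
        proof (rule sum.neutral, rule ballI, rule less.hyps)
          fix k assume "k \<in> ?A"
          then have "fst k \<notin> C"
            using contracted_halves_at[OF k0(2)] by blast
          then show "length (filter (\<lambda>k. fst k \<in> C) (k # xs @ ys)) < length (filter (\<lambda>k. fst k \<in> C) ks)"
            using k0(2) by (simp add: ks)
        qed
        finally show ?thesis
          by simp
      next
        case False
        then have "hat G y (k # ks) = 0" for k
          using hat_nonzeroD[of G y "k # ks"] by auto
        then show ?thesis by simp
      qed
    qed
  qed
qed

lemma pulls_back_elementary: "pulls_back G G' \<phi> c y"
  unfolding pulls_back_iff
proof (intro conjI allI impI)
  show "y \<in> sw_complex G"
    unfolding sw_complex_iff[OF wf] vertex_sums_zero_hat[OF wf]
    using keys_elementary elementary_A_ring elementary_sum by blast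
qed (use elementary_uncontracted elementary_antisymmetric in auto)

end
end
end

lemma is_pullback_pulls_back:
  "is_pullback G G' \<phi> f \<Longrightarrow> c \<in> sw_complex G' \<Longrightarrow> pulls_back G G' \<phi> c (f c)"
proof (induction arbitrary: c rule: is_pullback.induct)
  case (elementary G G' \<phi>)
  then show ?case
    using contracting.pulls_back_elementary contracting_iff by blast
next
  case (composite G G' \<phi> f G'' \<psi> f')
  interpret composed G G' G'' \<phi> \<psi>
    using composite.hyps is_pullback_contraction by (simp add: composed_def contracting_iff)
  have x: "pulls_back G' G'' \<psi> c (f' c)"
    using composite by blast
  then have "pulls_back G G' \<phi> (f' c) (f (f' c))"
    using composite.IH(1) B.pulls_backD(1) by blast
  then show ?case
    using pulls_back_comp[OF composite.prems x] by simp
qed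

lemma pulls_back_sw_pullback:
  assumes "contraction G G' \<phi>" "graph_of_genus g G" "c \<in> sw_complex G'"
  shows "pulls_back G G' \<phi> c (sw_pullback G G' \<phi> c)"
proof -
  have "is_pullback G G' \<phi> (sw_pullback G G' \<phi>)"
    unfolding sw_pullback_def using is_pullback_exists[OF assms(1,2)] by (rule someI_ex)
  then show ?thesis
    using assms(3) by (rule is_pullback_pulls_back)
qed

section \<open>Spanning forests of half-edges\<close>

context rooted_graph
begin

text \<open>The half-edges that do not point to the root form an ordered forest: below the half-edge
  at the lower end of a tree edge hang the half-edges at its upper end.\<close>

definition nodes :: "half set" where
  "nodes = {h \<in> halves G. hvert G h = r \<or> h \<noteq> par (hvert G h)}"

definition kid :: "(half \<times> half) set" where
  "kid = {(opp (par (hvert G k)), k) | k. k \<in> nodes \<and> hvert G k \<noteq> r}"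

lemma nodes_edges: "h \<in> nodes \<Longrightarrow> fst h \<in> edges G"
  by (simp add: nodes_def)

lemma finite_nodes [simp]: "finite nodes"
  by (rule finite_subset[OF _ finite_halves[OF wf]]) (auto simp: nodes_def)

lemma hvert_verts: "fst h \<in> edges G \<Longrightarrow> hvert G h \<in> verts G"
  by (rule wf_graph_hvert[OF wf])

lemma opp_par_node:
  assumes "v \<in> verts G" "v \<noteq> r"
  shows "opp (par v) \<in> nodes"
proof -
  let ?u = "hvert G (opp (par v))"
  have e: "fst (par v) \<in> edges G"
    using par_simps[OF assms] by simp
  have "opp (par v) \<noteq> par ?u" if "?u \<noteq> r"
  proof
    assume eq: "opp (par v) = par ?u"
    have "?u \<in> verts G"
      using hvert_verts[of "opp (par v)"] e by simp
    moreover have "fst (par v) = fst (par ?u)"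
      using arg_cong[OF eq, of fst] by simp
    ultimately have "v = ?u"
      using par_edge_inj[OF assms] that by blast
    then show False
      using par_rk[OF assms] by simp
  qed
  then show ?thesis
    using e by (auto simp: nodes_def)
qed

lemma node_tree_edge:
  assumes "h \<in> nodes" "fst h \<in> tree_edges"
  shows "hvert G (opp h) \<noteq> r" "opp h = par (hvert G (opp h))" "h = opp (par (hvert G (opp h)))"
proof -
  obtain v where v: "v \<in> verts G" "v \<noteq> r" "fst h = fst (par v)"
    using assms(2) by (auto simp: tree_edges_def)
  moreover have "h \<noteq> par v"
    using assms(1) v par_simps[of v] by (auto simp: nodes_def)
  ultimately have "h = opp (par v)"
    by (simp add: fst_eq_cases)
  then show "hvert G (opp h) \<noteq> r" "opp h = par (hvert G (opp h))" "h = opp (par (hvert G (opp h)))"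
    using v par_simps[OF v(1,2)] by auto
qed

lemma chord_node:
  assumes "fst h \<in> chords"
  shows "h \<in> nodes"
proof -
  have "h \<noteq> par (hvert G h)" if "hvert G h \<noteq> r"
  proof
    assume h: "h = par (hvert G h)"
    have "hvert G h \<in> verts G"
      using hvert_verts[of h] assms by (simp add: chords_def)
    then have "fst (par (hvert G h)) \<in> tree_edges"
      using that by (auto simp: tree_edges_def)
    then show False
      using assms h by (simp add: chords_def)
  qed
  then show ?thesis
    using assms by (auto simp: nodes_def chords_def)
qed

text \<open>Of the two halves of a tree edge just the one pointing away from the root is a node,
  while both halves of a chord are. So every half-edge is a node or opposite to one.\<close>

lemma node_cases:
  assumes "fst h \<in> edges G"
  obtains (node) "h \<in> nodes" | (par) "hvert G h \<noteq> r" "h = par (hvert G h)" "opp h \<in> nodes"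
proof (cases "h \<in> nodes")
  case False
  then have "hvert G h \<noteq> r" "h = par (hvert G h)"
    using assms by (auto simp: nodes_def)
  moreover from this have "opp h \<in> nodes"
    using opp_par_node[of "hvert G h"] hvert_verts[OF assms] by simp
  ultimately show ?thesis
    by (rule par)
qed (rule node)

lemma both_nodes: "h \<in> nodes \<Longrightarrow> opp h \<in> nodes \<Longrightarrow> fst h \<in> chords"
  using node_tree_edge[of h] nodes_edges[of h] unfolding chords_def
  by (auto simp: nodes_def)

lemma kidD:
  assumes "(h, k) \<in> kid"
  shows "h \<in> nodes" "k \<in> nodes" "hvert G k \<noteq> r" "opp h = par (hvert G k)" "hvert G (opp h) = hvert G k"
    "rk (hvert G h) < rk (hvert G k)" "fst h \<in> tree_edges"
proof -
  from assms have k: "k \<in> nodes" "hvert G k \<noteq> r" "h = opp (par (hvert G k))"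
    by (auto simp: kid_def)
  then have v: "hvert G k \<in> verts G"
    using hvert_verts nodes_edges by blast
  show "h \<in> nodes" "k \<in> nodes" "hvert G k \<noteq> r" "opp h = par (hvert G k)" "hvert G (opp h) = hvert G k"
    "rk (hvert G h) < rk (hvert G k)"
    using k opp_par_node[OF v] par_rk[OF v] par_simps[OF v] by auto
  show "fst h \<in> tree_edges"
    using k v by (auto simp: tree_edges_def)
qed

lemma kidI: "k \<in> nodes \<Longrightarrow> hvert G k \<noteq> r \<Longrightarrow> (opp (par (hvert G k)), k) \<in> kid"
  by (auto simp: kid_def)

lemma kid_iff:
  assumes "h \<in> nodes" "fst h \<in> tree_edges"
  shows "(h, k) \<in> kid \<longleftrightarrow> k \<in> nodes \<and> hvert G k = hvert G (opp h)"
proof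
  assume "(h, k) \<in> kid"
  then show "k \<in> nodes \<and> hvert G k = hvert G (opp h)"
    using kidD by metis
next
  assume k: "k \<in> nodes \<and> hvert G k = hvert G (opp h)"
  then show "(h, k) \<in> kid"
    using kidI[of k] node_tree_edge[OF assms] by metis
qed

lemma kid_rk: "(h, k) \<in> kid\<^sup>+ \<Longrightarrow> rk (hvert G h) < rk (hvert G k)"
  by (induction rule: trancl_induct) (auto dest: kidD(6))

lemma kid_nodes: "(h, k) \<in> kid\<^sup>+ \<Longrightarrow> h \<in> nodes \<and> k \<in> nodes"
  by (induction rule: trancl_induct) (auto dest: kidD)

lemma kid_unique: "(a, k) \<in> kid \<Longrightarrow> (b, k) \<in> kid \<Longrightarrow> a = b"
  by (auto simp: kid_def)

lemma kid_last:
  assumes "(a, k) \<in> kid\<^sup>+" "(b, k) \<in> kid"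
  shows "(a, b) \<in> kid\<^sup>*"
  using assms(1)
proof (cases rule: tranclE)
  case base
  then show ?thesis using kid_unique assms(2) by blast
next
  case (step c)
  then have "c = b"
    using kid_unique assms(2) by blast
  then show ?thesis
    using step(1) by auto
qed

lemma kid_comparable:
  assumes "(a, k) \<in> kid\<^sup>*" "(b, k) \<in> kid\<^sup>*"
  shows "(a, b) \<in> kid\<^sup>* \<or> (b, a) \<in> kid\<^sup>*"
  using assms(1,2)
proof (induction arbitrary: b rule: rtrancl_induct)
  case (step y z)
  show ?case
  proof (cases "b = z")
    case True
    then show ?thesis
      using step.hyps by (meson rtrancl.rtrancl_into_rtrancl)
  next
    case False
    then have "(b, z) \<in> kid\<^sup>+"
      using step.prems by (metis rtranclD)
    then have "(b, y) \<in> kid\<^sup>*"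
      using kid_last step.hyps(2) by blast
    then show ?thesis
      by (rule step.IH)
  qed
qed auto

text \<open>The ancestors of a node form a chain along which the rank of the vertex grows strictly,
  so two of them at one vertex coincide. This separates the subtrees of siblings.\<close>

lemma kid_siblings:
  assumes "(a, k) \<in> kid\<^sup>*" "(b, k) \<in> kid\<^sup>*" "hvert G a = hvert G b"
  shows "a = b"
  using kid_comparable[OF assms(1,2)] assms(3) kid_rk[of a b] kid_rk[of b a]
  by (auto simp: rtrancl_eq_or_trancl)

text \<open>The order of siblings is an arbitrary choice that the tree records; it enters the
  preorder by which words are compared.\<close>

primrec is_forest :: "half tree \<Rightarrow> half list \<Rightarrow> bool" where
  "is_forest Leaf hs \<longleftrightarrow> hs = []"
| "is_forest (Node l h s) hs \<longleftrightarrow> (\<exists>ks hs'. hs = h # hs' \<and> set ks = kid `` {h} \<and> distinct ks \<and>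
     is_forest l ks \<and> is_forest s hs')"

lemma is_forest_props:
  assumes "is_forest F hs" "distinct hs" "set hs \<subseteq> nodes" "\<And>h k. h \<in> set hs \<Longrightarrow> k \<in> set hs \<Longrightarrow> hvert G h = hvert G k"
  shows "set_tree F = kid\<^sup>* `` set hs \<and> tree_distinct F \<and> tree_anc F = kid\<^sup>+ \<inter> (set_tree F \<times> set_tree F)"
  using assms
proof (induction F arbitrary: hs)
  case (Node l h s)
  then obtain ks hs' where hs: "hs = h # hs'" "set ks = kid `` {h}" "distinct ks" "is_forest l ks" "is_forest s hs'"
    by auto
  have "set ks \<subseteq> nodes"
    using hs(2) kidD by auto
  moreover have "hvert G a = hvert G b" if "a \<in> set ks" "b \<in> set ks" for a b
    using that kidD(5)[of h a] kidD(5)[of h b] hs(2) by auto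
  ultimately have L: "set_tree l = kid\<^sup>* `` set ks" "tree_distinct l" "tree_anc l = kid\<^sup>+ \<inter> (set_tree l \<times> set_tree l)"
    using Node.IH(1)[OF hs(4,3)] by blast+
  have S: "set_tree s = kid\<^sup>* `` set hs'" "tree_distinct s" "tree_anc s = kid\<^sup>+ \<inter> (set_tree s \<times> set_tree s)"
    using Node.IH(2)[OF hs(5)] Node.prems hs(1) by auto
  have L': "set_tree l = kid\<^sup>+ `` {h}"
    unfolding L(1) hs(2) by (auto simp: trancl_unfold_left)
  have irr: "(a, a) \<notin> kid\<^sup>+" for a
    using kid_rk[of a a] by blast
  \<comment> \<open>Subtrees of siblings are disjoint: a common descendant would have two ancestors
    at one vertex.\<close>
  have sib: "x \<notin> kid\<^sup>* `` {h}" if "x \<in> set_tree s" for x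
  proof
    assume "x \<in> kid\<^sup>* `` {h}"
    moreover have "x \<in> kid\<^sup>* `` set hs'"
      using that S(1) by simp
    then obtain k where "k \<in> set hs'" "(k, x) \<in> kid\<^sup>*"
      by (rule ImageE)
    ultimately have "h = k"
      using kid_siblings[of h x k] Node.prems(4)[of h k] hs(1) by simp
    then show False
      using \<open>k \<in> set hs'\<close> Node.prems(2) hs(1) by simp
  qed
  have S_closed: "y \<in> set_tree s" if "x \<in> set_tree s" "(x, y) \<in> kid\<^sup>+" for x y
  proof -
    have "x \<in> kid\<^sup>* `` set hs'"
      using that S(1) by simp
    then obtain k where "k \<in> set hs'" "(k, x) \<in> kid\<^sup>*"
      by (rule ImageE)
    moreover from this have "(k, y) \<in> kid\<^sup>*"
      using that(2) by (meson rtrancl_trans trancl_into_rtrancl)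
    ultimately show ?thesis
      unfolding S(1) by (intro ImageI)
  qed
  have h_S: "(x, h) \<notin> kid\<^sup>+" if "x \<in> set_tree s" for x
    using S_closed[OF that] sib by blast
  have hset: "set_tree (Node l h s) = {h} \<union> kid\<^sup>+ `` {h} \<union> set_tree s"
    using L' by auto
  have "set_tree (Node l h s) = kid\<^sup>* `` set hs"
    unfolding hset S(1) hs(1) by (auto simp: rtrancl_eq_or_trancl)
  moreover have "tree_distinct (Node l h s)"
  proof -
    have "h \<notin> set_tree l"
      unfolding L' using irr by simp
    moreover have "h \<notin> set_tree s"
      using sib[of h] by blast
    moreover have "x \<notin> set_tree s" if "x \<in> set_tree l" for x
    proof -
      have "x \<in> kid\<^sup>* `` {h}"
        using that unfolding L' by (simp add: trancl_into_rtrancl)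
      then show ?thesis
        using sib[of x] by blast
    qed
    ultimately show ?thesis
      using L(2) S(2) by auto
  qed
  moreover have "tree_anc (Node l h s) = kid\<^sup>+ \<inter> (set_tree (Node l h s) \<times> set_tree (Node l h s))"
  proof (intro equalityI subrelI)
    fix x y assume "(x, y) \<in> tree_anc (Node l h s)"
    then show "(x, y) \<in> kid\<^sup>+ \<inter> (set_tree (Node l h s) \<times> set_tree (Node l h s))"
      using L(3) S(3) L' by auto
  next
    fix x y assume "(x, y) \<in> kid\<^sup>+ \<inter> (set_tree (Node l h s) \<times> set_tree (Node l h s))"
    then have xy: "(x, y) \<in> kid\<^sup>+" "x = h \<or> x \<in> set_tree l \<or> x \<in> set_tree s" "y = h \<or> y \<in> set_tree l \<or> y \<in> set_tree s"
      by auto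
    from xy(2) consider "x = h" | "x \<in> set_tree l" | "x \<in> set_tree s"
      by blast
    then show "(x, y) \<in> tree_anc (Node l h s)"
    proof cases
      case 1
      then show ?thesis using xy(1) L' by auto
    next
      case 2
      then have "(h, y) \<in> kid\<^sup>+"
        using xy(1) L' by (auto intro: trancl_trans)
      then show ?thesis
        using xy(1) 2 L' L(3) by auto
    next
      case 3
      then show ?thesis
        using xy(1) S_closed S(3) by auto
    qed
  qed
  ultimately show ?case
    by blast
qed auto

lemma is_forest_list:
  assumes "\<And>h. h \<in> set hs \<Longrightarrow> \<exists>l ks. set ks = kid `` {h} \<and> distinct ks \<and> is_forest l ks"
  shows "\<exists>F. is_forest F hs"
  using assms
proof (induction hs)
  case Nil
  show ?case by (intro exI[of _ Leaf]) simp
next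
  case (Cons h hs)
  then obtain s where "is_forest s hs"
    by auto
  moreover obtain l ks where "set ks = kid `` {h}" "distinct ks" "is_forest l ks"
    using Cons.prems[of h] by auto
  ultimately show ?case
    by (intro exI[of _ "Node l h s"]) auto
qed

lemma is_forest_exists:
  assumes "h \<in> nodes"
  shows "\<exists>l ks. set ks = kid `` {h} \<and> distinct ks \<and> is_forest l ks"
  using assms
proof (induction "Max (rk ` verts G) - rk (hvert G h)" arbitrary: h rule: less_induct)
  case less
  have "finite (kid `` {h})"
    by (rule finite_subset[OF _ finite_nodes]) (auto dest: kidD)
  then obtain ks where ks: "set ks = kid `` {h}" "distinct ks"
    using finite_distinct_list by blast
  have "\<exists>l ks. set ks = kid `` {k} \<and> distinct ks \<and> is_forest l ks" if "k \<in> set ks" for k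
  proof (rule less.hyps)
    have hk: "(h, k) \<in> kid"
      using that ks by blast
    then show "k \<in> nodes"
      by (rule kidD)
    then have "rk (hvert G k) \<le> Max (rk ` verts G)"
      using hvert_verts nodes_edges by simp
    then show "Max (rk ` verts G) - rk (hvert G k) < Max (rk ` verts G) - rk (hvert G h)"
      using kidD(6)[OF hk] by linarith
  qed
  then obtain l where "is_forest l ks"
    using is_forest_list by blast
  with ks show ?case
    by blast
qed

definition forest :: "half tree \<Rightarrow> bool" where
  "forest F \<longleftrightarrow> set_tree F = nodes \<and> tree_distinct F \<and> tree_anc F = kid\<^sup>+"

lemma forest_exists: "\<exists>F. forest F"
proof -
  let ?R = "{h \<in> nodes. hvert G h = r}"
  obtain hs where hs: "set hs = ?R" "distinct hs"
    using finite_distinct_list[of ?R] by auto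
  obtain F where F: "is_forest F hs"
    using is_forest_list[of hs] is_forest_exists hs(1) by blast
  have *: "set_tree F = kid\<^sup>* `` ?R \<and> tree_distinct F \<and> tree_anc F = kid\<^sup>+ \<inter> (set_tree F \<times> set_tree F)"
    unfolding hs(1)[symmetric] using hs by (intro is_forest_props[OF F]) auto
  have "k \<in> kid\<^sup>* `` ?R" if "k \<in> nodes" for k
    using that
  proof (induction "rk (hvert G k)" arbitrary: k rule: less_induct)
    case less
    show ?case
    proof (cases "hvert G k = r")
      case False
      let ?h = "opp (par (hvert G k))"
      have hk: "(?h, k) \<in> kid"
        using less.prems False by (rule kidI)
      then have "?h \<in> kid\<^sup>* `` ?R"
        using kidD(1,6) by (intro less.hyps) blast+
      then show ?thesis
        using hk by (meson Image_iff rtrancl.rtrancl_into_rtrancl)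
    qed (use less.prems in auto)
  qed
  then have "nodes \<subseteq> kid\<^sup>* `` ?R"
    by (rule subsetI)
  moreover have "kid\<^sup>* `` ?R \<subseteq> nodes"
    using kid_nodes by (auto simp: rtrancl_eq_or_trancl)
  ultimately have "kid\<^sup>* `` ?R = nodes"
    by (rule subset_antisym[rotated])
  moreover have "kid\<^sup>+ \<inter> (nodes \<times> nodes) = kid\<^sup>+"
    using kid_nodes by auto
  ultimately have "forest F"
    using * unfolding forest_def by simp
  then show ?thesis
    by (rule exI)
qed

end

section \<open>From embeddings of forests to contractions\<close>

text \<open>The embedding runs from the nodes of the smaller graph \<open>G'\<close> to those of
  \<open>G\<close>, against the contraction to be built. Chords are matched by number and end; since
  both graphs have exactly \<open>g\<close> chords, every chord of \<open>G\<close> is hit and only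
  tree edges get contracted.\<close>

locale forest_embedding = R: rooted_graph G r par rk + R': rooted_graph G' r' par' rk'
  for G r par rk G' r' par' rk' +
  fixes \<iota> :: "half \<Rightarrow> half" and num num' :: "nat \<Rightarrow> nat" and g :: nat
  assumes genus: "graph_of_genus g G" "graph_of_genus g G'"
    and \<iota>_node: "x \<in> R'.nodes \<Longrightarrow> \<iota> x \<in> R.nodes"
    and \<iota>_inj: "inj_on \<iota> R'.nodes"
    and \<iota>_kid: "x \<in> R'.nodes \<Longrightarrow> y \<in> R'.nodes \<Longrightarrow> (\<iota> x, \<iota> y) \<in> R.kid\<^sup>+ \<longleftrightarrow> (x, y) \<in> R'.kid\<^sup>+"
    and \<iota>_chord: "x \<in> R'.nodes \<Longrightarrow> fst (\<iota> x) \<in> R.chords \<longleftrightarrow> fst x \<in> R'.chords"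
    and \<iota>_num: "x \<in> R'.nodes \<Longrightarrow> fst x \<in> R'.chords \<Longrightarrow> num (fst (\<iota> x)) = num' (fst x) \<and> snd (\<iota> x) = snd x"
    and num: "bij_betw num R.chords {..<g}" "bij_betw num' R'.chords {..<g}"
begin

lemma \<iota>_eq: "x \<in> R'.nodes \<Longrightarrow> y \<in> R'.nodes \<Longrightarrow> \<iota> x = \<iota> y \<longleftrightarrow> x = y"
  using \<iota>_inj by (rule inj_on_eq_iff)

lemma \<iota>_kid_rtrancl:
  "x \<in> R'.nodes \<Longrightarrow> y \<in> R'.nodes \<Longrightarrow> (\<iota> x, \<iota> y) \<in> R.kid\<^sup>* \<longleftrightarrow> (x, y) \<in> R'.kid\<^sup>*"
  by (auto simp: rtrancl_eq_or_trancl \<iota>_kid \<iota>_eq)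

lemma chord_\<iota>:
  assumes "fst k \<in> R.chords"
  obtains x where "x \<in> R'.nodes" "\<iota> x = k" "fst x \<in> R'.chords" "\<iota> (opp x) = opp k"
proof -
  have "num (fst k) \<in> {..<g}"
    using assms num(1) by (auto simp: bij_betw_def)
  then obtain e where e: "e \<in> R'.chords" "num' e = num (fst k)"
    using num(2) by (metis bij_betw_def imageE)
  have *: "\<iota> (e, b) = (fst k, b)" "(e, b) \<in> R'.nodes" for b
  proof -
    show n: "(e, b) \<in> R'.nodes"
      using e by (intro R'.chord_node) simp
    have "fst (\<iota> (e, b)) \<in> R.chords" "num (fst (\<iota> (e, b))) = num (fst k)" "snd (\<iota> (e, b)) = b"
      using \<iota>_chord[OF n] \<iota>_num[OF n] e by auto
    moreover from this have "fst (\<iota> (e, b)) = fst k"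
      using assms num(1) by (metis bij_betw_inv_into_left)
    ultimately show "\<iota> (e, b) = (fst k, b)"
      by (simp add: prod_eq_iff)
  qed
  show thesis
    using that[of "(e, snd k)"] * e by (simp add: opp_def)
qed

lemma \<iota>_opp_chord:
  assumes "x \<in> R'.nodes" "fst x \<in> R'.chords"
  shows "\<iota> (opp x) = opp (\<iota> x)" "opp x \<in> R'.nodes"
proof -
  show "opp x \<in> R'.nodes"
    using assms(2) by (intro R'.chord_node) simp
  obtain y where "y \<in> R'.nodes" "\<iota> y = \<iota> x" "\<iota> (opp y) = opp (\<iota> x)"
    using chord_\<iota>[of "\<iota> x"] \<iota>_chord[OF assms(1)] assms(2) by blast
  then show "\<iota> (opp x) = opp (\<iota> x)"
    using \<iota>_eq assms(1) by simp
qed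

lemma \<iota>_tree:
  assumes "x \<in> R'.nodes" "fst x \<notin> R'.chords"
  shows "fst (\<iota> x) \<in> R.tree_edges" "fst x \<in> R'.tree_edges" "opp (\<iota> x) \<notin> R.nodes" "opp x \<notin> R'.nodes"
  using assms \<iota>_chord[OF assms(1)] R.nodes_edges[OF \<iota>_node[OF assms(1)]] R'.nodes_edges[OF assms(1)]
    R.both_nodes[of "\<iota> x"] R'.both_nodes[of x] \<iota>_node[OF assms(1)]
  by (auto simp: R.chords_def R'.chords_def)

definition J :: "half set" where "J = \<iota> ` R'.nodes"

definition unemb :: "half \<Rightarrow> half" where "unemb = inv_into R'.nodes \<iota>"

lemma unemb [simp]: "x \<in> R'.nodes \<Longrightarrow> unemb (\<iota> x) = x"
  unfolding unemb_def using \<iota>_inj by simp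

lemma J_nodes: "J \<subseteq> R.nodes"
  using \<iota>_node by (auto simp: J_def)

lemma J_chord: "fst k \<in> R.chords \<Longrightarrow> k \<in> J"
  by (metis J_def chord_\<iota> imageI)

text \<open>The nodes \<open>opp (par v)\<close> and their ancestors are the edges of the tree path
  from the root to \<open>v\<close>; these are the half-edges of \<open>G'\<close> whose images lie
  on that path.\<close>

definition above :: "nat \<Rightarrow> half set" where
  "above v = {x \<in> R'.nodes. v \<noteq> r \<and> (\<iota> x, opp (par v)) \<in> R.kid\<^sup>*}"

text \<open>A vertex follows its path from the root: it goes to the far end of the last edge on the
  path that survives, or to the root if none does.\<close>

definition vm :: "nat \<Rightarrow> nat" where
  "vm v = (if above v = {} then r'
     else hvert G' (opp (SOME x. x \<in> above v \<and> (\<forall>y\<in>above v. (y, x) \<in> R'.kid\<^sup>*))))"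

lemma vm_eq:
  assumes "x \<in> above v" "\<And>y. y \<in> above v \<Longrightarrow> (y, x) \<in> R'.kid\<^sup>*"
  shows "vm v = hvert G' (opp x)"
proof -
  have "x' = x" if "x' \<in> above v \<and> (\<forall>y\<in>above v. (y, x') \<in> R'.kid\<^sup>*)" for x'
  proof -
    have "(x', x) \<in> R'.kid\<^sup>*" "(x, x') \<in> R'.kid\<^sup>*"
      using assms that by auto
    then show ?thesis
      using R'.kid_rk[of x x'] R'.kid_rk[of x' x] by (auto simp: rtrancl_eq_or_trancl)
  qed
  then have "(SOME x. x \<in> above v \<and> (\<forall>y\<in>above v. (y, x) \<in> R'.kid\<^sup>*)) = x"
    using assms by (intro some_equality) auto
  then show ?thesis
    using assms(1) by (auto simp: vm_def)
qed

lemma vm_root [simp]: "vm r = r'"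
  by (simp add: vm_def above_def)

lemma parent_verts:
  assumes "v \<in> verts G" "v \<noteq> r"
  shows "hvert G (opp (par v)) \<in> verts G"
  using R.hvert_verts[of "opp (par v)"] R.par_simps[OF assms] by simp

lemma vm_image:
  assumes v: "v \<in> verts G" "v \<noteq> r" and x: "x \<in> R'.nodes" "\<iota> x = opp (par v)"
  shows "vm v = hvert G' (opp x)"
proof (rule vm_eq)
  show "x \<in> above v"
    using assms by (simp add: above_def)
  fix y assume "y \<in> above v"
  then show "(y, x) \<in> R'.kid\<^sup>*"
    using x \<iota>_kid_rtrancl[of y x] by (auto simp: above_def)
qed

text \<open>The paths to \<open>v\<close> and to its parent differ by one edge, which is not in the
  image.\<close>

lemma vm_parent:
  assumes v: "v \<in> verts G" "v \<noteq> r" and J: "opp (par v) \<notin> J"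
  shows "vm v = vm (hvert G (opp (par v)))"
proof -
  let ?k = "opp (par v)" and ?u = "hvert G (opp (par v))"
  have k: "?k \<in> R.nodes"
    using v by (rule R.opp_par_node)
  have "(\<iota> x, ?k) \<in> R.kid\<^sup>* \<longleftrightarrow> ?u \<noteq> r \<and> (\<iota> x, opp (par ?u)) \<in> R.kid\<^sup>*" if x: "x \<in> R'.nodes" for x
  proof
    assume "(\<iota> x, ?k) \<in> R.kid\<^sup>*"
    moreover have "\<iota> x \<noteq> ?k"
      using J x unfolding J_def by (metis imageI)
    ultimately have t: "(\<iota> x, ?k) \<in> R.kid\<^sup>+"
      by (metis rtranclD)
    then have "?u \<noteq> r"
      using R.kidD(3) by (metis tranclE)
    then show "?u \<noteq> r \<and> (\<iota> x, opp (par ?u)) \<in> R.kid\<^sup>*"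
      using R.kid_last[OF t R.kidI[OF k]] by blast
  next
    assume "?u \<noteq> r \<and> (\<iota> x, opp (par ?u)) \<in> R.kid\<^sup>*"
    then show "(\<iota> x, ?k) \<in> R.kid\<^sup>*"
      using R.kidI[OF k] by (meson rtrancl.rtrancl_into_rtrancl)
  qed
  then have "above v = above ?u"
    using v(2) by (auto simp: above_def)
  then show ?thesis
    by (simp add: vm_def)
qed

text \<open>Ancestry is reflected as well as preserved: the images on the path to the vertex of
  \<open>\<iota> x\<close> are those of the ancestors of \<open>x\<close>, and the last of them is
  the edge through which the vertex of \<open>x\<close> is reached in \<open>G'\<close>.\<close>

lemma vm_node:
  assumes x: "x \<in> R'.nodes"
  shows "vm (hvert G (\<iota> x)) = hvert G' x"
proof -
  let ?v = "hvert G (\<iota> x)"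
  note \<iota>x = \<iota>_node[OF x]
  have below: "(y, x) \<in> R'.kid\<^sup>+" if "y \<in> above ?v" for y
  proof -
    have "?v \<noteq> r" "y \<in> R'.nodes" "(\<iota> y, opp (par ?v)) \<in> R.kid\<^sup>*"
      using that by (auto simp: above_def)
    then have "(\<iota> y, \<iota> x) \<in> R.kid\<^sup>+"
      using R.kidI[OF \<iota>x] by (meson rtrancl_into_trancl1)
    then show ?thesis
      using \<iota>_kid x \<open>y \<in> R'.nodes\<close> by blast
  qed
  show ?thesis
  proof (cases "hvert G' x = r'")
    case True
    have "above ?v = {}"
    proof (rule ccontr)
      assume "above ?v \<noteq> {}"
      then obtain y where "(y, x) \<in> R'.kid\<^sup>+"
        using below by blast
      then show False
        using True R'.kidD(3) by (metis tranclE)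
    qed
    then show ?thesis
      using True by (simp add: vm_def)
  next
    case False
    define y where "y = opp (par' (hvert G' x))"
    have yx: "(y, x) \<in> R'.kid"
      unfolding y_def using x False by (rule R'.kidI)
    then have y: "y \<in> R'.nodes"
      by (rule R'.kidD)
    have t: "(\<iota> y, \<iota> x) \<in> R.kid\<^sup>+"
      using \<iota>_kid y x yx by blast
    then have "?v \<noteq> r"
      using R.kidD(3) by (metis tranclE)
    have "vm ?v = hvert G' (opp y)"
    proof (rule vm_eq)
      show "y \<in> above ?v"
        using y \<open>?v \<noteq> r\<close> R.kid_last[OF t R.kidI[OF \<iota>x]] by (simp add: above_def)
      show "(z, y) \<in> R'.kid\<^sup>*" if "z \<in> above ?v" for z
        using R'.kid_last[OF below[OF that] yx] .
    qed
    then show ?thesis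
      using R'.kidD(5)[OF yx] by simp
  qed
qed

text \<open>The second clause takes care of tree edges, where only the half pointing away from the
  root is an image. On a chord both halves are images and the two clauses agree. An edge with
  neither half in \<open>J\<close> is contracted.\<close>

definition emb_map :: cmap where
  "emb_map = \<lparr>vmap = restrict vm (verts G),
     hmap = (\<lambda>k. if k \<in> J then Some (unemb k) else if opp k \<in> J then Some (opp (unemb (opp k))) else None)\<rparr>"

lemma emb_map_simps:
  "vmap emb_map = restrict vm (verts G)"
  "hmap emb_map k = (if k \<in> J then Some (unemb k) else if opp k \<in> J then Some (opp (unemb (opp k))) else None)"
  by (simp_all add: emb_map_def)

lemma hmap_\<iota>: "x \<in> R'.nodes \<Longrightarrow> hmap emb_map (\<iota> x) = Some x"
  by (simp add: emb_map_simps J_def)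

lemma hmap_opp_\<iota>:
  assumes "x \<in> R'.nodes"
  shows "hmap emb_map (opp (\<iota> x)) = Some (opp x)"
proof (cases "fst x \<in> R'.chords")
  case True
  then show ?thesis
    using \<iota>_opp_chord[OF assms True] hmap_\<iota> by metis
next
  case False
  then have "opp (\<iota> x) \<notin> J"
    using \<iota>_tree[OF assms False] J_nodes by blast
  then show ?thesis
    using assms by (simp add: emb_map_simps J_def)
qed

lemma hmap_emb_cases:
  assumes "hmap emb_map k = Some k'"
  obtains x where "x \<in> R'.nodes" "k = \<iota> x" "k' = x"
  | x where "x \<in> R'.nodes" "k = opp (\<iota> x)" "k' = opp x" "fst x \<notin> R'.chords"
proof (cases "k \<in> J")
  case True
  then obtain x where "x \<in> R'.nodes" "k = \<iota> x"
    by (auto simp: J_def)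
  then show ?thesis
    using assms that(1) hmap_\<iota> by simp
next
  case False
  then have "opp k \<in> J"
    using assms by (auto simp: emb_map_simps split: if_splits)
  then obtain x where x: "x \<in> R'.nodes" "opp k = \<iota> x"
    by (auto simp: J_def)
  then have k: "k = opp (\<iota> x)"
    by (metis opp_simps(4))
  have "fst x \<notin> R'.chords"
    using False \<iota>_opp_chord[OF x(1)] k unfolding J_def by (metis imageI)
  then show ?thesis
    using that(2) x k assms hmap_opp_\<iota> by simp
qed

lemma vm_opp_\<iota>:
  assumes "x \<in> R'.nodes" "fst x \<notin> R'.chords"
  shows "vm (hvert G (opp (\<iota> x))) = hvert G' (opp x)"
proof -
  note t = R.node_tree_edge[OF \<iota>_node[OF assms(1)] \<iota>_tree(1)[OF assms]]
  have "fst (opp (\<iota> x)) \<in> edges G"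
    using R.nodes_edges[OF \<iota>_node[OF assms(1)]] by simp
  then show ?thesis
    using vm_image[OF R.hvert_verts t(1) assms(1)] t(3) by simp
qed

lemma hmap_emb_None:
  assumes "e \<in> edges G" "hmap emb_map (e, b) = None"
  obtains v where "v \<in> verts G" "v \<noteq> r" "e = fst (par v)" "opp (par v) \<notin> J"
proof -
  have n: "(e, b) \<notin> J" "opp (e, b) \<notin> J"
    using assms(2) by (auto simp: emb_map_simps split: if_splits)
  then have "e \<notin> R.chords"
    using J_chord[of "(e, b)"] by auto
  then obtain v where v: "v \<in> verts G" "v \<noteq> r" "e = fst (par v)"
    using assms(1) by (auto simp: R.chords_def R.tree_edges_def)
  then have "opp (par v) = (e, b) \<or> opp (par v) = opp (e, b)"
    using fst_eq_cases[of "opp (par v)" "(e, b)"] by simp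
  then show thesis
    using that v n by metis
qed

lemma hmap_emb_contracted:
  assumes "v \<in> verts G" "v \<noteq> r" "opp (par v) \<notin> J"
  shows "hmap emb_map (par v) = None" "hmap emb_map (opp (par v)) = None"
proof -
  have "fst (par v) \<in> R.tree_edges"
    using assms by (auto simp: R.tree_edges_def)
  then have "par v \<notin> R.nodes"
    using R.both_nodes[of "par v"] R.opp_par_node[OF assms(1,2)] by (auto simp: R.chords_def)
  then have "par v \<notin> J"
    using J_nodes by blast
  then show "hmap emb_map (par v) = None" "hmap emb_map (opp (par v)) = None"
    using assms by (simp_all add: emb_map_simps)
qed

lemma vm_verts: "v \<in> verts G \<Longrightarrow> vm v \<in> verts G'"
proof (induction "rk v" arbitrary: v rule: less_induct)
  case less
  show ?case
  proof (cases "v = r")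
    case False
    show ?thesis
    proof (cases "opp (par v) \<in> J")
      case True
      then obtain x where x: "x \<in> R'.nodes" "\<iota> x = opp (par v)"
        by (auto simp: J_def)
      then show ?thesis
        using vm_image[OF less.prems False x] R'.hvert_verts[of "opp x"] R'.nodes_edges by simp
    next
      case J: False
      show ?thesis
        unfolding vm_parent[OF less.prems False J]
        using R.par_rk[OF less.prems False] parent_verts[OF less.prems False] by (rule less.hyps)
    qed
  qed (simp add: R'.root)
qed

lemma edgewise_emb_map: "edgewise_morphism G G' emb_map"
  unfolding edgewise_morphism_def
proof (intro conjI allI impI ballI)
  show "wf_graph G" "wf_graph G'"
    by (rule R.wf R'.wf)+
  show "vmap emb_map \<in> verts G \<rightarrow>\<^sub>E verts G'"
    using vm_verts by (auto simp: emb_map_simps)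
  show "dom (hmap emb_map) \<subseteq> halves G"
  proof
    fix k assume "k \<in> dom (hmap emb_map)"
    then obtain k' where "hmap emb_map k = Some k'" by blast
    then show "k \<in> halves G"
      by (cases rule: hmap_emb_cases) (use \<iota>_node R.nodes_edges in auto)
  qed
  show "ran (hmap emb_map) \<subseteq> halves G'"
  proof
    fix k' assume "k' \<in> ran (hmap emb_map)"
    then obtain k where "hmap emb_map k = Some k'"
      by (auto simp: ran_def)
    then show "k' \<in> halves G'"
      by (cases rule: hmap_emb_cases) (use R'.nodes_edges in auto)
  qed
  fix e b e' b' assume "hmap emb_map (e, b) = Some (e', b')"
  then have "hmap emb_map (opp (e, b)) = Some (opp (e', b')) \<and> vm (hvert G (e, b)) = hvert G' (e', b') \<and> e \<in> edges G"
  proof (cases rule: hmap_emb_cases)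
    case (1 x)
    have "e \<in> edges G"
      using R.nodes_edges[OF \<iota>_node[OF 1(1)]] arg_cong[OF 1(2), of fst] by simp
    then show ?thesis
      unfolding 1(2,3) using 1(1) hmap_opp_\<iota> vm_node by simp
  next
    case (2 x)
    have "e \<in> edges G"
      using R.nodes_edges[OF \<iota>_node[OF 2(1)]] arg_cong[OF 2(2), of fst] by simp
    then show ?thesis
      unfolding 2(2,3) using 2(1,4) hmap_\<iota> vm_opp_\<iota> by simp
  qed
  then show "hmap emb_map (e, \<not> b) = Some (e', \<not> b')" "vmap emb_map (endpt G e b) = endpt G' e' b'"
    using R.hvert_verts[of "(e, b)"] by (auto simp: emb_map_simps(1))
next
  fix e assume "e \<in> edges G" "hmap emb_map (e, True) = None"
  then obtain v where v: "v \<in> verts G" "v \<noteq> r" "e = fst (par v)" "opp (par v) \<notin> J"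
    by (rule hmap_emb_None)
  have "vm (hvert G (opp (par v))) = vm (hvert G (par v))"
    using vm_parent[OF v(1,2,4)] R.par_simps[OF v(1,2)] by simp
  moreover have "par v = (e, True) \<or> par v = (e, False)"
    using v(3) by (cases "par v"; cases "snd (par v)") auto
  ultimately have "vm (endpt G e False) = vm (endpt G e True)"
    by auto
  then show "vmap emb_map (endpt G e False) = vmap emb_map (endpt G e True)"
    using R.hvert_verts[of "(e, True)"] R.hvert_verts[of "(e, False)"] \<open>e \<in> edges G\<close> by (simp add: emb_map_simps(1))
qed

lemma contraction_emb_map: "contraction G G' emb_map"
proof (rule contractionI[OF edgewise_emb_map genus])
  have "\<exists>v\<in>verts G. vm v = v'" if v': "v' \<in> verts G'" for v'
  proof (cases "v' = r'")
    case True
    then show ?thesis using R.root by (intro bexI[of _ r]) auto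
  next
    case False
    let ?x = "opp (par' v')"
    have x: "?x \<in> R'.nodes"
      using v' False by (rule R'.opp_par_node)
    have "fst ?x \<in> R'.tree_edges"
      using v' False by (auto simp: R'.tree_edges_def)
    then have "vm (hvert G (opp (\<iota> ?x))) = hvert G' (opp ?x)"
      using x by (intro vm_opp_\<iota>) (auto simp: R'.chords_def)
    moreover have "hvert G (opp (\<iota> ?x)) \<in> verts G"
      using R.hvert_verts[of "opp (\<iota> ?x)"] R.nodes_edges \<iota>_node[OF x] by simp
    ultimately show ?thesis
      using R'.par_simps[OF v' False] by auto
  qed
  moreover have "vmap emb_map ` verts G \<subseteq> verts G'"
    using vm_verts by (auto simp: emb_map_simps)
  ultimately show "vmap emb_map ` verts G = verts G'"
    by (auto simp: emb_map_simps image_iff)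
  show "ran (hmap emb_map) = halves G'"
  proof (intro equalityI subsetI)
    fix k' assume "k' \<in> ran (hmap emb_map)"
    then show "k' \<in> halves G'"
      using edgewise_emb_map unfolding edgewise_morphism_def by blast
  next
    fix k' assume "k' \<in> halves G'"
    then have "fst k' \<in> edges G'"
      by simp
    then show "k' \<in> ran (hmap emb_map)"
    proof (cases rule: R'.node_cases)
      case node
      then show ?thesis
        using hmap_\<iota> by (metis ranI)
    next
      case par
      then show ?thesis
        using hmap_opp_\<iota>[of "opp k'"] by (metis opp_simps(4) ranI)
    qed
  qed
  show "inj_on (hmap emb_map) (dom (hmap emb_map))"
  proof (rule inj_onI)
    fix h k assume "h \<in> dom (hmap emb_map)" and eq: "hmap emb_map h = hmap emb_map k"
    then obtain k' where h: "hmap emb_map h = Some k'"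
      by blast
    then have k: "hmap emb_map k = Some k'"
      using eq by simp
    from h show "h = k"
    proof (cases rule: hmap_emb_cases)
      case (1 x)
      from k show ?thesis
        by (cases rule: hmap_emb_cases) (use 1 \<iota>_tree(4) in auto)
    next
      case (2 x)
      from k show ?thesis
        by (cases rule: hmap_emb_cases) (use 2 \<iota>_tree(4) in \<open>auto dest: arg_cong[of "opp x" _ opp]\<close>)
    qed
  qed
  fix w assume w: "w \<in> verts G'"
  let ?F = "fibre G emb_map w"
  \<comment> \<open>The vertex of the fibre nearest to the root: the root itself, or the far end of
    the image of the edge leading to \<open>w\<close>. Every vertex of the fibre reaches it through
    contracted parent edges.\<close>
  define t where "t = (if w = r' then r else hvert G (opp (\<iota> (opp (par' w)))))"
  have to_t: "(v, t) \<in> (adj ?F)\<^sup>*" if "v \<in> verts G" "vm v = w" for v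
    using that
  proof (induction "rk v" arbitrary: v rule: less_induct)
    case less
    show ?case
    proof (cases "v = r")
      case True
      then show ?thesis
        using less.prems by (simp add: t_def)
    next
      case False
      show ?thesis
      proof (cases "opp (par v) \<in> J")
        case True
        then obtain x where x: "x \<in> R'.nodes" "\<iota> x = opp (par v)"
          by (auto simp: J_def)
        have "fst (\<iota> x) \<in> R.tree_edges"
          using x less.prems False by (auto simp: R.tree_edges_def)
        then have "fst x \<notin> R'.chords"
          using \<iota>_chord[OF x(1)] by (auto simp: R.chords_def)
        then have xt: "fst x \<in> R'.tree_edges"
          using R'.nodes_edges[OF x(1)] by (simp add: R'.chords_def)
        have "w = hvert G' (opp x)"
          using vm_image[OF less.prems(1) False x] less.prems by simp
        then have "t = hvert G (opp (\<iota> x))"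
          using R'.node_tree_edge[OF x(1) xt] by (simp add: t_def)
        then have "t = v"
          using x R.par_simps[OF less.prems(1) False] by simp
        then show ?thesis by simp
      next
        case J: False
        let ?u = "hvert G (opp (par v))"
        have u: "?u \<in> verts G" "vm ?u = w"
          using parent_verts[OF less.prems(1) False] vm_parent[OF less.prems(1) False J] less.prems by auto
        have e: "fst (par v) \<in> edges G"
          using R.par_simps[OF less.prems(1) False] by simp
        have "vmap emb_map (hvert G (par v)) = w" "vmap emb_map (hvert G (opp (par v))) = w"
          using R.par_simps[OF less.prems(1) False] less.prems u by (simp_all add: emb_map_simps)
        then have "vmap emb_map (endpt G (fst (par v)) True) = w"
          by (cases "par v"; cases "snd (par v)") auto
        moreover have "fst (par v) \<in> contracted_edges G emb_map"
          using hmap_emb_contracted[OF less.prems(1) False J] e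
          by (cases "par v"; cases "snd (par v)") (auto simp: contracted_edges_def)
        ultimately have "(v, ?u) \<in> adj ?F"
          using adjI[of "par v" ?F] R.par_simps[OF less.prems(1) False] by simp
        then show ?thesis
          using less.hyps[OF R.par_rk[OF less.prems(1) False] u] by (rule converse_rtrancl_into_rtrancl)
      qed
    qed
  qed
  have "sym (adj ?F)"
    unfolding sym_def adj_def by fastforce
  then have sym: "sym ((adj ?F)\<^sup>*)"
    by (rule sym_rtrancl)
  have "(u, v) \<in> (adj ?F)\<^sup>*" if "u \<in> verts G" "v \<in> verts G" "vm u = w" "vm v = w" for u v
    using to_t[OF that(1,3)] symD[OF sym to_t[OF that(2,4)]] by (rule rtrancl_trans)
  then show "connected_graph ?F"
    unfolding connected_graph_adj by (auto simp: emb_map_simps)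
qed

lemma uncontracted_node:
  assumes "k \<in> R.nodes" "fst k \<notin> contracted_edges G emb_map"
  shows "k \<in> J"
proof (rule ccontr)
  assume k: "k \<notin> J"
  then have "fst k \<notin> R.chords"
    using J_chord by blast
  then have "fst k \<in> R.tree_edges"
    using R.nodes_edges[OF assms(1)] by (simp add: R.chords_def)
  note t = R.node_tree_edge[OF assms(1) this]
  have "hvert G (opp k) \<in> verts G"
    using R.hvert_verts[of "opp k"] R.nodes_edges[OF assms(1)] by simp
  then have "hmap emb_map (opp k) = None \<and> hmap emb_map k = None"
    using hmap_emb_contracted[of "hvert G (opp k)"] t k by simp
  then have "fst k \<in> contracted_edges G emb_map"
    using R.nodes_edges[OF assms(1)] by (cases k; cases "snd k") (auto simp: contracted_edges_def)
  then show False
    using assms(2) by blast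
qed

lemma contracted_tree:
  assumes "fst k \<in> contracted_edges G emb_map"
  shows "fst k \<in> R.tree_edges"
proof -
  have "fst k \<in> edges G" "hmap emb_map (fst k, True) = None"
    using assms by (auto simp: contracted_edges_def)
  then obtain v where "v \<in> verts G" "v \<noteq> r" "fst k = fst (par v)"
    by (rule hmap_emb_None)
  then show ?thesis
    by (auto simp: R.tree_edges_def)
qed

end

section \<open>Leading coefficients and noetherianity\<close>

definition edge_mono :: "half list \<Rightarrow> (nat \<Rightarrow>\<^sub>0 nat)" where
  "edge_mono ls = (\<Sum>h\<leftarrow>ls. Poly_Mapping.single (fst h) 1)"

text \<open>A word of length \<open>n\<close> names a coefficient in bidegree \<open>(i, n)\<close>:
  its first \<open>i\<close> letters form the state, while of the other letters only the edges
  count, as factors of the monomial. Different words may name the same coefficient up to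
  sign.\<close>

definition coef :: "graph \<Rightarrow> nat \<Rightarrow> sw_chain \<Rightarrow> half list \<Rightarrow> int" where
  "coef G i c b = Poly_Mapping.lookup (hat G c (take i b)) (edge_mono (drop i b))"

lemma edge_mono_simps [simp]:
  "edge_mono [] = 0" "edge_mono (h # ls) = Poly_Mapping.single (fst h) 1 + edge_mono ls"
  by (simp_all add: edge_mono_def)

lemma keys_edge_mono: "Poly_Mapping.keys (edge_mono ls) = fst ` set ls"
proof (induction ls)
  case (Cons h ls)
  have "Poly_Mapping.keys (Poly_Mapping.single (fst h) (1 :: nat) + m) = insert (fst h) (Poly_Mapping.keys m)" for m
    by (auto simp: in_keys_iff lookup_add lookup_single when_def split: if_splits)
  with Cons show ?case by simp
qed simp

lemma edge_mono_exists:
  assumes "Poly_Mapping.keys m \<subseteq> fst ` X"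
  shows "\<exists>ls. set ls \<subseteq> X \<and> length ls = mono_degree m \<and> edge_mono ls = m"
  using assms
proof (induction "mono_degree m" arbitrary: m)
  case 0
  then have "m = 0"
    using mono_degree_eq_0_iff by metis
  then show ?case by (intro exI[of _ "[]"]) simp
next
  case (Suc d)
  then have "m \<noteq> 0"
    by auto
  then obtain e where e: "e \<in> Poly_Mapping.keys m"
    by (metis in_keys_iff lookup_zero poly_mapping_eqI)
  then obtain h where h: "h \<in> X" "fst h = e"
    using Suc.prems by auto
  define m' where "m' = m - Poly_Mapping.single e 1"
  have m: "m = Poly_Mapping.single e 1 + m'"
  proof (rule poly_mapping_eqI)
    fix x show "Poly_Mapping.lookup m x = Poly_Mapping.lookup (Poly_Mapping.single e 1 + m') x"
      using e by (auto simp: m'_def lookup_add lookup_minus lookup_single when_def in_keys_iff)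
  qed
  then have "mono_degree m = Suc (mono_degree m')"
    by (simp add: mono_degree_add)
  then have d: "d = mono_degree m'"
    using Suc.hyps(2) by simp
  have "Poly_Mapping.keys m' \<subseteq> Poly_Mapping.keys m"
    by (subst m) (auto simp: in_keys_iff lookup_add)
  then have "Poly_Mapping.keys m' \<subseteq> fst ` X"
    using Suc.prems by blast
  then obtain ls where "set ls \<subseteq> X" "length ls = mono_degree m'" "edge_mono ls = m'"
    using Suc.hyps(1)[OF d] by blast
  then show ?case
    using h m d Suc.hyps(2) by (intro exI[of _ "h # ls"]) auto
qed

lemma coef_add: "coef G i (c + d) b = coef G i c b + coef G i d b"
  by (simp add: coef_def hat_add lookup_add)

lemma coef_diff: "coef G i (c - d) b = coef G i c b - coef G i d b"
  by (simp add: coef_def hat_diff lookup_minus)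

lemma coef_0 [simp]: "coef G i 0 b = 0"
  by (simp add: coef_def)

definition zmul :: "int \<Rightarrow> sw_chain \<Rightarrow> sw_chain" where
  "zmul k c = smul (of_int k) c"

lemma zmul_0 [simp]: "zmul 0 c = 0"
  by (rule poly_mapping_eqI) (simp add: zmul_def)

lemma zmul_add: "zmul (k + l) c = zmul k c + zmul l c"
  by (rule poly_mapping_eqI) (simp add: zmul_def lookup_add distrib_right)

lemma zmul_1 [simp]: "zmul 1 c = c"
  by (rule poly_mapping_eqI) (simp add: zmul_def)

lemma zmul_induct:
  assumes "P 0" "\<And>x. P x \<Longrightarrow> P (x + c)" "\<And>x. P x \<Longrightarrow> P (x - c)"
  shows "P (zmul k c)"
proof (induction k rule: int_induct[where k = 0])
  case base
  show ?case using assms(1) by simp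
next
  case (step1 i)
  then show ?case using assms(2) by (simp add: zmul_add)
next
  case (step2 i)
  have "zmul (i - 1) c = zmul i c - c"
    using zmul_add[of "i - 1" 1 c] by simp
  then show ?case using assms(3) step2 by simp
qed

lemma coef_zmul: "coef G i (zmul k c) b = k * coef G i c b"
proof (induction k rule: int_induct[where k = 0])
  case (step1 j)
  then show ?case by (simp add: zmul_add coef_add distrib_right)
next
  case (step2 j)
  have "zmul (j - 1) c = zmul j c - c"
    using zmul_add[of "j - 1" 1 c] by simp
  then show ?case using step2 by (simp add: coef_diff left_diff_distrib)
qed simp

section \<open>Generated subgroups and ideals of the integers\<close>

inductive_set add_span :: "'a::ab_group_add set \<Rightarrow> 'a set" for S where
  zero: "0 \<in> add_span S"
| plus: "x \<in> add_span S \<Longrightarrow> s \<in> S \<Longrightarrow> x + s \<in> add_span S"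
| minus: "x \<in> add_span S \<Longrightarrow> s \<in> S \<Longrightarrow> x - s \<in> add_span S"

lemma add_span_add: "x \<in> add_span S \<Longrightarrow> y \<in> add_span S \<Longrightarrow> x + y \<in> add_span S"
  by (rotate_tac 1, induction y rule: add_span.induct)
    (auto intro: add_span.intros simp: add.assoc[symmetric] add_diff_eq)

lemma add_span_uminus: "x \<in> add_span S \<Longrightarrow> - x \<in> add_span S"
proof (induction x rule: add_span.induct)
  case zero
  show ?case by (simp add: add_span.zero)
next
  case (plus x s)
  then show ?case using add_span.minus[of "- x" S s] by simp
next
  case (minus x s)
  then show ?case using add_span.plus[of "- x" S s] by simp
qed

lemma add_span_gen: "s \<in> S \<Longrightarrow> s \<in> add_span S"
  using add_span.plus[OF add_span.zero] by force

lemma add_span_zmul: "s \<in> S \<Longrightarrow> zmul k s \<in> add_span S"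
  by (rule zmul_induct) (auto intro: add_span.intros)

lemma int_subgroup_principal:
  fixes J :: "int set"
  assumes "0 \<in> J" "\<And>a b. a \<in> J \<Longrightarrow> b \<in> J \<Longrightarrow> a - b \<in> J"
  shows "\<exists>d\<in>J. \<forall>a\<in>J. d dvd a"
proof (cases "J = {0}")
  case False
  have neg: "- a \<in> J" if "a \<in> J" for a
    using assms(2)[OF assms(1) that] by simp
  have plus: "a + b \<in> J" if "a \<in> J" "b \<in> J" for a b
    using assms(2)[OF that(1) neg[OF that(2)]] by simp
  have mult: "k * a \<in> J" if "a \<in> J" for k a
  proof (induction k rule: int_induct[where k = 0])
    case (step1 j)
    then show ?case using plus[OF _ that] by (simp add: distrib_right)
  next
    case (step2 j)
    then show ?case using assms(2)[OF _ that] by (simp add: left_diff_distrib)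
  qed (use assms in simp)
  obtain a where a: "a \<in> J" "a \<noteq> 0"
    using False assms(1) by blast
  have "\<exists>n>0. int n \<in> J"
    using a neg[OF a(1)] by (intro exI[of _ "nat \<bar>a\<bar>"]) (auto simp: abs_if)
  then have n: "0 < (LEAST n. 0 < n \<and> int n \<in> J) \<and> int (LEAST n. 0 < n \<and> int n \<in> J) \<in> J"
    by (rule LeastI_ex)
  define d where "d = (LEAST n. 0 < n \<and> int n \<in> J)"
  have d: "0 < d" "int d \<in> J"
    using n by (auto simp: d_def)
  have "int d dvd b" if b: "b \<in> J" for b
  proof (rule ccontr)
    assume nd: "\<not> int d dvd b"
    have "b - (b div int d) * int d \<in> J"
      using b mult[OF d(2)] by (rule assms(2))
    then have "b mod int d \<in> J"
      by (simp add: minus_div_mult_eq_mod)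
    moreover have "b mod int d \<noteq> 0"
      using nd by (simp add: dvd_eq_mod_eq_0)
    moreover have "0 \<le> b mod int d" "b mod int d < int d"
      using d(1) by (simp_all add: pos_mod_sign pos_mod_bound)
    ultimately have "0 < nat (b mod int d) \<and> int (nat (b mod int d)) \<in> J" and lt: "nat (b mod int d) < d"
      by simp_all
    then have "d \<le> nat (b mod int d)"
      unfolding d_def by (intro Least_le)
    then show False
      using lt by simp
  qed
  with d show ?thesis by blast
qed auto

lemma map_le_lex: "list_all2 (\<lambda>x y. f x \<le> g y) xs ys \<Longrightarrow> map f xs \<le> (map g ys :: nat list)"
  by (induction xs ys rule: list_all2_induct) auto

section \<open>Coefficients at words of nodes and leading words\<close>

context rooted_graph
begin

lemma coef_determines:
  assumes c: "c \<in> sw_part G i n" and zero: "\<And>b. set b \<subseteq> nodes \<Longrightarrow> length b = n \<Longrightarrow> coef G i c b = 0"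
  shows "c = 0"
proof -
  define ref where "ref v = (if v \<in> verts G - {r} then Some (par v) else None)" for v
  note c' = c[unfolded sw_part_iff[OF wf] sw_complex_iff[OF wf]]
  show ?thesis
  proof (rule reference_determines[OF wf, where ref = ref])
    show "vertex_sums_zero G c" "Poly_Mapping.keys c \<subseteq> states G"
      using c' by auto
    fix s assume s: "s \<in> states G" "\<And>v. s v = None \<or> s v \<noteq> ref v"
    then obtain ks where ks: "distinct (map (hvert G) ks)" "fst ` set ks \<subseteq> edges G" "state_of G ks = s"
      using states_state_of[OF wf] by metis
    have nodes: "k \<in> nodes" if "k \<in> set ks" for k
    proof (rule ccontr)
      assume "k \<notin> nodes"
      moreover have "fst k \<in> edges G"
        using that ks(2) by blast
      ultimately have "hvert G k \<noteq> r" "k = par (hvert G k)" "hvert G k \<in> verts G"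
        using hvert_verts by (auto simp: nodes_def)
      moreover have "s (hvert G k) = Some k"
        using that state_of_Some[OF ks(1)] ks(3) by simp
      ultimately show False
        using s(2)[of "hvert G k"] by (simp add: ref_def)
    qed
    have "hat G c ks = 0"
    proof (rule ccontr)
      assume nz: "hat G c ks \<noteq> 0"
      then have i: "length ks = i" "i \<le> n" "homogeneous (n - i) (hat G c ks)"
        using c' by auto
      obtain m where m: "m \<in> Poly_Mapping.keys (hat G c ks)"
        using nz by (metis all_not_in_conv keys_eq_empty)
      have "hat G c ks \<in> A_ring G"
        using c' by (intro hat_A_ring) auto
      then have "Poly_Mapping.keys m \<subseteq> edges G"
        using m by (auto simp: A_ring_def)
      also have "edges G \<subseteq> fst ` nodes"
      proof
        fix e assume "e \<in> edges G"
        then have "fst (e, True) \<in> edges G" by simp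
        then show "e \<in> fst ` nodes"
          by (cases rule: node_cases) (metis fst_conv image_eqI opp_simps(2))+
      qed
      finally obtain ls where ls: "set ls \<subseteq> nodes" "length ls = mono_degree m" "edge_mono ls = m"
        using edge_mono_exists by blast
      have "mono_degree m = n - i"
        using m i(3) by (auto simp: homogeneous_def)
      then have "coef G i c (ks @ ls) = 0"
        using ls nodes i by (intro zero) auto
      then show False
        using m i ls by (simp add: coef_def in_keys_iff)
    qed
    then show "Poly_Mapping.lookup c s = 0"
      using ks by (simp add: hat_def)
  qed
qed

text \<open>The word \<open>b\<close> bounds from above the words with nonzero coefficient, but its
  own coefficient may be zero; this makes the coefficients at \<open>b\<close> a subgroup of the
  integers. Words are compared lexicographically by the index of their letters.\<close>

definition lead :: "(half \<Rightarrow> nat) \<Rightarrow> nat \<Rightarrow> sw_chain \<Rightarrow> half list \<Rightarrow> bool" where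
  "lead idx i c b \<longleftrightarrow> set b \<subseteq> nodes \<and>
     (\<forall>b'. set b' \<subseteq> nodes \<and> length b' = length b \<and> map idx b < map idx b' \<longrightarrow> coef G i c b' = 0)"

end

section \<open>Leading words under the pullback of an embedding\<close>

context forest_embedding
begin

sublocale C: contracting G G' emb_map
  using contraction_emb_map by (simp add: contracting_iff)

lemma hm_\<iota>:
  assumes "x \<in> R'.nodes"
  shows "fst (\<iota> x) \<in> edges G - C.C" "C.hm (\<iota> x) = x" "pre_edge emb_map (fst x) = fst (\<iota> x)"
proof -
  have h: "hmap emb_map (\<iota> x) = Some x"
    using assms by (rule hmap_\<iota>)
  then show hm: "C.hm (\<iota> x) = x"
    by (simp add: C.hm_def)
  show "fst (\<iota> x) \<in> edges G - C.C"
    using h C.hmap_None_iff[of "\<iota> x"] by auto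
  then show "pre_edge emb_map (fst x) = fst (\<iota> x)"
    using C.pre_edge_hm[of "\<iota> x"] hm by simp
qed

lemma rename_edge_mono:
  "set b \<subseteq> R'.nodes \<Longrightarrow> rename_mono (pre_edge emb_map) (edge_mono b) = edge_mono (map \<iota> b)"
  by (induction b) (auto simp: rename_mono_add hm_\<iota>, simp add: rename_mono_def)

context
  fixes c y
  assumes c: "c \<in> sw_complex G'" and y: "pulls_back G G' emb_map c y"
begin

text \<open>Image words contain no contracted letter, and there a pullback is a relabelling.\<close>

lemma coef_\<iota>:
  assumes b: "set b \<subseteq> R'.nodes"
  shows "coef G i y (map \<iota> b) = coef G' i c b"
proof -
  let ?t = "take i b" and ?d = "drop i b"
  have t: "set ?t \<subseteq> R'.nodes" "set ?d \<subseteq> R'.nodes"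
    using b by (auto dest: in_set_takeD in_set_dropD)
  have hm: "map C.hm (map \<iota> ?t) = ?t"
    using t(1) hm_\<iota>(2) by (auto intro!: map_idI)
  have "hat G y (map \<iota> ?t) = rename_vars (pre_edge emb_map) (hat G' c (map C.hm (map \<iota> ?t)))"
    using hm_\<iota>(1) t(1) by (intro C.pulls_backD(2)[OF y]) auto
  then have hat: "hat G y (map \<iota> ?t) = rename_vars (pre_edge emb_map) (hat G' c ?t)"
    unfolding hm .
  have "hat G' c ?t \<in> A_ring G'"
    using c sw_complex_iff[OF C.wf'] by (intro hat_A_ring) blast
  then have "Poly_Mapping.lookup (rename_vars (pre_edge emb_map) (hat G' c ?t))
      (rename_mono (pre_edge emb_map) (edge_mono ?d)) = Poly_Mapping.lookup (hat G' c ?t) (edge_mono ?d)"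
    using t(2) R'.nodes_edges keys_edge_mono[of ?d]
    by (intro lookup_rename_vars[OF C.inj_pre_edge]) (auto simp: A_ring_def)
  then show ?thesis
    unfolding rename_edge_mono[OF t(2)] using hat by (simp add: coef_def take_map drop_map)
qed

text \<open>At lists without contracted half-edges the variables are preimages of edges of
  \<open>G'\<close>; \<open>pulls_back_monomials\<close> spreads this to all lists.\<close>

lemma hat_monomials:
  assumes "m \<in> Poly_Mapping.keys (hat G y ks)"
  shows "Poly_Mapping.keys m \<inter> C.C = {}"
  using y _ assms
proof (rule C.pulls_back_monomials[where Q = "\<lambda>_ m. Poly_Mapping.keys m \<inter> C.C = {}"])
  fix ks m assume "m \<in> Poly_Mapping.keys (rename_vars (pre_edge emb_map) (hat G' c (map C.hm ks)))"
  then obtain m' where m': "m' \<in> Poly_Mapping.keys (hat G' c (map C.hm ks))" "m = rename_mono (pre_edge emb_map) m'"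
    using keys_rename_vars by blast
  have "hat G' c (map C.hm ks) \<in> A_ring G'"
    using c sw_complex_iff[OF C.wf'] by (intro hat_A_ring) blast
  then have "Poly_Mapping.keys m' \<subseteq> edges G'"
    using m' by (auto simp: A_ring_def)
  then have "pre_edge emb_map ` Poly_Mapping.keys m' \<subseteq> edges G - C.C"
    using C.pre_edge_mem by blast
  then show "Poly_Mapping.keys m \<inter> C.C = {}"
    using keys_rename_mono[of "pre_edge emb_map" m'] m'(2) by blast
qed

text \<open>Antisymmetry replaces \<open>k\<close> by minus its opposite, and the vertex sum at the
  far end replaces that by the sum over the other half-edges there. These are the children of
  \<open>k\<close>, because \<open>opp k\<close> is the parent half-edge of that vertex.\<close>

lemma contracted_expand:
  assumes k: "k \<in> R.nodes" "fst k \<in> C.C"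
  shows "hat G y (xs @ k # ys) = (\<Sum>l\<in>R.kid `` {k}. hat G y (xs @ l # ys))"
proof -
  let ?v = "hvert G (opp k)"
  have t: "fst k \<in> R.tree_edges"
    using k(2) by (rule contracted_tree)
  note tk = R.node_tree_edge[OF k(1) t]
  have e: "fst k \<in> edges G"
    using k(1) by (rule R.nodes_edges)
  have nk: "opp k \<notin> R.nodes"
    using R.both_nodes[OF k(1)] t by (auto simp: R.chords_def)
  have v: "?v \<in> verts G"
    using R.hvert_verts[of "opp k"] e by simp
  have "halves_at G ?v - {opp k} = R.kid `` {k}"
  proof (intro equalityI subsetI)
    fix l assume l: "l \<in> halves_at G ?v - {opp k}"
    then have "l \<in> R.nodes"
      using tk(2)[symmetric] by (auto simp: R.nodes_def)
    then show "l \<in> R.kid `` {k}"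
      using R.kid_iff[OF k(1) t] l by simp
  next
    fix l assume "l \<in> R.kid `` {k}"
    then have "l \<in> R.nodes" "hvert G l = ?v"
      using R.kid_iff[OF k(1) t] by auto
    then show "l \<in> halves_at G ?v - {opp k}"
      using nk R.nodes_edges[of l] by auto
  qed
  moreover have "opp k \<in> halves_at G ?v"
    using e by simp
  then have "hat G y (xs @ opp k # ys) + (\<Sum>l\<in>halves_at G ?v - {opp k}. hat G y (xs @ l # ys)) = 0"
    using C.pulls_backD(4)[OF y v, of xs ys] finite_halves_at[OF R.wf, of ?v] by (metis sum.remove)
  moreover have "hat G y (xs @ k # ys) + hat G y (xs @ opp k # ys) = 0"
    using C.pulls_backD(3)[OF y k(2)] .
  ultimately show ?thesis
    by (metis add.commute add_left_cancel)
qed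

text \<open>Contracted letters among the first \<open>i\<close> are replaced by children until none
  is left. Each replacement raises the index of one letter; as indices are at most \<open>M\<close>
  this ends, and the final word, an image under \<open>\<iota>\<close>, dominates \<open>b\<close>
  letter by letter.\<close>

lemma coef_dominated:
  assumes "set b \<subseteq> R.nodes" "coef G i y b \<noteq> 0"
    and idx: "\<And>k l. (k, l) \<in> R.kid \<Longrightarrow> idx k < idx l" and M: "\<And>k. k \<in> R.nodes \<Longrightarrow> idx k \<le> (M :: nat)"
  shows "\<exists>b'. set b' \<subseteq> R'.nodes \<and> length b' = length b \<and> coef G' i c b' \<noteq> 0 \<and>
    list_all2 (\<lambda>x x'. idx x \<le> idx (\<iota> x')) b b'"
  using assms(1,2)
proof (induction "sum_list (map (\<lambda>k. M - idx k) b)" arbitrary: b rule: less_induct)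
  case less
  show ?case
  proof (cases "\<exists>k\<in>set (take i b). fst k \<in> C.C")
    case True
    then obtain k xs ys where k: "fst k \<in> C.C" "take i b = xs @ k # ys"
      by (metis split_list)
    define zs where "zs = drop i b"
    have b: "b = xs @ k # ys @ zs"
      using append_take_drop_id[of i b] k(2) by (simp add: zs_def)
    \<comment> \<open>Exchanging one of the first \<open>i\<close> letters does not move the border
      between state and monomial, even for a word shorter than \<open>i\<close>.\<close>
    have co: "coef G i x (xs @ l # ys @ zs) = Poly_Mapping.lookup (hat G x (xs @ l # ys)) (edge_mono zs)" for x l
    proof -
      have "length (take i b) = length (xs @ k # ys)"
        using k(2) by simp
      then have "length (xs @ l # ys) \<le> i" "i \<le> length b \<Longrightarrow> length (xs @ l # ys) = i"
        by simp_all
      moreover have "zs = []" if "\<not> i \<le> length b"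
        using that by (simp add: zs_def)
      ultimately have "length (xs @ l # ys) = i \<or> length (xs @ l # ys) \<le> i \<and> zs = []"
        by blast
      moreover have "take i (us @ zs) = us \<and> drop i (us @ zs) = zs"
        if "length us = i \<or> length us \<le> i \<and> zs = []" for us :: "half list"
        using that by auto
      ultimately have "take i ((xs @ l # ys) @ zs) = xs @ l # ys \<and> drop i ((xs @ l # ys) @ zs) = zs"
        by metis
      then have "take i (xs @ l # ys @ zs) = xs @ l # ys \<and> drop i (xs @ l # ys @ zs) = zs"
        by (simp only: append_assoc append_Cons)
      then show ?thesis
        by (simp add: coef_def)
    qed
    have kn: "k \<in> R.nodes"
      using less.prems(1) b by simp
    have "coef G i y b = (\<Sum>l\<in>R.kid `` {k}. coef G i y (xs @ l # ys @ zs))"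
      unfolding b co contracted_expand[OF kn k(1)] lookup_sum ..
    then obtain l where l: "(k, l) \<in> R.kid" "coef G i y (xs @ l # ys @ zs) \<noteq> 0"
      using less.prems(2) by (metis (no_types, lifting) Image_singleton_iff sum.neutral)
    let ?b = "xs @ l # ys @ zs"
    have ln: "l \<in> R.nodes"
      using l(1) by (rule R.kidD)
    have "M - idx l < M - idx k"
      using idx[OF l(1)] M[OF ln] by linarith
    then have lt: "sum_list (map (\<lambda>k. M - idx k) ?b) < sum_list (map (\<lambda>k. M - idx k) b)"
      unfolding b map_append list.map sum_list_append sum_list.Cons by linarith
    have "set ?b \<subseteq> R.nodes"
      using less.prems(1) ln b by auto
    from less.hyps[OF lt this l(2)] obtain b' where b': "set b' \<subseteq> R'.nodes" "length b' = length ?b" "coef G' i c b' \<noteq> 0"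
        "list_all2 (\<lambda>x x'. idx x \<le> idx (\<iota> x')) ?b b'"
      by (elim exE conjE)
    have "list_all2 (\<lambda>x x'. idx x \<le> idx x') b ?b"
      unfolding b using idx[OF l(1)] by (auto intro!: list_all2_appendI list_all2_refl)
    then have "list_all2 (\<lambda>x x'. idx x \<le> idx (\<iota> x')) b b'"
      by (rule list_all2_trans[rotated, OF _ b'(4)]) auto
    then show ?thesis
      using b' by (intro exI[of _ b']) (simp add: b)
  next
    case False
    \<comment> \<open>Letters of the state are uncontracted in this case, and letters of the
      monomial always are, so the whole word is an image.\<close>
    have "k \<in> J" if "k \<in> set b" for k
    proof (rule uncontracted_node)
      show "k \<in> R.nodes"
        using that less.prems by blast
      have "edge_mono (drop i b) \<in> Poly_Mapping.keys (hat G y (take i b))"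
        using less.prems(2) by (simp add: coef_def in_keys_iff)
      then have "fst ` set (drop i b) \<inter> C.C = {}"
        using hat_monomials keys_edge_mono by metis
      moreover have "k \<in> set (take i b) \<or> k \<in> set (drop i b)"
        using that by (metis Un_iff append_take_drop_id set_append)
      ultimately show "fst k \<notin> C.C"
        using False by blast
    qed
    then have *: "unemb k \<in> R'.nodes \<and> \<iota> (unemb k) = k" if "k \<in> set b" for k
      using that unemb unfolding J_def by (metis imageE)
    define b' where "b' = map unemb b"
    have "b = map \<iota> b'" "set b' \<subseteq> R'.nodes"
      using * by (auto simp: b'_def intro!: map_idI[symmetric])
    then show ?thesis
      using less.prems(2) coef_\<iota>[of b' i]
      by (intro exI[of _ b']) (auto simp: list_all2_conv_all_nth)
  qed
qed

text \<open>A word above \<open>map \<iota> b\<close> with nonzero coefficient would be dominated by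
  the image of a word at which \<open>c\<close> is nonzero. That word is not above \<open>b\<close>,
  and \<open>\<iota>\<close> preserves the lexicographic order, a contradiction.\<close>

lemma lead_pulls_back:
  assumes idx: "\<And>k l. (k, l) \<in> R.kid \<Longrightarrow> idx k < idx l"
    and idx': "inj_on idx' R'.nodes"
    and mono: "\<And>x y. x \<in> R'.nodes \<Longrightarrow> y \<in> R'.nodes \<Longrightarrow> idx' x < idx' y \<Longrightarrow> idx (\<iota> x) < idx (\<iota> y)"
    and lead: "R'.lead idx' i c b"
  shows "R.lead idx i y (map \<iota> b)"
  unfolding R.lead_def
proof (intro conjI allI impI)
  have b: "set b \<subseteq> R'.nodes"
    using lead by (simp add: R'.lead_def)
  then show "set (map \<iota> b) \<subseteq> R.nodes"
    using \<iota>_node by auto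
  have lex: "map idx' xs \<le> map idx' ys \<Longrightarrow> map idx (map \<iota> xs) \<le> map idx (map \<iota> ys)"
    if "length xs = length ys" "set xs \<subseteq> R'.nodes" "set ys \<subseteq> R'.nodes" for xs ys
    using that
  proof (induction xs ys rule: list_induct2)
    case (Cons x xs y ys)
    then show ?case
      using mono[of x y] inj_onD[OF idx', of x y] by auto
  qed simp
  fix b2 assume b2: "set b2 \<subseteq> R.nodes \<and> length b2 = length (map \<iota> b) \<and> map idx (map \<iota> b) < map idx b2"
  show "coef G i y b2 = 0"
  proof (rule ccontr)
    assume nz: "coef G i y b2 \<noteq> 0"
    have "finite (idx ` R.nodes)"
      by simp
    then have "idx k \<le> Max (idx ` R.nodes)" if "k \<in> R.nodes" for k
      using that by simp
    then obtain b' where b': "set b' \<subseteq> R'.nodes" "length b' = length b2" "coef G' i c b' \<noteq> 0"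
        "list_all2 (\<lambda>x x'. idx x \<le> idx (\<iota> x')) b2 b'"
      using coef_dominated[of b2 i idx] b2 nz idx by metis
    have "\<not> map idx' b < map idx' b'"
      using lead b' b2 unfolding R'.lead_def by auto
    then have "map idx (map \<iota> b') \<le> map idx (map \<iota> b)"
      using b' b2 b by (intro lex) auto
    moreover have "map idx b2 \<le> map idx (map \<iota> b')"
      using map_le_lex[OF b'(4)] by (simp add: o_def)
    ultimately show False
      using b2 by auto
  qed
qed

end

end

section \<open>Decorated graphs and their order by tree embedding\<close>

text \<open>The choices on which leading words depend. They are made for each graph separately; two
  graphs are compared through finite labels derived from them.\<close>

record decoration =
  dgraph :: graph
  droot :: nat
  dpar :: "nat \<Rightarrow> half"
  drk :: "nat \<Rightarrow> nat"
  dforest :: "half tree"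
  dnum :: "nat \<Rightarrow> nat"

definition decorated :: "nat \<Rightarrow> decoration \<Rightarrow> bool" where
  "decorated g D \<longleftrightarrow> graph_of_genus g (dgraph D) \<and> rooted_graph (dgraph D) (droot D) (dpar D) (drk D) \<and>
     rooted_graph.forest (dgraph D) (droot D) (dpar D) (dforest D) \<and>
     bij_betw (dnum D) (rooted_graph.chords (dgraph D) (droot D) (dpar D)) {..<g}"

abbreviation dnodes :: "decoration \<Rightarrow> half set" where
  "dnodes D \<equiv> rooted_graph.nodes (dgraph D) (droot D) (dpar D)"

abbreviation dchords :: "decoration \<Rightarrow> nat set" where
  "dchords D \<equiv> rooted_graph.chords (dgraph D) (droot D) (dpar D)"

abbreviation dindex :: "decoration \<Rightarrow> half \<Rightarrow> nat" where
  "dindex D \<equiv> preorder_index (dforest D)"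

abbreviation dlead :: "decoration \<Rightarrow> nat \<Rightarrow> sw_chain \<Rightarrow> half list \<Rightarrow> bool" where
  "dlead D \<equiv> rooted_graph.lead (dgraph D) (droot D) (dpar D) (dindex D)"

lemma decoration_exists:
  assumes "graph_of_genus g G"
  shows "\<exists>D. decorated g D \<and> dgraph D = G"
proof -
  obtain r where "r \<in> verts G"
    using assms by (auto simp: graph_of_genus_def)
  then obtain par rk where R: "rooted_graph G r par rk"
    using rooted_graph_exists assms unfolding graph_of_genus_def by blast
  interpret R: rooted_graph G r par rk
    by (rule R)
  obtain F where F: "R.forest F"
    using R.forest_exists by blast
  have "card R.chords = g"
    using R.genus_eq_card_chords assms by (simp add: graph_of_genus_def)
  moreover have "finite R.chords"
    by (simp add: R.chords_def)
  ultimately obtain num where "bij_betw num R.chords {..<g}"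
    by (metis ex_bij_betw_finite_nat atLeast0LessThan)
  then show ?thesis
    using R F assms
    by (intro exI[of _ "\<lparr>dgraph = G, droot = r, dpar = par, drk = rk, dforest = F, dnum = num\<rparr>"])
      (simp add: decorated_def)
qed

text \<open>For fixed \<open>g\<close> and \<open>n\<close> this is a finite alphabet: a half of a
  chord shows the number of the chord and its end, and every node shows its positions in the word,
  which forces an embedding to carry one word to the other.\<close>

definition dlabel :: "decoration \<Rightarrow> half list \<Rightarrow> half \<Rightarrow> (nat \<times> bool) option \<times> nat set" where
  "dlabel D b k = (if fst k \<in> dchords D then Some (dnum D (fst k), snd k) else None, {j. j < length b \<and> b ! j = k})"

definition dtree :: "decoration \<times> half list \<Rightarrow> ((nat \<times> bool) option \<times> nat set) tree" where
  "dtree = (\<lambda>(D, b). map_tree (dlabel D b) (dforest D))"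

text \<open>Strict growth of the preorder index makes the node map injective; equal labels give the
  conditions on chords, and equal sets of positions give \<open>b = map \<iota> b'\<close>.\<close>

lemma embedding_of_tree_emb:
  assumes D: "decorated g D" and D': "decorated g D'"
    and b: "set b \<subseteq> dnodes D" "length b = n" and b': "set b' \<subseteq> dnodes D'" "length b' = n"
    and emb: "tree_emb (=) (dtree (D', b')) (dtree (D, b))"
  obtains \<iota> where "forest_embedding (dgraph D) (droot D) (dpar D) (drk D) (dgraph D') (droot D') (dpar D') (drk D') \<iota> (dnum D) (dnum D') g"
    "b = map \<iota> b'"
    "\<And>x y. x \<in> dnodes D' \<Longrightarrow> y \<in> dnodes D' \<Longrightarrow> dindex D' x < dindex D' y \<Longrightarrow> dindex D (\<iota> x) < dindex D (\<iota> y)"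
proof -
  interpret R: rooted_graph "dgraph D" "droot D" "dpar D" "drk D"
    using D by (simp add: decorated_def)
  interpret R': rooted_graph "dgraph D'" "droot D'" "dpar D'" "drk D'"
    using D' by (simp add: decorated_def)
  have F: "set_tree (dforest D) = R.nodes" "tree_distinct (dforest D)" "tree_anc (dforest D) = R.kid\<^sup>+"
    using D by (simp_all add: decorated_def R.forest_def)
  have F': "set_tree (dforest D') = R'.nodes" "tree_distinct (dforest D')" "tree_anc (dforest D') = R'.kid\<^sup>+"
    using D' by (simp_all add: decorated_def R'.forest_def)
  have e: "tree_emb (\<lambda>x y. dlabel D' b' x = dlabel D b y) (dforest D') (dforest D)"
    using emb by (rule tree_emb_map) (simp_all add: dtree_def)
  from tree_emb_map_nodes[OF e F'(2) F(2)] obtain \<iota> where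
    *: "\<forall>x\<in>set_tree (dforest D'). \<iota> x \<in> set_tree (dforest D) \<and> dlabel D' b' x = dlabel D b (\<iota> x)"
    "\<forall>x\<in>set_tree (dforest D'). \<forall>y\<in>set_tree (dforest D').
      dindex D' x < dindex D' y \<longrightarrow> dindex D (\<iota> x) < dindex D (\<iota> y)"
    "\<forall>x\<in>set_tree (dforest D'). \<forall>y\<in>set_tree (dforest D').
      (\<iota> x, \<iota> y) \<in> tree_anc (dforest D) \<longleftrightarrow> (x, y) \<in> tree_anc (dforest D')"
    by (elim exE conjE)
  have \<iota>: "\<iota> x \<in> set_tree (dforest D) \<and> dlabel D' b' x = dlabel D b (\<iota> x)" if "x \<in> set_tree (dforest D')" for x
    using *(1) that by simp
  have mono: "dindex D (\<iota> x) < dindex D (\<iota> y)"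
    if "x \<in> set_tree (dforest D')" "y \<in> set_tree (dforest D')" "dindex D' x < dindex D' y" for x y
    using *(2) that by simp
  have anc: "(\<iota> x, \<iota> y) \<in> tree_anc (dforest D) \<longleftrightarrow> (x, y) \<in> tree_anc (dforest D')"
    if "x \<in> set_tree (dforest D')" "y \<in> set_tree (dforest D')" for x y
    using *(3) that by simp
  have "inj_on \<iota> R'.nodes"
  proof (rule inj_onI)
    fix x y assume xy: "x \<in> R'.nodes" "y \<in> R'.nodes" "\<iota> x = \<iota> y"
    then have "dindex D' x = dindex D' y"
      using mono[of x y] mono[of y x] F'(1) by (metis less_irrefl nat_neq_iff)
    then show "x = y"
      using xy inj_onD[OF inj_on_preorder_index, of "dforest D'" x y] F'(1) by simp
  qed
  moreover have "fst (\<iota> x) \<in> R.chords \<longleftrightarrow> fst x \<in> R'.chords"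
    "fst x \<in> R'.chords \<Longrightarrow> dnum D (fst (\<iota> x)) = dnum D' (fst x) \<and> snd (\<iota> x) = snd x" if "x \<in> R'.nodes" for x
  proof -
    have "dlabel D' b' x = dlabel D b (\<iota> x)"
      using \<iota> that F'(1) by simp
    then show "fst (\<iota> x) \<in> R.chords \<longleftrightarrow> fst x \<in> R'.chords"
        "fst x \<in> R'.chords \<Longrightarrow> dnum D (fst (\<iota> x)) = dnum D' (fst x) \<and> snd (\<iota> x) = snd x"
      unfolding dlabel_def by (auto split: if_splits)
  qed
  ultimately have emb: "forest_embedding (dgraph D) (droot D) (dpar D) (drk D) (dgraph D') (droot D') (dpar D') (drk D') \<iota> (dnum D) (dnum D') g"
    using D D' \<iota> anc F F' by (unfold_locales) (simp_all add: decorated_def)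
  have "b ! j = \<iota> (b' ! j)" if "j < n" for j
  proof -
    have x: "b' ! j \<in> R'.nodes"
      using b' that by (metis nth_mem subsetD)
    then have "snd (dlabel D' b' (b' ! j)) = snd (dlabel D b (\<iota> (b' ! j)))"
      using \<iota> F'(1) by simp
    moreover have "j \<in> snd (dlabel D' b' (b' ! j))"
      using that b' by (simp add: dlabel_def)
    ultimately show ?thesis
      by (simp add: dlabel_def)
  qed
  then have "b = map \<iota> b'"
    using b b' by (intro nth_equalityI) auto
  with emb show thesis
    using that mono F'(1) by simp
qed

lemma almost_full_dtree:
  "almost_full_on (\<lambda>s t. tree_emb (=) (dtree s) (dtree t)) {(D, b). decorated g D \<and> set b \<subseteq> dnodes D \<and> length b = n}"
  unfolding almost_full_on_def
proof (intro allI impI)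
  fix f :: "nat \<Rightarrow> decoration \<times> half list"
  assume f: "range f \<subseteq> {(D, b). decorated g D \<and> set b \<subseteq> dnodes D \<and> length b = n}"
  let ?L = "insert None (Some ` ({..<g} \<times> UNIV)) \<times> Pow {..<n} :: ((nat \<times> bool) option \<times> nat set) set"
  have "finite ?L"
    by simp
  moreover have "set_tree (dtree (f i)) \<subseteq> ?L" for i
  proof -
    obtain D b where Db: "f i = (D, b)"
      by fastforce
    then have D: "decorated g D" "length b = n"
      using f by (auto simp: image_subset_iff dest!: spec[of _ i])
    have "dlabel D b k \<in> ?L" for k
      using D by (auto simp: dlabel_def decorated_def bij_betw_def)
    then show ?thesis
      unfolding Db dtree_def prod.case tree.set_map by (intro image_subsetI)
  qed
  then have "range (dtree \<circ> f) \<subseteq> {t. set_tree t \<subseteq> ?L}"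
    by auto
  ultimately have "\<exists>i j. i < j \<and> tree_emb (=) ((dtree \<circ> f) i) ((dtree \<circ> f) j)"
    using almost_full_on_tree_emb[of ?L] unfolding almost_full_on_def by blast
  then show "\<exists>i j. i < j \<and> tree_emb (=) (dtree (f i)) (dtree (f j))"
    by simp
qed

lemma tree_emb_refl: "tree_emb (=) t t"
  by (induction t) (auto intro: tree_emb.intros)

section \<open>The Groebner basis argument\<close>

locale sw_submodule =
  fixes g i n :: nat and P :: "graph \<Rightarrow> sw_chain set"
  assumes part: "graph_of_genus g G \<Longrightarrow> P G \<subseteq> sw_part G i n"
    and zero: "graph_of_genus g G \<Longrightarrow> 0 \<in> P G"
    and diff: "graph_of_genus g G \<Longrightarrow> x \<in> P G \<Longrightarrow> y \<in> P G \<Longrightarrow> x - y \<in> P G"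
    and pull: "graph_of_genus g G \<Longrightarrow> graph_of_genus g G' \<Longrightarrow> contraction G G' \<phi> \<Longrightarrow> x \<in> P G' \<Longrightarrow>
      sw_pullback G G' \<phi> x \<in> P G"
begin

lemma zmul_P:
  assumes "graph_of_genus g G" "x \<in> P G"
  shows "zmul k x \<in> P G"
proof (rule zmul_induct)
  have neg: "- x \<in> P G"
    using diff[OF assms(1) zero[OF assms(1)] assms(2)] by simp
  show "y + x \<in> P G" if "y \<in> P G" for y
    using diff[OF assms(1) that neg] by simp
qed (use assms zero diff in auto)

definition span_from :: "graph \<Rightarrow> (graph \<times> sw_chain) set \<Rightarrow> sw_chain set" where
  "span_from G X = add_span {sw_pullback G G' \<phi> v | G' \<phi> v. (G', v) \<in> X \<and> contraction G G' \<phi>}"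

definition lead_ideal :: "decoration \<times> half list \<Rightarrow> int set" where
  "lead_ideal = (\<lambda>(D, b). {coef (dgraph D) i x b | x. x \<in> P (dgraph D) \<and> dlead D i x b})"

lemma lead_ideal_subgroup:
  assumes "decorated g D" "set b \<subseteq> dnodes D"
  shows "0 \<in> lead_ideal (D, b)" "a \<in> lead_ideal (D, b) \<Longrightarrow> a' \<in> lead_ideal (D, b) \<Longrightarrow> a - a' \<in> lead_ideal (D, b)"
proof -
  interpret R: rooted_graph "dgraph D" "droot D" "dpar D" "drk D"
    using assms(1) by (simp add: decorated_def)
  have g: "graph_of_genus g (dgraph D)"
    using assms(1) by (simp add: decorated_def)
  show "0 \<in> lead_ideal (D, b)"
    unfolding lead_ideal_def using zero[OF g] assms(2) by (auto simp: R.lead_def intro!: exI[of _ 0])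
  assume "a \<in> lead_ideal (D, b)" "a' \<in> lead_ideal (D, b)"
  then obtain x x' where x: "a = coef (dgraph D) i x b" "x \<in> P (dgraph D)" "R.lead (dindex D) i x b"
      "a' = coef (dgraph D) i x' b" "x' \<in> P (dgraph D)" "R.lead (dindex D) i x' b"
    by (auto simp: lead_ideal_def)
  then have "R.lead (dindex D) i (x - x') b"
    by (simp add: R.lead_def coef_diff)
  moreover have "x - x' \<in> P (dgraph D)"
    using diff[OF g] x by blast
  moreover have "a - a' = coef (dgraph D) i (x - x') b"
    using x by (simp add: coef_diff)
  ultimately show "a - a' \<in> lead_ideal (D, b)"
    by (auto simp: lead_ideal_def)
qed

lemma lead_transfer:
  assumes D: "decorated g D" and D': "decorated g D'"
    and b: "set b \<subseteq> dnodes D" "length b = n" and b': "set b' \<subseteq> dnodes D'" "length b' = n"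
    and emb: "tree_emb (=) (dtree (D', b')) (dtree (D, b))"
    and x: "x \<in> P (dgraph D')" "dlead D' i x b'"
  obtains \<phi> where "contraction (dgraph D) (dgraph D') \<phi>" "dlead D i (sw_pullback (dgraph D) (dgraph D') \<phi> x) b"
    "coef (dgraph D) i (sw_pullback (dgraph D) (dgraph D') \<phi> x) b = coef (dgraph D') i x b'"
proof -
  obtain \<iota> where emb: "forest_embedding (dgraph D) (droot D) (dpar D) (drk D) (dgraph D') (droot D') (dpar D') (drk D') \<iota> (dnum D) (dnum D') g"
    and b\<iota>: "b = map \<iota> b'"
    and mono: "\<And>x y. x \<in> dnodes D' \<Longrightarrow> y \<in> dnodes D' \<Longrightarrow> dindex D' x < dindex D' y \<Longrightarrow> dindex D (\<iota> x) < dindex D (\<iota> y)"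
    using embedding_of_tree_emb[OF D D' b b' emb] by metis
  interpret E: forest_embedding "dgraph D" "droot D" "dpar D" "drk D" "dgraph D'" "droot D'" "dpar D'" "drk D'" \<iota> "dnum D" "dnum D'" g
    by (rule emb)
  have F: "E.R.forest (dforest D)" "E.R'.forest (dforest D')"
    using D D' by (simp_all add: decorated_def)
  have c: "x \<in> sw_complex (dgraph D')"
    using x(1) part[OF E.genus(2)] by (auto simp: sw_part_def)
  let ?y = "sw_pullback (dgraph D) (dgraph D') E.emb_map x"
  have y: "pulls_back (dgraph D) (dgraph D') E.emb_map x ?y"
    using E.contraction_emb_map E.genus(1) c by (rule pulls_back_sw_pullback)
  show thesis
  proof (rule that)
    show "contraction (dgraph D) (dgraph D') E.emb_map"
      by (rule E.contraction_emb_map)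
    show "E.R.lead (dindex D) i ?y b"
      unfolding b\<iota>
    proof (rule E.lead_pulls_back[OF c y])
      show "dindex D k < dindex D l" if "(k, l) \<in> E.R.kid" for k l
        using F(1) that unfolding E.R.forest_def by (intro tree_anc_preorder_index) auto
      show "inj_on (dindex D') E.R'.nodes"
        using inj_on_preorder_index[of "dforest D'"] F(2) unfolding E.R'.forest_def by simp
    qed (use mono x(2) in auto)
    show "coef (dgraph D) i ?y b = coef (dgraph D') i x b'"
      unfolding b\<iota> using b'(1) by (rule E.coef_\<iota>[OF c y])
  qed
qed

lemma lead_ideal_mono:
  assumes "decorated g D" "decorated g D'" "set b \<subseteq> dnodes D" "length b = n"
    "set b' \<subseteq> dnodes D'" "length b' = n" "tree_emb (=) (dtree (D', b')) (dtree (D, b))"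
  shows "lead_ideal (D', b') \<subseteq> lead_ideal (D, b)"
proof
  fix a assume "a \<in> lead_ideal (D', b')"
  then obtain x where x: "a = coef (dgraph D') i x b'" "x \<in> P (dgraph D')" "dlead D' i x b'"
    by (auto simp: lead_ideal_def)
  obtain \<phi> where \<phi>: "contraction (dgraph D) (dgraph D') \<phi>" "dlead D i (sw_pullback (dgraph D) (dgraph D') \<phi> x) b"
    "coef (dgraph D) i (sw_pullback (dgraph D) (dgraph D') \<phi> x) b = coef (dgraph D') i x b'"
    using lead_transfer[OF assms x(2,3)] by metis
  moreover have "sw_pullback (dgraph D) (dgraph D') \<phi> x \<in> P (dgraph D)"
    using assms(1,2) \<phi>(1) x(2) by (intro pull) (simp_all add: decorated_def)
  ultimately show "a \<in> lead_ideal (D, b)"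
    using x(1) by (auto simp: lead_ideal_def intro!: exI[of _ "sw_pullback (dgraph D) (dgraph D') \<phi> x"])
qed

abbreviation monomials :: "(decoration \<times> half list) set" where
  "monomials \<equiv> {(D, b). decorated g D \<and> set b \<subseteq> dnodes D \<and> length b = n}"

text \<open>Along a subsequence increasing for tree embedding the ideals ascend. Their union is a
  subgroup of the integers, hence principal, and once its generator has appeared the ideals no
  longer grow; there two consecutive members are related.\<close>

lemma almost_full_lead_ideal:
  "almost_full_on (\<lambda>s t. tree_emb (=) (dtree s) (dtree t) \<and> lead_ideal t \<subseteq> lead_ideal s) monomials"
  unfolding almost_full_on_def
proof (intro allI impI)
  fix f :: "nat \<Rightarrow> decoration \<times> half list"
  assume f: "range f \<subseteq> monomials"
  obtain h :: "nat \<Rightarrow> nat" where h: "strict_mono h" "\<forall>i j. i < j \<longrightarrow> tree_emb (=) (dtree (f (h i))) (dtree (f (h j)))"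
    using almost_full_on_subsequence[OF almost_full_dtree f] by metis
  define I where "I k = lead_ideal (f (h k))" for k
  have fk: "\<exists>D b. f k = (D, b) \<and> decorated g D \<and> set b \<subseteq> dnodes D \<and> length b = n" for k
    using f by (cases "f k") (auto simp: image_subset_iff dest!: spec[of _ k])
  have mono: "I j \<subseteq> I k" if "j \<le> k" for j k
  proof (cases "j = k")
    case False
    then have emb: "tree_emb (=) (dtree (f (h j))) (dtree (f (h k)))"
      using that h(2) by simp
    obtain D b where 1: "f (h j) = (D, b)" "decorated g D" "set b \<subseteq> dnodes D" "length b = n"
      using fk by blast
    obtain D' b' where 2: "f (h k) = (D', b')" "decorated g D'" "set b' \<subseteq> dnodes D'" "length b' = n"
      using fk by blast
    show ?thesis
      unfolding I_def 1(1) 2(1) using emb 1 2 by (intro lead_ideal_mono) auto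
  qed simp
  have sub: "0 \<in> I k" "a \<in> I k \<Longrightarrow> a' \<in> I k \<Longrightarrow> a - a' \<in> I k" for k a a'
    using fk[of "h k"] lead_ideal_subgroup unfolding I_def by metis+
  define U where "U = (\<Union>k. I k)"
  have "0 \<in> U"
    using sub(1)[of 0] by (auto simp: U_def)
  moreover have "a - a' \<in> U" if a: "a \<in> U" "a' \<in> U" for a a'
  proof -
    obtain k k' where "a \<in> I k" "a' \<in> I k'"
      using a by (auto simp: U_def)
    then have "a \<in> I (max k k')" "a' \<in> I (max k k')"
      using mono[of k "max k k'"] mono[of k' "max k k'"] by auto
    then show ?thesis
      using sub(2) unfolding U_def by blast
  qed
  ultimately obtain d where d: "d \<in> U" "\<forall>a\<in>U. d dvd a"
    using int_subgroup_principal by metis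
  then obtain k where k: "d \<in> I k"
    by (auto simp: U_def)
  have neg: "- a \<in> I k" if "a \<in> I k" for a
    using sub(2)[OF sub(1) that] by simp
  have mult: "q * d \<in> I k" for q
  proof (induction q rule: int_induct[where k = 0])
    case (step1 j)
    then show ?case using sub(2)[OF _ neg[OF k]] by (fastforce simp: distrib_right)
  next
    case (step2 j)
    then show ?case using sub(2)[OF _ k] by (simp add: left_diff_distrib)
  qed (use sub in simp)
  have "I (Suc k) \<subseteq> I k"
  proof
    fix a assume "a \<in> I (Suc k)"
    then have "d dvd a"
      using d(2) by (auto simp: U_def)
    then show "a \<in> I k"
      using mult by (metis dvd_def mult.commute)
  qed
  then show "\<exists>i j. i < j \<and> tree_emb (=) (dtree (f i)) (dtree (f j)) \<and> lead_ideal (f j) \<subseteq> lead_ideal (f i)"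
    using h unfolding I_def by (intro exI[of _ "h k"] exI[of _ "h (Suc k)"]) (simp add: strict_mono_less)
qed

text \<open>For each monomial of a finite basis a chain is chosen whose leading coefficient
  generates the ideal there. Any chain is reduced by subtracting a multiple of a pullback of one of
  these from its leading term; as finitely many words have length \<open>n\<close>, this ends at a
  chain all of whose coefficients at words vanish, which is zero.\<close>

theorem finitely_spanned:
  "\<exists>X. finite X \<and> (\<forall>(G, v)\<in>X. graph_of_genus g G \<and> v \<in> P G) \<and>
     (\<forall>G. graph_of_genus g G \<longrightarrow> P G \<subseteq> span_from G X)"
proof -
  from almost_full_on_finite_basis[OF almost_full_lead_ideal]
  obtain S where S: "finite S" "S \<subseteq> monomials"
      "\<forall>t\<in>monomials. t \<in> S \<or> (\<exists>s\<in>S. tree_emb (=) (dtree s) (dtree t) \<and> lead_ideal t \<subseteq> lead_ideal s)"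
    by (elim exE conjE)
  have "\<forall>s\<in>S. \<exists>v. v \<in> P (dgraph (fst s)) \<and> dlead (fst s) i v (snd s) \<and>
      (\<forall>a\<in>lead_ideal s. coef (dgraph (fst s)) i v (snd s) dvd a)"
  proof
    fix s assume "s \<in> S"
    then obtain D b where s: "s = (D, b)" "decorated g D" "set b \<subseteq> dnodes D"
      using S(2) by auto
    have "\<exists>d\<in>lead_ideal (D, b). \<forall>a\<in>lead_ideal (D, b). d dvd a"
      using lead_ideal_subgroup[OF s(2,3)] by (rule int_subgroup_principal)
    then obtain v where "v \<in> P (dgraph D)" "dlead D i v b" "\<forall>a\<in>lead_ideal (D, b). coef (dgraph D) i v b dvd a"
      by (auto simp: lead_ideal_def)
    then show "\<exists>v. v \<in> P (dgraph (fst s)) \<and> dlead (fst s) i v (snd s) \<and>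
      (\<forall>a\<in>lead_ideal s. coef (dgraph (fst s)) i v (snd s) dvd a)"
      using s(1) by auto
  qed
  then obtain w where w: "\<forall>s\<in>S. w s \<in> P (dgraph (fst s)) \<and> dlead (fst s) i (w s) (snd s) \<and>
      (\<forall>a\<in>lead_ideal s. coef (dgraph (fst s)) i (w s) (snd s) dvd a)"
    unfolding bchoice_iff by (rule exE)
  define X where "X = (\<lambda>s. (dgraph (fst s), w s)) ` S"
  have "finite X"
    using S(1) by (simp add: X_def)
  moreover have "\<forall>(G, v)\<in>X. graph_of_genus g G \<and> v \<in> P G"
    using S(2) w by (auto simp: X_def decorated_def)
  moreover have "x \<in> span_from G X" if g: "graph_of_genus g G" and x: "x \<in> P G" for G x
  proof -
    obtain D where D: "decorated g D" "dgraph D = G"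
      using decoration_exists[OF g] by blast
    interpret R: rooted_graph G "droot D" "dpar D" "drk D"
      using D by (simp add: decorated_def)
    define B where "B = {b. set b \<subseteq> R.nodes \<and> length b = n}"
    define key where "key = map (dindex D)"
    have finB: "finite B"
      unfolding B_def by (rule finite_lists_length_eq) simp
    have "inj_on (dindex D) R.nodes"
      using inj_on_preorder_index[of "dforest D"] D by (simp add: decorated_def R.forest_def)
    then have key_inj: "key b = key b' \<Longrightarrow> b = b'" if "b \<in> B" "b' \<in> B" for b b'
      using that inj_on_mapI[of "dindex D" "{b, b'}"]
      by (auto simp: key_def B_def inj_on_def dest!: map_inj_on inj_on_subset)
    define supp where "supp x = {b \<in> B. coef G i x b \<noteq> 0}" for x
    \<comment> \<open>The measure of the induction: a reduction step kills the coefficient at the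
      leading word and creates none above it, so that word leaves this finite set.\<close>
    define below where "below x = {b \<in> B. \<exists>b'\<in>supp x. key b \<le> key b'}" for x
    show ?thesis
      using x
    proof (induction "card (below x)" arbitrary: x rule: less_induct)
      case less
      show ?case
      proof (cases "supp x = {}")
        case True
        have "x = 0"
          using part[OF g] less.prems True by (intro R.coef_determines[of x i n]) (auto simp: supp_def B_def)
        then show ?thesis
          by (simp add: span_from_def add_span.zero)
      next
        case False
        have fin: "finite (key ` supp x)" "finite (supp x)"
          using finB by (auto simp: supp_def)
        then have "Max (key ` supp x) \<in> key ` supp x"
          using False by (intro Max_in) auto
        then obtain b where b: "b \<in> supp x" "key b = Max (key ` supp x)"
          by (metis imageE)
        have max: "key b' \<le> key b" if "b' \<in> supp x" for b'
          unfolding b(2) using fin that by simp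
        have bB: "set b \<subseteq> R.nodes" "length b = n"
          using b(1) by (auto simp: supp_def B_def)
        have lead: "R.lead (dindex D) i x b"
          unfolding R.lead_def
        proof (intro conjI allI impI)
          fix b' assume b': "set b' \<subseteq> R.nodes \<and> length b' = length b \<and> map (dindex D) b < map (dindex D) b'"
          show "coef G i x b' = 0"
          proof (rule ccontr)
            assume "coef G i x b' \<noteq> 0"
            then have "b' \<in> supp x"
              using b' bB by (simp add: supp_def B_def)
            then have "key b' \<le> key b"
              by (rule max)
            then show False
              using b' by (simp add: key_def leD)
          qed
        qed (rule bB)
        let ?a = "coef G i x b"
        have a: "?a \<in> lead_ideal (D, b)"
          unfolding lead_ideal_def using lead less.prems D(2) by auto
        have "(D, b) \<in> monomials"
          using D bB by simp
        then obtain s where s: "s \<in> S" "tree_emb (=) (dtree s) (dtree (D, b))" "?a \<in> lead_ideal s"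
          using S(3) a tree_emb_refl by blast
        obtain D' b' where s': "s = (D', b')" "decorated g D'" "set b' \<subseteq> dnodes D'" "length b' = n"
          using s(1) S(2) by auto
        have ws: "w s \<in> P (dgraph D')" "dlead D' i (w s) b'" "coef (dgraph D') i (w s) b' dvd ?a"
          using w s(1,3) s'(1) by auto
        obtain \<phi> where \<phi>: "contraction G (dgraph D') \<phi>" "R.lead (dindex D) i (sw_pullback G (dgraph D') \<phi> (w s)) b"
            "coef G i (sw_pullback G (dgraph D') \<phi> (w s)) b = coef (dgraph D') i (w s) b'"
          using lead_transfer[OF D(1) s'(2) _ bB(2) s'(3,4) _ ws(1,2)] s(2) s'(1) bB(1) D(2) by metis
        define y where "y = sw_pullback G (dgraph D') \<phi> (w s)"
        \<comment> \<open>The ideal at \<open>s\<close> contains \<open>?a\<close>, and the leading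
          coefficient of \<open>w s\<close> generates it.\<close>
        obtain q where q: "?a = coef (dgraph D') i (w s) b' * q"
          using ws(3) by (auto simp: dvd_def)
        define x1 where "x1 = x - zmul q y"
        have yP: "y \<in> P G"
          unfolding y_def using g s'(2) \<phi>(1) ws(1) by (intro pull) (auto simp: decorated_def)
        then have x1P: "x1 \<in> P G"
          unfolding x1_def by (intro diff[OF g less.prems] zmul_P[OF g])
        have coef0: "coef G i x1 b = 0"
          using \<phi>(3) q by (simp add: x1_def coef_diff coef_zmul y_def)
        have supp1: "key b2 < key b" if b2: "b2 \<in> supp x1" for b2
        proof (rule ccontr)
          assume nlt: "\<not> key b2 < key b"
          have "b2 \<in> B" "coef G i x1 b2 \<noteq> 0"
            using b2 by (auto simp: supp_def)
          then have "key b2 \<noteq> key b"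
            using coef0 key_inj[of b2 b] b(1) by (auto simp: supp_def)
          then have "map (dindex D) b < map (dindex D) b2"
            using nlt by (simp add: key_def)
          then have "coef G i x b2 = 0" "coef G i y b2 = 0"
            using lead \<phi>(2) \<open>b2 \<in> B\<close> bB unfolding R.lead_def y_def B_def by auto
          then show False
            using \<open>coef G i x1 b2 \<noteq> 0\<close> by (simp add: x1_def coef_diff coef_zmul)
        qed
        have "below x1 \<subset> below x"
        proof
          show "below x1 \<subseteq> below x"
          proof
            fix b2 assume "b2 \<in> below x1"
            then obtain b' where b': "b2 \<in> B" "b' \<in> supp x1" "key b2 \<le> key b'"
              by (auto simp: below_def)
            then have "key b2 \<le> key b"
              using supp1[OF b'(2)] by simp
            then show "b2 \<in> below x"
              using b(1) b'(1) by (auto simp: below_def)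
          qed
          have "b \<in> below x"
            using b(1) by (auto simp: below_def supp_def)
          moreover have "b \<notin> below x1"
            using supp1 leD by (auto simp: below_def)
          ultimately show "below x1 \<noteq> below x"
            by blast
        qed
        then have "card (below x1) < card (below x)"
          using finB by (intro psubset_card_mono) (auto simp: below_def)
        then have "x1 \<in> span_from G X"
          using x1P by (rule less.hyps)
        moreover have "zmul q y \<in> span_from G X"
          unfolding span_from_def
        proof (rule add_span_zmul)
          have "(dgraph D', w s) \<in> X"
            using s(1) s'(1) by (force simp: X_def)
          then show "y \<in> {sw_pullback G G' \<phi> v |G' \<phi> v. (G', v) \<in> X \<and> contraction G G' \<phi>}"
            using \<phi>(1) unfolding y_def by blast
        qed
        ultimately have "x1 + zmul q y \<in> span_from G X"
          unfolding span_from_def by (rule add_span_add)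
        then show ?thesis
          by (simp add: x1_def)
      qed
    qed
  qed
  ultimately show ?thesis
    by blast
qed

end

section \<open>Generation in low degree\<close>

lemma sw_pullback_eqI:
  assumes "contraction G G' \<phi>" "graph_of_genus g G" "c \<in> sw_complex G'" "pulls_back G G' \<phi> c y"
  shows "sw_pullback G G' \<phi> c = y"
  using contracting.pulls_back_unique[OF _ pulls_back_sw_pullback[OF assms(1-3)] assms(4)] assms(1)
  by (simp add: contracting_iff)

lemma sw_complex_0 [simp]: "0 \<in> sw_complex G"
  by (simp add: sw_complex_def A_span.zero)

lemma sw_complex_add: "x \<in> sw_complex G \<Longrightarrow> y \<in> sw_complex G \<Longrightarrow> x + y \<in> sw_complex G"
  unfolding sw_complex_def by (rule A_span_add)

lemma sw_complex_minus: "wf_graph G \<Longrightarrow> x \<in> sw_complex G \<Longrightarrow> - x \<in> sw_complex G"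
  by (simp add: sw_complex_iff vertex_sums_zero_minus A_ring_minus)

lemma sw_part_0 [simp]: "0 \<in> sw_part G i n"
  by (simp add: sw_part_def)

lemma sw_part_degree:
  assumes "x \<in> sw_part G i n" "s \<in> Poly_Mapping.keys x" "m \<in> Poly_Mapping.keys (Poly_Mapping.lookup x s)"
  shows "mono_degree m + card (occupied s) = n"
  using assms unfolding sw_part_def by blast

lemma sw_part_add:
  assumes "x \<in> sw_part G i n" "y \<in> sw_part G i n"
  shows "x + y \<in> sw_part G i n"
  unfolding sw_part_def
proof (intro CollectI conjI ballI)
  show "x + y \<in> sw_complex G"
    using assms sw_complex_add by (auto simp: sw_part_def)
  fix s assume "s \<in> Poly_Mapping.keys (x + y)"
  then have "s \<in> Poly_Mapping.keys x \<or> s \<in> Poly_Mapping.keys y"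
    using Poly_Mapping.keys_add[of x y] by blast
  then show cs: "card (occupied s) = i"
    using assms by (auto simp: sw_part_def)
  fix m assume "m \<in> Poly_Mapping.keys (Poly_Mapping.lookup (x + y) s)"
  then have "m \<in> Poly_Mapping.keys (Poly_Mapping.lookup x s) \<or> m \<in> Poly_Mapping.keys (Poly_Mapping.lookup y s)"
    using Poly_Mapping.keys_add[of "Poly_Mapping.lookup x s" "Poly_Mapping.lookup y s"] by (auto simp: lookup_add)
  moreover have "s \<in> Poly_Mapping.keys z" if "m \<in> Poly_Mapping.keys (Poly_Mapping.lookup z s)" for z :: sw_chain
    using that by (auto simp: in_keys_iff)
  ultimately have "s \<in> Poly_Mapping.keys x \<and> m \<in> Poly_Mapping.keys (Poly_Mapping.lookup x s) \<or>
      s \<in> Poly_Mapping.keys y \<and> m \<in> Poly_Mapping.keys (Poly_Mapping.lookup y s)"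
    by meson
  then show "mono_degree m + card (occupied s) = n"
    using sw_part_degree assms by (elim disjE conjE)
qed

lemma sw_part_minus: "wf_graph G \<Longrightarrow> x \<in> sw_part G i n \<Longrightarrow> - x \<in> sw_part G i n"
  by (auto simp: sw_part_def sw_complex_minus)

lemma sw_part_diff: "wf_graph G \<Longrightarrow> x \<in> sw_part G i n \<Longrightarrow> y \<in> sw_part G i n \<Longrightarrow> x - y \<in> sw_part G i n"
  using sw_part_add[of x G i n "- y"] sw_part_minus[of G y i n] by simp

lemma sw_part_complex: "x \<in> sw_part G i n \<Longrightarrow> x \<in> sw_complex G"
  by (simp add: sw_part_def)

lemma graph_of_genus_wf: "graph_of_genus g G \<Longrightarrow> wf_graph G"
  by (simp add: graph_of_genus_def)

section \<open>Functoriality of the pullback\<close>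

context
  fixes g G G' \<phi>
  assumes con: "contraction G G' \<phi>" and gen: "graph_of_genus g G"
begin

interpretation contracting G G' \<phi>
  using con by (simp add: contracting_iff)

lemma sw_pullback_add:
  assumes "x \<in> sw_complex G'" "y \<in> sw_complex G'"
  shows "sw_pullback G G' \<phi> (x + y) = sw_pullback G G' \<phi> x + sw_pullback G G' \<phi> y"
  using con gen assms by (intro sw_pullback_eqI pulls_back_add pulls_back_sw_pullback sw_complex_add)

lemma sw_pullback_0: "sw_pullback G G' \<phi> 0 = 0"
  using sw_pullback_add[of 0 0] by simp

lemma sw_pullback_minus:
  assumes "x \<in> sw_complex G'"
  shows "sw_pullback G G' \<phi> (- x) = - sw_pullback G G' \<phi> x"
  using sw_pullback_add[OF assms sw_complex_minus[OF wf' assms]] sw_pullback_0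
  by (simp add: add_eq_0_iff)

lemma sw_pullback_part:
  assumes "x \<in> sw_part G' i n"
  shows "sw_pullback G G' \<phi> x \<in> sw_part G i n"
  using con gen assms by (intro pulls_back_part[OF assms] pulls_back_sw_pullback sw_part_complex)

lemma sw_pullback_sw_diff:
  assumes "x \<in> sw_complex G'"
  shows "sw_pullback G G' \<phi> (sw_diff x) = sw_diff (sw_pullback G G' \<phi> x)"
  using con gen assms wf'
  by (intro sw_pullback_eqI pulls_back_sw_diff pulls_back_sw_pullback sw_diff_complex)

end

lemma rename_vars_id:
  assumes "p \<in> A_ring G" "\<And>e. e \<in> edges G \<Longrightarrow> f e = e"
  shows "rename_vars f p = p"
proof -
  have "rename_mono id m = m" for m
  proof (rule poly_mapping_eqI)
    fix e show "Poly_Mapping.lookup (rename_mono id m) e = Poly_Mapping.lookup m e"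
      using lookup_rename_mono[of id UNIV m e] by simp
  qed
  then have "rename_vars id p = p"
    by (simp add: rename_vars_frag_extend frag_expansion[symmetric])
  then show ?thesis
    using rename_vars_cong[OF assms(1), of f id] assms(2) by simp
qed

lemma sw_pullback_id:
  assumes g: "graph_of_genus g G" and x: "x \<in> sw_complex G"
  shows "sw_pullback G G (cmap_id G) x = x"
proof (rule sw_pullback_eqI[OF _ g x])
  have wf: "wf_graph G"
    using g by (rule graph_of_genus_wf)
  show con: "contraction G G (cmap_id G)"
    using wf by (rule contraction_cmap_id)
  interpret contracting G G "cmap_id G"
    using con by (simp add: contracting_iff)
  have hm: "hm h = h" if "fst h \<in> edges G" for h
  proof -
    have "hmap (cmap_id G) h = Some h"
      using that by (simp add: cmap_id_def)
    then show ?thesis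
      by (simp add: hm_def)
  qed
  have C: "C = {}"
    using wf by (rule contraction_cmap_id)
  show "pulls_back G G (cmap_id G) x x"
    unfolding pulls_back_iff C
  proof (intro conjI allI impI)
    fix ks :: "half list" assume ks: "fst ` set ks \<subseteq> edges G - {}"
    have "map hm ks = ks"
      using ks hm by (intro map_idI) auto
    moreover have "rename_vars (pre_edge (cmap_id G)) (hat G x ks) = hat G x ks"
    proof (rule rename_vars_id)
      show "hat G x ks \<in> A_ring G"
        using x sw_complex_iff[OF wf] by (intro hat_A_ring) blast
      show "pre_edge (cmap_id G) e = e" if "e \<in> edges G" for e
        using pre_edge_hm[of "(e, True)"] hm[of "(e, True)"] that C by simp
    qed
    ultimately show "hat G x ks = rename_vars (pre_edge (cmap_id G)) (hat G x (map hm ks))"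
      by simp
  qed (use x in auto)
qed

lemma sw_pullback_comp:
  assumes "graph_of_genus g G" "graph_of_genus g G'" "contraction G G' \<phi>" "contraction G' G'' \<psi>" "x \<in> sw_complex G''"
  shows "sw_pullback G G'' (cmap_comp G \<psi> \<phi>) x = sw_pullback G G' \<phi> (sw_pullback G' G'' \<psi> x)"
proof (rule sw_pullback_eqI[OF contraction_cmap_comp[OF assms(3,4)] assms(1,5)])
  interpret composed G G' G'' \<phi> \<psi>
    using assms by (simp add: composed_def contracting_iff)
  have x: "pulls_back G' G'' \<psi> x (sw_pullback G' G'' \<psi> x)"
    by (rule pulls_back_sw_pullback[OF assms(4,2,5)])
  then have "sw_pullback G' G'' \<psi> x \<in> sw_complex G'"
    by (rule B.pulls_backD)
  then have "pulls_back G G' \<phi> (sw_pullback G' G'' \<psi> x) (sw_pullback G G' \<phi> (sw_pullback G' G'' \<psi> x))"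
    by (rule pulls_back_sw_pullback[OF assms(3,1)])
  then show "pulls_back G G'' (cmap_comp G \<psi> \<phi>) x (sw_pullback G G' \<phi> (sw_pullback G' G'' \<psi> x))"
    by (rule pulls_back_comp[OF assms(5) x])
qed

section \<open>Chains from alternating functions\<close>

definition alternating :: "(half list \<Rightarrow> epoly) \<Rightarrow> bool" where
  "alternating H \<longleftrightarrow> (\<forall>xs k ys. H (xs @ k # ys) = (-1) ^ length xs * H (k # xs @ ys))"

text \<open>Induction on \<open>ls\<close>: its first entry is moved to the front of
  \<open>ks\<close>, and the sign of the move in \<open>H\<close> cancels the one in
  \<open>vsign\<close>.\<close>

lemma alternating_sort:
  assumes "alternating H" "distinct (map f ks)" "distinct (map f ls)" "set ks = set ls"
  shows "vsign (map f ks) * H ks = vsign (map f ls) * H ls"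
  using assms
proof (induction ls arbitrary: ks H)
  case (Cons k ls)
  then have "k \<in> set ks"
    by simp
  then obtain xs ys where ks: "ks = xs @ k # ys"
    by (meson split_list)
  have alt: "alternating (\<lambda>ls. H (k # ls))"
    unfolding alternating_def
  proof (intro allI)
    fix xs l ys
    have "H ((k # xs) @ l # ys) = (-1) ^ length (k # xs) * H (l # (k # xs) @ ys)"
      using Cons.prems(1) unfolding alternating_def by blast
    moreover have "H ([l] @ k # xs @ ys) = (-1) ^ length [l] * H (k # [l] @ xs @ ys)"
      using Cons.prems(1) unfolding alternating_def by blast
    ultimately show "H (k # xs @ l # ys) = (-1) ^ length xs * H (k # l # xs @ ys)"
      by simp
  qed
  have set: "set (xs @ ys) = set ls" and d: "distinct (map f (xs @ ys))" "distinct (map f ls)"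
    using Cons.prems(2-4) ks by (auto simp: distinct_map)
  have IH: "vsign (map f (xs @ ys)) * H (k # xs @ ys) = vsign (map f ls) * H (k # ls)"
    using Cons.IH[OF alt d set] .
  have "vsign (map f ks) = (-1) ^ length xs * vsign (map f (k # xs @ ys))"
    using vsign_move[of "map f xs" "f k" "map f ys"] Cons.prems(2) by (simp add: ks)
  moreover have "H ks = (-1) ^ length xs * H (k # xs @ ys)"
    using Cons.prems(1) unfolding alternating_def ks by blast
  moreover have "(-1 :: epoly) ^ length xs * ((-1) ^ length xs * p) = p" for p
    by (simp add: mult.assoc[symmetric] power_mult_distrib[symmetric])
  ultimately have 1: "vsign (map f ks) * H ks = vsign (map f (k # xs @ ys)) * H (k # xs @ ys)"
    by (simp add: ac_simps)
  have card_filter: "length (filter P us) = card {w \<in> set us. P w}" if "distinct us" for P and us :: "nat list"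
    using distinct_card[OF distinct_filter[OF that, of P]] by simp
  have len: "length (filter (\<lambda>w. w < f k) (map f (xs @ ys))) = length (filter (\<lambda>w. w < f k) (map f ls))"
    by (simp only: card_filter[OF d(1)] card_filter[OF d(2)] set_map set)
  have vs: "vsign (map f (k # us)) = (-1) ^ length (filter (\<lambda>w. w < f k) (map f us)) * vsign (map f us)" for us
    by (simp add: vsign_def power_add)
  show ?case
    unfolding 1 vs len using IH by (simp only: mult.assoc)
qed simp

text \<open>The converse of passing to \<open>hat\<close>: the coefficient at a state is prescribed
  through one chosen listing, and alternation settles the other listings. It serves to reinterpret a
  chain on a smaller graph.\<close>

lemma chain_of_alternating:
  assumes wf: "wf_graph G" and alt: "alternating H"
    and supp: "\<And>ks. H ks \<noteq> 0 \<Longrightarrow> distinct (map (hvert G) ks) \<and> fst ` set ks \<subseteq> edges G"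
  shows "\<exists>c. Poly_Mapping.keys c \<subseteq> states G \<and> (\<forall>ks. hat G c ks = H ks)"
proof -
  have "\<forall>s\<in>states G. \<exists>ks. distinct (map (hvert G) ks) \<and> fst ` set ks \<subseteq> edges G \<and> state_of G ks = s"
    using states_state_of[OF wf] by metis
  then obtain can where can: "\<forall>s\<in>states G. distinct (map (hvert G) (can s)) \<and> fst ` set (can s) \<subseteq> edges G \<and>
      state_of G (can s) = s"
    unfolding bchoice_iff by (rule exE)
  define c where "c = (\<Sum>s\<in>states G. Poly_Mapping.single s (vsign (map (hvert G) (can s)) * H (can s)))"
  have lk: "Poly_Mapping.lookup c s = (if s \<in> states G then vsign (map (hvert G) (can s)) * H (can s) else 0)" for s
    using finite_states[OF wf] by (simp add: c_def lookup_sum lookup_single when_def)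
  have "hat G c ks = H ks" for ks
  proof (cases "distinct (map (hvert G) ks) \<and> fst ` set ks \<subseteq> edges G")
    case True
    let ?s = "state_of G ks"
    have s: "?s \<in> states G"
      using True by (intro state_of_states[OF wf]) simp
    note cs = can[rule_format, OF s]
    have "k \<in> set (can ?s) \<longleftrightarrow> k \<in> set ks" for k
      using state_of_Some[of G "can ?s" "hvert G k" k] state_of_Some[of G ks "hvert G k" k] cs True by simp
    then have "set (can ?s) = set ks"
      by blast
    then have "vsign (map (hvert G) (can ?s)) * H (can ?s) = vsign (map (hvert G) ks) * H ks"
      using cs True by (intro alternating_sort[OF alt]) auto
    then show ?thesis
      using True s by (simp add: hat_def lk)
  next
    case False
    then have "H ks = 0"
      using supp by blast
    moreover have "hat G c ks = 0"
      unfolding hat_def using False by (simp only: if_False)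
    ultimately show ?thesis by simp
  qed
  moreover have "Poly_Mapping.keys c \<subseteq> states G"
    by (auto simp: in_keys_iff lk split: if_splits)
  ultimately show ?thesis
    by blast
qed

text \<open>Since \<open>t\<close> has no half-edge at \<open>v\<close> and none on
  \<open>e\<close>, merging the ends of \<open>e\<close> keeps occupied vertices distinct, and the
  alternating function of \<open>t\<close> can be read unchanged on the contracted graph. Its
  pullback is \<open>t\<close>; antisymmetry on \<open>e\<close> holds because both terms are
  zero.\<close>

lemma pulls_back_contr:
  assumes wf: "wf_graph G" and e: "e \<in> edges G" "endpt G e False \<noteq> endpt G e True"
    and v: "v = endpt G e False \<or> v = endpt G e True"
    and t: "t \<in> sw_part G i n"
    and avoid: "\<And>ks. hat G t ks \<noteq> 0 \<Longrightarrow> v \<notin> hvert G ` set ks \<and> e \<notin> fst ` set ks"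
    and avoid': "\<And>ks m. m \<in> Poly_Mapping.keys (hat G t ks) \<Longrightarrow> e \<notin> Poly_Mapping.keys m"
  shows "\<exists>t'. t' \<in> sw_part (contr G e) i n \<and> pulls_back G (contr G e) (contr_map G e) t' t"
proof -
  let ?K = "contr G e" and ?p = "endpt G e False" and ?c = "endpt G e True"
  have con: "contraction G ?K (contr_map G e)"
    using wf e by (rule contraction_contr)
  interpret contracting G ?K "contr_map G e"
    using con by (simp add: contracting_iff)
  have C: "C = {e}"
    using e(1) by (rule contracted_contr_map)
  note t' = t[unfolded sw_part_iff[OF wf]]
  then have tc: "Poly_Mapping.keys t \<subseteq> states G" "vertex_sums_zero G t" "\<And>s. Poly_Mapping.lookup t s \<in> A_ring G"
    unfolding sw_complex_iff[OF wf] by blast+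
  have supp: "distinct (map (hvert ?K) ks) \<and> fst ` set ks \<subseteq> edges ?K" if nz: "hat G t ks \<noteq> 0" for ks
  proof
    have d: "distinct (map (hvert G) ks)" "fst ` set ks \<subseteq> edges G"
      using hat_nonzeroD[OF nz] by auto
    show "fst ` set ks \<subseteq> edges ?K"
      using d avoid[OF nz] by auto
    have "hvert ?K k \<noteq> hvert ?K l" if "k \<in> set ks" "l \<in> set ks" "hvert G k \<noteq> hvert G l" for k l
    proof -
      have "hvert G k \<noteq> v" "hvert G l \<noteq> v"
        using avoid[OF nz] that by blast+
      then show ?thesis
        using v that(3) by auto
    qed
    then have "inj_on (hvert ?K) (set ks)"
      using d(1) unfolding distinct_map inj_on_def by metis
    then show "distinct (map (hvert ?K) ks)"
      using d(1) by (simp add: distinct_map)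
  qed
  have "alternating (hat G t)"
    unfolding alternating_def using hat_move by blast
  then obtain t' where t': "Poly_Mapping.keys t' \<subseteq> states ?K" "\<And>ks. hat ?K t' ks = hat G t ks"
    using chain_of_alternating[OF wf' _ supp] by metis
  have "(\<Sum>h\<in>halves_at ?K w. hat G t (h # ks)) = 0" if w: "w \<in> verts ?K" for w ks
  proof -
    have z: "hat G t (h # ks) = 0" if "fst h = e" for h
      using avoid[of "h # ks"] that by auto
    have V: "w \<in> verts G" "?c \<in> verts G"
      using w e(1) wf by (auto simp: wf_graph_def)
    have rest: "(\<Sum>h\<in>{h \<in> halves_at G u. fst h \<noteq> e}. hat G t (h # ks)) = 0" if "u \<in> verts G" for u
    proof -
      have "(\<Sum>h\<in>{h \<in> halves_at G u. fst h \<noteq> e}. hat G t (h # ks)) = (\<Sum>h\<in>halves_at G u. hat G t (h # ks))"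
        using z finite_halves_at[OF wf, of u] by (intro sum.mono_neutral_left) auto
      then show ?thesis
        using hat_sum_zero[OF wf tc(2) that, of "[]"] by simp
    qed
    show ?thesis
    \<comment> \<open>The half-edges at the merged vertex are those at the two ends without the
      halves of \<open>e\<close>; each of the two sums vanishes because \<open>t\<close> is zero on
      the halves of \<open>e\<close>.\<close>
    proof (cases "w = ?p")
      case True
      have "halves_at ?K w = {h \<in> halves_at G ?p. fst h \<noteq> e} \<union> {h \<in> halves_at G ?c. fst h \<noteq> e}"
        using True e(2) by auto
      moreover have "finite {h \<in> halves_at G u. fst h \<noteq> e}" for u
        by (rule finite_Collect_conjI, rule disjI1, simp only: Collect_mem_eq finite_halves_at[OF wf])
      moreover have "{h \<in> halves_at G ?p. fst h \<noteq> e} \<inter> {h \<in> halves_at G ?c. fst h \<noteq> e} = {}"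
      proof -
        have "h \<notin> halves_at G ?c" if "h \<in> halves_at G ?p" for h
          using that e(2) unfolding halves_at_def by simp
        then show ?thesis by blast
      qed
      ultimately have "(\<Sum>h\<in>halves_at ?K w. hat G t (h # ks)) =
          (\<Sum>h\<in>{h \<in> halves_at G ?p. fst h \<noteq> e}. hat G t (h # ks)) +
          (\<Sum>h\<in>{h \<in> halves_at G ?c. fst h \<noteq> e}. hat G t (h # ks))"
        using sum.union_disjoint[of "{h \<in> halves_at G ?p. fst h \<noteq> e}" "{h \<in> halves_at G ?c. fst h \<noteq> e}"]
        by simp
      then show ?thesis
        using rest V True by simp
    next
      case False
      have "halves_at ?K w = {h \<in> halves_at G w. fst h \<noteq> e}"
        using False w by auto
      then show ?thesis
        using rest[OF V(1)] by simp
    qed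
  qed
  then have "vertex_sums_zero ?K t'"
    unfolding vertex_sums_zero_hat[OF wf'] t'(2) by blast
  moreover have A: "hat G t ks \<in> A_ring ?K" for ks
  proof -
    have "hat G t ks \<in> A_ring G"
      using tc(3) by (rule hat_A_ring)
    then show ?thesis
      using avoid' by (fastforce simp: A_ring_def)
  qed
  then have "Poly_Mapping.lookup t' s \<in> A_ring ?K" for s
    using t' by (intro A_ring_hat[OF wf']) auto
  ultimately have "t' \<in> sw_part ?K i n"
    unfolding sw_part_iff[OF wf'] sw_complex_iff[OF wf'] t'(2) using t'(1) t[unfolded sw_part_iff[OF wf]] by blast
  moreover have "pulls_back G ?K (contr_map G e) t' t"
    unfolding pulls_back_iff C
  proof (intro conjI allI impI)
    show "t \<in> sw_complex G"
      using t by (rule sw_part_complex)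
    fix ks :: "half list" assume ks: "fst ` set ks \<subseteq> edges G - {e}"
    have hm: "hm h = h" if "fst h \<in> edges G - {e}" for h
      using that by (simp add: hm_def)
    then have "map hm ks = ks"
      using ks by (intro map_idI) auto
    moreover have "rename_vars (pre_edge (contr_map G e)) (hat G t ks) = hat G t ks"
      using A
    proof (rule rename_vars_id)
      show "pre_edge (contr_map G e) x = x" if "x \<in> edges ?K" for x
        using pre_edge_hm[of "(x, True)"] hm[of "(x, True)"] that C by simp
    qed
    ultimately show "hat G t ks = rename_vars (pre_edge (contr_map G e)) (hat ?K t' (map hm ks))"
      using t'(2) by simp
  next
    fix h :: half and ks assume h: "fst h \<in> {e}"
    then have "hat G t (h # ks) = 0" "hat G t (opp h # ks) = 0"
      using avoid[of "h # ks"] avoid[of "opp h # ks"] by auto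
    then show "hat G t (h # ks) + hat G t (opp h # ks) = 0"
      by simp
  qed
  ultimately show ?thesis
    by blast
qed

lemma card_keys_le_mono_degree: "card (Poly_Mapping.keys m) \<le> mono_degree m"
  unfolding mono_degree_def card_eq_sum by (rule sum_mono) (simp add: in_keys_iff)

lemma prod_unit_cases:
  "(\<And>v. v \<in> S \<Longrightarrow> f v \<in> {0, 1, - 1 :: epoly}) \<Longrightarrow> (\<Prod>v\<in>S. f v) \<in> {0, 1, - 1}"
proof (induction S rule: infinite_finite_induct)
  case (insert v S)
  then have "f v \<in> {0, 1, - 1}" "(\<Prod>v\<in>S. f v) \<in> {0, 1, - 1}"
    by auto
  then show ?case
    unfolding prod.insert[OF insert.hyps(1,2)] by auto
qed auto

lemma keys_single_unit:
  assumes "p \<in> {0, 1, - 1 :: epoly}"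
  shows "Poly_Mapping.keys (Poly_Mapping.single m (a :: int) * p) \<subseteq> {m}"
proof -
  from assms consider "p = 0" | "p = 1" | "p = - 1" by blast
  then show ?thesis
  proof cases
    case 3
    then have "Poly_Mapping.single m a * p = - Poly_Mapping.single m a"
      by simp
    then show ?thesis by simp
  qed simp_all
qed

lemma reference_factor_units: "Poly_Mapping.lookup (reference_factor ref s v) b \<in> {0, 1, - 1}"
  by (auto simp: reference_factor_def lookup_minus lookup_basis_elt split: option.splits)

lemma reference_factor_nonzero:
  assumes "Poly_Mapping.lookup (reference_factor ref s v) b \<noteq> 0"
  shows "b = s v \<or> s v \<noteq> None \<and> b = ref v"
  using assms by (auto simp: reference_factor_def lookup_minus lookup_basis_elt split: option.splits if_splits)

section \<open>Chains induced from graphs with fewer edges\<close>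

definition contr_images :: "nat \<Rightarrow> graph \<Rightarrow> nat \<Rightarrow> nat \<Rightarrow> sw_chain set" where
  "contr_images g G i n = {sw_pullback G G' \<phi> v | G' \<phi> v. contraction G G' \<phi> \<and> graph_of_genus g G' \<and>
     card (edges G') < card (edges G) \<and> v \<in> sw_part G' i n}"

context
  fixes g G i n
  assumes G: "graph_of_genus g G" and large: "card (edges G) > g + i + n"
begin

text \<open>The origin of the bound \<open>g + i + n\<close>. Counting provides a free vertex
  \<open>v\<close> besides the root whose parent edge \<open>e\<close> occurs neither in
  \<open>s\<close> nor in \<open>m\<close>. The reference half-edges in the tensor are parent
  half-edges of occupied vertices, so they avoid \<open>e\<close> too, and the term is pulled back
  from \<open>contr G e\<close>.\<close>

lemma term_in_contr_images:
  assumes R: "rooted_graph G r par rk" and s: "s \<in> states G" "s r = None" "card (occupied s) = i"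
    and m: "Poly_Mapping.keys m \<subseteq> edges G" "mono_degree m + i = n"
  defines "ref \<equiv> \<lambda>v. if v \<in> verts G - {r} then Some (par v) else None"
  shows "smul (Poly_Mapping.single m a) (pure_tensor G (reference_factor ref s)) \<in> contr_images g G i n"
proof -
  interpret R: rooted_graph G r par rk
    by (rule R)
  let ?T = "pure_tensor G (reference_factor ref s)"
  let ?t = "smul (Poly_Mapping.single m a) ?T"
  have occ: "occupied s \<subseteq> verts G" "finite (occupied s)"
    using occupied_subset[OF s(1)] finite_subset[OF occupied_subset[OF s(1)]] by auto
  have rocc: "r \<notin> occupied s"
    using s(2) by (simp add: occupied_def)
  \<comment> \<open>Edges that must survive: those of the \<open>i\<close> half-edges of
    \<open>s\<close> and the variables of \<open>m\<close>, at most \<open>i + (n - i)\<close> in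
    number.\<close>
  define bad where "bad = (\<lambda>u. fst (the (s u))) ` occupied s \<union> Poly_Mapping.keys m"
  have "card bad \<le> card ((\<lambda>u. fst (the (s u))) ` occupied s) + card (Poly_Mapping.keys m)"
    unfolding bad_def by (rule card_Un_le)
  also have "\<dots> \<le> n"
    using card_image_le[OF occ(2), of "\<lambda>u. fst (the (s u))"] card_keys_le_mono_degree[of m] m(2) s(3) by linarith
  finally have bad: "card bad \<le> n" .
  \<comment> \<open>The Euler characteristic gives
    \<open>card (verts G) - 1 - i = card (edges G) - g - i > n\<close> candidates, and their parent
    edges are pairwise different.\<close>
  define cand where "cand = verts G - {r} - occupied s"
  have "card cand = card (verts G) - 1 - i"
    unfolding cand_def using occ rocc R.root s(3)
    by (subst card_Diff_subset) (auto simp: card_Diff_singleton)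
  moreover have "g + card (verts G) = card (edges G) + 1"
    using G by (rule graph_of_genus_formula)
  ultimately have "n < card cand"
    using large by linarith
  moreover have "inj_on (\<lambda>v. fst (par v)) cand"
    by (rule inj_onI) (auto simp: cand_def intro: R.par_edge_inj)
  ultimately have "card bad < card ((\<lambda>v. fst (par v)) ` cand)"
    using bad by (simp add: card_image)
  then have "\<not> (\<lambda>v. fst (par v)) ` cand \<subseteq> bad"
    using card_mono[of bad "(\<lambda>v. fst (par v)) ` cand"] occ(2) by (auto simp: bad_def)
  then obtain v where v: "v \<in> verts G" "v \<noteq> r" "v \<notin> occupied s" "fst (par v) \<notin> bad"
    by (auto simp: cand_def)
  define e where "e = fst (par v)"
  have et: "e \<in> R.tree_edges"
    using v by (auto simp: e_def R.tree_edges_def)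
  then have eG: "e \<in> edges G"
    using R.tree_edges_subset by blast
  have nl: "endpt G e False \<noteq> endpt G e True"
    using et by (rule R.tree_edge_not_loop)
  have ve: "v = endpt G e False \<or> v = endpt G e True"
    using R.par_simps[OF v(1,2)] unfolding e_def by (cases "par v"; cases "snd (par v)") auto
  have red: "reference_factor ref s u \<in> reduced_S G u" for u
  proof (rule reference_factor_reduced_S[OF s(1)])
    assume "s u \<noteq> None"
    then have "u \<in> verts G" "u \<noteq> r"
      using occ rocc by (auto simp: occupied_def)
    then show "ref u \<in> Some ` halves_at G u"
      using R.par_at[of u] by (simp add: ref_def)
  qed
  have tc: "?t \<in> sw_complex G"
    unfolding sw_complex_def
  proof (rule A_span_smul_gen)
    show "?T \<in> {pure_tensor G x |x. \<forall>v\<in>verts G. x v \<in> reduced_S G v}"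
      using red by blast
    show "Poly_Mapping.single m a \<in> A_ring G"
      using m(1) by (auto simp: A_ring_def)
  qed
  have lk: "Poly_Mapping.lookup ?t s' = Poly_Mapping.single m a * (\<Prod>u\<in>verts G. Poly_Mapping.lookup (reference_factor ref s u) (s' u))"
    if "s' \<in> states G" for s'
    using that by (simp add: lookup_pure_tensor[OF R.wf])
  have keys: "Poly_Mapping.keys (Poly_Mapping.lookup ?t s') \<subseteq> {m}" for s'
  proof (cases "s' \<in> states G")
    case True
    then show ?thesis
      unfolding lk[OF True] by (intro keys_single_unit prod_unit_cases reference_factor_units)
  next
    case False
    then show ?thesis
      by (simp add: lookup_pure_tensor[OF R.wf])
  qed
  have st: "s' \<in> states G \<and> (\<forall>u. s' u = s u \<or> s u \<noteq> None \<and> s' u = Some (par u) \<and> u \<in> verts G - {r})"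
    if s': "s' \<in> Poly_Mapping.keys ?t" for s'
  proof
    show S: "s' \<in> states G"
      using s' by (auto simp: in_keys_iff lookup_pure_tensor[OF R.wf] split: if_splits)
    have nz: "(\<Prod>u\<in>verts G. Poly_Mapping.lookup (reference_factor ref s u) (s' u)) \<noteq> 0"
      using s' unfolding in_keys_iff lk[OF S] by (metis mult_zero_right)
    show "\<forall>u. s' u = s u \<or> s u \<noteq> None \<and> s' u = Some (par u) \<and> u \<in> verts G - {r}"
    proof
      fix u
      show "s' u = s u \<or> s u \<noteq> None \<and> s' u = Some (par u) \<and> u \<in> verts G - {r}"
      proof (cases "u \<in> verts G")
        case True
        have "Poly_Mapping.lookup (reference_factor ref s u) (s' u) \<noteq> 0"
        proof
          assume "Poly_Mapping.lookup (reference_factor ref s u) (s' u) = 0"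
          then have "(\<Prod>u\<in>verts G. Poly_Mapping.lookup (reference_factor ref s u) (s' u)) = 0"
            using True by (intro prod_zero) auto
          with nz show False by blast
        qed
        then have "s' u = s u \<or> s u \<noteq> None \<and> s' u = ref u"
          by (rule reference_factor_nonzero)
        moreover have "u \<noteq> r" if "s u \<noteq> None"
          using that s(2) by blast
        ultimately show ?thesis
          using True by (auto simp: ref_def)
      next
        case False
        then show ?thesis
          using states_None[OF S] states_None[OF s(1)] by simp
      qed
    qed
  qed
  have occ': "occupied s' = occupied s" if "s' \<in> Poly_Mapping.keys ?t" for s'
    using st[OF that] unfolding occupied_def by (metis option.distinct(1))
  have tp: "?t \<in> sw_part G i n"
    unfolding sw_part_def using tc occ' s(3) keys m(2) by fastforce
  have avoid: "v \<notin> hvert G ` set ks \<and> e \<notin> fst ` set ks" "Poly_Mapping.keys (hat G ?t ks) \<subseteq> {m}"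
    if nz: "hat G ?t ks \<noteq> 0" for ks
  proof -
    let ?s = "state_of G ks"
    have d: "distinct (map (hvert G) ks)" and h: "hat G ?t ks = vsign (map (hvert G) ks) * Poly_Mapping.lookup ?t ?s"
      using nz by (auto simp: hat_def split: if_splits)
    then have S: "?s \<in> Poly_Mapping.keys ?t"
      using nz by (auto simp: in_keys_iff)
    have "hvert G ` set ks = occupied s"
      using occ'[OF S] unfolding occupied_state_of .
    moreover have "fst k \<noteq> e" if k: "k \<in> set ks" for k
    proof -
      let ?u = "hvert G k"
      have su: "?s ?u = Some k"
        using state_of_Some[OF d] k by blast
      have uo: "?u \<in> occupied s"
        using \<open>hvert G ` set ks = occupied s\<close> k by blast
      consider "s ?u = Some k" | "k = par ?u" "?u \<in> verts G - {r}"
      proof -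
        have "?s ?u = s ?u \<or> s ?u \<noteq> None \<and> ?s ?u = Some (par ?u) \<and> ?u \<in> verts G - {r}"
          using st[OF S] by blast
        then show thesis
          using su that by (metis option.inject)
      qed
      then show ?thesis
      proof cases
        case 1
        then have "fst k \<in> bad"
          unfolding bad_def using uo by force
        then show ?thesis
          using v(4) unfolding e_def by metis
      next
        case 2
        then have "fst (par v) \<noteq> fst (par ?u)"
          using R.par_edge_inj[OF v(1,2), of ?u] uo v(3) by auto
        then show ?thesis
          using 2(1) unfolding e_def by metis
      qed
    qed
    ultimately show "v \<notin> hvert G ` set ks \<and> e \<notin> fst ` set ks"
      using v(3) by blast
    show "Poly_Mapping.keys (hat G ?t ks) \<subseteq> {m}"
      unfolding h vsign_def using keys by (cases "even (inv_count (map (hvert G) ks))") auto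
  qed
  have "e \<notin> Poly_Mapping.keys m"
    using v(4) by (simp add: e_def bad_def)
  then have avoid': "e \<notin> Poly_Mapping.keys m'" if "m' \<in> Poly_Mapping.keys (hat G ?t ks)" for ks m'
    using that avoid(2)[of ks] by fastforce
  obtain t' where t': "t' \<in> sw_part (contr G e) i n" "pulls_back G (contr G e) (contr_map G e) t' ?t"
    using pulls_back_contr[OF R.wf eG nl ve tp] avoid(1) avoid' by (metis (no_types, lifting))
  have con: "contraction G (contr G e) (contr_map G e)"
    using R.wf eG nl by (rule contraction_contr)
  have "sw_pullback G (contr G e) (contr_map G e) t' = ?t"
    using con G sw_part_complex[OF t'(1)] t'(2) by (rule sw_pullback_eqI)
  moreover have "graph_of_genus g (contr G e)"
    using con G contracting.graph_of_genus_target contracting_iff by blast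
  moreover have "card (edges (contr G e)) < card (edges G)"
    using eG by (simp only: contr_simps) (intro card_Diff1_less, auto)
  ultimately show ?thesis
    unfolding contr_images_def using con t'(1) by (metis (mono_tags, lifting) mem_Collect_eq)
qed

lemma sum_in_add_span: "(\<And>x. x \<in> S \<Longrightarrow> f x \<in> add_span T) \<Longrightarrow> (\<Sum>x\<in>S. f x) \<in> add_span T"
  by (induction S rule: infinite_finite_induct) (auto intro: add_span_add add_span.zero)

text \<open>The expansion wants a root that no state occupies, so the chain is first cut into parts
  with a fixed set \<open>W\<close> of occupied vertices. Each part keeps vanishing vertex sums,
  because such a sum runs over states with one and the same occupied set. A root outside
  \<open>W\<close> exists, as \<open>W\<close> has only \<open>i\<close> elements.\<close>

lemma sw_part_in_contr_span:
  assumes c: "c \<in> sw_part G i n"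
  shows "c \<in> add_span (contr_images g G i n)"
proof -
  note wf = graph_of_genus_wf[OF G]
  note c' = sw_part_complex[OF c, unfolded sw_complex_iff[OF wf]]
  define part where "part W = (\<Sum>s\<in>{s \<in> Poly_Mapping.keys c. occupied s = W}. Poly_Mapping.single s (Poly_Mapping.lookup c s))" for W
  have lk: "Poly_Mapping.lookup (part W) s = (if occupied s = W then Poly_Mapping.lookup c s else 0)" for W s
    by (auto simp: part_def lookup_sum lookup_single when_def in_keys_iff)
  have fin: "finite (occupied ` Poly_Mapping.keys c)"
    by simp
  have "c = (\<Sum>W\<in>occupied ` Poly_Mapping.keys c. part W)"
  proof (rule poly_mapping_eqI)
    fix s show "Poly_Mapping.lookup c s = Poly_Mapping.lookup (\<Sum>W\<in>occupied ` Poly_Mapping.keys c. part W) s"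
      using fin by (cases "s \<in> Poly_Mapping.keys c") (auto simp: lookup_sum lk in_keys_iff)
  qed
  moreover have "part W \<in> add_span (contr_images g G i n)" if W: "W \<in> occupied ` Poly_Mapping.keys c" for W
  proof -
    have cW: "card W = i" "W \<subseteq> verts G"
    proof -
      obtain s where s: "s \<in> Poly_Mapping.keys c" "W = occupied s"
        using W by blast
      then show "card W = i"
        using c by (simp add: sw_part_def)
      have "s \<in> states G"
        using s(1) c' by blast
      then show "W \<subseteq> verts G"
        unfolding s(2) by (rule occupied_subset)
    qed
    have "g + card (verts G) = card (edges G) + 1"
      using G by (rule graph_of_genus_formula)
    then have "card W < card (verts G)"
      using large cW(1) by linarith
    then have "\<not> verts G \<subseteq> W"
      using card_mono[OF finite_subset[OF cW(2)], of "verts G"] wf by (auto simp: wf_graph_def)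
    then obtain r where r: "r \<in> verts G" "r \<notin> W"
      by blast
    obtain par rk where R: "rooted_graph G r par rk"
      using rooted_graph_exists[OF wf _ r(1)] G unfolding graph_of_genus_def by blast
    interpret R: rooted_graph G r par rk
      by (rule R)
    define ref where "ref = (\<lambda>v. if v \<in> verts G - {r} then Some (par v) else None)"
    have keys: "s \<in> Poly_Mapping.keys c \<and> occupied s = W" if "s \<in> Poly_Mapping.keys (part W)" for s
      using that by (auto simp: in_keys_iff lk split: if_splits)
    have vs: "vertex_sums_zero G (part W)"
      unfolding vertex_sums_zero_def
    proof (intro ballI impI)
      fix v s assume v: "v \<in> verts G" "s \<in> states G" "s v = None"
      have "occupied (s(v \<mapsto> h)) = insert v (occupied s)" for h
        by (auto simp: occupied_def)
      then show "(\<Sum>h\<in>halves_at G v. Poly_Mapping.lookup (part W) (s(v \<mapsto> h))) = 0"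
        using vertex_sums_zeroD[OF _ v] c' by (cases "insert v (occupied s) = W") (simp_all add: lk)
    qed
    have "part W = (\<Sum>s\<in>{s \<in> Poly_Mapping.keys (part W). \<forall>v. s v = None \<or> s v \<noteq> ref v}.
        smul (Poly_Mapping.lookup (part W) s) (pure_tensor G (reference_factor ref s)))"
    proof (rule reference_expansion[OF wf vs])
      show "Poly_Mapping.keys (part W) \<subseteq> states G"
        using keys c' by blast
      fix s v assume s: "s \<in> Poly_Mapping.keys (part W)" "s v \<noteq> None"
      then have "v \<in> W"
        using keys[OF s(1)] by (auto simp: occupied_def)
      then have "v \<in> verts G" "v \<noteq> r"
        using cW r by auto
      then show "ref v \<in> Some ` halves_at G v"
        using R.par_at[of v] by (simp add: ref_def)
    qed
    also have "\<dots> \<in> add_span (contr_images g G i n)"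
    proof (rule sum_in_add_span)
      fix s assume "s \<in> {s \<in> Poly_Mapping.keys (part W). \<forall>v. s v = None \<or> s v \<noteq> ref v}"
      then have s: "s \<in> Poly_Mapping.keys c" "occupied s = W"
        using keys by auto
      let ?p = "Poly_Mapping.lookup c s" and ?T = "pure_tensor G (reference_factor ref s)"
      have "?p = (\<Sum>m\<in>Poly_Mapping.keys ?p. Poly_Mapping.single m (Poly_Mapping.lookup ?p m))"
        by (intro poly_mapping_eqI) (simp add: lookup_sum lookup_single when_def in_keys_iff)
      then have "smul ?p ?T = smul (\<Sum>m\<in>Poly_Mapping.keys ?p. Poly_Mapping.single m (Poly_Mapping.lookup ?p m)) ?T"
        by (rule arg_cong[of _ _ "\<lambda>p. smul p ?T"])
      also have "\<dots> = (\<Sum>m\<in>Poly_Mapping.keys ?p. smul (Poly_Mapping.single m (Poly_Mapping.lookup ?p m)) ?T)"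
        by (intro poly_mapping_eqI) (simp add: lookup_sum sum_distrib_right)
      also have "\<dots> \<in> add_span (contr_images g G i n)"
      proof (intro sum_in_add_span add_span_gen)
        fix m assume m: "m \<in> Poly_Mapping.keys ?p"
        show "smul (Poly_Mapping.single m (Poly_Mapping.lookup ?p m)) ?T \<in> contr_images g G i n"
          unfolding ref_def
        proof (rule term_in_contr_images[OF R])
          show "s \<in> states G"
            using s c' by blast
          show "s r = None"
            using r(2) s(2) by (auto simp: occupied_def)
          show "card (occupied s) = i"
            using s cW by simp
          have "?p \<in> A_ring G"
            using c' by blast
          then show "Poly_Mapping.keys m \<subseteq> edges G"
            using m by (auto simp: A_ring_def)
          show "mono_degree m + i = n"
            using c s m by (auto simp: sw_part_def)
        qed
      qed
      finally show "smul (Poly_Mapping.lookup (part W) s) ?T \<in> add_span (contr_images g G i n)"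
        using s(2) by (simp add: lk)
    qed
    finally show ?thesis .
  qed
  ultimately show ?thesis
    by (metis (no_types, lifting) sum_in_add_span)
qed

end

lemma add_span_mono: "S \<subseteq> T \<Longrightarrow> x \<in> add_span S \<Longrightarrow> x \<in> add_span T"
  by (rotate_tac 1, induction x rule: add_span.induct) (auto intro: add_span.intros)

lemma sw_pullback_add_span:
  assumes G: "graph_of_genus g G" "graph_of_genus g G'" and \<phi>: "contraction G G' \<phi>"
    and X: "\<And>G'' v. (G'', v) \<in> X \<Longrightarrow> graph_of_genus g G'' \<and> v \<in> sw_part G'' i n"
    and x: "x \<in> add_span {sw_pullback G' G'' \<psi> v | G'' \<psi> v. (G'', v) \<in> X \<and> contraction G' G'' \<psi>}"
  shows "sw_pullback G G' \<phi> x \<in> add_span {sw_pullback G G'' \<psi> v | G'' \<psi> v. (G'', v) \<in> X \<and> contraction G G'' \<psi>}"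
proof -
  let ?S = "{sw_pullback G' G'' \<psi> v | G'' \<psi> v. (G'', v) \<in> X \<and> contraction G' G'' \<psi>}"
  let ?T = "{sw_pullback G G'' \<psi> v | G'' \<psi> v. (G'', v) \<in> X \<and> contraction G G'' \<psi>}"
  have gen: "s \<in> sw_complex G' \<and> sw_pullback G G' \<phi> s \<in> ?T" if sS: "s \<in> ?S" for s
  proof -
    obtain G'' \<psi> v where s: "s = sw_pullback G' G'' \<psi> v" "(G'', v) \<in> X" "contraction G' G'' \<psi>"
      using sS by blast
    then have v: "v \<in> sw_part G'' i n"
      using X by blast
    have "s \<in> sw_complex G'"
      unfolding s(1) using sw_pullback_part[OF s(3) G(2) v] by (rule sw_part_complex)
    moreover have "sw_pullback G G' \<phi> s = sw_pullback G G'' (cmap_comp G \<psi> \<phi>) v"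
      unfolding s(1) using sw_pullback_comp[OF G \<phi> s(3) sw_part_complex[OF v]] by simp
    ultimately show ?thesis
      using s(2) contraction_cmap_comp[OF \<phi> s(3)] by blast
  qed
  have "x \<in> sw_complex G' \<and> sw_pullback G G' \<phi> x \<in> add_span ?T"
    using x
  proof (induction x rule: add_span.induct)
    case zero
    then show ?case
      using sw_pullback_0[OF \<phi> G(1)] by (simp add: add_span.zero)
  next
    case (plus x s)
    then show ?case
      using gen[OF plus.hyps(2)] sw_pullback_add[OF \<phi> G(1), of x s]
      by (simp add: sw_complex_add add_span.plus)
  next
    case (minus x s)
    have wf: "wf_graph G'"
      using G(2) by (rule graph_of_genus_wf)
    have s: "s \<in> sw_complex G'" "sw_pullback G G' \<phi> s \<in> ?T"
      using gen[OF minus.hyps(2)] by auto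
    have "sw_pullback G G' \<phi> (x + - s) = sw_pullback G G' \<phi> x - sw_pullback G G' \<phi> s"
      using sw_pullback_add[OF \<phi> G(1), of x "- s"] sw_pullback_minus[OF \<phi> G(1) s(1)] minus.IH
        sw_complex_minus[OF wf s(1)] by simp
    then show ?case
      using minus.IH s sw_complex_add[OF _ sw_complex_minus[OF wf s(1)], of x] add_span.minus[OF _ s(2)]
      by simp
  qed
  then show ?thesis
    by blast
qed

text \<open>Induction on the number of edges: above the bound a chain is a finite combination of
  pullbacks from smaller graphs, and the finite generating sets of these are united.\<close>

lemma sw_part_low_degree:
  assumes "graph_of_genus g G" "c \<in> sw_part G i n"
  shows "\<exists>X. finite X \<and> (\<forall>(G', v)\<in>X. graph_of_genus g G' \<and> v \<in> sw_part G' i n \<and> card (edges G') \<le> g + i + n) \<and>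
    c \<in> add_span {sw_pullback G G' \<phi> v | G' \<phi> v. (G', v) \<in> X \<and> contraction G G' \<phi>}"
  using assms
proof (induction "card (edges G)" arbitrary: G c rule: less_induct)
  case less
  let ?S = "\<lambda>G X. {sw_pullback G G' \<phi> v | G' \<phi> v. (G', v) \<in> X \<and> contraction G G' \<phi>}"
  let ?ok = "\<lambda>X. finite X \<and> (\<forall>(G', v)\<in>X. graph_of_genus g G' \<and> v \<in> sw_part G' i n \<and> card (edges G') \<le> g + i + n)"
  note g = less.prems(1)
  show ?case
  proof (cases "card (edges G) \<le> g + i + n")
    case True
    have "sw_pullback G G (cmap_id G) c = c"
      using g sw_part_complex[OF less.prems(2)] by (rule sw_pullback_id)
    then have "c \<in> ?S G {(G, c)}"
      using contraction_cmap_id(1)[OF graph_of_genus_wf[OF g]] by (metis (mono_tags, lifting) mem_Collect_eq singletonI)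
    then show ?thesis
      using True less.prems by (intro exI[of _ "{(G, c)}"]) (auto intro: add_span_gen)
  next
    case False
    have gen: "\<exists>X. ?ok X \<and> s \<in> add_span (?S G X)" if s: "s \<in> contr_images g G i n" for s
    proof -
      obtain G' \<phi> v where s': "s = sw_pullback G G' \<phi> v" "contraction G G' \<phi>" "graph_of_genus g G'"
          "card (edges G') < card (edges G)" "v \<in> sw_part G' i n"
        using s False less.prems(1) unfolding contr_images_def by blast
      obtain X where X: "?ok X" "v \<in> add_span (?S G' X)"
        using less.hyps[OF s'(4,3,5)] by blast
      have "s \<in> add_span (?S G X)"
        unfolding s'(1) by (rule sw_pullback_add_span[OF g s'(3,2) _ X(2)]) (use X(1) in auto)
      then show ?thesis
        using X(1) by blast
    qed
    have union: "x \<in> add_span (?S G (X \<union> Y))" if "x \<in> add_span (?S G X)" for x X Y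
      using that by (rule add_span_mono[rotated]) blast
    have union': "x \<in> add_span (?S G (X \<union> Y))" if "x \<in> add_span (?S G Y)" for x X Y
      using that by (rule add_span_mono[rotated]) blast
    have "c \<in> add_span (contr_images g G i n)"
      using sw_part_in_contr_span[OF g _ less.prems(2)] False by simp
    then show ?thesis
    proof (induction c rule: add_span.induct)
      case zero
      show ?case by (intro exI[of _ "{}"]) (simp add: add_span.zero)
    next
      case (plus x s)
      obtain X where X: "?ok X" "x \<in> add_span (?S G X)"
        using plus.IH by blast
      obtain Y where Y: "?ok Y" "s \<in> add_span (?S G Y)"
        using gen[OF plus.hyps(2)] by blast
      have "x + s \<in> add_span (?S G (X \<union> Y))"
        by (rule add_span_add[OF union[OF X(2)] union'[OF Y(2)]])
      then show ?case
        using X(1) Y(1) by (intro exI[of _ "X \<union> Y"]) auto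
    next
      case (minus x s)
      obtain X where X: "?ok X" "x \<in> add_span (?S G X)"
        using minus.IH by blast
      obtain Y where Y: "?ok Y" "s \<in> add_span (?S G Y)"
        using gen[OF minus.hyps(2)] by blast
      have "x + - s \<in> add_span (?S G (X \<union> Y))"
        by (rule add_span_add[OF union[OF X(2)] add_span_uminus[OF union'[OF Y(2)]]])
      then show ?case
        using X(1) Y(1) by (intro exI[of _ "X \<union> Y"]) auto
    qed
  qed
qed

section \<open>Modules presented by chain groups\<close>

text \<open>Links the additive span of chains with generation in a group that receives an additive
  map from them.\<close>

lemma add_span_generate:
  assumes "group H" and P: "0 \<in> P" "\<And>x y. x \<in> P \<Longrightarrow> y \<in> P \<Longrightarrow> x - y \<in> P"
    and f: "\<And>x. x \<in> P \<Longrightarrow> f x \<in> carrier H" "\<And>x y. x \<in> P \<Longrightarrow> y \<in> P \<Longrightarrow> f (x + y) = f x \<otimes>\<^bsub>H\<^esub> f y"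
    and T: "T \<subseteq> P" and x: "x \<in> add_span T"
  shows "x \<in> P \<and> f x \<in> generate H (f ` T)"
proof -
  interpret H: group H by fact
  have f_diff: "f (x - y) = f x \<otimes>\<^bsub>H\<^esub> inv\<^bsub>H\<^esub> f y" if "x \<in> P" "y \<in> P" for x y
    using f(2)[of "x - y" y] that P f(1) by (subst H.inv_solve_right) auto
  have f0: "f 0 = \<one>\<^bsub>H\<^esub>"
    using f_diff[OF P(1) P(1)] f(1)[OF P(1)] by simp
  have P_add: "x + y \<in> P" if "x \<in> P" "y \<in> P" for x y
    using P(2)[OF that(1) P(2)[OF P(1) that(2)]] by simp
  show ?thesis
    using x
  proof (induction x rule: add_span.induct)
    case zero
    then show ?case
      using P(1) by (simp add: f0 generate.one)
  next
    case (plus x s)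
    then have "f s \<in> generate H (f ` T)" "s \<in> P"
      using T by (auto intro: generate.incl)
    then show ?case
      using plus.IH by (auto simp: f(2) P_add intro: generate.eng)
  next
    case (minus x s)
    then have "inv\<^bsub>H\<^esub> f s \<in> generate H (f ` T)" "s \<in> P"
      using T by (auto intro: generate.inv)
    then show ?case
      using minus.IH by (auto simp: f_diff P intro: generate.eng)
  qed
qed

text \<open>All values are subgroups of one type, so a submodule is a smaller family
  \<open>P\<close> with the same maps \<open>pb\<close>.\<close>

locale chain_functor =
  fixes g :: nat and P :: "graph \<Rightarrow> 'c::ab_group_add set" and pb :: "graph \<Rightarrow> graph \<Rightarrow> cmap \<Rightarrow> 'c \<Rightarrow> 'c"
  assumes P_0: "graph_of_genus g G \<Longrightarrow> 0 \<in> P G"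
    and P_diff: "graph_of_genus g G \<Longrightarrow> x \<in> P G \<Longrightarrow> y \<in> P G \<Longrightarrow> x - y \<in> P G"
    and pb_P: "graph_of_genus g G \<Longrightarrow> graph_of_genus g G' \<Longrightarrow> contraction G G' \<phi> \<Longrightarrow> x \<in> P G' \<Longrightarrow>
      pb G G' \<phi> x \<in> P G"
    and pb_add: "graph_of_genus g G \<Longrightarrow> graph_of_genus g G' \<Longrightarrow> contraction G G' \<phi> \<Longrightarrow> x \<in> P G' \<Longrightarrow> y \<in> P G' \<Longrightarrow>
      pb G G' \<phi> (x + y) = pb G G' \<phi> x + pb G G' \<phi> y"
    and pb_id: "graph_of_genus g G \<Longrightarrow> x \<in> P G \<Longrightarrow> pb G G (cmap_id G) x = x"
    and pb_comp: "graph_of_genus g G \<Longrightarrow> graph_of_genus g G' \<Longrightarrow> graph_of_genus g G'' \<Longrightarrow>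
      contraction G G' \<phi> \<Longrightarrow> contraction G' G'' \<psi> \<Longrightarrow> x \<in> P G'' \<Longrightarrow>
      pb G G'' (cmap_comp G \<psi> \<phi>) x = pb G G' \<phi> (pb G' G'' \<psi> x)"
begin

lemma P_add:
  assumes "graph_of_genus g G" "x \<in> P G" "y \<in> P G"
  shows "x + y \<in> P G"
  using P_diff[OF assms(1,2) P_diff[OF assms(1) P_0[OF assms(1)] assms(3)]] by simp

definition spanned_by :: "(graph \<times> 'c) set \<Rightarrow> bool" where
  "spanned_by X \<longleftrightarrow> (\<forall>(G', v)\<in>X. graph_of_genus g G' \<and> v \<in> P G') \<and>
     (\<forall>G. graph_of_genus g G \<longrightarrow> P G \<subseteq> add_span {pb G G' \<phi> v | G' \<phi> v. (G', v) \<in> X \<and> contraction G G' \<phi>})"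

end

text \<open>The module is described through representatives: \<open>f G\<close> maps the chains of
  \<open>G\<close> onto the value at \<open>G\<close> and carries \<open>pb\<close> to the structure
  maps. Functoriality and generation are then inherited from the chains.\<close>

locale presented_module = chain_functor g P pb
  for g :: nat and P :: "graph \<Rightarrow> 'c::ab_group_add set" and pb +
  fixes M :: "'a gop_module" and f :: "graph \<Rightarrow> 'c \<Rightarrow> 'a"
  assumes comm_group_obj: "graph_of_genus g G \<Longrightarrow> comm_group (obj M G)"
    and f_onto: "graph_of_genus g G \<Longrightarrow> f G ` P G = carrier (obj M G)"
    and f_add: "graph_of_genus g G \<Longrightarrow> x \<in> P G \<Longrightarrow> y \<in> P G \<Longrightarrow> f G (x + y) = f G x \<otimes>\<^bsub>obj M G\<^esub> f G y"
    and mor_f: "graph_of_genus g G \<Longrightarrow> graph_of_genus g G' \<Longrightarrow> contraction G G' \<phi> \<Longrightarrow> x \<in> P G' \<Longrightarrow>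
      mor M G G' \<phi> (f G' x) = f G (pb G G' \<phi> x)"
begin

lemma Gop_module: "Gop_module g M"
  unfolding Gop_module_def
proof (intro conjI allI impI ballI; (elim conjE)?)
  fix G assume g: "graph_of_genus g G"
  then show "comm_group (obj M G)"
    by (rule comm_group_obj)
  fix x assume "x \<in> carrier (obj M G)"
  then obtain z where "z \<in> P G" "x = f G z"
    using f_onto[OF g] by blast
  then show "mor M G G (cmap_id G) x = x"
    using mor_f[OF g g contraction_cmap_id(1)] g pb_id[OF g] by (simp add: graph_of_genus_def)
next
  fix G G' \<phi> assume g: "graph_of_genus g G" "graph_of_genus g G'" and \<phi>: "contraction G G' \<phi>"
  show "mor M G G' \<phi> \<in> hom (obj M G') (obj M G)"
  proof (rule homI)
    fix x assume "x \<in> carrier (obj M G')"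
    then obtain z where z: "z \<in> P G'" "x = f G' z"
      using f_onto[OF g(2)] by blast
    then show "mor M G G' \<phi> x \<in> carrier (obj M G)"
      using mor_f[OF g \<phi> z(1)] pb_P[OF g \<phi> z(1)] f_onto[OF g(1)] by auto
    fix y assume "y \<in> carrier (obj M G')"
    then obtain w where w: "w \<in> P G'" "y = f G' w"
      using f_onto[OF g(2)] by blast
    have "mor M G G' \<phi> (f G' z \<otimes>\<^bsub>obj M G'\<^esub> f G' w) = f G (pb G G' \<phi> (z + w))"
      using mor_f[OF g \<phi> P_add[OF g(2) z(1) w(1)]] f_add[OF g(2) z(1) w(1)] by simp
    also have "\<dots> = mor M G G' \<phi> (f G' z) \<otimes>\<^bsub>obj M G\<^esub> mor M G G' \<phi> (f G' w)"
      using mor_f[OF g \<phi>] pb_add[OF g \<phi>] f_add[OF g(1)] pb_P[OF g \<phi>] z(1) w(1) by simp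
    finally show "mor M G G' \<phi> (x \<otimes>\<^bsub>obj M G'\<^esub> y) = mor M G G' \<phi> x \<otimes>\<^bsub>obj M G\<^esub> mor M G G' \<phi> y"
      unfolding z w .
  qed
next
  fix G G' G'' \<phi> \<psi> x
  assume g: "graph_of_genus g G" "graph_of_genus g G'" "graph_of_genus g G''"
    and c: "contraction G G' \<phi>" "contraction G' G'' \<psi>" and "x \<in> carrier (obj M G'')"
  then obtain z where z: "z \<in> P G''" "x = f G'' z"
    using f_onto[OF g(3)] by blast
  then show "mor M G G'' (cmap_comp G \<psi> \<phi>) x = mor M G G' \<phi> (mor M G' G'' \<psi> x)"
    using mor_f[OF g(1,3) contraction_cmap_comp[OF c]] mor_f[OF g(2,3) c(2)] mor_f[OF g(1,2) c(1)]
      pb_P[OF g(2,3) c(2)] pb_comp[OF g c] by simp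
qed

lemma generated_by:
  assumes "spanned_by X"
  shows "generated_by g M ((\<lambda>(G, v). (G, f G v)) ` X)"
proof -
  have X: "graph_of_genus g G' \<and> v \<in> P G'" if "(G', v) \<in> X" for G' v
    using assms that unfolding spanned_by_def by blast
  have *: "generate (obj M G) {mor M G G' \<phi> v | G' \<phi> v.
      (G', v) \<in> (\<lambda>(G, v). (G, f G v)) ` X \<and> contraction G G' \<phi>} = carrier (obj M G)"
    (is "generate _ ?S = _") if g: "graph_of_genus g G" for G
  proof -
    interpret comm_group "obj M G"
      using g by (rule comm_group_obj)
    let ?T = "{pb G G' \<phi> v | G' \<phi> v. (G', v) \<in> X \<and> contraction G G' \<phi>}"
    have T: "?T \<subseteq> P G"
      using X pb_P[OF g] by blast
    have "?S = f G ` ?T"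
    proof (intro equalityI subsetI)
      fix y assume "y \<in> ?S"
      then obtain G' \<phi> v where y: "y = mor M G G' \<phi> (f G' v)" "(G', v) \<in> X" "contraction G G' \<phi>"
        by auto
      then have "y = f G (pb G G' \<phi> v)"
        using X[OF y(2)] mor_f[OF g _ y(3)] by simp
      then show "y \<in> f G ` ?T"
        using y(2,3) by blast
    next
      fix y assume "y \<in> f G ` ?T"
      then obtain G' \<phi> v where y: "y = f G (pb G G' \<phi> v)" "(G', v) \<in> X" "contraction G G' \<phi>"
        by blast
      then have "y = mor M G G' \<phi> (f G' v)"
        using X[OF y(2)] mor_f[OF g _ y(3)] by simp
      moreover have "(G', f G' v) \<in> (\<lambda>(G, v). (G, f G v)) ` X"
        using y(2) by force
      ultimately show "y \<in> ?S"
        using y(3) by blast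
    qed
    moreover have "generate (obj M G) (f G ` ?T) = carrier (obj M G)"
    proof
      have "f G ` ?T \<subseteq> carrier (obj M G)"
        using T f_onto[OF g] by blast
      then show "generate (obj M G) (f G ` ?T) \<subseteq> carrier (obj M G)"
        by (rule generate_incl)
      show "carrier (obj M G) \<subseteq> generate (obj M G) (f G ` ?T)"
      proof
        fix y assume "y \<in> carrier (obj M G)"
        then obtain x where x: "x \<in> P G" "y = f G x"
          using f_onto[OF g] by blast
        have "x \<in> add_span ?T"
          using assms g x(1) unfolding spanned_by_def by blast
        then have "x \<in> P G \<and> f G x \<in> generate (obj M G) (f G ` ?T)"
          using P_0[OF g] P_diff[OF g] f_onto[OF g] f_add[OF g] T
          by (intro add_span_generate[OF is_group]) auto
        then show "y \<in> generate (obj M G) (f G ` ?T)"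
          using x(2) by simp
      qed
    qed
    ultimately show ?thesis
      by simp
  qed
  show ?thesis
    unfolding generated_by_def
  proof (intro conjI allI impI ballI)
    fix p assume "p \<in> (\<lambda>(G, v). (G, f G v)) ` X"
    then obtain G' v where p: "p = (G', f G' v)" "(G', v) \<in> X"
      by auto
    then show "case p of (G', v) \<Rightarrow> graph_of_genus g G' \<and> v \<in> carrier (obj M G')"
      using X[OF p(2)] f_onto[of G'] by auto
  qed (rule *)
qed

lemma finitely_generated: "finite X \<Longrightarrow> spanned_by X \<Longrightarrow> finitely_generated g M"
  unfolding finitely_generated_def
  by (rule exI, rule conjI[rotated], rule generated_by, assumption, rule finite_imageI)

end

text \<open>The chain groups are countable, so they can be transported to \<open>nat\<close>.\<close>

lemma (in chain_functor) small:
  assumes "presented_module g Q pb M f" and Q: "\<And>G. graph_of_genus g G \<Longrightarrow> Q G \<subseteq> P G"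
    and K: "countable K" "\<And>G. graph_of_genus g G \<Longrightarrow> P G \<subseteq> K"
    and X: "finite X" "spanned_by X" "\<And>G v. (G, v) \<in> X \<Longrightarrow> card (edges G) \<le> d"
  shows "small g d M"
proof -
  interpret Q: presented_module g Q pb M f
    by (rule assms(1))
  define enc where "enc = to_nat_on K"
  define dec where "dec = from_nat_into K"
  have dec [simp]: "dec (enc x) = x" if "x \<in> P G" "graph_of_genus g G" for x G
  proof -
    have "x \<in> K"
      using K(2)[OF that(2)] that(1) by (rule subsetD)
    with K(1) show ?thesis
      unfolding enc_def dec_def by (rule from_nat_into_to_nat_on)
  qed
  define N where "N = \<lparr>obj = (\<lambda>G. \<lparr>carrier = enc ` P G, monoid.mult = (\<lambda>a b. enc (dec a + dec b)), one = enc 0\<rparr>),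
    mor = (\<lambda>G G' \<phi>. enc \<circ> pb G G' \<phi> \<circ> dec)\<rparr>"
  interpret N: presented_module g P pb N "\<lambda>_. enc"
  proof (rule presented_module.intro[OF chain_functor_axioms presented_module_axioms.intro])
    fix G assume g: "graph_of_genus g G"
    note P = P_0[OF g] P_add[OF g] dec[OF _ g]
    show "comm_group (obj N G)"
    proof (rule comm_groupI)
      fix x assume "x \<in> carrier (obj N G)"
      then obtain z where z: "z \<in> P G" "x = enc z"
        by (auto simp: N_def)
      have "- z \<in> P G"
        using P_diff[OF g P_0[OF g] z(1)] by simp
      then show "\<exists>y\<in>carrier (obj N G). y \<otimes>\<^bsub>obj N G\<^esub> x = \<one>\<^bsub>obj N G\<^esub>"
        using z P by (intro bexI[of _ "enc (- z)"]) (auto simp: N_def)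
    qed (use P in \<open>auto simp: N_def ac_simps\<close>)
    show "enc ` P G = carrier (obj N G)"
      by (simp add: N_def)
    show "enc (x + y) = enc x \<otimes>\<^bsub>obj N G\<^esub> enc y" if "x \<in> P G" "y \<in> P G" for x y
      using that P by (simp add: N_def)
  next
    fix G G' \<phi> x
    assume "graph_of_genus g G" "graph_of_genus g G'" "contraction G G' \<phi>" "x \<in> P G'"
    then show "mor N G G' \<phi> (enc x) = enc (pb G G' \<phi> x)"
      by (simp add: N_def dec[of x G'])
  qed
  have "finitely_generated_in_degrees_le g d N"
    unfolding finitely_generated_in_degrees_le_def using X N.generated_by[OF X(2)]
    by (intro exI[of _ "(\<lambda>(G, v). (G, enc v)) ` X"]) auto
  moreover have "subquotient g M N"
    unfolding subquotient_def Gop_submodule_def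
  proof (intro exI[of _ "\<lambda>G. enc ` Q G"] exI[of _ "\<lambda>G. f G \<circ> dec"] conjI allI impI ballI; (elim conjE)?)
    fix G assume g: "graph_of_genus g G"
    interpret NG: comm_group "obj N G"
      using g by (rule N.comm_group_obj)
    have d: "dec (enc x) = x" if "x \<in> Q G" for x
      using that Q[OF g] dec[OF _ g] by blast
    show "subgroup (enc ` Q G) (obj N G)"
    proof (rule NG.subgroupI)
      show "enc ` Q G \<subseteq> carrier (obj N G)"
        using Q[OF g] by (auto simp: N_def)
      show "enc ` Q G \<noteq> {}"
        using Q.P_0[OF g] by blast
      fix a assume "a \<in> enc ` Q G"
      then obtain x where x: "x \<in> Q G" "a = enc x"
        by blast
      have mx: "- x \<in> Q G"
        using Q.P_diff[OF g Q.P_0[OF g] x(1)] by simp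
      then have "enc (- x) \<otimes>\<^bsub>obj N G\<^esub> enc x = \<one>\<^bsub>obj N G\<^esub>"
        using d[OF x(1)] d[OF mx] by (simp add: N_def)
      then have "inv\<^bsub>obj N G\<^esub> a = enc (- x)"
        unfolding x(2) using Q[OF g] x(1) mx by (intro NG.inv_equality) (auto simp: N_def)
      then show "inv\<^bsub>obj N G\<^esub> a \<in> enc ` Q G"
        using mx by simp
      fix b assume "b \<in> enc ` Q G"
      then obtain y where y: "y \<in> Q G" "b = enc y"
        by blast
      have "a \<otimes>\<^bsub>obj N G\<^esub> b = enc (x + y)"
        unfolding x y using d[OF x(1)] d[OF y(1)] by (simp add: N_def)
      then show "a \<otimes>\<^bsub>obj N G\<^esub> b \<in> enc ` Q G"
        using Q.P_add[OF g x(1) y(1)] by simp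
    qed
    show "f G \<circ> dec \<in> epi (obj N G\<lparr>carrier := enc ` Q G\<rparr>) (obj M G)"
      unfolding epi_def
    proof (intro CollectI conjI homI)
      fix a assume "a \<in> carrier (obj N G\<lparr>carrier := enc ` Q G\<rparr>)"
      then obtain x where x: "x \<in> Q G" "a = enc x"
        by auto
      then show "(f G \<circ> dec) a \<in> carrier (obj M G)"
        using Q.f_onto[OF g] d by auto
      fix b assume "b \<in> carrier (obj N G\<lparr>carrier := enc ` Q G\<rparr>)"
      then obtain y where y: "y \<in> Q G" "b = enc y"
        by auto
      then show "(f G \<circ> dec) (a \<otimes>\<^bsub>obj N G\<lparr>carrier := enc ` Q G\<rparr>\<^esub> b) =
          (f G \<circ> dec) a \<otimes>\<^bsub>obj M G\<^esub> (f G \<circ> dec) b"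
        using x y d Q.f_add[OF g x(1) y(1)] Q.P_add[OF g x(1) y(1)] by (simp add: N_def)
    next
      have "(f G \<circ> dec) ` enc ` Q G = f G ` Q G"
        using d by (force simp: image_image)
      then show "(f G \<circ> dec) ` carrier (obj N G\<lparr>carrier := enc ` Q G\<rparr>) = carrier (obj M G)"
        using Q.f_onto[OF g] by simp
    qed
  next
    fix G G' \<phi> assume g: "graph_of_genus g G" "graph_of_genus g G'" and \<phi>: "contraction G G' \<phi>"
    show "mor N G G' \<phi> ` enc ` Q G' \<subseteq> enc ` Q G"
      using N.mor_f[OF g \<phi>] Q[OF g(2)] Q.pb_P[OF g \<phi>] by fastforce
    fix a assume "a \<in> enc ` Q G'"
    then obtain x where x: "x \<in> Q G'" "a = enc x"
      by blast
    then have "x \<in> P G'" "pb G G' \<phi> x \<in> P G"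
      using Q[OF g(2)] Q[OF g(1)] Q.pb_P[OF g \<phi>] by blast+
    then show "(f G \<circ> dec) (mor N G G' \<phi> a) = mor M G G' \<phi> ((f G' \<circ> dec) a)"
      using N.mor_f[OF g \<phi>] Q.mor_f[OF g \<phi> x(1)] x(2) g by (simp add: dec[of _ G] dec[of _ G'])
  qed
  ultimately show ?thesis
    unfolding small_def using N.Gop_module by blast
qed

section \<open>Countability of the chain groups\<close>

lemma countable_finite_support:
  fixes V :: "'b::zero set"
  assumes "countable S" "countable V"
  shows "countable {c :: 'a \<Rightarrow>\<^sub>0 'b. Poly_Mapping.keys c \<subseteq> S \<and> range (Poly_Mapping.lookup c) \<subseteq> V}" (is "countable ?C")
proof -
  define F where "F c = {(s, Poly_Mapping.lookup c s) | s. s \<in> Poly_Mapping.keys c}" for c :: "'a \<Rightarrow>\<^sub>0 'b"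
  have "inj F"
  proof (rule injI)
    fix c d :: "'a \<Rightarrow>\<^sub>0 'b" assume eq: "F c = F d"
    show "c = d"
    proof (rule poly_mapping_eqI)
      fix s
      have mem: "(s, x) \<in> F e \<longleftrightarrow> x \<noteq> 0 \<and> Poly_Mapping.lookup e s = x" for x and e :: "'a \<Rightarrow>\<^sub>0 'b"
        by (auto simp: F_def in_keys_iff)
      show "Poly_Mapping.lookup c s = Poly_Mapping.lookup d s"
        using mem[of "Poly_Mapping.lookup c s" c] mem[of "Poly_Mapping.lookup c s" d]
          mem[of "Poly_Mapping.lookup d s" c] mem[of "Poly_Mapping.lookup d s" d] eq by metis
    qed
  qed
  have "F ` ?C \<subseteq> {A. finite A \<and> A \<subseteq> S \<times> V}"
  proof
    fix A assume "A \<in> F ` ?C"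
    then obtain c where c: "c \<in> ?C" "A = F c"
      by (rule imageE)
    have "F c = (\<lambda>s. (s, Poly_Mapping.lookup c s)) ` Poly_Mapping.keys c"
      by (auto simp: F_def)
    then show "A \<in> {A. finite A \<and> A \<subseteq> S \<times> V}"
      using c by auto
  qed
  then have "countable (F ` ?C)"
    using assms by (intro countable_subset[OF _ countable_Collect_finite_subset]) auto
  then show ?thesis
    using \<open>inj F\<close> by (rule countable_image_inj_on[OF _ inj_on_subset[OF _ subset_UNIV]])
qed

lemma countable_finite_maps: "countable {s :: 'a::countable \<Rightarrow> 'b::countable option. finite (dom s)}"
proof -
  define F where "F s = {(v, h). s v = Some h}" for s :: "'a \<Rightarrow> 'b option"
  have "inj F"
  proof (rule injI, rule ext)
    fix s t :: "'a \<Rightarrow> 'b option" and v assume "F s = F t"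
    then have "s v = Some h \<longleftrightarrow> t v = Some h" for h
      unfolding F_def by blast
    then show "s v = t v"
      by (metis not_Some_eq)
  qed
  have "finite (F s)" if "finite (dom s)" for s
  proof -
    have "F s = (\<lambda>v. (v, the (s v))) ` dom s"
      by (force simp: F_def)
    then show ?thesis
      using that by simp
  qed
  then have "F ` {s. finite (dom s)} \<subseteq> Collect finite"
    by blast
  then have "countable (F ` {s. finite (dom s)})"
    using countable_Collect_finite by (rule countable_subset)
  then show ?thesis
    using \<open>inj F\<close> by (rule countable_image_inj_on[OF _ inj_on_subset[OF _ subset_UNIV]])
qed

text \<open>One countable set contains the chains of all graphs, so a single coding by natural
  numbers serves all values of the module.\<close>

lemma countable_sw_chains: "countable {c :: sw_chain. Poly_Mapping.keys c \<subseteq> {s. finite (dom s)}}"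
proof -
  have m: "countable (UNIV :: (nat \<Rightarrow>\<^sub>0 nat) set)"
    using countable_finite_support[of "UNIV :: nat set" "UNIV :: nat set"] by simp
  have "countable (UNIV :: epoly set)"
    using countable_finite_support[OF m, of "UNIV :: int set"] by simp
  then show ?thesis
    using countable_finite_support[OF countable_finite_maps[where 'a=nat and 'b=half], of "UNIV :: epoly set"] by simp
qed

section \<open>The homology of the reduced complex\<close>

definition sw_cycles :: "graph \<Rightarrow> nat \<Rightarrow> nat \<Rightarrow> sw_chain set" where
  "sw_cycles G i n = {c \<in> sw_part G i n. sw_diff c = 0}"

definition sw_class :: "graph \<Rightarrow> nat \<Rightarrow> nat \<Rightarrow> sw_chain \<Rightarrow> sw_chain set" where
  "sw_class G i n z = sw_boundaries G i n #>\<^bsub>sw_cycle_group G i n\<^esub> z"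

lemma sw_cycle_group_simps [simp]:
  "carrier (sw_cycle_group G i n) = sw_cycles G i n" "monoid.mult (sw_cycle_group G i n) = (+)"
  "one (sw_cycle_group G i n) = 0"
  by (simp_all add: sw_cycle_group_def sw_cycles_def)

lemma sw_diff_0: "sw_diff 0 = 0"
  by (simp add: sw_diff_def)

lemma sw_diff_plus:
  assumes "wf_graph G" "x \<in> sw_complex G" "y \<in> sw_complex G"
  shows "sw_diff (x + y) = sw_diff x + sw_diff y"
  using assms by (intro sw_diff_add[of G]) (simp_all add: sw_complex_iff)

lemma sw_diff_minus:
  assumes "wf_graph G" "x \<in> sw_complex G"
  shows "sw_diff (- x) = - sw_diff x"
  using sw_diff_plus[OF assms sw_complex_minus[OF assms]] sw_diff_0 by (simp add: add_eq_0_iff)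

lemma sw_cycles_0: "0 \<in> sw_cycles G i n"
  by (simp add: sw_cycles_def sw_diff_0)

lemma sw_cycles_minus: "wf_graph G \<Longrightarrow> x \<in> sw_cycles G i n \<Longrightarrow> - x \<in> sw_cycles G i n"
  using sw_diff_minus[of G x] sw_part_complex[of x G i n] by (simp add: sw_cycles_def sw_part_minus)

lemma sw_cycles_add: "wf_graph G \<Longrightarrow> x \<in> sw_cycles G i n \<Longrightarrow> y \<in> sw_cycles G i n \<Longrightarrow> x + y \<in> sw_cycles G i n"
  using sw_diff_plus[of G x y] sw_part_complex[of x G i n] sw_part_complex[of y G i n]
  by (simp add: sw_cycles_def sw_part_add)

lemma sw_cycles_diff: "wf_graph G \<Longrightarrow> x \<in> sw_cycles G i n \<Longrightarrow> y \<in> sw_cycles G i n \<Longrightarrow> x - y \<in> sw_cycles G i n"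
  using sw_cycles_add[of G x i n "- y"] sw_cycles_minus[of G y i n] by simp

lemma sw_cycles_complex: "x \<in> sw_cycles G i n \<Longrightarrow> x \<in> sw_complex G"
  by (simp add: sw_cycles_def sw_part_def)

lemma comm_group_sw_cycle_group:
  assumes "wf_graph G"
  shows "comm_group (sw_cycle_group G i n)"
proof (rule comm_groupI)
  fix x assume "x \<in> carrier (sw_cycle_group G i n)"
  then show "\<exists>y\<in>carrier (sw_cycle_group G i n). y \<otimes>\<^bsub>sw_cycle_group G i n\<^esub> x = \<one>\<^bsub>sw_cycle_group G i n\<^esub>"
    using sw_cycles_minus[OF assms] by (intro bexI[of _ "- x"]) auto
qed (auto simp: sw_cycles_add[OF assms] sw_cycles_0 ac_simps)

lemma sw_boundaries_0: "0 \<in> sw_boundaries G i n"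
  unfolding sw_boundaries_def by (rule image_eqI[of _ _ 0]) (simp_all add: sw_diff_0)

lemma sw_boundaries_add:
  assumes wf: "wf_graph G" and "x \<in> sw_boundaries G i n" "y \<in> sw_boundaries G i n"
  shows "x + y \<in> sw_boundaries G i n"
proof -
  obtain a b where ab: "a \<in> sw_part G (i + 1) n" "x = sw_diff a" "b \<in> sw_part G (i + 1) n" "y = sw_diff b"
    using assms(2,3) unfolding sw_boundaries_def by blast
  then have "x + y = sw_diff (a + b)"
    using sw_diff_plus[OF wf] sw_part_complex by metis
  then show ?thesis
    unfolding sw_boundaries_def using sw_part_add[OF ab(1,3)] by blast
qed

lemma sw_boundaries_minus:
  assumes wf: "wf_graph G" and "x \<in> sw_boundaries G i n"
  shows "- x \<in> sw_boundaries G i n"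
proof -
  obtain a where a: "a \<in> sw_part G (i + 1) n" "x = sw_diff a"
    using assms(2) unfolding sw_boundaries_def by blast
  then have "- x = sw_diff (- a)"
    using sw_diff_minus[OF wf sw_part_complex[OF a(1)]] by simp
  then show ?thesis
    unfolding sw_boundaries_def using sw_part_minus[OF wf a(1)] by blast
qed

lemma sw_boundaries_cycles: "wf_graph G \<Longrightarrow> sw_boundaries G i n \<subseteq> sw_cycles G i n"
  unfolding sw_boundaries_def sw_cycles_def using sw_diff_part sw_diff_sw_diff sw_part_complex by blast

lemma normal_sw_boundaries:
  assumes wf: "wf_graph G"
  shows "sw_boundaries G i n \<lhd> sw_cycle_group G i n"
proof -
  interpret comm_group "sw_cycle_group G i n"
    using wf by (rule comm_group_sw_cycle_group)
  have "subgroup (sw_boundaries G i n) (sw_cycle_group G i n)"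
  proof (rule subgroupI)
    show B: "sw_boundaries G i n \<subseteq> carrier (sw_cycle_group G i n)"
      using sw_boundaries_cycles[OF wf] by simp
    show "sw_boundaries G i n \<noteq> {}"
      using sw_boundaries_0 by blast
    fix a assume a: "a \<in> sw_boundaries G i n"
    then have "inv\<^bsub>sw_cycle_group G i n\<^esub> a = - a"
      using B sw_boundaries_minus[OF wf a] by (intro inv_equality) auto
    then show "inv\<^bsub>sw_cycle_group G i n\<^esub> a \<in> sw_boundaries G i n"
      using sw_boundaries_minus[OF wf a] by simp
    fix b assume "b \<in> sw_boundaries G i n"
    then show "a \<otimes>\<^bsub>sw_cycle_group G i n\<^esub> b \<in> sw_boundaries G i n"
      using sw_boundaries_add[OF wf a] by simp
  qed
  then show ?thesis
    by (rule subgroup_imp_normal)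
qed

lemma sw_class_hom: "wf_graph G \<Longrightarrow> sw_class G i n \<in> hom (sw_cycle_group G i n) (sw_homology G i n)"
  using normal.r_coset_hom_Mod[OF normal_sw_boundaries[of G i n]] unfolding sw_homology_def sw_class_def
  by (simp add: eta_contract_eq)

lemma carrier_sw_homology: "carrier (sw_homology G i n) = sw_class G i n ` sw_cycles G i n"
  by (simp add: sw_homology_def carrier_FactGroup sw_class_def)

lemma sw_pullback_cycles:
  assumes "contraction G G' \<phi>" "graph_of_genus g G" "x \<in> sw_cycles G' i n"
  shows "sw_pullback G G' \<phi> x \<in> sw_cycles G i n"
  using sw_pullback_part[OF assms(1,2)] sw_pullback_sw_diff[OF assms(1,2) sw_cycles_complex[OF assms(3)]]
    sw_pullback_0[OF assms(1,2)] assms(3) by (simp add: sw_cycles_def)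

lemma sw_pullback_boundaries:
  assumes "contraction G G' \<phi>" "graph_of_genus g G" "x \<in> sw_boundaries G' i n"
  shows "sw_pullback G G' \<phi> x \<in> sw_boundaries G i n"
proof -
  obtain a where a: "a \<in> sw_part G' (i + 1) n" "x = sw_diff a"
    using assms(3) unfolding sw_boundaries_def by blast
  then show ?thesis
    using sw_pullback_sw_diff[OF assms(1,2) sw_part_complex[OF a(1)]] sw_pullback_part[OF assms(1,2) a(1)]
    by (simp add: sw_boundaries_def)
qed

text \<open>The definition multiplies the image of a whole coset by the boundaries. Pullbacks of
  boundaries are boundaries, so the result is the coset of the pulled back cycle.\<close>

lemma sw_homology_map_class:
  assumes con: "contraction G G' \<phi>" and g: "graph_of_genus g G" and z: "z \<in> sw_cycles G' i n"
  shows "sw_homology_map G G' \<phi> i n (sw_class G' i n z) = sw_class G i n (sw_pullback G G' \<phi> z)"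
proof -
  interpret contracting G G' \<phi>
    using con by (simp add: contracting_iff)
  let ?f = "sw_pullback G G' \<phi>"
  have add: "?f (b + z) = ?f b + ?f z" if "b \<in> sw_boundaries G' i n" for b
  proof -
    have "b \<in> sw_cycles G' i n"
      using sw_boundaries_cycles[OF wf'] that by blast
    then show ?thesis
      by (intro sw_pullback_add[OF con g] sw_cycles_complex[OF z] sw_cycles_complex[of b])
  qed
  have L: "sw_homology_map G G' \<phi> i n (sw_class G' i n z) =
      {b + ?f (b' + z) | b b'. b \<in> sw_boundaries G i n \<and> b' \<in> sw_boundaries G' i n}"
    unfolding sw_homology_map_def sw_class_def set_mult_def r_coset_def sw_cycle_group_simps by blast
  have R: "sw_class G i n (?f z) = {b + ?f z | b. b \<in> sw_boundaries G i n}"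
    unfolding sw_class_def r_coset_def sw_cycle_group_simps by blast
  show ?thesis
  proof (intro equalityI subsetI)
    fix x assume "x \<in> sw_homology_map G G' \<phi> i n (sw_class G' i n z)"
    then obtain b b' where b: "b \<in> sw_boundaries G i n" "b' \<in> sw_boundaries G' i n" "x = b + ?f (b' + z)"
      unfolding L by blast
    have "x = (b + ?f b') + ?f z"
      unfolding b(3) add[OF b(2)] by (simp add: add.assoc)
    then show "x \<in> sw_class G i n (?f z)"
      unfolding R using sw_boundaries_add[OF wf b(1) sw_pullback_boundaries[OF con g b(2)]] by blast
  next
    fix x assume "x \<in> sw_class G i n (?f z)"
    then obtain b where b: "b \<in> sw_boundaries G i n" "x = b + ?f z"
      unfolding R by blast
    then have "x = b + ?f (0 + z)"
      by simp
    then show "x \<in> sw_homology_map G G' \<phi> i n (sw_class G' i n z)"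
      unfolding L using b(1) sw_boundaries_0[of G' i n] by blast
  qed
qed

lemma chain_functor_sw_part: "chain_functor g (\<lambda>G. sw_part G i n) sw_pullback"
  by (rule chain_functor.intro)
    (simp_all add: sw_part_diff graph_of_genus_wf sw_pullback_part sw_pullback_add sw_pullback_id sw_pullback_comp
      sw_part_complex)

lemma chain_functor_sw_cycles: "chain_functor g (\<lambda>G. sw_cycles G i n) sw_pullback"
  by (rule chain_functor.intro)
    (simp_all add: sw_cycles_0 sw_cycles_diff graph_of_genus_wf sw_pullback_cycles sw_pullback_add sw_pullback_id
      sw_pullback_comp sw_cycles_complex)

lemma sw_submodule_sw_part: "sw_submodule g i n (\<lambda>G. sw_part G i n)"
  by (rule sw_submodule.intro) (simp_all add: sw_part_diff graph_of_genus_wf sw_pullback_part)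

lemma sw_submodule_sw_cycles: "sw_submodule g i n (\<lambda>G. sw_cycles G i n)"
  by (rule sw_submodule.intro)
    (simp_all add: sw_cycles_0 sw_cycles_diff graph_of_genus_wf sw_pullback_cycles, simp add: sw_cycles_def)

text \<open>The noetherian argument for cycles. The degrees of these generators are unknown; they
  serve for finite generation of homology, while smallness rests on
  \<open>sw_part_spanned\<close>.\<close>

lemma sw_cycles_spanned:
  "\<exists>X. finite X \<and> chain_functor.spanned_by g (\<lambda>G. sw_cycles G i n) sw_pullback X"
  using sw_submodule.finitely_spanned[OF sw_submodule_sw_cycles[of g i n]]
  unfolding chain_functor.spanned_by_def[OF chain_functor_sw_cycles]
    sw_submodule.span_from_def[OF sw_submodule_sw_cycles] by blast

lemma add_span_trans:
  assumes "x \<in> add_span S" "\<And>s. s \<in> S \<Longrightarrow> s \<in> add_span T"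
  shows "x \<in> add_span T"
  using assms(1)
proof (induction x rule: add_span.induct)
  case (minus x s)
  then show ?case
    using add_span_add[of x T "- s"] add_span_uminus[OF assms(2), of s] by simp
qed (auto intro: add_span.zero add_span_add assms(2))

text \<open>The noetherian argument for all chains gives finitely many generators of unknown degree;
  each of them is then replaced by finitely many of low degree.\<close>

lemma sw_part_spanned:
  "\<exists>X. finite X \<and> chain_functor.spanned_by g (\<lambda>G. sw_part G i n) sw_pullback X \<and>
     (\<forall>p\<in>X. card (edges (fst p)) \<le> g + i + n)"
proof -
  let ?S = "\<lambda>G X. {sw_pullback G G' \<phi> v | G' \<phi> v. (G', v) \<in> X \<and> contraction G G' \<phi>}"
  let ?low = "\<lambda>Y. \<forall>p\<in>Y. graph_of_genus g (fst p) \<and> snd p \<in> sw_part (fst p) i n \<and> card (edges (fst p)) \<le> g + i + n"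
  obtain X where X: "finite X" "\<forall>p\<in>X. graph_of_genus g (fst p) \<and> snd p \<in> sw_part (fst p) i n"
      "\<forall>G. graph_of_genus g G \<longrightarrow> sw_part G i n \<subseteq> add_span (?S G X)"
    using sw_submodule.finitely_spanned[OF sw_submodule_sw_part[of g i n]]
    unfolding sw_submodule.span_from_def[OF sw_submodule_sw_part] case_prod_beta by (elim exE conjE)
  have "\<forall>p\<in>X. \<exists>Y. finite Y \<and> ?low Y \<and> snd p \<in> add_span (?S (fst p) Y)"
  proof
    fix p assume "p \<in> X"
    then have "graph_of_genus g (fst p)" "snd p \<in> sw_part (fst p) i n"
      using X(2) by simp_all
    then show "\<exists>Y. finite Y \<and> ?low Y \<and> snd p \<in> add_span (?S (fst p) Y)"
      by (rule sw_part_low_degree[unfolded case_prod_beta])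
  qed
  then obtain Y where Y: "\<forall>p\<in>X. finite (Y p) \<and> ?low (Y p) \<and> snd p \<in> add_span (?S (fst p) (Y p))"
    unfolding bchoice_iff by (rule exE)
  define W where "W = (\<Union>p\<in>X. Y p)"
  have low: "?low W"
    unfolding W_def using Y by blast
  have "sw_part G i n \<subseteq> add_span (?S G W)" if g: "graph_of_genus g G" for G
  proof
    fix x assume "x \<in> sw_part G i n"
    then have "x \<in> add_span (?S G X)"
      using X(3) g by blast
    then show "x \<in> add_span (?S G W)"
    proof (rule add_span_trans)
      fix s assume "s \<in> ?S G X"
      then obtain G' \<phi> v where s: "s = sw_pullback G G' \<phi> v" "(G', v) \<in> X" "contraction G G' \<phi>"
        by blast
      have Yp1: "?low (Y (G', v))"
        using bspec[OF Y s(2)] by (rule conjunct2[THEN conjunct1])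
      have Yp2: "v \<in> add_span (?S G' (Y (G', v)))"
        using bspec[OF Y s(2), THEN conjunct2, THEN conjunct2] by (simp only: fst_conv snd_conv)
      have g': "graph_of_genus g G'"
        using bspec[OF X(2) s(2)] by simp
      have "sw_pullback G G' \<phi> v \<in> add_span (?S G (Y (G', v)))"
      proof (rule sw_pullback_add_span[OF g g' s(3) _ Yp2])
        fix G'' w assume "(G'', w) \<in> Y (G', v)"
        then show "graph_of_genus g G'' \<and> w \<in> sw_part G'' i n"
          using bspec[OF Yp1] by fastforce
      qed
      moreover have "?S G (Y (G', v)) \<subseteq> ?S G W"
        unfolding W_def using s(2) by blast
      ultimately show "s \<in> add_span (?S G W)"
        unfolding s(1) using add_span_mono by blast
    qed
  qed
  moreover have "finite W"
    unfolding W_def using X(1) Y by blast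
  ultimately show ?thesis
    unfolding chain_functor.spanned_by_def[OF chain_functor_sw_part] case_prod_beta using low by blast
qed

section \<open>The module structure on the homology of configuration spaces\<close>

text \<open>The surjection from cycles to singular homology that presents the module: the class in
  the reduced complex, followed by the inverse of \<open>\<theta>\<close>.\<close>

definition conf_class :: "nat \<Rightarrow> nat \<Rightarrow> (graph \<Rightarrow> uconf_class \<Rightarrow> sw_chain set) \<Rightarrow> graph \<Rightarrow> sw_chain \<Rightarrow> uconf_class" where
  "conf_class i n \<theta> G z = inv_into (carrier (homology_group (int i) (UConf n G))) (\<theta> G) (sw_class G i n z)"

context
  fixes g i n \<theta>
  assumes ADK: "ADK_isomorphisms g i n \<theta>"
begin

lemma conf_class_eq:
  assumes g: "graph_of_genus g G" "\<not> exceptional i n G" and z: "z \<in> sw_cycles G i n"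
  shows "\<theta> G (conf_class i n \<theta> G z) = sw_class G i n z"
proof -
  have "\<theta> G \<in> iso (homology_group (int i) (UConf n G)) (sw_homology G i n)"
    using ADK g unfolding ADK_isomorphisms_def by blast
  then have "\<theta> G ` carrier (homology_group (int i) (UConf n G)) = carrier (sw_homology G i n)"
    by (simp add: iso_iff)
  then have "sw_class G i n z \<in> \<theta> G ` carrier (homology_group (int i) (UConf n G))"
    unfolding carrier_sw_homology using z by blast
  then show ?thesis
    unfolding conf_class_def by (rule f_inv_into_f)
qed

lemma conf_class_hom:
  assumes g: "graph_of_genus g G" "\<not> exceptional i n G"
  shows "conf_class i n \<theta> G \<in> hom (sw_cycle_group G i n) (homology_group (int i) (UConf n G))"
    and "conf_class i n \<theta> G ` sw_cycles G i n = carrier (homology_group (int i) (UConf n G))"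
proof -
  let ?H = "homology_group (int i) (UConf n G)"
  have "\<theta> G \<in> iso ?H (sw_homology G i n)"
    using ADK g unfolding ADK_isomorphisms_def by blast
  then have iso: "inv_into (carrier ?H) (\<theta> G) \<in> iso (sw_homology G i n) ?H"
    by (intro group.iso_set_sym) simp_all
  have eq: "conf_class i n \<theta> G = inv_into (carrier ?H) (\<theta> G) \<circ> sw_class G i n"
    by (simp add: conf_class_def fun_eq_iff)
  show "conf_class i n \<theta> G \<in> hom (sw_cycle_group G i n) ?H"
    unfolding eq using sw_class_hom[OF graph_of_genus_wf[OF g(1)]] iso
    by (intro hom_compose[of _ _ "sw_homology G i n"]) (simp_all add: iso_def)
  have "inv_into (carrier ?H) (\<theta> G) ` carrier (sw_homology G i n) = carrier ?H"
    using iso by (simp add: iso_iff)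
  then show "conf_class i n \<theta> G ` sw_cycles G i n = carrier ?H"
    unfolding eq image_comp[symmetric] carrier_sw_homology .
qed

lemma mor_conf_class:
  assumes g: "graph_of_genus g G" "graph_of_genus g G'" and \<phi>: "contraction G G' \<phi>"
    and ne: "\<not> exceptional i n G'" and z: "z \<in> sw_cycles G' i n"
  shows "mor (conf_module i n \<theta>) G G' \<phi> (conf_class i n \<theta> G' z) = conf_class i n \<theta> G (sw_pullback G G' \<phi> z)"
  using ne conf_class_eq[OF g(2) ne z] sw_homology_map_class[OF \<phi> g(1) z]
  by (simp add: conf_module_def conf_class_def)

lemma presented_conf_module:
  assumes ne: "\<And>G. graph_of_genus g G \<Longrightarrow> \<not> exceptional i n G"
  shows "presented_module g (\<lambda>G. sw_cycles G i n) sw_pullback (conf_module i n \<theta>) (conf_class i n \<theta>)"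
proof (rule presented_module.intro[OF chain_functor_sw_cycles presented_module_axioms.intro])
  fix G assume g: "graph_of_genus g G"
  show "comm_group (obj (conf_module i n \<theta>) G)"
    by (simp add: conf_module_def)
  show "conf_class i n \<theta> G ` sw_cycles G i n = carrier (obj (conf_module i n \<theta>) G)"
    using conf_class_hom(2)[OF g ne[OF g]] by (simp add: conf_module_def)
  show "conf_class i n \<theta> G (x + y) = conf_class i n \<theta> G x \<otimes>\<^bsub>obj (conf_module i n \<theta>) G\<^esub> conf_class i n \<theta> G y"
    if "x \<in> sw_cycles G i n" "y \<in> sw_cycles G i n" for x y
    using hom_mult[OF conf_class_hom(1)[OF g ne[OF g]], of x y] that by (simp add: conf_module_def)
qed (rule mor_conf_class, assumption+, rule ne, assumption+)

lemma conf_module_small: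
  assumes ne: "\<And>G. graph_of_genus g G \<Longrightarrow> \<not> exceptional i n G"
  shows "Gop_module g (conf_module i n \<theta>) \<and> small g (g + i + n) (conf_module i n \<theta>) \<and>
    finitely_generated g (conf_module i n \<theta>)"
proof -
  interpret C: presented_module g "\<lambda>G. sw_cycles G i n" sw_pullback "conf_module i n \<theta>" "conf_class i n \<theta>"
    using ne by (rule presented_conf_module)
  interpret P: chain_functor g "\<lambda>G. sw_part G i n" sw_pullback
    by (rule chain_functor_sw_part)
  obtain X where X: "finite X" "P.spanned_by X" "\<forall>p\<in>X. card (edges (fst p)) \<le> g + i + n"
    using sw_part_spanned[of g i n] by (elim exE conjE)
  have "small g (g + i + n) (conf_module i n \<theta>)"
  proof (rule P.small[OF presented_conf_module[OF ne] _ countable_sw_chains _ X(1,2)])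
    show "card (edges G) \<le> g + i + n" if "(G, v) \<in> X" for G v
      using bspec[OF X(3) that] by simp
    show "sw_cycles G i n \<subseteq> sw_part G i n" for G
      by (auto simp: sw_cycles_def)
    fix G assume g: "graph_of_genus g G"
    then have wf: "wf_graph G"
      by (rule graph_of_genus_wf)
    have "finite (dom s)" if "s \<in> states G" for s
    proof (rule finite_subset)
      show "dom s \<subseteq> verts G"
        using states_None[OF that] by (metis domIff subsetI)
      show "finite (verts G)"
        using wf by (simp add: wf_graph_def)
    qed
    moreover have "Poly_Mapping.keys c \<subseteq> states G" if "c \<in> sw_part G i n" for c
      using sw_part_complex[OF that] unfolding sw_complex_iff[OF wf] by blast
    ultimately show "sw_part G i n \<subseteq> {c. Poly_Mapping.keys c \<subseteq> {s. finite (dom s)}}"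
      by blast
  qed
  moreover obtain Z where "finite Z" "C.spanned_by Z"
    using sw_cycles_spanned[of g i n] by (elim exE conjE)
  then have "finitely_generated g (conf_module i n \<theta>)"
    by (rule C.finitely_generated)
  ultimately show ?thesis
    using C.Gop_module by blast
qed

end

section \<open>One particle on a tree\<close>

lemma singular_simplex_point:
  "x \<in> topspace X \<Longrightarrow> singular_simplex 0 X (restrict (\<lambda>_. x) (standard_simplex 0))"
  unfolding singular_simplex_def by (auto intro: continuous_map_eq[of _ _ "\<lambda>_. x"])

lemma singular_simplex_0D:
  assumes "singular_simplex 0 X f"
  shows "\<exists>x\<in>topspace X. f = restrict (\<lambda>_. x) (standard_simplex 0)"
proof -
  obtain a :: "nat \<Rightarrow> real" where a: "standard_simplex 0 = {a}"
    using standard_simplex_0 by blast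
  have "f a \<in> topspace X" "f \<in> extensional {a}"
    using assms unfolding singular_simplex_def a by (auto simp: continuous_map_def)
  moreover have "f = restrict (\<lambda>_. f a) {a}"
  proof
    fix b show "f b = restrict (\<lambda>_. f a) {a} b"
      using \<open>f \<in> extensional {a}\<close> by (cases "b = a") (simp_all add: extensional_def)
  qed
  ultimately show ?thesis
    unfolding a by blast
qed

lemma singular_relcycle_0_iff: "singular_relcycle 0 X {} c \<longleftrightarrow> singular_chain 0 X c"
  by (simp add: singular_cycle chain_boundary_def)

lemma point_class_carrier:
  assumes "x \<in> topspace X"
  shows "point_class X x \<in> carrier (homology_group 0 X)"
  unfolding carrier_relative_homology_group_0 point_class_def
  using singular_simplex_point[OF assms]
  by (intro imageI) (simp only: mem_Collect_eq singular_relcycle_0_iff singular_chain_of)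

lemma homologous_rel_set_add:
  "homologous_rel_set p X S (a + b) =
    homologous_rel_set p X S a \<otimes>\<^bsub>relative_homology_group (int p) X S\<^esub> homologous_rel_set p X S b"
proof -
  have *: "homologous_rel p X S (a + b) c \<longleftrightarrow> (\<exists>r s. homologous_rel p X S a r \<and> homologous_rel p X S b s \<and> c = r + s)" for c
  proof
    assume "homologous_rel p X S (a + b) c"
    then have "homologous_rel p X S a (c - b)" "homologous_rel p X S b b"
      by (simp_all add: homologous_rel_def algebra_simps)
    then show "\<exists>r s. homologous_rel p X S a r \<and> homologous_rel p X S b s \<and> c = r + s"
      by (metis diff_add_cancel)
  qed (auto intro: homologous_rel_add)
  show ?thesis
    unfolding mult_relative_homology_group * by (intro equalityI subsetI) (auto simp del: homologous_rel_set_eq)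
qed

text \<open>A singular 0-chain is an integral combination of points, so a class shared by all points
  generates. Which points can be joined by paths does not enter.\<close>

lemma homology_group_0_generated:
  assumes c: "\<And>x. x \<in> topspace X \<Longrightarrow> point_class X x = c" and y: "y \<in> carrier (homology_group 0 X)"
    and ne: "topspace X \<noteq> {}"
  shows "\<exists>k::int. y = c [^]\<^bsub>homology_group 0 X\<^esub> k"
proof -
  interpret comm_group "homology_group 0 X"
    by simp
  let ?h = "homologous_rel_set 0 X {}"
  have cc: "c \<in> carrier (homology_group 0 X)"
  proof -
    obtain x where x: "x \<in> topspace X"
      using ne by blast
    then show ?thesis
      using point_class_carrier[OF x] c[OF x] by simp
  qed
  obtain z where z: "y = ?h z" "singular_chain 0 X z"
    using y unfolding carrier_relative_homology_group_0 by (auto simp: singular_relcycle_0_iff)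
  have "Poly_Mapping.keys z \<subseteq> {f. singular_simplex 0 X f}"
    using z(2) by (auto simp: singular_chain_def)
  then have "singular_chain 0 X z \<and> (\<exists>k::int. ?h z = c [^]\<^bsub>homology_group 0 X\<^esub> k)"
  proof (rule frag_induction)
    have "?h 0 = ?h 0 \<otimes>\<^bsub>homology_group 0 X\<^esub> ?h 0" "?h 0 \<in> carrier (homology_group 0 X)"
      using homologous_rel_set_add[of 0 X "{}" 0 0] unfolding carrier_relative_homology_group_0 by auto
    then have "?h 0 = c [^]\<^bsub>homology_group 0 X\<^esub> (0::int)"
      by (metis int_pow_0 l_cancel_one')
    moreover have "singular_chain 0 X 0"
      by simp
    ultimately show "singular_chain 0 X 0 \<and> (\<exists>k::int. ?h 0 = c [^]\<^bsub>homology_group 0 X\<^esub> k)"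
      by blast
  next
    fix f assume "f \<in> {f. singular_simplex 0 X f}"
    then have f: "singular_simplex 0 X f"
      by simp
    then have "?h (frag_of f) = c"
      using singular_simplex_0D[OF f] c unfolding point_class_def by blast
    then show "singular_chain 0 X (frag_of f) \<and> (\<exists>k::int. ?h (frag_of f) = c [^]\<^bsub>homology_group 0 X\<^esub> k)"
      using f int_pow_1[OF cc] by (auto simp: singular_chain_of intro!: exI[of _ 1])
  next
    fix a b
    assume a: "singular_chain 0 X a \<and> (\<exists>k::int. ?h a = c [^]\<^bsub>homology_group 0 X\<^esub> k)"
      and b: "singular_chain 0 X b \<and> (\<exists>k::int. ?h b = c [^]\<^bsub>homology_group 0 X\<^esub> k)"
    then obtain k l :: int where kl: "?h a = c [^]\<^bsub>homology_group 0 X\<^esub> k" "?h b = c [^]\<^bsub>homology_group 0 X\<^esub> l"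
      by blast
    have ab: "singular_chain 0 X (a - b)"
      using a b by (simp add: singular_chain_diff)
    then have "?h (a - b) \<in> carrier (homology_group 0 X)"
      unfolding carrier_relative_homology_group_0 by (intro imageI) (simp add: singular_relcycle_0_iff)
    moreover have "?h a = ?h (a - b) \<otimes>\<^bsub>homology_group 0 X\<^esub> ?h b"
      using homologous_rel_set_add[of 0 X "{}" "a - b" b] by simp
    ultimately have "?h (a - b) = c [^]\<^bsub>homology_group 0 X\<^esub> k \<otimes>\<^bsub>homology_group 0 X\<^esub> inv\<^bsub>homology_group 0 X\<^esub> (c [^]\<^bsub>homology_group 0 X\<^esub> l)"
      unfolding kl using int_pow_closed[OF cc] by (subst inv_solve_right) auto
    then have "?h (a - b) = c [^]\<^bsub>homology_group 0 X\<^esub> (k - l)"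
      using int_pow_diff[OF cc] by simp
    then show "singular_chain 0 X (a - b) \<and> (\<exists>k::int. ?h (a - b) = c [^]\<^bsub>homology_group 0 X\<^esub> k)"
      using ab by blast
  qed
  then show ?thesis
    using z(1) by blast
qed

lemma topspace_quotient_topology: "topspace (quotient_topology X q) = q ` topspace X"
  using quotient_imp_surjective_map[OF quotient_map_quotient_topology] by metis

lemma topspace_cells: "topspace (cells G) = Inl ` verts G \<union> Inr ` (edges G \<times> {0..1})" (is "_ = ?U")
proof
  have "{t. Inr (e, t) \<in> ?U} = {0..1}" if "e \<in> edges G" for e
    using that by auto
  then have "openin (cells G) ?U"
    unfolding openin_cells by simp
  then show "?U \<subseteq> topspace (cells G)"
    by (rule openin_subset)
  have "openin (cells G) (topspace (cells G))"
    by simp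
  then show "topspace (cells G) \<subseteq> ?U"
    unfolding openin_cells by blast
qed

lemma topspace_realization: "topspace (realization G) = attach G ` (Inl ` verts G \<union> Inr ` (edges G \<times> {0..1}))"
  by (simp only: realization_def topspace_quotient_topology topspace_cells)

lemma topspace_UConf_1:
  "topspace (UConf 1 G) = (\<lambda>p. orbit 1 (restrict (\<lambda>_. p) {..<1})) ` topspace (realization G)"
proof -
  have "topspace (Conf 1 (realization G)) = (\<lambda>p. restrict (\<lambda>_. p) {..<1}) ` topspace (realization G)"
  proof (intro equalityI subsetI)
    fix x assume "x \<in> topspace (Conf 1 (realization G))"
    then have x: "x \<in> {..<1::nat} \<rightarrow>\<^sub>E topspace (realization G)"
      by (simp add: Conf_def)
    then have "x = restrict (\<lambda>_. x 0) {..<1}" "x 0 \<in> topspace (realization G)"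
      by (auto simp: fun_eq_iff PiE_def extensional_def)
    then show "x \<in> (\<lambda>p. restrict (\<lambda>_. p) {..<1}) ` topspace (realization G)"
      by blast
  qed (auto simp: Conf_def inj_on_def)
  then show ?thesis
    by (simp add: UConf_def topspace_quotient_topology image_image)
qed

lemma topspace_UConf_1_nonempty:
  assumes "graph_of_genus g G"
  shows "topspace (UConf 1 G) \<noteq> {}"
  using assms unfolding topspace_UConf_1 topspace_realization graph_of_genus_def by simp

lemma topspace_UConf_1_single_point:
  assumes "graph_of_genus g G" "single_point G"
  shows "\<exists>x. topspace (UConf 1 G) = {x}"
proof -
  obtain v where "verts G = {v}"
    using assms(2)[unfolded single_point_def, THEN conjunct1] by (rule card_1_singletonE)
  then show ?thesis
    using assms(2) unfolding topspace_UConf_1 topspace_realization single_point_def by simp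
qed

lemma tree_has_edge:
  assumes "graph_of_genus 0 G" "\<not> single_point G"
  shows "\<exists>e. e \<in> edges G"
proof (rule ccontr)
  assume "\<not> (\<exists>e. e \<in> edges G)"
  then have "edges G = {}"
    by blast
  then show False
    using graph_of_genus_formula[OF assms(1)] assms(2) by (simp add: single_point_def)
qed

lemma single_point_contraction:
  assumes "contraction G G' \<phi>" "graph_of_genus 0 G" "graph_of_genus 0 G'" "single_point G"
  shows "single_point G'"
proof -
  interpret contracting G G' \<phi>
    using assms(1) by (simp add: contracting_iff)
  obtain v where "verts G = {v}"
    using assms(4)[unfolded single_point_def, THEN conjunct1] by (rule card_1_singletonE)
  then have 1: "card (verts G') = 1"
    unfolding surj(1)[symmetric] by simp
  then have "card (edges G') = 0"
    using graph_of_genus_formula[OF assms(3)] by simp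
  then show ?thesis
    using 1 wf' by (simp add: single_point_def wf_graph_def)
qed

abbreviation edge_class :: "nat \<Rightarrow> sw_chain" where
  "edge_class e \<equiv> Poly_Mapping.single (\<lambda>_. None) (edge_var e)"

lemma hat_edge_class: "hat G (edge_class e) ks = (if ks = [] then edge_var e else 0)"
proof (cases ks)
  case (Cons k ks')
  have "state_of G ks (hvert G k) \<noteq> None"
    using Cons by (simp add: state_of_None_iff)
  then have "Poly_Mapping.lookup (edge_class e) (state_of G ks) = 0" "ks \<noteq> []"
    using Cons by (metis lookup_single_not_eq, simp)
  then show ?thesis
    unfolding hat_def by simp
qed (simp add: hat_def vsign_def)

lemma edge_class_cycle:
  assumes wf: "wf_graph G" and e: "e \<in> edges G"
  shows "edge_class e \<in> sw_cycles G 0 1"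
proof -
  have occ: "occupied (\<lambda>_. None) = {}"
    by (simp add: occupied_def)
  have "edge_var e \<in> A_ring G"
    using e by (simp add: A_ring_def edge_var_def)
  moreover have "(\<lambda>_. None) \<noteq> s(v \<mapsto> h)" for s :: state and v h
    by (metis fun_upd_same option.distinct(1))
  ultimately have "edge_class e \<in> sw_complex G"
    unfolding sw_complex_iff[OF wf] vertex_sums_zero_def
    by (auto simp: lookup_single when_def states_def A_ring_def)
  moreover have "mono_degree (Poly_Mapping.single e 1) = 1"
    by (simp add: mono_degree_def)
  ultimately have "edge_class e \<in> sw_part G 0 1"
    unfolding sw_part_def by (auto simp: occ edge_var_def lookup_single)
  then show ?thesis
    by (simp add: sw_cycles_def sw_diff_def occ)
qed

lemma sw_pullback_edge_class:
  assumes con: "contraction G G' \<phi>" and g: "graph_of_genus g G" and e: "e \<in> edges G'"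
  shows "sw_pullback G G' \<phi> (edge_class e) = edge_class (pre_edge \<phi> e)" "pre_edge \<phi> e \<in> edges G"
proof -
  interpret contracting G G' \<phi>
    using con by (simp add: contracting_iff)
  show pe: "pre_edge \<phi> e \<in> edges G"
    using pre_edge_mem[OF e] by simp
  have ren: "rename_vars (pre_edge \<phi>) (edge_var e) = edge_var (pre_edge \<phi> e)"
    by (simp add: rename_vars_frag_extend edge_var_def)
  have ren0: "rename_vars (pre_edge \<phi>) 0 = 0"
    by (simp add: rename_vars_def)
  have "pulls_back G G' \<phi> (edge_class e) (edge_class (pre_edge \<phi> e))"
    unfolding pulls_back_iff hat_edge_class
    using sw_cycles_complex[OF edge_class_cycle[OF wf pe]] ren ren0 by auto
  then show "sw_pullback G G' \<phi> (edge_class e) = edge_class (pre_edge \<phi> e)"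
    using sw_cycles_complex[OF edge_class_cycle[OF wf' e]] by (intro sw_pullback_eqI[OF con g])
qed

definition tree_class :: "graph \<Rightarrow> uconf_class" where
  "tree_class G = point_class (UConf 1 G) (SOME x. x \<in> topspace (UConf 1 G))"

definition point_graph :: graph where
  "point_graph = \<lparr>verts = {0}, edges = {}, endpt = \<lambda>_ _. 0\<rparr>"

lemma point_graph_tree: "graph_of_genus 0 point_graph"
  by (simp add: graph_of_genus_iff point_graph_def wf_graph_def connected_graph_def)

lemma contraction_point_graph:
  assumes g: "graph_of_genus 0 G"
  shows "\<exists>\<phi>. contraction G point_graph \<phi>"
proof
  let ?\<phi> = "\<lparr>vmap = restrict (\<lambda>_. 0) (verts G), hmap = \<lambda>_. None\<rparr>"
  have wf: "wf_graph G"
    using g by (rule graph_of_genus_wf)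
  then have ends: "endpt G e b \<in> verts G" if "e \<in> edges G" for e b
    using that by (simp add: wf_graph_def)
  have "edgewise_morphism G point_graph ?\<phi>"
    unfolding edgewise_morphism_def using wf point_graph_tree ends
    by (auto simp: point_graph_def graph_of_genus_def)
  then show "contraction G point_graph ?\<phi>"
    using g point_graph_tree
  proof (rule contractionI)
    show "vmap ?\<phi> ` verts G = verts point_graph"
      using g by (auto simp: point_graph_def graph_of_genus_def)
    show "ran (hmap ?\<phi>) = halves point_graph" "inj_on (hmap ?\<phi>) (dom (hmap ?\<phi>))"
      by (auto simp: point_graph_def halves_def)
    fix w assume "w \<in> verts point_graph"
    then have "w = 0"
      by (simp add: point_graph_def)
    then have "verts (fibre G ?\<phi> w) = verts G" "edges (fibre G ?\<phi> w) = edges G" "endpt (fibre G ?\<phi> w) = endpt G"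
      using ends by (auto simp: fibre_def contracted_edges_def)
    then show "connected_graph (fibre G ?\<phi> w)"
      using g unfolding connected_graph_def graph_of_genus_def by simp
  qed
qed

context
  fixes \<theta>
  assumes ADK: "ADK_isomorphisms 0 0 1 \<theta>"
begin

lemma iso_tree:
  assumes "graph_of_genus 0 G" "\<not> single_point G"
  shows "\<theta> G \<in> iso (homology_group 0 (UConf 1 G)) (sw_homology G 0 1)"
  using ADK assms unfolding ADK_isomorphisms_def exceptional_def by simp

text \<open>No path in the tree is constructed. If there is an edge \<open>e\<close>, the
  normalization of \<open>\<theta>\<close> sends every particle to the class of \<open>e\<close>
  times \<open>\<emptyset>\<close>, and \<open>\<theta>\<close> is injective; otherwise the space
  has one point.\<close>

lemma point_class_tree:
  assumes g: "graph_of_genus 0 G" and x: "x \<in> topspace (UConf 1 G)"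
  shows "point_class (UConf 1 G) x = tree_class G"
proof -
  define y where "y = (SOME x. x \<in> topspace (UConf 1 G))"
  have y: "y \<in> topspace (UConf 1 G)"
    unfolding y_def using x by (rule someI)
  have "point_class (UConf 1 G) x = point_class (UConf 1 G) y"
  proof (cases "single_point G")
    case True
    then obtain p where "topspace (UConf 1 G) = {p}"
      using topspace_UConf_1_single_point[OF g] by blast
    then show ?thesis
      using x y by simp
  next
    case False
    then obtain e where e: "e \<in> edges G"
      using tree_has_edge[OF g] by blast
    have eq: "\<theta> G (point_class (UConf 1 G) x) = \<theta> G (point_class (UConf 1 G) y)"
      using ADK g x y e unfolding ADK_isomorphisms_def by simp
    have "inj_on (\<theta> G) (carrier (homology_group 0 (UConf 1 G)))"
      using iso_tree[OF g False] by (simp add: iso_iff)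
    then show ?thesis
      using eq point_class_carrier[OF x] point_class_carrier[OF y] by (rule inj_onD)
  qed
  then show ?thesis
    by (simp add: tree_class_def y_def)
qed

lemma tree_class_carrier:
  assumes g: "graph_of_genus 0 G"
  shows "tree_class G \<in> carrier (homology_group 0 (UConf 1 G))"
  unfolding tree_class_def using topspace_UConf_1_nonempty[OF g] by (intro point_class_carrier) (simp add: some_in_eq)

lemma tree_class_generates:
  assumes g: "graph_of_genus 0 G" and "y \<in> carrier (homology_group 0 (UConf 1 G))"
  shows "\<exists>k::int. y = tree_class G [^]\<^bsub>homology_group 0 (UConf 1 G)\<^esub> k"
  by (rule homology_group_0_generated[OF point_class_tree[OF g] assms(2) topspace_UConf_1_nonempty[OF g]])

text \<open>Over a single point the configuration space is a point, in particular path-connected,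
  and the class of a point is then an infinite cyclic generator.\<close>

lemma tree_class_infinite_order:
  fixes k l :: int
  assumes g: "graph_of_genus 0 G" and "single_point G"
    and eq: "tree_class G [^]\<^bsub>homology_group 0 (UConf 1 G)\<^esub> k = tree_class G [^]\<^bsub>homology_group 0 (UConf 1 G)\<^esub> l"
  shows "k = l"
proof -
  obtain x where x: "topspace (UConf 1 G) = {x}"
    using topspace_UConf_1_single_point[OF assms(1,2)] by blast
  then have "path_connected_space (UConf 1 G)"
    by (metis path_connectedin_singleton path_connectedin_topspace singletonI)
  moreover have "singular_simplex 0 (UConf 1 G) (restrict (\<lambda>_. x) (standard_simplex 0))"
    using x by (intro singular_simplex_point) simp
  ultimately have "pow (homology_group 0 (UConf 1 G)) (point_class (UConf 1 G) x)
      \<in> iso integer_group (homology_group 0 (UConf 1 G))"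
    unfolding point_class_def by (rule iso_integer_zeroth_homology_group)
  moreover have "point_class (UConf 1 G) x = tree_class G"
    using x by (intro point_class_tree[OF g]) simp
  ultimately have "inj_on (pow (homology_group 0 (UConf 1 G)) (tree_class G) :: int \<Rightarrow> _) (carrier integer_group)"
    by (simp add: iso_iff)
  then show ?thesis
    using eq by (simp add: inj_on_def)
qed

text \<open>The map to the one-point space takes particle class to particle class. The latter has
  infinite order, so the map is injective on the powers of the former, which are the whole group,
  and can be inverted there.\<close>

lemma canonical_H0_tree_class:
  fixes k :: int
  assumes g: "graph_of_genus 0 G" "graph_of_genus 0 G'" and pt: "single_point G'"
  shows "canonical_H0 G G' (tree_class G' [^]\<^bsub>homology_group 0 (UConf 1 G')\<^esub> k) =
    tree_class G [^]\<^bsub>homology_group 0 (UConf 1 G)\<^esub> k"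
proof -
  let ?H = "homology_group 0 (UConf 1 G)" and ?H' = "homology_group 0 (UConf 1 G')"
  obtain p where p: "topspace (UConf 1 G') = {p}"
    using topspace_UConf_1_single_point[OF g(2) pt] by blast
  define F where "F = hom_induced 0 (UConf 1 G) {} (UConf 1 G') {} (\<lambda>_. the_elem (topspace (UConf 1 G')))"
  have hom: "F \<in> hom ?H ?H'"
    unfolding F_def by (rule hom_induced_hom)
  have F: "F (tree_class G) = tree_class G'"
  proof -
    obtain x where x: "x \<in> topspace (UConf 1 G)"
      using topspace_UConf_1_nonempty[OF g(1)] by blast
    let ?s = "\<lambda>x. restrict (\<lambda>_. x) (standard_simplex 0)"
    have "F (point_class (UConf 1 G) x) = homologous_rel_set 0 (UConf 1 G') {} (chain_map 0 (\<lambda>_. p) (frag_of (?s x)))"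
      unfolding F_def point_class_def p the_elem_eq
      using singular_simplex_point[OF x] p hom_induced_chain_map[of "UConf 1 G" "UConf 1 G'" "\<lambda>_. p" "{}" "{}" 0 "frag_of (?s x)"]
      by (simp add: singular_relcycle_0_iff singular_chain_of)
    also have "chain_map 0 (\<lambda>_. p) (frag_of (?s x)) = frag_of (?s p)"
      by (simp add: simplex_map_def o_def)
    also have "homologous_rel_set 0 (UConf 1 G') {} (frag_of (?s p)) = point_class (UConf 1 G') p"
      by (simp add: point_class_def)
    finally show ?thesis
      using point_class_tree[OF g(1) x] point_class_tree[OF g(2), of p] p by simp
  qed
  have F_pow: "F (tree_class G [^]\<^bsub>?H\<^esub> l) = tree_class G' [^]\<^bsub>?H'\<^esub> l" for l :: int
    using hom_int_pow[OF hom tree_class_carrier[OF g(1)]] F by simp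
  have "inj_on F (carrier ?H)"
  proof (rule inj_onI)
    fix x y assume xy: "x \<in> carrier ?H" "y \<in> carrier ?H" "F x = F y"
    obtain l m :: int where lm: "x = tree_class G [^]\<^bsub>?H\<^esub> l" "y = tree_class G [^]\<^bsub>?H\<^esub> m"
      using tree_class_generates[OF g(1)] xy(1,2) by blast
    then have "l = m"
      using xy(3) tree_class_infinite_order[OF g(2) pt] unfolding lm F_pow by blast
    then show "x = y"
      using lm by simp
  qed
  moreover have "tree_class G [^]\<^bsub>?H\<^esub> k \<in> carrier ?H"
    using tree_class_carrier[OF g(1)] by (simp add: group.int_pow_closed)
  ultimately show ?thesis
    unfolding canonical_H0_def F_def[symmetric] F_pow[symmetric] by (rule inv_into_f_f)
qed

lemma conf_class_edge_class:
  assumes g: "graph_of_genus 0 G" and e: "e \<in> edges G"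
  shows "conf_class 0 1 \<theta> G (edge_class e) = tree_class G"
proof -
  have ne: "\<not> single_point G"
    using e by (auto simp: single_point_def)
  have "(SOME x. x \<in> topspace (UConf 1 G)) \<in> topspace (UConf 1 G)"
    using topspace_UConf_1_nonempty[OF g] by (simp add: some_in_eq)
  then have "\<theta> G (tree_class G) = sw_class G 0 1 (edge_class e)"
    unfolding tree_class_def sw_class_def using ADK g e unfolding ADK_isomorphisms_def by simp
  moreover have "inj_on (\<theta> G) (carrier (homology_group 0 (UConf 1 G)))"
    using iso_tree[OF g ne] by (simp add: iso_iff)
  ultimately show ?thesis
    unfolding conf_class_def using inv_into_f_f[OF _ tree_class_carrier[OF g], of "\<theta> G"] by simp
qed

text \<open>Over a single point the canonical identification matches particle classes. Otherwise
  these correspond to classes of an edge times \<open>\<emptyset>\<close>, which a pullback takes to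
  the same expression for the preimage edge. It is the normalization of \<open>\<theta>\<close> that
  makes the two cases agree in sign.\<close>

lemma mor_tree_class:
  fixes k :: int
  assumes g: "graph_of_genus 0 G" "graph_of_genus 0 G'" and \<phi>: "contraction G G' \<phi>"
  shows "mor (conf_module 0 1 \<theta>) G G' \<phi> (tree_class G' [^]\<^bsub>homology_group 0 (UConf 1 G')\<^esub> k) =
    tree_class G [^]\<^bsub>homology_group 0 (UConf 1 G)\<^esub> k"
proof (cases "single_point G'")
  case True
  then show ?thesis
    using canonical_H0_tree_class[OF g True] by (simp add: conf_module_def exceptional_def)
next
  case False
  then have ne: "\<not> exceptional 0 1 G" "\<not> exceptional 0 1 G'"
    using single_point_contraction[OF \<phi> g] by (auto simp: exceptional_def)
  obtain e where e: "e \<in> edges G'"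
    using tree_has_edge[OF g(2) False] by blast
  let ?Z = "sw_cycle_group G 0 1" and ?Z' = "sw_cycle_group G' 0 1"
  have wf: "wf_graph G" "wf_graph G'"
    using g by (auto intro: graph_of_genus_wf)
  have grp: "group ?Z" "group ?Z'"
    using comm_group_sw_cycle_group wf by (auto intro: comm_group.axioms)
  have e': "edge_class e \<in> carrier ?Z'" "edge_class (pre_edge \<phi> e) \<in> carrier ?Z"
    using edge_class_cycle[OF wf(2) e] edge_class_cycle[OF wf(1) sw_pullback_edge_class(2)[OF \<phi> g(1) e]] by simp_all
  have pb: "sw_pullback G G' \<phi> \<in> hom ?Z' ?Z"
    using sw_pullback_cycles[OF \<phi> g(1)] sw_pullback_add[OF \<phi> g(1)] sw_cycles_complex by (intro homI) auto
  have "tree_class G' [^]\<^bsub>homology_group 0 (UConf 1 G')\<^esub> k = conf_class 0 1 \<theta> G' (edge_class e [^]\<^bsub>?Z'\<^esub> k)"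
    using hom_int_pow[OF conf_class_hom(1)[OF ADK g(2) ne(2)] e'(1) grp(2)] conf_class_edge_class[OF g(2) e] by simp
  moreover have "edge_class e [^]\<^bsub>?Z'\<^esub> k \<in> sw_cycles G' 0 1"
    using group.int_pow_closed[OF grp(2) e'(1)] by simp
  ultimately have "mor (conf_module 0 1 \<theta>) G G' \<phi> (tree_class G' [^]\<^bsub>homology_group 0 (UConf 1 G')\<^esub> k) =
      conf_class 0 1 \<theta> G (sw_pullback G G' \<phi> (edge_class e [^]\<^bsub>?Z'\<^esub> k))"
    using mor_conf_class[OF ADK g \<phi> ne(2)] by simp
  also have "\<dots> = conf_class 0 1 \<theta> G (edge_class (pre_edge \<phi> e) [^]\<^bsub>?Z\<^esub> k)"
    using hom_int_pow[OF pb e'(1) grp(2,1)] sw_pullback_edge_class(1)[OF \<phi> g(1) e] by simp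
  also have "\<dots> = tree_class G [^]\<^bsub>homology_group 0 (UConf 1 G)\<^esub> k"
    using hom_int_pow[OF conf_class_hom(1)[OF ADK g(1) ne(1)] e'(2) grp(1)]
      conf_class_edge_class[OF g(1) sw_pullback_edge_class(2)[OF \<phi> g(1) e]] by simp
  finally show ?thesis .
qed

text \<open>The module of one particle on trees is constant with value \<open>\<int>\<close>, generated by the single point.\<close>

lemma conf_module_tree_small:
  "Gop_module 0 (conf_module 0 1 \<theta>) \<and> small 0 1 (conf_module 0 1 \<theta>) \<and> finitely_generated 0 (conf_module 0 1 \<theta>)"
proof -
  interpret P: chain_functor 0 "\<lambda>_. UNIV :: int set" "\<lambda>_ _ _ k. k"
    by (rule chain_functor.intro) simp_all
  have M_pres: "presented_module 0 (\<lambda>_. UNIV :: int set) (\<lambda>_ _ _ k. k) (conf_module 0 1 \<theta>)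
    (\<lambda>G k. tree_class G [^]\<^bsub>homology_group 0 (UConf 1 G)\<^esub> k)"
  proof (rule presented_module.intro[OF P.chain_functor_axioms presented_module_axioms.intro])
    fix G assume g: "graph_of_genus 0 G"
    show "comm_group (obj (conf_module 0 1 \<theta>) G)"
      by (simp add: conf_module_def)
    interpret H: comm_group "homology_group 0 (UConf 1 G)"
      by simp
    note c = tree_class_carrier[OF g]
    show "range (\<lambda>k::int. tree_class G [^]\<^bsub>homology_group 0 (UConf 1 G)\<^esub> k) = carrier (obj (conf_module 0 1 \<theta>) G)"
      using tree_class_generates[OF g] H.int_pow_closed[OF c] by (auto simp: conf_module_def)
    show "tree_class G [^]\<^bsub>homology_group 0 (UConf 1 G)\<^esub> (x + y) =
        tree_class G [^]\<^bsub>homology_group 0 (UConf 1 G)\<^esub> x \<otimes>\<^bsub>obj (conf_module 0 1 \<theta>) G\<^esub>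
        tree_class G [^]\<^bsub>homology_group 0 (UConf 1 G)\<^esub> y" for x y :: int
      using H.int_pow_mult[OF c] by (simp add: conf_module_def)
  qed (rule mor_tree_class)
  then interpret M: presented_module 0 "\<lambda>_. UNIV :: int set" "\<lambda>_ _ _ k. k" "conf_module 0 1 \<theta>"
    "\<lambda>G k. tree_class G [^]\<^bsub>homology_group 0 (UConf 1 G)\<^esub> k" .
  let ?X = "{(point_graph, 1 :: int)}"
  have X: "P.spanned_by ?X"
    unfolding P.spanned_by_def
  proof (intro conjI allI impI subsetI)
    show "\<forall>(G', v)\<in>?X. graph_of_genus 0 G' \<and> v \<in> UNIV"
      using point_graph_tree by simp
    fix G and k :: int assume "graph_of_genus 0 G"
    then have "{v | G' \<phi> v. (G', v) \<in> ?X \<and> contraction G G' \<phi>} = {1}"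
      using contraction_point_graph by auto
    moreover have "k \<in> add_span {1}"
      by (induction k rule: int_induct[of _ 0]) (auto intro: add_span.intros)
    ultimately show "k \<in> add_span {v | G' \<phi> v. (G', v) \<in> ?X \<and> contraction G G' \<phi>}"
      by simp
  qed
  have "small 0 1 (conf_module 0 1 \<theta>)"
    by (rule P.small[OF M_pres _ countableI_type[of UNIV] _ _ X])
      (auto simp: point_graph_def)
  then show ?thesis
    using M.Gop_module M.finitely_generated[OF _ X] by simp
qed

end

theorem theorem1p2:
  fixes g i n :: nat
    and \<theta> :: "graph \<Rightarrow> uconf_class \<Rightarrow> sw_chain set"
  assumes "ADK_isomorphisms g i n \<theta>"
  shows "Gop_module g (conf_module i n \<theta>) \<and>
         small g (g + i + n) (conf_module i n \<theta>) \<and>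
         finitely_generated g (conf_module i n \<theta>)"
proof (cases "g = 0 \<and> i = 0 \<and> n = 1")
  case True
  then show ?thesis
    using conf_module_tree_small assms by auto
next
  case False
  \<comment> \<open>One vertex and no edge force \<open>g = 0\<close>, so an exceptional graph would
    lead back to the excluded case.\<close>
  have "\<not> exceptional i n G" if "graph_of_genus g G" for G
    using False graph_of_genus_formula[OF that] by (auto simp: exceptional_def single_point_def)
  with assms show ?thesis
    by (rule conf_module_small)
qed

end
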